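(* Let $M$ and $H$ be Hopf algebras with bicovariant calculi $\Omega^1(M)$, $\Omega^1(H)$ (given by ideals $Q_M$, $Q_H$), and let $P=M\otimes H$ with the calculus $\Omega^1(P)$ defined by $N_P=N_M\otimes H\otimes H+M\otimes M\otimes N_H+\Omega^1M\otimes\Omega^1H$. Then $\Omega^1(P)$ is bicovariant for the tensor product Hopf algebra $P$, with $$Q_P=Q_M\otimes H+M\otimes Q_H+\ker\epsilon_M\otimes\ker\epsilon_H,\qquad \Omega_{0P}=\Omega_{0M}\otimes1\oplus1\otimes\Omega_{0H},$$ and the (Woronowicz) exterior algebras $\Omega^\cdot(P)$, $\Omega^\cdot(M)$ obey $\Omega^2(M)\subset\Omega^2(P)$ and $\Omega^2(M)P\subset\Omega^2(P)$, i.e. the natural maps $\Omega^2(M)\to\Omega^2(P)$ and $\Omega^2(M)\otimes H\to\Omega^2(P)$, $\alpha\otimes h\mapsto\alpha h$, are injective. In the case $M=H$ (with the same calculus), the Maurer–Cartan form $$e:\Omega_0\to\Omega^1(H),\qquad e(v)=\pi_{N_H}(S\tilde v_{(1)}\otimes\tilde v_{(2)}),$$ for any representative $\tilde v\in\ker\epsilon$ of $v\in\Omega_0$, provides a framing (it is an $\Omega_0$-bein), and $A=e:\Omega_0\to\Omega^1(H)$ is a gauge field with zero curvature.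
   Context: Everything is over a field $k$; Hopf algebras have invertible antipode. For an algebra $M$, $\Omega^1M=\ker(M\otimes M\to M)$, $\mathrm dm=1\otimes m-m\otimes1$, and a calculus is $\Omega^1(M)=\Omega^1M/N_M$ with $N_M$ a sub-bimodule. For a Hopf algebra $H$, bicovariant calculi correspond to right ideals $Q_H\subset\ker\epsilon$ stable under $\mathrm{Ad}(h)=h_{(2)}\otimes(Sh_{(1)})h_{(3)}$; $N_H$ corresponds to $H\otimes Q_H$ under $h\otimes g\mapsto hg_{(1)}\otimes g_{(2)}$, and $\Omega_0=\Omega_{0H}=\ker\epsilon/Q_H$. $\pi_{N_H}:\Omega^1H\to\Omega^1(H)$ is the quotient map. In $N_P$ we identify $P\otimes P=M\otimes M\otimes H\otimes H$. The Woronowicz exterior algebra has $\Omega^2(H)=\Omega^1(H)\otimes_H\Omega^1(H)/\ker(\mathrm{id}-\Psi)$, where $\Psi$ is the $H$-bimodule map determined by $\Psi(v\otimes_Hw)=w\otimes_Hv$ for $v$ left-invariant and $w$ right-invariant; equivalently $\Psi(e(v)\otimes_He(w))=e(\pi_{\Omega_0}\tilde w_{(2)})\otimes_He(v\cdot(S\tilde w_{(1)})\tilde w_{(3)})$. An $\Omega_0$-bein is a linear map $e:\Omega_0\to\Omega^1(H)$ such that $H\otimes\Omega_0\to\Omega^1(H)$, $h\otimes v\mapsto h\,e(v)$, is an isomorphism; here $\Omega_0$ is a right $H$-comodule by the projected $\mathrm{Ad}$, and an $\Omega_0$-bein is equivalent to a framing by the bundle $P=H\otimes H$. A gauge field is a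 linear map $A:\Omega_0\to\Omega^1(H)$. Its curvature is $F_A:\ker\epsilon\to\Omega^2(H)$, $F_A(h)=\mathrm dA(\tilde\pi_{\Omega_0}h)+A(\tilde\pi_{\Omega_0}h_{(1)})\wedge A(\tilde\pi_{\Omega_0}h_{(2)})$, where $\tilde\pi_{\Omega_0}:H\to\Omega_0$ is $h\mapsto h-\epsilon(h)1$ followed by the quotient $\pi_{\Omega_0}$. *)

theory Defs
  imports Complex_Main "HOL-Library.Function_Algebras"
begin

section \<open>Vector spaces, quotients and tensor products\<close>

text \<open>
  A vector space over the field \<open>'k\<close> is a linear subspace \<open>carrier V\<close> of a type carrying a
  scalar multiplication \<open>smul V\<close>.  Quotients and tensor products are realised inside spaces
  of \<open>'k\<close>-valued functions with the pointwise structure \<open>fsmul\<close>, so that addition is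
  always that of the type.
\<close>

record ('k, 'a) vs =
  carrier :: "'a set"
  smul :: "'k \<Rightarrow> 'a \<Rightarrow> 'a"

definition fsmul :: "'k::field \<Rightarrow> ('x \<Rightarrow> 'k) \<Rightarrow> 'x \<Rightarrow> 'k" where
  "fsmul c f = (\<lambda>x. c * f x)"

definition vspace :: "('k::field, 'a::ab_group_add, 'z) vs_scheme \<Rightarrow> bool" where
  "vspace V \<longleftrightarrow> vector_space (smul V) \<and> module.subspace (smul V) (carrier V)"

definition subsp :: "('k::field, 'a::ab_group_add, 'z) vs_scheme \<Rightarrow> 'a set \<Rightarrow> bool" where
  "subsp V N \<longleftrightarrow> N \<subseteq> carrier V \<and> module.subspace (smul V) N"

definition lin :: "('k::field, 'a::ab_group_add, 'y) vs_scheme \<Rightarrow>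
    ('k, 'b::ab_group_add, 'z) vs_scheme \<Rightarrow> ('a \<Rightarrow> 'b) \<Rightarrow> bool" where
  "lin V W f \<longleftrightarrow> f ` carrier V \<subseteq> carrier W \<and>
     (\<forall>x\<in>carrier V. \<forall>y\<in>carrier V. f (x + y) = f x + f y) \<and>
     (\<forall>c. \<forall>x\<in>carrier V. f (smul V c x) = smul W c (f x))"

definition bilin :: "('k::field, 'a::ab_group_add, 'x) vs_scheme \<Rightarrow>
    ('k, 'b::ab_group_add, 'y) vs_scheme \<Rightarrow> ('k, 'c::ab_group_add, 'z) vs_scheme \<Rightarrow>
    ('a \<Rightarrow> 'b \<Rightarrow> 'c) \<Rightarrow> bool" where
  "bilin V W U f \<longleftrightarrow> (\<forall>x\<in>carrier V. lin W U (f x)) \<and> (\<forall>y\<in>carrier W. lin V U (\<lambda>x. f x y))"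

text \<open>
  \<open>proj V N v\<close> is the class of \<open>v\<close> modulo \<open>N\<close>, represented by evaluation at \<open>v\<close> on the
  functionals vanishing on \<open>N\<close>; see \<open>proj_eq_iff\<close> below for the fact that two classes agree
  exactly if the difference of the representatives is in \<open>N\<close>.
\<close>

type_synonym ('k, 'a) quo = "('a \<Rightarrow> 'k) \<Rightarrow> 'k"

definition proj :: "('k::field, 'a::ab_group_add, 'z) vs_scheme \<Rightarrow> 'a set \<Rightarrow> 'a \<Rightarrow> ('k, 'a) quo" where
  "proj V N v = (\<lambda>f. if Vector_Spaces.linear (smul V) (*) f \<and> (\<forall>n\<in>N. f n = 0) then f v else 0)"

definition quot :: "('k::field, 'a::ab_group_add, 'z) vs_scheme \<Rightarrow> 'a set \<Rightarrow> ('k, ('k, 'a) quo) vs" where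
  "quot V N = \<lparr>carrier = proj V N ` carrier V, smul = fsmul\<rparr>"

text \<open>\<open>descend V N f\<close> is the map that \<open>f\<close> induces on the quotient of \<open>V\<close> by \<open>N\<close>;
  it is meaningful only if \<open>f\<close> is constant on classes.\<close>

definition descend :: "('k::field, 'a::ab_group_add, 'z) vs_scheme \<Rightarrow> 'a set \<Rightarrow> ('a \<Rightarrow> 'b) \<Rightarrow>
    ('k, 'a) quo \<Rightarrow> 'b" where
  "descend V N f x = (THE u. \<exists>v\<in>carrier V. x = proj V N v \<and> u = f v)"

lemma vector_space_mult: "vector_space ((*) :: 'k::field \<Rightarrow> 'k \<Rightarrow> 'k)"
  by unfold_locales (simp_all add: algebra_simps)

lemma vector_space_fsmul: "vector_space (fsmul :: 'k::field \<Rightarrow> ('x \<Rightarrow> 'k) \<Rightarrow> 'x \<Rightarrow> 'k)"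
  by unfold_locales (simp_all add: fsmul_def fun_eq_iff algebra_simps)

lemma linear_minus:
  assumes "Vector_Spaces.linear s t f"
  shows "f (x - y) = f x - f y"
proof -
  interpret Vector_Spaces.linear s t f by fact
  show ?thesis by (rule diff)
qed

lemma separating_functional:
  fixes s :: "'k::field \<Rightarrow> 'a::ab_group_add \<Rightarrow> 'a"
  assumes "vector_space s" and "module.subspace s N" and "x \<notin> N"
  shows "\<exists>f. Vector_Spaces.linear s (*) f \<and> (\<forall>n\<in>N. f n = 0) \<and> f x = 1"
proof -
  interpret vs: vector_space s by fact
  interpret k: vector_space "(*) :: 'k \<Rightarrow> 'k \<Rightarrow> 'k" by (rule vector_space_mult)
  interpret p: vector_space_pair s "(*) :: 'k \<Rightarrow> 'k \<Rightarrow> 'k" by unfold_locales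
  obtain B where B: "B \<subseteq> N" "vs.independent B" "N \<subseteq> vs.span B"
    using vs.maximal_independent_subset by blast
  have sp: "vs.span B = N"
    using B assms(2) vs.span_minimal by blast
  have "vs.independent (insert x B)"
    using B(2) sp assms(3) by (simp add: vs.independent_insertI)
  from p.linear_independent_extend[OF this, of "\<lambda>y. if y = x then 1 else 0"]
  obtain g where g: "Vector_Spaces.linear s (*) g"
    "\<forall>y\<in>insert x B. g y = (if y = x then 1 else 0)"
    by blast
  have "\<forall>y\<in>B. g y = 0" using g(2) B(1) assms(3) by auto
  then have "g n = 0" if "n \<in> N" for n
    using p.linear_eq_0_on_span[OF g(1), of B n] sp that by blast
  then show ?thesis using g by auto
qed

lemma subspace_projection:
  fixes s :: "'k::field \<Rightarrow> 'a::ab_group_add \<Rightarrow> 'a"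
  assumes "vector_space s" and "module.subspace s N"
  shows "\<exists>p. Vector_Spaces.linear s s p \<and> range p \<subseteq> N \<and> (\<forall>n\<in>N. p n = n)"
proof -
  interpret vs: vector_space s by fact
  interpret p: vector_space_pair s s by unfold_locales
  obtain B where B: "B \<subseteq> N" "vs.independent B" "N \<subseteq> vs.span B"
    using vs.maximal_independent_subset by blast
  have sp: "vs.span B = N"
    using B assms(2) vs.span_minimal by blast
  from p.linear_independent_extend_subspace[OF B(2), of "\<lambda>x. x"]
  obtain g where g: "Vector_Spaces.linear s s g" "\<forall>y\<in>B. g y = y" "range g = vs.span B"
    unfolding image_ident by blast
  have id: "Vector_Spaces.linear s s (\<lambda>x. x)"
    using assms(1) by (simp add: Vector_Spaces.linear_iff)
  have "g n = n" if "n \<in> N" for n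
    using p.linear_eq_on[OF g(1) id, of n B] g(2) sp that by blast
  then show ?thesis using g sp by auto
qed

lemma proj_eq_iff:
  assumes "vector_space (smul V)" and "module.subspace (smul V) N"
  shows "proj V N v = proj V N w \<longleftrightarrow> v - w \<in> N"
proof
  assume eq: "proj V N v = proj V N w"
  show "v - w \<in> N"
  proof (rule ccontr)
    assume "v - w \<notin> N"
    then obtain f where f: "Vector_Spaces.linear (smul V) (*) f" "\<forall>n\<in>N. f n = 0" "f (v - w) = 1"
      using separating_functional[OF assms] by blast
    have "f v = f w" using fun_cong[OF eq, of f] f by (simp add: proj_def)
    then show False using f(3) linear_minus[OF f(1), of v w] by simp
  qed
next
  assume n: "v - w \<in> N"
  show "proj V N v = proj V N w"
  proof (rule ext)
    fix f
    have "f v = f w" if f: "Vector_Spaces.linear (smul V) (*) f" "\<forall>n\<in>N. f n = 0"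
      using n f(2) linear_minus[OF f(1), of v w] by force
    then show "proj V N v f = proj V N w f" by (auto simp: proj_def)
  qed
qed

lemma lin_proj:
  assumes "vspace V"
  shows "lin V (quot V N) (proj V N)"
  by (auto simp: lin_def quot_def proj_def fsmul_def fun_eq_iff Vector_Spaces.linear_iff)

lemma descend_proj:
  assumes "vspace V" and "subsp V N" and "v \<in> carrier V"
    and "\<And>x y. x \<in> carrier V \<Longrightarrow> y \<in> carrier V \<Longrightarrow> x - y \<in> N \<Longrightarrow> f x = f y"
  shows "descend V N f (proj V N v) = f v"
  unfolding descend_def
proof (rule the_equality)
  show "\<exists>x\<in>carrier V. proj V N v = proj V N x \<and> f v = f x" using assms(3) by blast
  show "u = f v" if "\<exists>x\<in>carrier V. proj V N v = proj V N x \<and> u = f x" for u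
    using that assms proj_eq_iff[of V N v] by (auto simp: vspace_def subsp_def)
qed

text \<open>
  The pure tensor \<open>v \<otimes> w\<close> is evaluation at \<open>(v, w)\<close> on bilinear forms; the tensor product is
  the span of the pure tensors.  Over a field this is the usual tensor product:
  \<open>bilin_tens\<close>, \<open>tprod_sum_list\<close> and \<open>lift_sum_list\<close> below give its universal property.
  The pure tensors depend on \<open>V\<close> and \<open>W\<close> only through the scalar multiplications, so tensors
  of subspaces are spans inside the ambient tensor product.
\<close>

type_synonym ('k, 'a, 'b) ten = "('a \<Rightarrow> 'b \<Rightarrow> 'k) \<Rightarrow> 'k"

definition tens :: "'a::ab_group_add \<Rightarrow> ('k::field, 'a, 'y) vs_scheme \<Rightarrow>
    ('k, 'b::ab_group_add, 'z) vs_scheme \<Rightarrow> 'b \<Rightarrow> ('k, 'a, 'b) ten"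
    ("(_ \<otimes>\<^bsub>_,_\<^esub> _)" [71, 0, 0, 71] 70) where
  "(v \<otimes>\<^bsub>V,W\<^esub> w) =
     (\<lambda>b. if (\<forall>y. Vector_Spaces.linear (smul V) (*) (\<lambda>x. b x y)) \<and>
             (\<forall>x. Vector_Spaces.linear (smul W) (*) (b x)) then b v w else 0)"

definition tspan :: "('k::field, 'a::ab_group_add, 'y) vs_scheme \<Rightarrow>
    ('k, 'b::ab_group_add, 'z) vs_scheme \<Rightarrow> 'a set \<Rightarrow> 'b set \<Rightarrow> ('k, 'a, 'b) ten set" where
  "tspan V W A B = module.span fsmul {a \<otimes>\<^bsub>V,W\<^esub> b | a b. a \<in> A \<and> b \<in> B}"

definition tprod :: "('k::field, 'a::ab_group_add, 'y) vs_scheme \<Rightarrow>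
    ('k, 'b::ab_group_add, 'z) vs_scheme \<Rightarrow> ('k, ('k, 'a, 'b) ten) vs" where
  "tprod V W = \<lparr>carrier = tspan V W (carrier V) (carrier W), smul = fsmul\<rparr>"

text \<open>\<open>lift V W f\<close> is the linear map on the tensor product with \<open>v \<otimes> w \<mapsto> f v w\<close>, for bilinear \<open>f\<close>.\<close>

definition lift :: "('k::field, 'a::ab_group_add, 'y) vs_scheme \<Rightarrow>
    ('k, 'b::ab_group_add, 'z) vs_scheme \<Rightarrow> ('a \<Rightarrow> 'b \<Rightarrow> 'c::ab_group_add) \<Rightarrow> ('k, 'a, 'b) ten \<Rightarrow> 'c" where
  "lift V W f t =
     (THE u. \<exists>xs. set xs \<subseteq> carrier V \<times> carrier W \<and>
        t = (\<Sum>(v, w)\<leftarrow>xs. v \<otimes>\<^bsub>V,W\<^esub> w) \<and> u = (\<Sum>(v, w)\<leftarrow>xs. f v w))"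

lemma bilin_tens: "bilin V W (tprod V W) (\<lambda>v w. v \<otimes>\<^bsub>V,W\<^esub> w)"
proof -
  interpret f: vector_space "fsmul :: 'a \<Rightarrow> (('b \<Rightarrow> 'd \<Rightarrow> 'a) \<Rightarrow> 'a) \<Rightarrow> _"
    by (rule vector_space_fsmul)
  have "(v \<otimes>\<^bsub>V,W\<^esub> w) \<in> carrier (tprod V W)" if "v \<in> carrier V" "w \<in> carrier W" for v w
    using that by (auto simp: tprod_def tspan_def intro!: f.span_base)
  then show ?thesis
    by (auto simp: bilin_def lin_def)
      (auto simp: tprod_def tens_def fsmul_def fun_eq_iff Vector_Spaces.linear_iff)
qed

lemma tprod_sum_list:
  assumes "vspace V" and "t \<in> carrier (tprod V W)"
  shows "\<exists>xs. set xs \<subseteq> carrier V \<times> carrier W \<and> t = (\<Sum>(v, w)\<leftarrow>xs. v \<otimes>\<^bsub>V,W\<^esub> w)"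
proof -
  interpret f: vector_space "fsmul :: 'a \<Rightarrow> (('b \<Rightarrow> 'd \<Rightarrow> 'a) \<Rightarrow> 'a) \<Rightarrow> _"
    by (rule vector_space_fsmul)
  have v: "vector_space (smul V)" "module.subspace (smul V) (carrier V)"
    using assms(1) by (auto simp: vspace_def)
  interpret v: vector_space "smul V" by (rule v(1))
  have "t \<in> f.span {v \<otimes>\<^bsub>V,W\<^esub> w | v w. v \<in> carrier V \<and> w \<in> carrier W}"
    using assms(2) by (simp add: tprod_def tspan_def)
  then show ?thesis
  proof (induction rule: f.span_induct_alt)
    case base
    show ?case by (rule exI[of _ "[]"]) simp
  next
    case (step c x y)
    then obtain a b xs where *: "x = (a \<otimes>\<^bsub>V,W\<^esub> b)" "a \<in> carrier V" "b \<in> carrier W"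
      "set xs \<subseteq> carrier V \<times> carrier W" "y = (\<Sum>(v, w)\<leftarrow>xs. v \<otimes>\<^bsub>V,W\<^esub> w)"
      by blast
    have "smul V c a \<in> carrier V" using v.subspace_scale[OF v(2)] *(2) by blast
    moreover have "fsmul c x = (smul V c a \<otimes>\<^bsub>V,W\<^esub> b)"
      using bilin_tens[of V W] *(2,3) by (simp add: *(1) bilin_def lin_def tprod_def)
    ultimately show ?case using * by (intro exI[of _ "(smul V c a, b) # xs"]) auto
  qed
qed

lemma sum_list_apply: "(\<Sum>x\<leftarrow>xs. f x) y = (\<Sum>x\<leftarrow>xs. f x y)"
  for f :: "'c \<Rightarrow> 'a \<Rightarrow> 'b::ab_group_add"
  by (induction xs) simp_all

lemma lift_sum_list:
  fixes U :: "('k::field, 'c::ab_group_add, 'z) vs_scheme"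
  assumes V: "vspace V" and W: "vspace W" and U: "vspace U" and f: "bilin V W U f"
    and xs: "set xs \<subseteq> carrier V \<times> carrier W"
  shows "lift V W f (\<Sum>(v, w)\<leftarrow>xs. v \<otimes>\<^bsub>V,W\<^esub> w) = (\<Sum>(v, w)\<leftarrow>xs. f v w)"
proof -
  have *: "(\<Sum>(v, w)\<leftarrow>xs. f v w) = (\<Sum>(v, w)\<leftarrow>ys. f v w)"
    if ys: "set ys \<subseteq> carrier V \<times> carrier W"
      and eq: "(\<Sum>(v, w)\<leftarrow>xs. v \<otimes>\<^bsub>V,W\<^esub> w) = (\<Sum>(v, w)\<leftarrow>ys. v \<otimes>\<^bsub>V,W\<^esub> w)" for ys
  proof (rule ccontr)
    assume ne: "(\<Sum>(v, w)\<leftarrow>xs. f v w) \<noteq> (\<Sum>(v, w)\<leftarrow>ys. f v w)"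
    interpret u: vector_space "smul U" using U by (simp add: vspace_def)
    have "(\<Sum>(v, w)\<leftarrow>xs. f v w) - (\<Sum>(v, w)\<leftarrow>ys. f v w) \<notin> {0}" using ne by simp
    from separating_functional[OF u.vector_space_axioms u.subspace_single_0 this]
    obtain g where g: "Vector_Spaces.linear (smul U) (*) g"
      "g ((\<Sum>(v, w)\<leftarrow>xs. f v w) - (\<Sum>(v, w)\<leftarrow>ys. f v w)) = 1" by blast
    obtain p where p: "Vector_Spaces.linear (smul V) (smul V) p" "range p \<subseteq> carrier V"
      "\<forall>n\<in>carrier V. p n = n"
      using subspace_projection[of "smul V" "carrier V"] V by (auto simp: vspace_def)
    obtain q where q: "Vector_Spaces.linear (smul W) (smul W) q" "range q \<subseteq> carrier W"
      "\<forall>n\<in>carrier W. q n = n"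
      using subspace_projection[of "smul W" "carrier W"] W by (auto simp: vspace_def)
    have pq: "p x \<in> carrier V" "q y \<in> carrier W" for x y using p(2) q(2) by auto
    define b where "b = (\<lambda>x y. g (f (p x) (q y)))"
    have f1: "f (x + x') y = f x y + f x' y" "f (smul V c x) y = smul U c (f x y)"
      if "x \<in> carrier V" "x' \<in> carrier V" "y \<in> carrier W" for c x x' y
      using f that unfolding bilin_def lin_def by blast+
    have f2: "f x (y + y') = f x y + f x y'" "f x (smul W c y) = smul U c (f x y)"
      if "x \<in> carrier V" "y \<in> carrier W" "y' \<in> carrier W" for c x y y'
      using f that unfolding bilin_def lin_def by blast+
    have b1: "Vector_Spaces.linear (smul V) (*) (\<lambda>x. b x y)" for y
      using p(1) g(1) pq f1(1)[OF pq(1) pq(1) pq(2)] f1(2)[OF pq(1) pq(1) pq(2)]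
      by (simp add: b_def Vector_Spaces.linear_iff)
    have b2: "Vector_Spaces.linear (smul W) (*) (b x)" for x
      using q(1) g(1) pq f2(1)[OF pq(1) pq(2) pq(2)] f2(2)[OF pq(1) pq(2) pq(2)]
      by (simp add: b_def Vector_Spaces.linear_iff)
    have ev: "(\<Sum>(v, w)\<leftarrow>zs. v \<otimes>\<^bsub>V,W\<^esub> w) b = g (\<Sum>(v, w)\<leftarrow>zs. f v w)"
      if "set zs \<subseteq> carrier V \<times> carrier W" for zs
      using that
    proof (induction zs)
      case Nil
      have "g 0 = 0" using linear_minus[OF g(1), of 0 0] by simp
      then show ?case by simp
    next
      case (Cons z zs)
      obtain v w where z: "z = (v, w)" by fastforce
      have "(v \<otimes>\<^bsub>V,W\<^esub> w) b = g (f v w)"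
        using Cons.prems p(3) q(3) b1 b2 by (simp add: z tens_def b_def)
      moreover have "g (x + y) = g x + g y" for x y
        using g(1) by (simp add: Vector_Spaces.linear_iff)
      ultimately show ?case using Cons by (simp add: z)
    qed
    show False
      using g(2) linear_minus[OF g(1)] ev[OF xs] ev[OF ys] eq by simp
  qed
  show ?thesis
    unfolding lift_def
  proof (rule the_equality, goal_cases)
    case 1
    show ?case by (rule exI[of _ xs]) (simp add: xs)
  next
    case (2 u)
    then obtain ys where "set ys \<subseteq> carrier V \<times> carrier W"
      "(\<Sum>(v, w)\<leftarrow>xs. v \<otimes>\<^bsub>V,W\<^esub> w) = (\<Sum>(v, w)\<leftarrow>ys. v \<otimes>\<^bsub>V,W\<^esub> w)" "u = (\<Sum>(v, w)\<leftarrow>ys. f v w)"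
      by (elim exE conjE)
    then show ?case using *[of ys] by (simp only:)
  qed
qed


section \<open>Hopf algebras\<close>

record ('k, 'a) alg = "('k, 'a) vs" +
  mul :: "'a \<Rightarrow> 'a \<Rightarrow> 'a" (infixl "\<cdot>\<index>" 75)
  unit :: 'a ("\<one>\<index>")

record ('k, 'a) hopf = "('k, 'a) alg" +
  comul :: "'a \<Rightarrow> ('k, 'a, 'a) ten"
  counit :: "'a \<Rightarrow> 'k"
  antip :: "'a \<Rightarrow> 'a"

definition algebra :: "('k::field, 'a::ab_group_add, 'z) alg_scheme \<Rightarrow> bool" where
  "algebra A \<longleftrightarrow> vspace A \<and> bilin A A A (mul A) \<and> \<one>\<^bsub>A\<^esub> \<in> carrier A \<and>
     (\<forall>a\<in>carrier A. \<forall>b\<in>carrier A. \<forall>c\<in>carrier A. a \<cdot>\<^bsub>A\<^esub> b \<cdot>\<^bsub>A\<^esub> c = a \<cdot>\<^bsub>A\<^esub> (b \<cdot>\<^bsub>A\<^esub> c)) \<and>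
     (\<forall>a\<in>carrier A. \<one>\<^bsub>A\<^esub> \<cdot>\<^bsub>A\<^esub> a = a \<and> a \<cdot>\<^bsub>A\<^esub> \<one>\<^bsub>A\<^esub> = a)"

definition tens_mul :: "('k::field, 'a::ab_group_add, 'y) alg_scheme \<Rightarrow>
    ('k, 'b::ab_group_add, 'z) alg_scheme \<Rightarrow> ('k, 'a, 'b) ten \<Rightarrow> ('k, 'a, 'b) ten \<Rightarrow> ('k, 'a, 'b) ten" where
  "tens_mul A B x y =
     lift A B (\<lambda>a b. lift A B (\<lambda>a' b'. (a \<cdot>\<^bsub>A\<^esub> a') \<otimes>\<^bsub>A,B\<^esub> (b \<cdot>\<^bsub>B\<^esub> b')) y) x"

text \<open>Sweedler notation: \<open>sw2 H f h\<close> is the sum of \<open>f h\<^sub>1 h\<^sub>2\<close>, and \<open>sw3 H f h\<close> the sum of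
  \<open>f h\<^sub>1 h\<^sub>2 h\<^sub>3\<close>, where \<open>h\<^sub>1 \<otimes> h\<^sub>2 \<otimes> h\<^sub>3\<close> is obtained by applying the coproduct to the left
  factor of the coproduct.\<close>

definition sw2 :: "('k::field, 'a::ab_group_add, 'z) hopf_scheme \<Rightarrow>
    ('a \<Rightarrow> 'a \<Rightarrow> 'c::ab_group_add) \<Rightarrow> 'a \<Rightarrow> 'c" where
  "sw2 H f h = lift H H f (comul H h)"

definition sw3 :: "('k::field, 'a::ab_group_add, 'z) hopf_scheme \<Rightarrow>
    ('a \<Rightarrow> 'a \<Rightarrow> 'a \<Rightarrow> 'c::ab_group_add) \<Rightarrow> 'a \<Rightarrow> 'c" where
  "sw3 H f h = sw2 H (\<lambda>x c. sw2 H (\<lambda>a b. f a b c) x) h"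

definition hopf_algebra :: "('k::field, 'a::ab_group_add, 'z) hopf_scheme \<Rightarrow> bool" where
  "hopf_algebra H \<longleftrightarrow>
     algebra H \<and>
     lin H (tprod H H) (comul H) \<and>
     (\<forall>h\<in>carrier H.
        sw2 H (\<lambda>x c. sw2 H (\<lambda>a b. (a \<otimes>\<^bsub>H,H\<^esub> b) \<otimes>\<^bsub>tprod H H,H\<^esub> c) x) h =
        sw2 H (\<lambda>a y. sw2 H (\<lambda>b c. (a \<otimes>\<^bsub>H,H\<^esub> b) \<otimes>\<^bsub>tprod H H,H\<^esub> c) y) h) \<and>
     (\<forall>g\<in>carrier H. \<forall>h\<in>carrier H. comul H (g \<cdot>\<^bsub>H\<^esub> h) = tens_mul H H (comul H g) (comul H h)) \<and>
     comul H \<one>\<^bsub>H\<^esub> = (\<one>\<^bsub>H\<^esub> \<otimes>\<^bsub>H,H\<^esub> \<one>\<^bsub>H\<^esub>) \<and>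
     lin H \<lparr>carrier = UNIV, smul = (*)\<rparr> (counit H) \<and>
     (\<forall>h\<in>carrier H. sw2 H (\<lambda>a b. smul H (counit H a) b) h = h \<and>
                    sw2 H (\<lambda>a b. smul H (counit H b) a) h = h) \<and>
     (\<forall>g\<in>carrier H. \<forall>h\<in>carrier H. counit H (g \<cdot>\<^bsub>H\<^esub> h) = counit H g * counit H h) \<and>
     counit H \<one>\<^bsub>H\<^esub> = 1 \<and>
     lin H H (antip H) \<and>
     (\<forall>h\<in>carrier H. sw2 H (\<lambda>a b. antip H a \<cdot>\<^bsub>H\<^esub> b) h = smul H (counit H h) \<one>\<^bsub>H\<^esub> \<and>
                    sw2 H (\<lambda>a b. a \<cdot>\<^bsub>H\<^esub> antip H b) h = smul H (counit H h) \<one>\<^bsub>H\<^esub>) \<and>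
     bij_betw (antip H) (carrier H) (carrier H)"

definition aug :: "('k::field, 'a::ab_group_add, 'z) hopf_scheme \<Rightarrow> 'a set" where
  "aug H = {h \<in> carrier H. counit H h = 0}"

definition tens_hopf :: "('k::field, 'a::ab_group_add, 'y) hopf_scheme \<Rightarrow>
    ('k, 'b::ab_group_add, 'z) hopf_scheme \<Rightarrow> ('k, ('k, 'a, 'b) ten) hopf" where
  "tens_hopf M H =
     \<lparr>carrier = carrier (tprod M H), smul = fsmul,
      mul = tens_mul M H, unit = (\<one>\<^bsub>M\<^esub> \<otimes>\<^bsub>M,H\<^esub> \<one>\<^bsub>H\<^esub>),
      comul = lift M H (\<lambda>m h.
        sw2 M (\<lambda>m1 m2. sw2 H (\<lambda>h1 h2. (m1 \<otimes>\<^bsub>M,H\<^esub> h1) \<otimes>\<^bsub>tprod M H,tprod M H\<^esub> (m2 \<otimes>\<^bsub>M,H\<^esub> h2)) h) m),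
      counit = lift M H (\<lambda>m h. counit M m * counit H h),
      antip = lift M H (\<lambda>m h. antip M m \<otimes>\<^bsub>M,H\<^esub> antip H h)\<rparr>"

definition right_comodule :: "('k::field, 'a::ab_group_add, 'y) hopf_scheme \<Rightarrow>
    ('k, 'v::ab_group_add, 'z) vs_scheme \<Rightarrow> ('v \<Rightarrow> ('k, 'v, 'a) ten) \<Rightarrow> bool" where
  "right_comodule H V \<rho> \<longleftrightarrow>
     lin V (tprod V H) \<rho> \<and>
     (\<forall>v\<in>carrier V.
        lift V H (\<lambda>w h. \<rho> w \<otimes>\<^bsub>tprod V H,H\<^esub> h) (\<rho> v) =
        lift V H (\<lambda>w h. sw2 H (\<lambda>a b. (w \<otimes>\<^bsub>V,H\<^esub> a) \<otimes>\<^bsub>tprod V H,H\<^esub> b) h) (\<rho> v)) \<and>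
     (\<forall>v\<in>carrier V. lift V H (\<lambda>w h. smul V (counit H h) w) (\<rho> v) = v)"


section \<open>First order calculi\<close>

record ('k, 'a, 'v) bimod = "('k, 'v) vs" +
  lact :: "'a \<Rightarrow> 'v \<Rightarrow> 'v"
  ract :: "'v \<Rightarrow> 'a \<Rightarrow> 'v"

text \<open>The universal calculus \<open>\<Omega>\<^sup>1A\<close>: the kernel of the product, as a sub-bimodule of \<open>A \<otimes> A\<close>.\<close>

definition univ :: "('k::field, 'a::ab_group_add, 'z) alg_scheme \<Rightarrow> ('k, 'a, ('k, 'a, 'a) ten) bimod" where
  "univ A =
     \<lparr>carrier = {t \<in> carrier (tprod A A). lift A A (mul A) t = 0}, smul = fsmul,
      lact = (\<lambda>a. lift A A (\<lambda>x y. (a \<cdot>\<^bsub>A\<^esub> x) \<otimes>\<^bsub>A,A\<^esub> y)),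
      ract = (\<lambda>t a. lift A A (\<lambda>x y. x \<otimes>\<^bsub>A,A\<^esub> (y \<cdot>\<^bsub>A\<^esub> a)) t)\<rparr>"

definition duniv :: "('k::field, 'a::ab_group_add, 'z) alg_scheme \<Rightarrow> 'a \<Rightarrow> ('k, 'a, 'a) ten" where
  "duniv A a = (\<one>\<^bsub>A\<^esub> \<otimes>\<^bsub>A,A\<^esub> a) - (a \<otimes>\<^bsub>A,A\<^esub> \<one>\<^bsub>A\<^esub>)"

definition sub_bimodule :: "('k::field, 'a::ab_group_add, 'z) alg_scheme \<Rightarrow> ('k, 'a, 'a) ten set \<Rightarrow> bool" where
  "sub_bimodule A N \<longleftrightarrow> subsp (univ A) N \<and>
     (\<forall>a\<in>carrier A. \<forall>n\<in>N. lact (univ A) a n \<in> N \<and> ract (univ A) n a \<in> N)"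

type_synonym ('k, 'a) form1 = "('k, ('k, 'a, 'a) ten) quo"

definition forms1 :: "('k::field, 'a::ab_group_add, 'z) alg_scheme \<Rightarrow> ('k, 'a, 'a) ten set \<Rightarrow>
    ('k, 'a, ('k, 'a) form1) bimod" where
  "forms1 A N =
     \<lparr>carrier = carrier (quot (univ A) N), smul = fsmul,
      lact = (\<lambda>a. descend (univ A) N (\<lambda>t. proj (univ A) N (lact (univ A) a t))),
      ract = (\<lambda>x a. descend (univ A) N (\<lambda>t. proj (univ A) N (ract (univ A) t a)) x)\<rparr>"

definition d0 :: "('k::field, 'a::ab_group_add, 'z) alg_scheme \<Rightarrow> ('k, 'a, 'a) ten set \<Rightarrow> 'a \<Rightarrow>
    ('k, 'a) form1" where
  "d0 A N a = proj (univ A) N (duniv A a)"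

text \<open>The coactions \<open>a \<otimes> b \<mapsto> a\<^sub>1b\<^sub>1 \<otimes> (a\<^sub>2 \<otimes> b\<^sub>2)\<close> and \<open>a \<otimes> b \<mapsto> (a\<^sub>1 \<otimes> b\<^sub>1) \<otimes> a\<^sub>2b\<^sub>2\<close> of \<open>H\<close> on \<open>H \<otimes> H\<close>.\<close>

definition lcoact :: "('k::field, 'a::ab_group_add, 'z) hopf_scheme \<Rightarrow> ('k, 'a, 'a) ten \<Rightarrow>
    ('k, 'a, ('k, 'a, 'a) ten) ten" where
  "lcoact H = lift H H (\<lambda>a b. sw2 H (\<lambda>a1 a2. sw2 H (\<lambda>b1 b2.
     (a1 \<cdot>\<^bsub>H\<^esub> b1) \<otimes>\<^bsub>H,univ H\<^esub> (a2 \<otimes>\<^bsub>H,H\<^esub> b2)) b) a)"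

definition rcoact :: "('k::field, 'a::ab_group_add, 'z) hopf_scheme \<Rightarrow> ('k, 'a, 'a) ten \<Rightarrow>
    ('k, ('k, 'a, 'a) ten, 'a) ten" where
  "rcoact H = lift H H (\<lambda>a b. sw2 H (\<lambda>a1 a2. sw2 H (\<lambda>b1 b2.
     (a1 \<otimes>\<^bsub>H,H\<^esub> b1) \<otimes>\<^bsub>univ H,H\<^esub> (a2 \<cdot>\<^bsub>H\<^esub> b2)) b) a)"

text \<open>The calculus given by \<open>N\<close> is bicovariant if the coactions descend to \<open>\<Omega>\<^sup>1H / N\<close>.\<close>

definition bicovariant :: "('k::field, 'a::ab_group_add, 'z) hopf_scheme \<Rightarrow> ('k, 'a, 'a) ten set \<Rightarrow> bool" where
  "bicovariant H N \<longleftrightarrow> sub_bimodule H N \<and>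
     lcoact H ` N \<subseteq> tspan H (univ H) (carrier H) N \<and>
     rcoact H ` N \<subseteq> tspan (univ H) H N (carrier H)"

definition Ad :: "('k::field, 'a::ab_group_add, 'z) hopf_scheme \<Rightarrow> 'a \<Rightarrow> ('k, 'a, 'a) ten" where
  "Ad H = sw3 H (\<lambda>a b c. b \<otimes>\<^bsub>H,H\<^esub> (antip H a \<cdot>\<^bsub>H\<^esub> c))"

definition ad_ideal :: "('k::field, 'a::ab_group_add, 'z) hopf_scheme \<Rightarrow> 'a set \<Rightarrow> bool" where
  "ad_ideal H Q \<longleftrightarrow> subsp H Q \<and> Q \<subseteq> aug H \<and>
     (\<forall>q\<in>Q. \<forall>h\<in>carrier H. q \<cdot>\<^bsub>H\<^esub> h \<in> Q) \<and>
     Ad H ` Q \<subseteq> tspan H H Q (carrier H)"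

text \<open>
  The linear isomorphism \<open>h \<otimes> g \<mapsto> hg\<^sub>1 \<otimes> g\<^sub>2\<close> maps \<open>\<Omega>\<^sup>1H\<close> onto \<open>H \<otimes> ker \<epsilon>\<close>, its inverse being
  \<open>h \<otimes> g \<mapsto> h(Sg\<^sub>1) \<otimes> g\<^sub>2\<close>; \<open>calc H Q\<close> is the subspace mapped onto \<open>H \<otimes> Q\<close>.
\<close>

definition triv :: "('k::field, 'a::ab_group_add, 'z) hopf_scheme \<Rightarrow> ('k, 'a, 'a) ten \<Rightarrow> ('k, 'a, 'a) ten" where
  "triv H = lift H H (\<lambda>h g. sw2 H (\<lambda>g1 g2. (h \<cdot>\<^bsub>H\<^esub> g1) \<otimes>\<^bsub>H,H\<^esub> g2) g)"

definition calc :: "('k::field, 'a::ab_group_add, 'z) hopf_scheme \<Rightarrow> 'a set \<Rightarrow> ('k, 'a, 'a) ten set" where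
  "calc H Q = {t \<in> carrier (tprod H H). triv H t \<in> tspan H H (carrier H) Q}"

definition Omega0 :: "('k::field, 'a::ab_group_add, 'z) hopf_scheme \<Rightarrow> 'a set \<Rightarrow> ('k, ('k, 'a) quo) vs" where
  "Omega0 H Q = quot \<lparr>carrier = aug H, smul = smul H\<rparr> Q"

text \<open>The map \<open>h \<mapsto> h - \<epsilon>(h)1\<close> followed by the projection to \<open>ker \<epsilon> / Q\<close>.\<close>

definition pi0 :: "('k::field, 'a::ab_group_add, 'z) hopf_scheme \<Rightarrow> 'a set \<Rightarrow> 'a \<Rightarrow> ('k, 'a) quo" where
  "pi0 H Q h = proj H Q (h - smul H (counit H h) \<one>\<^bsub>H\<^esub>)"


section \<open>Forms of degree two\<close>

definition bal_rel :: "('k::field, 'a::ab_group_add, 'x) alg_scheme \<Rightarrow>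
    ('k, 'a, 'v::ab_group_add, 'y) bimod_scheme \<Rightarrow> ('k, 'v, 'v) ten set" where
  "bal_rel A B = module.span fsmul
     {(ract B v a \<otimes>\<^bsub>B,B\<^esub> w) - (v \<otimes>\<^bsub>B,B\<^esub> lact B a w) | v a w.
        v \<in> carrier B \<and> a \<in> carrier A \<and> w \<in> carrier B}"

text \<open>The bimodule \<open>B \<otimes>\<^sub>A B\<close> and its generators.\<close>

definition baltens :: "('k::field, 'a::ab_group_add, 'x) alg_scheme \<Rightarrow>
    ('k, 'a, 'v::ab_group_add, 'y) bimod_scheme \<Rightarrow> 'v \<Rightarrow> 'v \<Rightarrow> ('k, ('k, 'v, 'v) ten) quo" where
  "baltens A B v w = proj (tprod B B) (bal_rel A B) (v \<otimes>\<^bsub>B,B\<^esub> w)"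

definition balprod :: "('k::field, 'a::ab_group_add, 'x) alg_scheme \<Rightarrow>
    ('k, 'a, 'v::ab_group_add, 'y) bimod_scheme \<Rightarrow> ('k, 'a, ('k, ('k, 'v, 'v) ten) quo) bimod" where
  "balprod A B =
     \<lparr>carrier = carrier (quot (tprod B B) (bal_rel A B)), smul = fsmul,
      lact = (\<lambda>a. descend (tprod B B) (bal_rel A B) (lift B B (\<lambda>v w. baltens A B (lact B a v) w))),
      ract = (\<lambda>x a. descend (tprod B B) (bal_rel A B) (lift B B (\<lambda>v w. baltens A B v (ract B w a))) x)\<rparr>"

definition left_invariant :: "('k::field, 'a::ab_group_add, 'z) hopf_scheme \<Rightarrow> ('k, 'a, 'a) ten set \<Rightarrow>
    ('k, 'a) form1 set" where
  "left_invariant H N = {v \<in> carrier (forms1 H N).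
     descend (univ H) N
       (\<lambda>t. lift H (tprod H H) (\<lambda>a s. a \<otimes>\<^bsub>H,forms1 H N\<^esub> proj (univ H) N s) (lcoact H t)) v =
     (\<one>\<^bsub>H\<^esub> \<otimes>\<^bsub>H,forms1 H N\<^esub> v)}"

definition right_invariant :: "('k::field, 'a::ab_group_add, 'z) hopf_scheme \<Rightarrow> ('k, 'a, 'a) ten set \<Rightarrow>
    ('k, 'a) form1 set" where
  "right_invariant H N = {v \<in> carrier (forms1 H N).
     descend (univ H) N
       (\<lambda>t. lift (tprod H H) H (\<lambda>s a. proj (univ H) N s \<otimes>\<^bsub>forms1 H N,H\<^esub> a) (rcoact H t)) v =
     (v \<otimes>\<^bsub>forms1 H N,H\<^esub> \<one>\<^bsub>H\<^esub>)}"

definition bimodule_map :: "('k::field, 'a::ab_group_add, 'x) alg_scheme \<Rightarrow>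
    ('k, 'a, 'v::ab_group_add, 'y) bimod_scheme \<Rightarrow> ('k, 'a, 'w::ab_group_add, 'z) bimod_scheme \<Rightarrow>
    ('v \<Rightarrow> 'w) \<Rightarrow> bool" where
  "bimodule_map A B C f \<longleftrightarrow> lin B C f \<and>
     (\<forall>a\<in>carrier A. \<forall>v\<in>carrier B. f (lact B a v) = lact C a (f v) \<and> f (ract B v a) = ract C (f v) a)"

text \<open>The Woronowicz braiding; it is unique on the carrier because left-invariant forms generate
  \<open>\<Omega>\<^sup>1(H)\<close> as a left module and right-invariant forms generate it as a right module.\<close>

definition braiding :: "('k::field, 'a::ab_group_add, 'z) hopf_scheme \<Rightarrow> ('k, 'a, 'a) ten set \<Rightarrow>
    ('k, ('k, ('k, 'a) form1, ('k, 'a) form1) ten) quo \<Rightarrow>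
    ('k, ('k, ('k, 'a) form1, ('k, 'a) form1) ten) quo" where
  "braiding H N = (SOME \<Psi>.
     bimodule_map H (balprod H (forms1 H N)) (balprod H (forms1 H N)) \<Psi> \<and>
     (\<forall>v\<in>left_invariant H N. \<forall>w\<in>right_invariant H N.
        \<Psi> (baltens H (forms1 H N) v w) = baltens H (forms1 H N) w v))"

definition braid_ker :: "('k::field, 'a::ab_group_add, 'z) hopf_scheme \<Rightarrow> ('k, 'a, 'a) ten set \<Rightarrow>
    ('k, ('k, ('k, 'a) form1, ('k, 'a) form1) ten) quo set" where
  "braid_ker H N = {t \<in> carrier (balprod H (forms1 H N)). t - braiding H N t = 0}"

type_synonym ('k, 'a) form2 = "('k, ('k, ('k, ('k, 'a) form1, ('k, 'a) form1) ten) quo) quo"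

definition forms2 :: "('k::field, 'a::ab_group_add, 'z) hopf_scheme \<Rightarrow> ('k, 'a, 'a) ten set \<Rightarrow>
    ('k, 'a, ('k, 'a) form2) bimod" where
  "forms2 H N =
    (let T = balprod H (forms1 H N); K = braid_ker H N in
     \<lparr>carrier = carrier (quot T K), smul = fsmul,
      lact = (\<lambda>a. descend T K (\<lambda>t. proj T K (lact T a t))),
      ract = (\<lambda>x a. descend T K (\<lambda>t. proj T K (ract T t a)) x)\<rparr>)"

definition wedge :: "('k::field, 'a::ab_group_add, 'z) hopf_scheme \<Rightarrow> ('k, 'a, 'a) ten set \<Rightarrow>
    ('k, 'a) form1 \<Rightarrow> ('k, 'a) form1 \<Rightarrow> ('k, 'a) form2" where
  "wedge H N v w = proj (balprod H (forms1 H N)) (braid_ker H N) (baltens H (forms1 H N) v w)"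

text \<open>An element of \<open>\<Omega>\<^sup>1H\<close> is a sum of terms \<open>a \<otimes> b\<close> and equals the sum of the \<open>a (db)\<close>, whence
  its exterior derivative is the sum of the \<open>da \<and> db\<close>.\<close>

definition d1 :: "('k::field, 'a::ab_group_add, 'z) hopf_scheme \<Rightarrow> ('k, 'a, 'a) ten set \<Rightarrow>
    ('k, 'a) form1 \<Rightarrow> ('k, 'a) form2" where
  "d1 H N = descend (univ H) N (lift H H (\<lambda>a b. wedge H N (d0 H N a) (d0 H N b)))"


section \<open>Framings and gauge fields\<close>

text \<open>An \<open>\<Omega>\<^sub>0\<close>-bein, \<open>\<Omega>\<^sub>0\<close> being a right comodule by the projected adjoint coaction.\<close>

definition bein :: "('k::field, 'a::ab_group_add, 'z) hopf_scheme \<Rightarrow> 'a set \<Rightarrow>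
    (('k, 'a) quo \<Rightarrow> ('k, 'a) form1) \<Rightarrow> bool" where
  "bein H Q e \<longleftrightarrow>
     right_comodule H (Omega0 H Q)
       (descend \<lparr>carrier = aug H, smul = smul H\<rparr> Q
          (\<lambda>h. lift H H (\<lambda>g a. pi0 H Q g \<otimes>\<^bsub>Omega0 H Q,H\<^esub> a) (Ad H h))) \<and>
     lin (Omega0 H Q) (forms1 H (calc H Q)) e \<and>
     bij_betw (lift H (Omega0 H Q) (\<lambda>h v. lact (forms1 H (calc H Q)) h (e v)))
       (carrier (tprod H (Omega0 H Q))) (carrier (forms1 H (calc H Q)))"

definition maurer_cartan :: "('k::field, 'a::ab_group_add, 'z) hopf_scheme \<Rightarrow> 'a set \<Rightarrow>
    ('k, 'a) quo \<Rightarrow> ('k, 'a) form1" where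
  "maurer_cartan H Q = descend \<lparr>carrier = aug H, smul = smul H\<rparr> Q
     (\<lambda>h. proj (univ H) (calc H Q) (sw2 H (\<lambda>a b. antip H a \<otimes>\<^bsub>H,H\<^esub> b) h))"

definition gauge_field :: "('k::field, 'a::ab_group_add, 'z) hopf_scheme \<Rightarrow> 'a set \<Rightarrow>
    (('k, 'a) quo \<Rightarrow> ('k, 'a) form1) \<Rightarrow> bool" where
  "gauge_field H Q A \<longleftrightarrow> lin (Omega0 H Q) (forms1 H (calc H Q)) A"

definition curvature :: "('k::field, 'a::ab_group_add, 'z) hopf_scheme \<Rightarrow> 'a set \<Rightarrow>
    (('k, 'a) quo \<Rightarrow> ('k, 'a) form1) \<Rightarrow> 'a \<Rightarrow> ('k, 'a) form2" where
  "curvature H Q A h =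
     d1 H (calc H Q) (A (pi0 H Q h)) +
     sw2 H (\<lambda>a b. wedge H (calc H Q) (A (pi0 H Q a)) (A (pi0 H Q b))) h"


section \<open>The calculus on a tensor product\<close>

definition sum3 :: "'a::ab_group_add set \<Rightarrow> 'a set \<Rightarrow> 'a set \<Rightarrow> 'a set" where
  "sum3 A B C = {a + b + c | a b c. a \<in> A \<and> b \<in> B \<and> c \<in> C}"

text \<open>The identification \<open>(m \<otimes> m') \<otimes> (h \<otimes> h') \<mapsto> (m \<otimes> h) \<otimes> (m' \<otimes> h')\<close> of
  \<open>M \<otimes> M \<otimes> H \<otimes> H\<close> with \<open>P \<otimes> P\<close>.\<close>

definition shuffle :: "('k::field, 'a::ab_group_add, 'y) hopf_scheme \<Rightarrow>
    ('k, 'b::ab_group_add, 'z) hopf_scheme \<Rightarrow>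
    ('k, ('k, 'a, 'a) ten, ('k, 'b, 'b) ten) ten \<Rightarrow> ('k, ('k, 'a, 'b) ten, ('k, 'a, 'b) ten) ten" where
  "shuffle M H = lift (tprod M M) (tprod H H) (\<lambda>s t. lift M M (\<lambda>m m'. lift H H (\<lambda>h h'.
     (m \<otimes>\<^bsub>M,H\<^esub> h) \<otimes>\<^bsub>tprod M H,tprod M H\<^esub> (m' \<otimes>\<^bsub>M,H\<^esub> h')) t) s)"

definition N_prod :: "('k::field, 'a::ab_group_add, 'y) hopf_scheme \<Rightarrow>
    ('k, 'b::ab_group_add, 'z) hopf_scheme \<Rightarrow> ('k, 'a, 'a) ten set \<Rightarrow> ('k, 'b, 'b) ten set \<Rightarrow>
    ('k, ('k, 'a, 'b) ten, ('k, 'a, 'b) ten) ten set" where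
  "N_prod M H NM NH = shuffle M H `
     sum3 (tspan (tprod M M) (tprod H H) NM (carrier (tprod H H)))
          (tspan (tprod M M) (tprod H H) (carrier (tprod M M)) NH)
          (tspan (tprod M M) (tprod H H) (carrier (univ M)) (carrier (univ H)))"

definition Q_prod :: "('k::field, 'a::ab_group_add, 'y) hopf_scheme \<Rightarrow>
    ('k, 'b::ab_group_add, 'z) hopf_scheme \<Rightarrow> 'a set \<Rightarrow> 'b set \<Rightarrow> ('k, 'a, 'b) ten set" where
  "Q_prod M H QM QH =
     sum3 (tspan M H QM (carrier H)) (tspan M H (carrier M) QH) (tspan M H (aug M) (aug H))"

end

theory Submission
  imports Defs
begin

text \<open>
  By \<open>h \<otimes> g \<mapsto> h g\<^sub>1 \<otimes> g\<^sub>2\<close> every bicovariant calculus is trivialised: \<open>\<Omega>\<^sup>1(H)\<close> is spanned by the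
  \<open>h e(g)\<close>, where \<open>e(g)\<close> is the class of \<open>S g\<^sub>1 \<otimes> g\<^sub>2\<close>, and the only relations come from
  \<open>e(Q\<^sub>H) = 0\<close> and \<open>e(1) = 0\<close>.  This is the bein property of \<open>e\<close>, and \<open>d e(g) = - e(g\<^sub>1) \<and> e(g\<^sub>2)\<close> is its
  flatness.  The trivialisation of \<open>P = M \<otimes> H\<close> is the product of those of \<open>M\<close> and \<open>H\<close> up to a
  permutation of factors, which turns the prescribed \<open>N\<^sub>P\<close> into \<open>P \<otimes> Q\<^sub>P\<close>.

  The map \<open>T(M) \<otimes> H \<rightarrow> T(P)\<close>, \<open>t \<otimes> h \<mapsto> t h\<close>, with \<open>T(M) = \<Omega>\<^sup>1(M) \<otimes>\<^sub>M \<Omega>\<^sup>1(M)\<close> intertwines \<open>\<Psi> \<otimes> id\<close> with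
  \<open>\<Psi>\<close>, and it has a left inverse, induced by \<open>\<Omega>\<^sup>1(P) \<rightarrow> \<Omega>\<^sup>1(M) \<otimes> H\<close> that kills \<open>e(1 \<otimes> ker \<epsilon>)\<close>.
  Hence the part of \<open>T(M) \<otimes> H\<close> that becomes \<open>0\<close> in \<open>\<Omega>\<^sup>2(P)\<close> is the kernel of \<open>(id - \<Psi>) \<otimes> id\<close>.  Over
  a field this kernel is \<open>ker(id - \<Psi>) \<otimes> H\<close>, so that \<open>\<Omega>\<^sup>2(M) \<otimes> H \<rightarrow> \<Omega>\<^sup>2(P)\<close> is injective.
\<close>

subsection \<open>Linear maps and tensor products\<close>

text \<open>The braiding is chosen by \<open>SOME\<close>, so nothing can be computed from it until
  a bimodule map with the flip property is exhibited and shown to be unique. Existence comes from an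
  explicit formula through the right coaction; uniqueness from the spanning set
  \<open>h (e(g) \<otimes> r(x)) c\<close>, where \<open>r(x) = (dx\<^sub>1) (S x\<^sub>2)\<close>
  is the right-handed counterpart of \<open>e(g) = (S g\<^sub>1) dg\<^sub>2\<close>. On this set
  every braiding is a plain flip, so the braidings of \<open>M\<close> and \<open>P\<close> are
  matched there without comparing formulas. The exterior derivative has to descend modulo
  \<open>ker (id - \<Psi>)\<close>. This amounts to
  \<open>e(q\<^sub>1) \<otimes> e(q\<^sub>2)\<close> being fixed by \<open>\<Psi>\<close> for
  \<open>q\<close> in \<open>Q\<close>, and it rests on the Ad-stability of \<open>Q\<close>. In the
  injectivity argument no basis of \<open>H\<close> is chosen: the projection onto
  \<open>\<Omega>\<^sup>2(M)\<close> factors as \<open>g \<circ> (id - \<Psi>)\<close> with a linear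
  \<open>g\<close>, and tensoring this factorisation with \<open>H\<close> sends every element fixed
  by \<open>\<Psi> \<otimes> id\<close> to zero.\<close>

interpretation fs: vector_space "fsmul :: 'k::field \<Rightarrow> ('x \<Rightarrow> 'k) \<Rightarrow> 'x \<Rightarrow> 'k"
  by (rule vector_space_fsmul)

abbreviation fspace :: "('k::field, 'x \<Rightarrow> 'k) vs" where
  "fspace \<equiv> \<lparr>carrier = UNIV, smul = fsmul\<rparr>"

abbreviation scalars :: "('k::field, 'k) vs" where
  "scalars \<equiv> \<lparr>carrier = UNIV, smul = (*)\<rparr>"

abbreviation sub :: "('k, 'a, 'z) vs_scheme \<Rightarrow> 'a set \<Rightarrow> ('k, 'a) vs" where
  "sub V A \<equiv> \<lparr>carrier = A, smul = smul V\<rparr>"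

lemma vspaceI:
  assumes "vector_space (smul V)" "0 \<in> carrier V"
    "\<And>x y. x \<in> carrier V \<Longrightarrow> y \<in> carrier V \<Longrightarrow> x + y \<in> carrier V"
    "\<And>c x. x \<in> carrier V \<Longrightarrow> smul V c x \<in> carrier V"
  shows "vspace V"
proof -
  interpret vector_space "smul V" by fact
  show ?thesis using assms by (auto simp: vspace_def subspace_def)
qed

lemma vspace_smul:
  assumes "vspace V"
  shows "smul V c (x + y) = smul V c x + smul V c y"
    "smul V (c + d) x = smul V c x + smul V d x"
    "smul V c (x - y) = smul V c x - smul V c y"
    "smul V (c - d) x = smul V c x - smul V d x"
    "smul V c (smul V d x) = smul V (c * d) x"
    "smul V 1 x = x" "smul V 0 x = 0" "smul V c 0 = 0" "smul V c (- x) = - smul V c x"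
proof -
  interpret vector_space "smul V" using assms by (simp add: vspace_def)
  show "smul V c (x + y) = smul V c x + smul V c y"
    "smul V (c + d) x = smul V c x + smul V d x"
    "smul V c (x - y) = smul V c x - smul V c y"
    "smul V (c - d) x = smul V c x - smul V d x"
    "smul V c (smul V d x) = smul V (c * d) x"
    "smul V 1 x = x" "smul V 0 x = 0" "smul V c 0 = 0" "smul V c (- x) = - smul V c x"
    by (simp_all add: scale_right_distrib scale_left_distrib scale_right_diff_distrib scale_left_diff_distrib)
qed

lemma vspace_closed [simp]:
  assumes "vspace V"
  shows "0 \<in> carrier V"
    "x \<in> carrier V \<Longrightarrow> y \<in> carrier V \<Longrightarrow> x + y \<in> carrier V"
    "x \<in> carrier V \<Longrightarrow> y \<in> carrier V \<Longrightarrow> x - y \<in> carrier V"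
    "x \<in> carrier V \<Longrightarrow> smul V c x \<in> carrier V"
    "x \<in> carrier V \<Longrightarrow> - x \<in> carrier V"
proof -
  interpret vector_space "smul V" using assms by (simp add: vspace_def)
  have "subspace (carrier V)" using assms by (simp add: vspace_def)
  then show "0 \<in> carrier V"
    "x \<in> carrier V \<Longrightarrow> y \<in> carrier V \<Longrightarrow> x + y \<in> carrier V"
    "x \<in> carrier V \<Longrightarrow> y \<in> carrier V \<Longrightarrow> x - y \<in> carrier V"
    "x \<in> carrier V \<Longrightarrow> smul V c x \<in> carrier V"
    "x \<in> carrier V \<Longrightarrow> - x \<in> carrier V"
    by (auto intro: subspace_0 subspace_add subspace_diff subspace_scale subspace_neg)
qed

lemma vspace_vector_space: "vspace V \<Longrightarrow> vector_space (smul V)"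
  by (simp add: vspace_def)

lemma subsp_iff:
  assumes "vspace V"
  shows "subsp V A \<longleftrightarrow> A \<subseteq> carrier V \<and> 0 \<in> A \<and> (\<forall>x\<in>A. \<forall>y\<in>A. x + y \<in> A) \<and> (\<forall>c. \<forall>x\<in>A. smul V c x \<in> A)"
proof -
  interpret vector_space "smul V" using assms by (simp add: vspace_def)
  show ?thesis by (auto simp: subsp_def subspace_def)
qed

lemma vspace_sub: "vspace V \<Longrightarrow> subsp V A \<Longrightarrow> vspace (sub V A)"
  by (simp add: vspace_def subsp_def)

lemma subsp_carrier [simp]: "vspace V \<Longrightarrow> subsp V (carrier V)"
  by (simp add: vspace_def subsp_def)

lemma vspace_fspace [simp]: "vspace fspace"
  by (simp add: vspace_def vector_space_fsmul)

lemma vspace_scalars [simp]: "vspace scalars"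
  by (rule vspaceI) (simp_all add: vector_space_mult)

lemma sum_list_mem:
  assumes "vspace V" "\<And>x. x \<in> set xs \<Longrightarrow> f x \<in> carrier V"
  shows "(\<Sum>x\<leftarrow>xs. f x) \<in> carrier V"
  using assms(2) by (induction xs) (simp_all add: assms(1))

lemma linI:
  assumes "\<And>x. x \<in> carrier V \<Longrightarrow> f x \<in> carrier W"
    "\<And>x y. x \<in> carrier V \<Longrightarrow> y \<in> carrier V \<Longrightarrow> f (x + y) = f x + f y"
    "\<And>c x. x \<in> carrier V \<Longrightarrow> f (smul V c x) = smul W c (f x)"
  shows "lin V W f"
  using assms by (auto simp: lin_def)

lemma linD:
  assumes "lin V W f"
  shows "x \<in> carrier V \<Longrightarrow> f x \<in> carrier W"
    "x \<in> carrier V \<Longrightarrow> y \<in> carrier V \<Longrightarrow> f (x + y) = f x + f y"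
    "x \<in> carrier V \<Longrightarrow> f (smul V c x) = smul W c (f x)"
  using assms by (auto simp: lin_def)

lemma lin_0:
  assumes "lin V W f" "vspace V"
  shows "f 0 = 0"
  using linD(2)[OF assms(1), of 0 0] assms(2) by simp

lemma lin_neg:
  assumes "lin V W f" "vspace V" "x \<in> carrier V"
  shows "f (- x) = - f x"
  using linD(2)[OF assms(1), of x "- x"] lin_0[OF assms(1,2)] assms(2,3)
  by (simp add: add_eq_0_iff)

lemma lin_diff:
  assumes "lin V W f" "vspace V" "x \<in> carrier V" "y \<in> carrier V"
  shows "f (x - y) = f x - f y"
  using linD(2)[OF assms(1), of "x - y" y] assms(2-) by simp

lemma lin_cong:
  assumes "\<And>x. x \<in> carrier V \<Longrightarrow> f x = g x" "vspace V"
  shows "lin V W f \<longleftrightarrow> lin V W g"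
  using assms by (auto simp: lin_def image_subset_iff)

lemma lin_compose: "lin V W g \<Longrightarrow> lin X V f \<Longrightarrow> lin X W (\<lambda>x. g (f x))"
  by (auto simp: lin_def image_subset_iff)

lemma lin_widen:
  "lin X V f \<Longrightarrow> smul U = smul V \<Longrightarrow> carrier V \<subseteq> carrier U \<Longrightarrow> lin X U f"
  by (auto simp: lin_def)

lemma lin_narrow:
  "lin V U f \<Longrightarrow> smul X = smul V \<Longrightarrow> carrier X \<subseteq> carrier V \<Longrightarrow> lin X U f"
  by (rule linI) (auto simp: linD subset_iff)

lemma lin_compose_widen:
  "lin V W g \<Longrightarrow> lin X V f \<Longrightarrow> smul U = smul W \<Longrightarrow> carrier W \<subseteq> carrier U \<Longrightarrow> lin X U (\<lambda>x. g (f x))"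
  by (rule lin_widen[OF lin_compose])

lemma lin_restrict: "lin X W f \<Longrightarrow> smul U = smul W \<Longrightarrow> (\<And>x. x \<in> carrier X \<Longrightarrow> f x \<in> carrier U) \<Longrightarrow> lin X U f"
  by (auto simp: lin_def)

lemma lin_id [simp]: "smul U = smul V \<Longrightarrow> carrier V \<subseteq> carrier U \<Longrightarrow> lin V U (\<lambda>x. x)"
  by (auto simp: lin_def)

lemma lin_zero [simp]: "vspace U \<Longrightarrow> lin V U (\<lambda>x. 0)"
  by (auto simp: lin_def vspace_smul)

lemma lin_add [simp]: "vspace U \<Longrightarrow> lin X U f \<Longrightarrow> lin X U g \<Longrightarrow> lin X U (\<lambda>x. f x + g x)"
  by (rule linI) (simp_all add: linD vspace_smul)

lemma lin_minus [simp]: "vspace U \<Longrightarrow> lin X U f \<Longrightarrow> lin X U g \<Longrightarrow> lin X U (\<lambda>x. f x - g x)"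
  by (rule linI) (simp_all add: linD vspace_smul)

lemma lin_smul [simp]: "vspace U \<Longrightarrow> smul V = smul U \<Longrightarrow> lin X U f \<Longrightarrow> lin X U (\<lambda>x. smul V c (f x))"
  by (rule linI) (simp_all add: linD vspace_smul mult.commute)

lemma lin_smul_scalar [simp]:
  "vspace U \<Longrightarrow> smul V = smul U \<Longrightarrow> lin X scalars f \<Longrightarrow> u \<in> carrier U \<Longrightarrow> lin X U (\<lambda>x. smul V (f x) u)"
  by (rule linI) (simp_all add: linD vspace_smul)

lemma lin_fsmul [simp]: "vspace U \<Longrightarrow> smul U = fsmul \<Longrightarrow> lin X U f \<Longrightarrow> lin X U (\<lambda>x. fsmul c (f x))"
  using lin_smul[of U U X f c] by simp

lemma lin_fsmul_scalar [simp]: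
  "vspace U \<Longrightarrow> smul U = fsmul \<Longrightarrow> lin X scalars f \<Longrightarrow> u \<in> carrier U \<Longrightarrow> lin X U (\<lambda>x. fsmul (f x) u)"
  using lin_smul_scalar[of U U X f u] by simp

lemma lin_mult_scalar [simp]:
  "lin X scalars f \<Longrightarrow> lin X scalars (\<lambda>x. f x * c)" "lin X scalars f \<Longrightarrow> lin X scalars (\<lambda>x. c * f x)"
  by (auto simp: lin_def algebra_simps)

lemma bilinI:
  assumes "\<And>x. x \<in> carrier V \<Longrightarrow> lin W U (f x)" "\<And>y. y \<in> carrier W \<Longrightarrow> lin V U (\<lambda>x. f x y)"
  shows "bilin V W U f"
  using assms by (simp add: bilin_def)

lemma bilinD:
  assumes "bilin V W U f"
  shows "x \<in> carrier V \<Longrightarrow> lin W U (f x)" "y \<in> carrier W \<Longrightarrow> lin V U (\<lambda>x. f x y)"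
  using assms by (simp_all add: bilin_def)

lemma bilin_iff [simp]:
  "bilin V W U f \<longleftrightarrow> (\<forall>x\<in>carrier V. lin W U (\<lambda>y. f x y)) \<and> (\<forall>y\<in>carrier W. lin V U (\<lambda>x. f x y))"
  by (simp add: bilin_def)

lemma bilin_mem: "bilin V W U f \<Longrightarrow> x \<in> carrier V \<Longrightarrow> y \<in> carrier W \<Longrightarrow> f x y \<in> carrier U"
  using bilinD(1) linD(1) by metis

lemma bilin_compose:
  assumes "bilin V W U f" "lin X V g" "lin Y W h"
  shows "bilin X Y U (\<lambda>x y. f (g x) (h y))"
proof (rule bilinI)
  show "lin Y U (\<lambda>y. f (g x) (h y))" if "x \<in> carrier X" for x
    by (rule lin_compose[OF bilinD(1)[OF assms(1)] assms(3)]) (rule linD(1)[OF assms(2) that])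
  show "lin X U (\<lambda>x. f (g x) (h y))" if "y \<in> carrier Y" for y
    by (rule lin_compose[OF bilinD(2)[OF assms(1)] assms(2)]) (rule linD(1)[OF assms(3) that])
qed

text \<open>The codomain \<open>U\<close> may exceed the codomain \<open>Z\<close> of the bilinear
  map. For most identities it is enough to know a map as linear into the ambient function space;
  membership in a carrier is then a separate matter.\<close>

lemma lin_bilin1:
  assumes "bilin V W Z f" "lin X V g" "c \<in> carrier W" "smul U = smul Z" "carrier Z \<subseteq> carrier U"
  shows "lin X U (\<lambda>x. f (g x) c)"
  using lin_compose_widen[OF bilinD(2)[OF assms(1,3)] assms(2,4,5)] .

lemma lin_bilin2:
  assumes "bilin V W Z f" "lin X W g" "c \<in> carrier V" "smul U = smul Z" "carrier Z \<subseteq> carrier U"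
  shows "lin X U (\<lambda>x. f c (g x))"
  using lin_compose_widen[OF bilinD(1)[OF assms(1,3)] assms(2,4,5)] .

section \<open>Pure tensors and induction on tensors\<close>

lemma smul_tprod [simp]: "smul (tprod V W) = fsmul"
  by (simp add: tprod_def)

lemma vspace_tprod [simp]: "vspace (tprod V W)"
  by (simp add: vspace_def tprod_def tspan_def vector_space_fsmul)

lemma tens_cong: "smul V = smul V' \<Longrightarrow> smul W = smul W' \<Longrightarrow> (v \<otimes>\<^bsub>V,W\<^esub> w) = (v \<otimes>\<^bsub>V',W'\<^esub> w)"
  by (simp add: tens_def)

lemma tens_mem [simp]: "v \<in> carrier V \<Longrightarrow> w \<in> carrier W \<Longrightarrow> (v \<otimes>\<^bsub>V,W\<^esub> w) \<in> carrier (tprod V W)"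
  using bilin_mem[OF bilin_tens] .

lemma lin_tens1 [simp]:
  "lin X V f \<Longrightarrow> w \<in> carrier W \<Longrightarrow> smul U = fsmul \<Longrightarrow> carrier (tprod V W) \<subseteq> carrier U \<Longrightarrow>
   lin X U (\<lambda>x. f x \<otimes>\<^bsub>V,W\<^esub> w)"
  by (rule lin_bilin1[OF bilin_tens]) simp_all

lemma lin_tens2 [simp]:
  "lin X W f \<Longrightarrow> v \<in> carrier V \<Longrightarrow> smul U = fsmul \<Longrightarrow> carrier (tprod V W) \<subseteq> carrier U \<Longrightarrow>
   lin X U (\<lambda>x. v \<otimes>\<^bsub>V,W\<^esub> f x)"
  by (rule lin_bilin2[OF bilin_tens]) simp_all

text \<open>A pure tensor is an evaluation on bilinear forms given on the whole types, so it is
  bilinear in arbitrary \<open>v\<close> and \<open>w\<close>, inside the carriers or not. The proof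
  passes to \<open>sub V UNIV\<close> and \<open>sub W UNIV\<close>, which have the same pure
  tensors.\<close>

lemma tens_linear:
  fixes V :: "('k::field, 'a::ab_group_add, 'x) vs_scheme"
    and W :: "('k, 'b::ab_group_add, 'y) vs_scheme"
  assumes "vspace V" "vspace W"
  shows "((v + v') \<otimes>\<^bsub>V,W\<^esub> w) = (v \<otimes>\<^bsub>V,W\<^esub> w) + (v' \<otimes>\<^bsub>V,W\<^esub> w)"
    "((v - v') \<otimes>\<^bsub>V,W\<^esub> w) = (v \<otimes>\<^bsub>V,W\<^esub> w) - (v' \<otimes>\<^bsub>V,W\<^esub> w)"
    "(smul V c v \<otimes>\<^bsub>V,W\<^esub> w) = fsmul c (v \<otimes>\<^bsub>V,W\<^esub> w)"
    "(v \<otimes>\<^bsub>V,W\<^esub> (w + w')) = (v \<otimes>\<^bsub>V,W\<^esub> w) + (v \<otimes>\<^bsub>V,W\<^esub> w')"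
    "(v \<otimes>\<^bsub>V,W\<^esub> (w - w')) = (v \<otimes>\<^bsub>V,W\<^esub> w) - (v \<otimes>\<^bsub>V,W\<^esub> w')"
    "(v \<otimes>\<^bsub>V,W\<^esub> smul W c w) = fsmul c (v \<otimes>\<^bsub>V,W\<^esub> w)"
    "(0 \<otimes>\<^bsub>V,W\<^esub> w) = 0" "(v \<otimes>\<^bsub>V,W\<^esub> 0) = 0"
proof -
  let ?V = "sub V UNIV" and ?W = "sub W UNIV"
  have V: "vspace ?V" "vspace ?W"
    using assms by (auto simp: vspace_vector_space intro!: vspaceI)
  have e: "(x \<otimes>\<^bsub>V,W\<^esub> y) = (x \<otimes>\<^bsub>?V,?W\<^esub> y)" for x y by (rule tens_cong) simp_all
  have b: "bilin ?V ?W (tprod ?V ?W) (\<lambda>v w. v \<otimes>\<^bsub>?V,?W\<^esub> w)" by (rule bilin_tens)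
  have 1: "lin ?V (tprod ?V ?W) (\<lambda>v. v \<otimes>\<^bsub>?V,?W\<^esub> w)" for w using bilinD(2)[OF b] by simp
  have 2: "lin ?W (tprod ?V ?W) (\<lambda>w. v \<otimes>\<^bsub>?V,?W\<^esub> w)" for v using bilinD(1)[OF b] by simp
  show "((v + v') \<otimes>\<^bsub>V,W\<^esub> w) = (v \<otimes>\<^bsub>V,W\<^esub> w) + (v' \<otimes>\<^bsub>V,W\<^esub> w)"
    "((v - v') \<otimes>\<^bsub>V,W\<^esub> w) = (v \<otimes>\<^bsub>V,W\<^esub> w) - (v' \<otimes>\<^bsub>V,W\<^esub> w)"
    "(smul V c v \<otimes>\<^bsub>V,W\<^esub> w) = fsmul c (v \<otimes>\<^bsub>V,W\<^esub> w)"
    "(v \<otimes>\<^bsub>V,W\<^esub> (w + w')) = (v \<otimes>\<^bsub>V,W\<^esub> w) + (v \<otimes>\<^bsub>V,W\<^esub> w')"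
    "(v \<otimes>\<^bsub>V,W\<^esub> (w - w')) = (v \<otimes>\<^bsub>V,W\<^esub> w) - (v \<otimes>\<^bsub>V,W\<^esub> w')"
    "(v \<otimes>\<^bsub>V,W\<^esub> smul W c w) = fsmul c (v \<otimes>\<^bsub>V,W\<^esub> w)"
    "(0 \<otimes>\<^bsub>V,W\<^esub> w) = 0" "(v \<otimes>\<^bsub>V,W\<^esub> 0) = 0"
    unfolding e
    using linD(2)[OF 1[of w], of v v'] lin_diff[OF 1[of w] V(1), of v v'] linD(3)[OF 1[of w], of v c]
      linD(2)[OF 2[of v], of w w'] lin_diff[OF 2[of v] V(2), of w w'] linD(3)[OF 2[of v], of w c]
      lin_0[OF 1[of w] V(1)] lin_0[OF 2[of v] V(2)] by simp_all
qed

text \<open>Scalars are absorbed into a factor, so finite sums of pure tensors exhaust the tensor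
  product and addition is the only closure case.\<close>

lemma tprod_induct [consumes 2, case_names zero tens add]:
  assumes "vspace V" "t \<in> carrier (tprod V W)"
    and "P 0"
    and "\<And>v w. v \<in> carrier V \<Longrightarrow> w \<in> carrier W \<Longrightarrow> P (v \<otimes>\<^bsub>V,W\<^esub> w)"
    and "\<And>s t. s \<in> carrier (tprod V W) \<Longrightarrow> t \<in> carrier (tprod V W) \<Longrightarrow> P s \<Longrightarrow> P t \<Longrightarrow> P (s + t)"
  shows "P t"
proof -
  obtain xs where xs: "set xs \<subseteq> carrier V \<times> carrier W" "t = (\<Sum>(v, w)\<leftarrow>xs. v \<otimes>\<^bsub>V,W\<^esub> w)"
    using tprod_sum_list[OF assms(1,2)] by blast
  have "P (\<Sum>(v, w)\<leftarrow>xs. v \<otimes>\<^bsub>V,W\<^esub> w) \<and> (\<Sum>(v, w)\<leftarrow>xs. v \<otimes>\<^bsub>V,W\<^esub> w) \<in> carrier (tprod V W)"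
    using xs(1) by (induction xs) (auto simp: assms(3-5))
  then show ?thesis using xs by simp
qed

section \<open>Linear maps out of a tensor product\<close>

lemma lift_cong:
  assumes "\<And>v w. v \<in> carrier V \<Longrightarrow> w \<in> carrier W \<Longrightarrow> f v w = g v w"
  shows "lift V W f t = lift V W g t"
proof -
  have *: "(\<Sum>(v, w)\<leftarrow>xs. f v w) = (\<Sum>(v, w)\<leftarrow>xs. g v w)" if "set xs \<subseteq> carrier V \<times> carrier W" for xs
    using that by (induction xs) (auto simp: assms)
  show ?thesis
    unfolding lift_def
    by (rule arg_cong[where f = The], rule ext, rule arg_cong[where f = Ex], rule ext, rule conj_cong[OF refl])
      (simp only: *)
qed

lemma lift_cong' [cong]:
  "V = V' \<Longrightarrow> W = W' \<Longrightarrow> t = t' \<Longrightarrow> (\<And>v w. v \<in> carrier V' \<Longrightarrow> w \<in> carrier W' \<Longrightarrow> f v w = g v w) \<Longrightarrow>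
   lift V W f t = lift V' W' g t'"
  using lift_cong[of V W f g t] by simp

text \<open>A tensor product sees only the carriers and scalars of its factors. This later
  identifies constructions over the Hopf algebra \<open>tens_hopf M H\<close> with those over its
  underlying space \<open>tprod M H\<close>.\<close>

lemma lift_space_cong:
  assumes "carrier V = carrier V'" "smul V = smul V'" "carrier W = carrier W'" "smul W = smul W'"
  shows "lift V W = lift V' W'"
  by (intro ext) (simp add: lift_def assms tens_cong[OF assms(2,4)])

lemma tprod_space_cong:
  assumes "carrier V = carrier V'" "smul V = smul V'" "carrier W = carrier W'" "smul W = smul W'"
  shows "tprod V W = tprod V' W'"
  by (simp add: tprod_def tspan_def assms tens_cong[OF assms(2,4)])

context
  fixes V :: "('k::field, 'a::ab_group_add, 'x) vs_scheme"
    and W :: "('k, 'b::ab_group_add, 'y) vs_scheme"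
    and U :: "('k, 'c::ab_group_add, 'z) vs_scheme"
    and f :: "'a \<Rightarrow> 'b \<Rightarrow> 'c"
  assumes V: "vspace V" and W: "vspace W" and U: "vspace U" and f: "bilin V W U f"
begin

lemma lift_tens_in:
  assumes "v \<in> carrier V" "w \<in> carrier W"
  shows "lift V W f (v \<otimes>\<^bsub>V,W\<^esub> w) = f v w"
  using lift_sum_list[OF V W U f, of "[(v, w)]"] assms by simp

lemma lin_lift: "lin (tprod V W) U (lift V W f)"
proof (rule linI)
  fix t assume t: "t \<in> carrier (tprod V W)"
  obtain xs where xs: "set xs \<subseteq> carrier V \<times> carrier W" "t = (\<Sum>(v, w)\<leftarrow>xs. v \<otimes>\<^bsub>V,W\<^esub> w)"
    using tprod_sum_list[OF V t] by blast
  show "lift V W f t \<in> carrier U"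
    unfolding xs(2) lift_sum_list[OF V W U f xs(1)]
    using xs(1) f by (intro sum_list_mem[OF U]) (auto intro: bilin_mem simp del: bilin_iff)
  show "lift V W f (smul (tprod V W) c t) = smul U c (lift V W f t)" for c
  proof -
    \<comment> \<open>A sum of pure tensors is scaled by scaling the first factor of each.\<close>
    let ?ys = "map (\<lambda>(v, w). (smul V c v, w)) xs"
    have ys: "set ?ys \<subseteq> carrier V \<times> carrier W" using xs(1) V by (auto)
    have "fsmul c t = (\<Sum>(v, w)\<leftarrow>?ys. v \<otimes>\<^bsub>V,W\<^esub> w)"
      unfolding xs(2) using xs(1)
      by (induction xs) (auto simp: fs.scale_right_distrib tens_linear[OF V W])
    moreover have "(\<Sum>(v, w)\<leftarrow>?ys. f v w) = smul U c (\<Sum>(v, w)\<leftarrow>xs. f v w)"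
      using xs(1)
      by (induction xs) (auto simp: vspace_smul[OF U] linD(3)[OF bilinD(2)[OF f]])
    ultimately show ?thesis
      using lift_sum_list[OF V W U f ys] lift_sum_list[OF V W U f xs(1)] xs(2) by simp
  qed
  fix s assume s: "s \<in> carrier (tprod V W)"
  obtain ys where ys: "set ys \<subseteq> carrier V \<times> carrier W" "s = (\<Sum>(v, w)\<leftarrow>ys. v \<otimes>\<^bsub>V,W\<^esub> w)"
    using tprod_sum_list[OF V s] by blast
  show "lift V W f (t + s) = lift V W f t + lift V W f s"
    using lift_sum_list[OF V W U f, of "xs @ ys"] lift_sum_list[OF V W U f xs(1)]
      lift_sum_list[OF V W U f ys(1)] xs ys by simp
qed

end

text \<open>Two additive maps that agree on pure tensors agree on their sums. The codomains
  \<open>U\<close> and \<open>U'\<close> may differ, so one side can be read in a carrier and the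
  other in the ambient function space.\<close>

lemma tprod_eqI:
  assumes "vspace V" "lin (tprod V W) U f" "lin (tprod V W) U' g"
    and "\<And>v w. v \<in> carrier V \<Longrightarrow> w \<in> carrier W \<Longrightarrow> f (v \<otimes>\<^bsub>V,W\<^esub> w) = g (v \<otimes>\<^bsub>V,W\<^esub> w)"
    and "t \<in> carrier (tprod V W)"
  shows "f t = g t"
  using assms(1,5)
proof (induction rule: tprod_induct)
  case zero
  show ?case unfolding lin_0[OF assms(2) vspace_tprod] lin_0[OF assms(3) vspace_tprod] ..
next
  case (add s t)
  show ?case
    unfolding linD(2)[OF assms(2) add(1,2)] linD(2)[OF assms(3) add(1,2)] add(3,4) ..
qed (rule assms(4))

lemma lift_mem [simp]:
  "vspace V \<Longrightarrow> vspace W \<Longrightarrow> vspace U \<Longrightarrow> bilin V W U f \<Longrightarrow> t \<in> carrier (tprod V W) \<Longrightarrow> lift V W f t \<in> carrier U"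
  by (rule linD(1)[OF lin_lift])

lemma lin_lift1 [simp]:
  "vspace V \<Longrightarrow> vspace W \<Longrightarrow> vspace U \<Longrightarrow> bilin V W U f \<Longrightarrow> lin X (tprod V W) g \<Longrightarrow>
   lin X U (\<lambda>x. lift V W f (g x))"
  by (rule lin_compose[OF lin_lift])

lemma lift_add_fun:
  assumes "vspace V" "vspace W" "vspace U" "bilin V W U f" "bilin V W U g" "t \<in> carrier (tprod V W)"
  shows "lift V W (\<lambda>v w. f v w + g v w) t = lift V W f t + lift V W g t"
  using assms(6,1)
proof (rule tprod_eqI[rotated -1])
  have 1: "bilin V W U (\<lambda>v w. f v w + g v w)" using assms by simp
  show "lin (tprod V W) U (lift V W (\<lambda>v w. f v w + g v w))"
    by (rule lin_lift[OF assms(1-3) 1])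
  show "lin (tprod V W) U (\<lambda>t. lift V W f t + lift V W g t)"
    by (rule lin_add[OF assms(3) lin_lift[OF assms(1-4)] lin_lift[OF assms(1-3,5)]])
  fix v w assume "v \<in> carrier V" "w \<in> carrier W"
  then show "lift V W (\<lambda>v w. f v w + g v w) (v \<otimes>\<^bsub>V,W\<^esub> w) =
    lift V W f (v \<otimes>\<^bsub>V,W\<^esub> w) + lift V W g (v \<otimes>\<^bsub>V,W\<^esub> w)"
    by (simp only: lift_tens_in[OF assms(1-3) 1] lift_tens_in[OF assms(1-3,4)] lift_tens_in[OF assms(1-3,5)])
qed

lemma lift_lin:
  assumes "vspace V" "vspace W" "vspace U" "vspace U'" "bilin V W U f" "lin U U' g" "t \<in> carrier (tprod V W)"
  shows "g (lift V W f t) = lift V W (\<lambda>v w. g (f v w)) t"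
  using assms(7,1)
proof (rule tprod_eqI[rotated -1])
  have 1: "bilin V W U' (\<lambda>v w. g (f v w))"
    using assms(5) by (simp add: lin_compose[OF assms(6)])
  show "lin (tprod V W) U' (\<lambda>t. g (lift V W f t))"
    by (rule lin_compose[OF assms(6) lin_lift[OF assms(1-3,5)]])
  show "lin (tprod V W) U' (lift V W (\<lambda>v w. g (f v w)))"
    by (rule lin_lift[OF assms(1,2,4) 1])
  fix v w assume "v \<in> carrier V" "w \<in> carrier W"
  then show "g (lift V W f (v \<otimes>\<^bsub>V,W\<^esub> w)) = lift V W (\<lambda>v w. g (f v w)) (v \<otimes>\<^bsub>V,W\<^esub> w)"
    using lift_tens_in[OF assms(1-3,5)] lift_tens_in[OF assms(1,2,4) 1] by simp
qed

text \<open>Here the parameter sits in the bilinear map while the tensor is fixed; in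
  \<open>lin_lift1\<close> it is the other way round. Together they give linearity of nested
  Sweedler sums in every variable.\<close>

lemma lin_lift2 [simp]:
  assumes "vspace V" "vspace W" "vspace U" "\<And>x. x \<in> carrier X \<Longrightarrow> bilin V W U (F x)"
    "\<And>v w. v \<in> carrier V \<Longrightarrow> w \<in> carrier W \<Longrightarrow> lin X U (\<lambda>x. F x v w)" "vspace X" "t \<in> carrier (tprod V W)"
  shows "lin X U (\<lambda>x. lift V W (F x) t)"
proof (rule linI)
  fix x assume x: "x \<in> carrier X"
  show "lift V W (F x) t \<in> carrier U" by (rule lift_mem[OF assms(1-3) assms(4)[OF x] assms(7)])
  show "lift V W (F (smul X c x)) t = smul U c (lift V W (F x) t)" for c
  proof -
    have "lift V W (F (smul X c x)) t = lift V W (\<lambda>v w. smul U c (F x v w)) t"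
      by (rule lift_cong) (rule linD(3)[OF assms(5) x])
    also have "\<dots> = smul U c (lift V W (F x) t)"
      by (rule lift_lin[OF assms(1-3,3) assms(4)[OF x] lin_smul[OF assms(3) refl lin_id[OF refl order_refl]] assms(7), symmetric])
    finally show ?thesis .
  qed
  fix y assume y: "y \<in> carrier X"
  have "lift V W (F (x + y)) t = lift V W (\<lambda>v w. F x v w + F y v w) t"
    by (rule lift_cong) (rule linD(2)[OF assms(5) x y])
  also have "\<dots> = lift V W (F x) t + lift V W (F y) t"
    by (rule lift_add_fun[OF assms(1-3) assms(4)[OF x] assms(4)[OF y] assms(7)])
  finally show "lift V W (F (x + y)) t = lift V W (F x) t + lift V W (F y) t" .
qed

text \<open>Rules whose codomain is a space of functions need no reference to the target space, which
  makes them usable as rewrite rules.\<close>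

lemmas lift_tens [simp] = lift_tens_in[where U = fspace, OF _ _ vspace_fspace]

lemma lift_lift [simp]:
  assumes "vspace V" "vspace W" "vspace V'" "vspace W'" "bilin V W fspace f" "bilin V' W' (tprod V W) g"
    "t \<in> carrier (tprod V' W')"
  shows "lift V W f (lift V' W' g t) = lift V' W' (\<lambda>x y. lift V W f (g x y)) t"
  using assms by (intro lift_lin[where U = "tprod V W" and U' = fspace] lin_lift) auto

lemma lift_linear [simp]:
  assumes "vspace V" "vspace W" "bilin V W fspace f"
  shows "s \<in> carrier (tprod V W) \<Longrightarrow> t \<in> carrier (tprod V W) \<Longrightarrow> lift V W f (s + t) = lift V W f s + lift V W f t"
    "s \<in> carrier (tprod V W) \<Longrightarrow> t \<in> carrier (tprod V W) \<Longrightarrow> lift V W f (s - t) = lift V W f s - lift V W f t"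
    "s \<in> carrier (tprod V W) \<Longrightarrow> lift V W f (fsmul c s) = fsmul c (lift V W f s)"
    "lift V W f 0 = 0"
  using lin_lift[OF assms(1,2) vspace_fspace assms(3)] lin_diff[OF lin_lift[OF assms(1,2) vspace_fspace assms(3)]]
    lin_0[OF lin_lift[OF assms(1,2) vspace_fspace assms(3)]]
  by (auto simp: lin_def)

text \<open>A Fubini rule: both sides are linear in \<open>s\<close>, and for a pure tensor
  \<open>s\<close> both reduce to a single lift over \<open>t\<close>. It exchanges Sweedler sums
  over independent elements.\<close>

lemma lift_swap:
  assumes "vspace V" "vspace W" "vspace V'" "vspace W'" "vspace U"
    "\<And>v w. v \<in> carrier V \<Longrightarrow> w \<in> carrier W \<Longrightarrow> bilin V' W' U (F v w)"
    "\<And>v w. v \<in> carrier V' \<Longrightarrow> w \<in> carrier W' \<Longrightarrow> bilin V W U (\<lambda>x y. F x y v w)"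
    "s \<in> carrier (tprod V W)" "t \<in> carrier (tprod V' W')"
  shows "lift V W (\<lambda>v w. lift V' W' (F v w) t) s = lift V' W' (\<lambda>v' w'. lift V W (\<lambda>v w. F v w v' w') s) t"
  using assms(8,1)
proof (rule tprod_eqI[rotated -1])
  have 1: "bilin V W U (\<lambda>v w. lift V' W' (F v w) t)" using assms by auto
  show "lin (tprod V W) U (lift V W (\<lambda>v w. lift V' W' (F v w) t))"
    by (rule lin_lift) (use assms 1 in auto)
  show "lin (tprod V W) U (\<lambda>s. lift V' W' (\<lambda>v' w'. lift V W (\<lambda>v w. F v w v' w') s) t)"
    by (rule lin_lift2) (use assms in auto)
  fix v w assume vw: "v \<in> carrier V" "w \<in> carrier W"
  have "lift V' W' (\<lambda>v' w'. lift V W (\<lambda>v w. F v w v' w') (v \<otimes>\<^bsub>V,W\<^esub> w)) t = lift V' W' (\<lambda>v' w'. F v w v' w') t"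
    by (rule lift_cong) (use lift_tens_in[OF assms(1,2,5)] assms(7) vw in blast)
  then show "lift V W (\<lambda>v w. lift V' W' (F v w) t) (v \<otimes>\<^bsub>V,W\<^esub> w) =
    lift V' W' (\<lambda>v' w'. lift V W (\<lambda>v w. F v w v' w') (v \<otimes>\<^bsub>V,W\<^esub> w)) t"
    using lift_tens_in[OF assms(1,2,5) 1 vw] by simp
qed

lemma tens_lift [simp]:
  assumes "vspace V" "vspace W" "vspace V'" "vspace W'" "bilin V' W' V f" "w \<in> carrier W" "t \<in> carrier (tprod V' W')"
  shows "((lift V' W' f t) \<otimes>\<^bsub>V,W\<^esub> w) = lift V' W' (\<lambda>x y. f x y \<otimes>\<^bsub>V,W\<^esub> w) t"
  by (rule lift_lin[where U = V and U' = fspace]) (use assms in auto)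

lemma tens_lift' [simp]:
  assumes "vspace V" "vspace W" "vspace V'" "vspace W'" "bilin V' W' W f" "v \<in> carrier V" "t \<in> carrier (tprod V' W')"
  shows "(v \<otimes>\<^bsub>V,W\<^esub> (lift V' W' f t)) = lift V' W' (\<lambda>x y. v \<otimes>\<^bsub>V,W\<^esub> f x y) t"
  by (rule lift_lin[where U = W and U' = fspace]) (use assms in auto)

lemma lift_tens_id [simp]:
  assumes "vspace V" "vspace W" "t \<in> carrier (tprod V W)"
  shows "lift V W (\<lambda>v w. v \<otimes>\<^bsub>V,W\<^esub> w) t = t"
proof (rule tprod_eqI[where f = "lift V W (\<lambda>v w. v \<otimes>\<^bsub>V,W\<^esub> w)" and g = "\<lambda>t. t" and U = fspace and U' = fspace])
  show "lin (tprod V W) fspace (lift V W (\<lambda>v w. v \<otimes>\<^bsub>V,W\<^esub> w))" by (rule lin_lift) (use assms in auto)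
  show "lin (tprod V W) fspace (\<lambda>t. t)" by simp
qed (use assms in \<open>simp_all del: lift_tens add: lift_tens_in[where U = fspace]\<close>)

section \<open>Spans of products of subspaces\<close>

lemma tspan_sub: "tspan V W A B = carrier (tprod (sub V A) (sub W B))"
  by (simp add: tprod_def tspan_def tens_cong[of "sub V A" V "sub W B" W])

lemma subsp_tspan [simp]:
  assumes "A \<subseteq> carrier V" "B \<subseteq> carrier W"
  shows "subsp (tprod V W) (tspan V W A B)"
proof -
  have "{a \<otimes>\<^bsub>V,W\<^esub> b | a b. a \<in> A \<and> b \<in> B} \<subseteq> {a \<otimes>\<^bsub>V,W\<^esub> b | a b. a \<in> carrier V \<and> b \<in> carrier W}"
    using assms by blast
  from fs.span_mono[OF this] show ?thesis
    by (simp add: subsp_def tprod_def tspan_def)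
qed

lemma tspan_carrier: "tspan V W (carrier V) (carrier W) = carrier (tprod V W)"
  by (simp add: tprod_def)

lemma tspan_mono: "A \<subseteq> A' \<Longrightarrow> B \<subseteq> B' \<Longrightarrow> tspan V W A B \<subseteq> tspan V W A' B'"
  unfolding tspan_def by (rule fs.span_mono) auto

lemma tspan_subset: "A \<subseteq> carrier V \<Longrightarrow> B \<subseteq> carrier W \<Longrightarrow> tspan V W A B \<subseteq> carrier (tprod V W)"
  using tspan_mono[of A "carrier V" B "carrier W" V W] by (simp add: tspan_carrier)

lemma tens_in_tspan [simp]: "a \<in> A \<Longrightarrow> b \<in> B \<Longrightarrow> (a \<otimes>\<^bsub>V,W\<^esub> b) \<in> tspan V W A B"
  unfolding tspan_def by (rule fs.span_base) auto

lemma tspan_space_cong: "smul V = smul V' \<Longrightarrow> smul W = smul W' \<Longrightarrow> tspan V W = tspan V' W'"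
  by (intro ext) (simp add: tspan_def tens_cong[of V V' W W'])

lemma tspan_induct [consumes 3, case_names zero tens add]:
  assumes "vspace V" "subsp V A" "t \<in> tspan V W A B"
    and "P 0"
    and "\<And>v w. v \<in> A \<Longrightarrow> w \<in> B \<Longrightarrow> P (v \<otimes>\<^bsub>V,W\<^esub> w)"
    and "\<And>s t. s \<in> tspan V W A B \<Longrightarrow> t \<in> tspan V W A B \<Longrightarrow> P s \<Longrightarrow> P t \<Longrightarrow> P (s + t)"
  shows "P t"
  using vspace_sub[OF assms(1,2)] assms(3)[unfolded tspan_sub]
proof (induction rule: tprod_induct)
  case (tens v w)
  then show ?case using assms(5)[of v w] by (simp add: tens_cong[of "sub V A" V "sub W B" W])
next
  case (add s t)
  have "P (s + t)" using add by (intro assms(6)) (simp_all add: tspan_sub)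
  then show ?case .
qed (rule assms(4))

lemma lift_in_subsp:
  assumes "vspace V" "vspace W" "vspace U" "bilin V W U f" "subsp V A" "B \<subseteq> carrier W" "t \<in> tspan V W A B" "subsp U S"
    and "\<And>a b. a \<in> A \<Longrightarrow> b \<in> B \<Longrightarrow> f a b \<in> S"
  shows "lift V W f t \<in> S"
  using assms(1,5,7)
proof (induction rule: tspan_induct)
  case zero
  show ?case unfolding lin_0[OF lin_lift[OF assms(1-4)] vspace_tprod] using assms(3,8) by (simp add: subsp_iff)
next
  case (tens v w)
  then have "v \<in> carrier V" "w \<in> carrier W" using assms(5,6) by (auto simp: subsp_def)
  then show ?case using lift_tens_in[OF assms(1-4)] assms(9)[OF tens] by simp
next
  case (add s t)
  have "tspan V W A B \<subseteq> carrier (tprod V W)"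
    using assms(5,6) by (intro tspan_subset) (auto simp: subsp_def)
  with add have "lift V W f (s + t) = lift V W f s + lift V W f t"
    by (intro linD(2)[OF lin_lift[OF assms(1-4)]]) auto
  moreover have "lift V W f s + lift V W f t \<in> S" using add assms(3,8) by (auto simp: subsp_iff)
  ultimately show ?case by (simp only:)
qed

lemma subsp_0: "vspace U \<Longrightarrow> subsp U {0}"
  by (auto simp: subsp_iff vspace_smul)

lemma lift_eq_0:
  assumes "vspace V" "vspace W" "vspace U" "bilin V W U f" "subsp V A" "B \<subseteq> carrier W" "t \<in> tspan V W A B"
    and "\<And>a b. a \<in> A \<Longrightarrow> b \<in> B \<Longrightarrow> f a b = 0"
  shows "lift V W f t = 0"
  using lift_in_subsp[OF assms(1-7) subsp_0[OF assms(3)]] assms(8) by auto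

text \<open>\<open>V\<close> is the sum of \<open>ker \<phi>\<close> and the line through
  \<open>u\<close>. Subtracting from any \<open>t\<close> its component
  \<open>u \<otimes> (\<phi> \<otimes> id) t\<close> along \<open>u\<close> therefore leaves an
  element of \<open>ker \<phi> \<otimes> W\<close>, and for the given \<open>t\<close> this
  component is zero.\<close>

lemma ker_functional_tens:
  assumes "vspace V" "vspace W" "lin V scalars \<phi>" "u \<in> carrier V" "\<phi> u = 1" "t \<in> carrier (tprod V W)"
    "lift V W (\<lambda>v w. smul W (\<phi> v) w) t = 0"
  shows "t \<in> tspan V W {v \<in> carrier V. \<phi> v = 0} (carrier W)"
proof -
  let ?S = "tspan V W {v \<in> carrier V. \<phi> v = 0} (carrier W)"
  let ?e = "lift V W (\<lambda>v w. smul W (\<phi> v) w)"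
  have e: "bilin V W W (\<lambda>v w. smul W (\<phi> v) w)" using assms by auto
  have S: "subsp (tprod V W) ?S" by (rule subsp_tspan) auto
  have "t - (u \<otimes>\<^bsub>V,W\<^esub> ?e t) \<in> ?S"
    using assms(1,6)
  proof (induction rule: tprod_induct)
    case zero
    have "0 - (u \<otimes>\<^bsub>V,W\<^esub> ?e 0) = 0"
      unfolding lin_0[OF lin_lift[OF assms(1,2,2) e] vspace_tprod] by (simp add: tens_linear assms(1,2))
    then show ?case using S by (simp only: subsp_iff[OF vspace_tprod])
  next
    case (tens v w)
    have "(v \<otimes>\<^bsub>V,W\<^esub> w) - (u \<otimes>\<^bsub>V,W\<^esub> ?e (v \<otimes>\<^bsub>V,W\<^esub> w)) = ((v - smul V (\<phi> v) u) \<otimes>\<^bsub>V,W\<^esub> w)"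
      using tens by (simp add: lift_tens_in[OF assms(1,2,2) e] tens_linear assms(1,2))
    also have "\<dots> \<in> ?S"
      using tens assms lin_diff[OF assms(3,1), of v "smul V (\<phi> v) u"] linD(3)[OF assms(3), of u "\<phi> v"]
      by (intro tens_in_tspan) auto
    finally show ?case .
  next
    case (add s t)
    have "s + t - (u \<otimes>\<^bsub>V,W\<^esub> ?e (s + t)) = (s - (u \<otimes>\<^bsub>V,W\<^esub> ?e s)) + (t - (u \<otimes>\<^bsub>V,W\<^esub> ?e t))"
      using add linD(2)[OF lin_lift[OF assms(1,2,2) e], of s t] by (simp add: tens_linear assms(1,2))
    then show ?case using add(3,4) S by (simp only: subsp_iff[OF vspace_tprod])
  qed
  then show ?thesis using assms by (simp add: tens_linear)
qed

subsection \<open>Algebras and Hopf algebras\<close>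

lemma smul_quot [simp]: "smul (quot V N) = fsmul"
  by (simp add: quot_def)

lemma carrier_quot: "carrier (quot V N) = proj V N ` carrier V"
  by (simp add: quot_def)

lemma proj_mem [simp]: "v \<in> carrier V \<Longrightarrow> proj V N v \<in> carrier (quot V N)"
  by (simp add: quot_def)

lemma vspace_quot [simp]:
  assumes "vspace V" shows "vspace (quot V N)"
proof (rule vspaceI)
  note p = lin_proj[OF assms, of N]
  show "0 \<in> carrier (quot V N)"
    using lin_0[OF p assms] assms by (metis proj_mem vspace_closed(1))
  fix x y assume "x \<in> carrier (quot V N)" "y \<in> carrier (quot V N)"
  then show "x + y \<in> carrier (quot V N)"
    unfolding carrier_quot using linD(2)[OF p] assms by (auto simp: image_iff) (metis vspace_closed(2))
next
  note p = lin_proj[OF assms, of N]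
  fix x c assume "x \<in> carrier (quot V N)"
  then show "smul (quot V N) c x \<in> carrier (quot V N)"
    unfolding carrier_quot using linD(3)[OF p] assms by (auto simp: image_iff) (metis smul_quot vspace_closed(4))
qed (simp add: vector_space_fsmul)

lemma lin_proj' [simp]:
  "vspace V \<Longrightarrow> lin X V f \<Longrightarrow> smul U = fsmul \<Longrightarrow> carrier (quot V N) \<subseteq> carrier U \<Longrightarrow> lin X U (\<lambda>x. proj V N (f x))"
  by (rule lin_compose_widen[OF lin_proj]) simp_all

lemma proj_space_cong: "smul V = smul V' \<Longrightarrow> proj V N = proj V' N"
  by (intro ext) (simp add: proj_def)

lemma proj_linear:
  assumes "vspace V"
  shows "proj V N (x + y) = proj V N x + proj V N y"
    "proj V N (x - y) = proj V N x - proj V N y"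
    "proj V N (smul V c x) = fsmul c (proj V N x)"
    "proj V N 0 = 0"
proof -
  let ?V = "sub V UNIV"
  have V: "vspace ?V" using assms by (auto simp: vspace_vector_space intro!: vspaceI)
  have e: "proj V N = proj ?V N" by (rule proj_space_cong) simp
  note p = lin_proj[OF V, of N]
  show "proj V N (x + y) = proj V N x + proj V N y"
    "proj V N (x - y) = proj V N x - proj V N y"
    "proj V N (smul V c x) = fsmul c (proj V N x)"
    "proj V N 0 = 0"
    unfolding e using linD(2)[OF p, of x y] lin_diff[OF p V, of x y] linD(3)[OF p, of x c] lin_0[OF p V] by simp_all
qed

lemma proj_eq: "vspace V \<Longrightarrow> subsp V N \<Longrightarrow> proj V N v = proj V N w \<longleftrightarrow> v - w \<in> N"
  by (rule proj_eq_iff) (auto simp: vspace_def subsp_def)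

lemma proj_eq_0: "vspace V \<Longrightarrow> subsp V N \<Longrightarrow> proj V N v = 0 \<longleftrightarrow> v \<in> N"
  using proj_eq[of V N v 0] by (simp add: proj_linear)

lemma descend_lin:
  assumes "vspace V" "subsp V N" "lin V U f" "\<And>n. n \<in> N \<Longrightarrow> f n = 0"
  shows "v \<in> carrier V \<Longrightarrow> descend V N f (proj V N v) = f v"
    and "lin (quot V N) U (descend V N f)"
proof -
  show *: "descend V N f (proj V N v) = f v" if "v \<in> carrier V" for v
  proof (rule descend_proj[OF assms(1,2) that])
    fix x y assume "x \<in> carrier V" "y \<in> carrier V" "x - y \<in> N"
    then show "f x = f y" using lin_diff[OF assms(3,1), of x y] assms(4) by simp
  qed
  note p = lin_proj[OF assms(1), of N]
  show "lin (quot V N) U (descend V N f)"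
  proof (rule linI)
    fix x assume x: "x \<in> carrier (quot V N)"
    then obtain v where v: "v \<in> carrier V" "x = proj V N v" unfolding carrier_quot by blast
    show "descend V N f x \<in> carrier U" using v * linD(1)[OF assms(3)] by simp
    show "descend V N f (smul (quot V N) c x) = smul U c (descend V N f x)" for c
      using v *[of "smul V c v"] assms(1) by (simp add: * linD(3)[OF assms(3)] proj_linear)
    fix y assume y: "y \<in> carrier (quot V N)"
    then obtain w where w: "w \<in> carrier V" "y = proj V N w" unfolding carrier_quot by blast
    show "descend V N f (x + y) = descend V N f x + descend V N f y"
      using v w *[of "v + w"] assms(1) by (simp add: * linD(2)[OF assms(3)] proj_linear)
  qed
qed

lemma descend_cong:
  assumes "\<And>v. v \<in> carrier V \<Longrightarrow> f v = g v"
  shows "descend V N f x = descend V N g x"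
  unfolding descend_def using assms by (metis (no_types, lifting))

section \<open>Algebras and the product on a tensor product\<close>

locale algebra_on =
  fixes A :: "('k::field, 'a::ab_group_add, 'z) alg_scheme"
  assumes algebra: "algebra A"
begin

lemma vspace_alg [simp]: "vspace A"
  using algebra by (simp add: algebra_def)

lemma mul_bilin: "bilin A A A (mul A)"
  using algebra by (simp add: algebra_def)

lemma mul_mem [simp]: "a \<in> carrier A \<Longrightarrow> b \<in> carrier A \<Longrightarrow> a \<cdot>\<^bsub>A\<^esub> b \<in> carrier A"
  using bilin_mem[OF mul_bilin] .

lemma lin_mul1 [simp]:
  "lin X A f \<Longrightarrow> c \<in> carrier A \<Longrightarrow> smul U = smul A \<Longrightarrow> carrier A \<subseteq> carrier U \<Longrightarrow> lin X U (\<lambda>x. f x \<cdot>\<^bsub>A\<^esub> c)"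
  by (rule lin_bilin1[OF mul_bilin]) simp_all

lemma lin_mul2 [simp]:
  "lin X A f \<Longrightarrow> c \<in> carrier A \<Longrightarrow> smul U = smul A \<Longrightarrow> carrier A \<subseteq> carrier U \<Longrightarrow> lin X U (\<lambda>x. c \<cdot>\<^bsub>A\<^esub> f x)"
  by (rule lin_bilin2[OF mul_bilin]) simp_all

lemma unit_mem [simp]: "\<one>\<^bsub>A\<^esub> \<in> carrier A"
  using algebra by (simp add: algebra_def)

lemma mul_assoc:
  "a \<in> carrier A \<Longrightarrow> b \<in> carrier A \<Longrightarrow> c \<in> carrier A \<Longrightarrow> a \<cdot>\<^bsub>A\<^esub> b \<cdot>\<^bsub>A\<^esub> c = a \<cdot>\<^bsub>A\<^esub> (b \<cdot>\<^bsub>A\<^esub> c)"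
  using algebra by (simp add: algebra_def)

lemma mul_unit [simp]:
  "a \<in> carrier A \<Longrightarrow> \<one>\<^bsub>A\<^esub> \<cdot>\<^bsub>A\<^esub> a = a" "a \<in> carrier A \<Longrightarrow> a \<cdot>\<^bsub>A\<^esub> \<one>\<^bsub>A\<^esub> = a"
  using algebra by (simp_all add: algebra_def)

lemma mul_linear:
  assumes "a \<in> carrier A" "b \<in> carrier A" "c \<in> carrier A"
  shows "(a + b) \<cdot>\<^bsub>A\<^esub> c = a \<cdot>\<^bsub>A\<^esub> c + b \<cdot>\<^bsub>A\<^esub> c" "a \<cdot>\<^bsub>A\<^esub> (b + c) = a \<cdot>\<^bsub>A\<^esub> b + a \<cdot>\<^bsub>A\<^esub> c"
    "(a - b) \<cdot>\<^bsub>A\<^esub> c = a \<cdot>\<^bsub>A\<^esub> c - b \<cdot>\<^bsub>A\<^esub> c" "a \<cdot>\<^bsub>A\<^esub> (b - c) = a \<cdot>\<^bsub>A\<^esub> b - a \<cdot>\<^bsub>A\<^esub> c"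
    "(smul A r a) \<cdot>\<^bsub>A\<^esub> c = smul A r (a \<cdot>\<^bsub>A\<^esub> c)" "a \<cdot>\<^bsub>A\<^esub> (smul A r b) = smul A r (a \<cdot>\<^bsub>A\<^esub> b)"
  using assms linD(2)[OF bilinD(2)[OF mul_bilin assms(3)], of a b] linD(2)[OF bilinD(1)[OF mul_bilin assms(1)], of b c]
    lin_diff[OF bilinD(2)[OF mul_bilin assms(3)] vspace_alg, of a b] lin_diff[OF bilinD(1)[OF mul_bilin assms(1)] vspace_alg, of b c]
    linD(3)[OF bilinD(2)[OF mul_bilin assms(3)], of a r] linD(3)[OF bilinD(1)[OF mul_bilin assms(1)], of b r]
  by auto

end

locale algebra_pair = A: algebra_on A + B: algebra_on B
  for A :: "('k::field, 'a::ab_group_add, 'y) alg_scheme" and B :: "('k, 'b::ab_group_add, 'z) alg_scheme"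
begin

lemma tens_mul_tens [simp]:
  assumes "a \<in> carrier A" "b \<in> carrier B" "c \<in> carrier A" "d \<in> carrier B"
  shows "tens_mul A B (a \<otimes>\<^bsub>A,B\<^esub> b) (c \<otimes>\<^bsub>A,B\<^esub> d) = ((a \<cdot>\<^bsub>A\<^esub> c) \<otimes>\<^bsub>A,B\<^esub> (b \<cdot>\<^bsub>B\<^esub> d))"
  using assms by (simp add: tens_mul_def)

lemma tens_mul_bilin: "bilin (tprod A B) (tprod A B) (tprod A B) (tens_mul A B)"
  by (auto simp: tens_mul_def)

lemma tens_mul_mem [simp]:
  "s \<in> carrier (tprod A B) \<Longrightarrow> t \<in> carrier (tprod A B) \<Longrightarrow> tens_mul A B s t \<in> carrier (tprod A B)"
  using bilin_mem[OF tens_mul_bilin] .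

lemma lin_tens_mul1 [simp]:
  "lin X (tprod A B) f \<Longrightarrow> t \<in> carrier (tprod A B) \<Longrightarrow> smul U = fsmul \<Longrightarrow> carrier (tprod A B) \<subseteq> carrier U \<Longrightarrow>
   lin X U (\<lambda>x. tens_mul A B (f x) t)"
  by (rule lin_bilin1[OF tens_mul_bilin]) simp_all

lemma lin_tens_mul2 [simp]:
  "lin X (tprod A B) f \<Longrightarrow> s \<in> carrier (tprod A B) \<Longrightarrow> smul U = fsmul \<Longrightarrow> carrier (tprod A B) \<subseteq> carrier U \<Longrightarrow>
   lin X U (\<lambda>x. tens_mul A B s (f x))"
  by (rule lin_bilin2[OF tens_mul_bilin]) simp_all

lemma tens_mul_assoc:
  assumes "r \<in> carrier (tprod A B)" "s \<in> carrier (tprod A B)" "t \<in> carrier (tprod A B)"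
  shows "tens_mul A B (tens_mul A B r s) t = tens_mul A B r (tens_mul A B s t)"
proof -
  have 1: "tens_mul A B (tens_mul A B r s) t = tens_mul A B r (tens_mul A B s t)"
    if "r = (a \<otimes>\<^bsub>A,B\<^esub> b)" "s = (c \<otimes>\<^bsub>A,B\<^esub> d)" "a \<in> carrier A" "b \<in> carrier B" "c \<in> carrier A" "d \<in> carrier B"
      "t \<in> carrier (tprod A B)" for a b c d r s t
    by (rule tprod_eqI[where V = A and W = B and U = fspace and U' = fspace and f = "\<lambda>t. tens_mul A B (tens_mul A B r s) t"])
      (use that in \<open>simp_all add: A.mul_assoc B.mul_assoc\<close>)
  have 2: "tens_mul A B (tens_mul A B r s) t = tens_mul A B r (tens_mul A B s t)"
    if "r = (a \<otimes>\<^bsub>A,B\<^esub> b)" "a \<in> carrier A" "b \<in> carrier B" "s \<in> carrier (tprod A B)"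
      "t \<in> carrier (tprod A B)" for a b r s t
    by (rule tprod_eqI[where V = A and W = B and U = fspace and U' = fspace and f = "\<lambda>s. tens_mul A B (tens_mul A B r s) t"])
      (use that in \<open>simp_all add: 1[OF refl refl] del: tens_mul_tens\<close>)
  show ?thesis
    by (rule tprod_eqI[where V = A and W = B and U = fspace and U' = fspace and f = "\<lambda>r. tens_mul A B (tens_mul A B r s) t"])
      (use assms in \<open>simp_all add: 2[OF refl]\<close>)
qed

lemma tens_mul_unit [simp]:
  assumes "t \<in> carrier (tprod A B)"
  shows "tens_mul A B (\<one>\<^bsub>A\<^esub> \<otimes>\<^bsub>A,B\<^esub> \<one>\<^bsub>B\<^esub>) t = t" "tens_mul A B t (\<one>\<^bsub>A\<^esub> \<otimes>\<^bsub>A,B\<^esub> \<one>\<^bsub>B\<^esub>) = t"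
proof -
  show "tens_mul A B (\<one>\<^bsub>A\<^esub> \<otimes>\<^bsub>A,B\<^esub> \<one>\<^bsub>B\<^esub>) t = t"
    by (rule tprod_eqI[where V = A and W = B and U = fspace and U' = fspace and f = "\<lambda>t. tens_mul A B (\<one>\<^bsub>A\<^esub> \<otimes>\<^bsub>A,B\<^esub> \<one>\<^bsub>B\<^esub>) t" and g = "\<lambda>t. t"])
      (use assms in simp_all)
  show "tens_mul A B t (\<one>\<^bsub>A\<^esub> \<otimes>\<^bsub>A,B\<^esub> \<one>\<^bsub>B\<^esub>) = t"
    by (rule tprod_eqI[where V = A and W = B and U = fspace and U' = fspace and f = "\<lambda>t. tens_mul A B t (\<one>\<^bsub>A\<^esub> \<otimes>\<^bsub>A,B\<^esub> \<one>\<^bsub>B\<^esub>)" and g = "\<lambda>t. t"])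
      (use assms in simp_all)
qed

end

section \<open>Sweedler sums\<close>

locale hopf_alg = algebra_on H for H :: "('k::field, 'a::ab_group_add) hopf" +
  assumes hopf: "hopf_algebra H"
begin

sublocale TT: algebra_pair H H ..

abbreviation sw :: "('a \<Rightarrow> 'a \<Rightarrow> 'c::ab_group_add) \<Rightarrow> 'a \<Rightarrow> 'c" where
  "sw \<equiv> sw2 H"

abbreviation T :: "('k, ('k, 'a, 'a) ten) vs" where
  "T \<equiv> tprod H H"

lemma comul_lin: "lin H T (comul H)"
  using hopf by (simp add: hopf_algebra_def)

lemma comul_mem [simp]: "h \<in> carrier H \<Longrightarrow> comul H h \<in> carrier T"
  by (rule linD(1)[OF comul_lin])

lemma lin_comul [simp]:
  "lin X H f \<Longrightarrow> smul U = fsmul \<Longrightarrow> carrier T \<subseteq> carrier U \<Longrightarrow> lin X U (\<lambda>x. comul H (f x))"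
  by (rule lin_compose_widen[OF comul_lin]) simp_all

lemma counit_lin: "lin H scalars (counit H)"
  using hopf by (simp add: hopf_algebra_def)

lemma lin_counit [simp]: "lin X H f \<Longrightarrow> lin X scalars (\<lambda>x. counit H (f x))"
  by (rule lin_compose[OF counit_lin])

lemma counit_simps [simp]:
  "g \<in> carrier H \<Longrightarrow> h \<in> carrier H \<Longrightarrow> counit H (g \<cdot>\<^bsub>H\<^esub> h) = counit H g * counit H h"
  "counit H \<one>\<^bsub>H\<^esub> = 1"
  "g \<in> carrier H \<Longrightarrow> h \<in> carrier H \<Longrightarrow> counit H (g + h) = counit H g + counit H h"
  "g \<in> carrier H \<Longrightarrow> h \<in> carrier H \<Longrightarrow> counit H (g - h) = counit H g - counit H h"
  "h \<in> carrier H \<Longrightarrow> counit H (smul H c h) = c * counit H h"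
  using hopf linD(2,3)[OF counit_lin] lin_diff[OF counit_lin] by (auto simp: hopf_algebra_def)

lemma antip_lin: "lin H H (antip H)"
  using hopf by (simp add: hopf_algebra_def)

lemma antip_mem [simp]: "h \<in> carrier H \<Longrightarrow> antip H h \<in> carrier H"
  by (rule linD(1)[OF antip_lin])

lemma lin_antip [simp]: "lin X H f \<Longrightarrow> smul U = smul H \<Longrightarrow> carrier H \<subseteq> carrier U \<Longrightarrow> lin X U (\<lambda>x. antip H (f x))"
  by (rule lin_compose_widen[OF antip_lin]) simp_all

lemma sw_mem [simp]: "vspace U \<Longrightarrow> bilin H H U F \<Longrightarrow> h \<in> carrier H \<Longrightarrow> sw F h \<in> carrier U"
  by (simp add: sw2_def)

lemma lin_sw1 [simp]: "vspace U \<Longrightarrow> bilin H H U F \<Longrightarrow> lin X H f \<Longrightarrow> lin X U (\<lambda>x. sw F (f x))"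
  by (simp add: sw2_def)

lemma lin_sw2 [simp]:
  assumes "vspace U" "vspace X" "\<And>x. x \<in> carrier X \<Longrightarrow> bilin H H U (F x)"
    "\<And>a b. a \<in> carrier H \<Longrightarrow> b \<in> carrier H \<Longrightarrow> lin X U (\<lambda>x. F x a b)" "h \<in> carrier H"
  shows "lin X U (\<lambda>x. sw (F x) h)"
  unfolding sw2_def by (rule lin_lift2) (use assms in auto)

lemma sw_cong [cong]:
  "K = K' \<Longrightarrow> h = h' \<Longrightarrow> (\<And>a b. a \<in> carrier K' \<Longrightarrow> b \<in> carrier K' \<Longrightarrow> F a b = G a b) \<Longrightarrow> sw2 K F h = sw2 K' G h'"
  for K :: "('k, 'x::ab_group_add) hopf"
  unfolding sw2_def by (auto intro: lift_cong)

lemma sw_linear: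
  assumes "vspace U" "vspace U'" "bilin H H U F" "lin U U' g" "h \<in> carrier H"
  shows "g (sw F h) = sw (\<lambda>a b. g (F a b)) h"
  unfolding sw2_def by (rule lift_lin[OF _ _ assms(1-4)]) (use assms(5) in auto)

lemma tens_sw [simp]:
  "vspace V \<Longrightarrow> vspace W \<Longrightarrow> bilin H H V F \<Longrightarrow> w \<in> carrier W \<Longrightarrow> h \<in> carrier H \<Longrightarrow>
   ((sw F h) \<otimes>\<^bsub>V,W\<^esub> w) = sw (\<lambda>a b. F a b \<otimes>\<^bsub>V,W\<^esub> w) h"
  by (simp add: sw2_def)

lemma tens_sw' [simp]:
  "vspace V \<Longrightarrow> vspace W \<Longrightarrow> bilin H H W F \<Longrightarrow> v \<in> carrier V \<Longrightarrow> h \<in> carrier H \<Longrightarrow>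
   (v \<otimes>\<^bsub>V,W\<^esub> (sw F h)) = sw (\<lambda>a b. v \<otimes>\<^bsub>V,W\<^esub> F a b) h"
  by (simp add: sw2_def)

lemma lift_sw [simp]:
  "vspace V \<Longrightarrow> vspace W \<Longrightarrow> bilin V W fspace f \<Longrightarrow> bilin H H (tprod V W) F \<Longrightarrow> h \<in> carrier H \<Longrightarrow>
   lift V W f (sw F h) = sw (\<lambda>a b. lift V W f (F a b)) h"
  by (simp add: sw2_def)

lemma mul_sw [simp]:
  assumes "bilin H H H F" "c \<in> carrier H" "h \<in> carrier H"
  shows "sw F h \<cdot>\<^bsub>H\<^esub> c = sw (\<lambda>a b. F a b \<cdot>\<^bsub>H\<^esub> c) h" "c \<cdot>\<^bsub>H\<^esub> sw F h = sw (\<lambda>a b. c \<cdot>\<^bsub>H\<^esub> F a b) h"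
  by (rule sw_linear[of H H], use assms in auto)+

lemma sw_swap:
  assumes "vspace U" "\<And>a b. a \<in> carrier H \<Longrightarrow> b \<in> carrier H \<Longrightarrow> bilin H H U (F a b)"
    "\<And>c d. c \<in> carrier H \<Longrightarrow> d \<in> carrier H \<Longrightarrow> bilin H H U (\<lambda>a b. F a b c d)" "g \<in> carrier H" "h \<in> carrier H"
  shows "sw (\<lambda>a b. sw (\<lambda>c d. F a b c d) h) g = sw (\<lambda>c d. sw (\<lambda>a b. F a b c d) g) h"
  unfolding sw2_def by (rule lift_swap) (use assms in auto)

lemma sw_lift_swap:
  assumes "vspace U" "vspace V" "vspace W" "\<And>a b. a \<in> carrier H \<Longrightarrow> b \<in> carrier H \<Longrightarrow> bilin V W U (F a b)"
    "\<And>c d. c \<in> carrier V \<Longrightarrow> d \<in> carrier W \<Longrightarrow> bilin H H U (\<lambda>a b. F a b c d)" "g \<in> carrier H" "t \<in> carrier (tprod V W)"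
  shows "sw (\<lambda>a b. lift V W (\<lambda>c d. F a b c d) t) g = lift V W (\<lambda>c d. sw (\<lambda>a b. F a b c d) g) t"
  unfolding sw2_def by (rule lift_swap) (use assms in auto)

text \<open>Coassociativity is postulated for the universal expression
  \<open>(a \<otimes> b) \<otimes> c\<close> only. The linear map \<open>?F\<close> with
  \<open>(a \<otimes> b) \<otimes> c \<mapsto> F a b c\<close> carries it over to every
  \<open>F\<close> that is linear in each of the three arguments.\<close>

lemma coassoc_in:
  assumes U: "vspace U"
    and 1: "\<And>b c. b \<in> carrier H \<Longrightarrow> c \<in> carrier H \<Longrightarrow> lin H U (\<lambda>a. F a b c)"
    and 2: "\<And>a c. a \<in> carrier H \<Longrightarrow> c \<in> carrier H \<Longrightarrow> lin H U (\<lambda>b. F a b c)"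
    and 3: "\<And>a b. a \<in> carrier H \<Longrightarrow> b \<in> carrier H \<Longrightarrow> lin H U (\<lambda>c. F a b c)"
    and h: "h \<in> carrier H"
  shows "sw (\<lambda>x c. sw (\<lambda>a b. F a b c) x) h = sw (\<lambda>a y. sw (\<lambda>b c. F a b c) y) h"
proof -
  let ?F = "lift T H (\<lambda>t c. lift H H (\<lambda>a b. F a b c) t)"
  have b: "bilin T H U (\<lambda>t c. lift H H (\<lambda>a b. F a b c) t)" using 1 2 3 U by simp
  have l: "lin (tprod T H) U ?F" by (rule lin_lift) (use b U in auto)
  have ev: "?F ((a \<otimes>\<^bsub>H,H\<^esub> b) \<otimes>\<^bsub>T,H\<^esub> c) = F a b c" if "a \<in> carrier H" "b \<in> carrier H" "c \<in> carrier H" for a b c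
  proof -
    have "?F ((a \<otimes>\<^bsub>H,H\<^esub> b) \<otimes>\<^bsub>T,H\<^esub> c) = lift H H (\<lambda>a b. F a b c) (a \<otimes>\<^bsub>H,H\<^esub> b)"
      by (rule lift_tens_in[OF _ _ U b]) (use that in auto)
    also have "\<dots> = F a b c" by (rule lift_tens_in[OF _ _ U]) (use that 1 2 3 in auto)
    finally show ?thesis .
  qed
  have "sw (\<lambda>x c. sw (\<lambda>a b. (a \<otimes>\<^bsub>H,H\<^esub> b) \<otimes>\<^bsub>T,H\<^esub> c) x) h =
    sw (\<lambda>a y. sw (\<lambda>b c. (a \<otimes>\<^bsub>H,H\<^esub> b) \<otimes>\<^bsub>T,H\<^esub> c) y) h"
    using hopf h by (simp add: hopf_algebra_def)
  then have "?F (sw (\<lambda>x c. sw (\<lambda>a b. (a \<otimes>\<^bsub>H,H\<^esub> b) \<otimes>\<^bsub>T,H\<^esub> c) x) h) =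
    ?F (sw (\<lambda>a y. sw (\<lambda>b c. (a \<otimes>\<^bsub>H,H\<^esub> b) \<otimes>\<^bsub>T,H\<^esub> c) y) h)" by simp
  also have "?F (sw (\<lambda>x c. sw (\<lambda>a b. (a \<otimes>\<^bsub>H,H\<^esub> b) \<otimes>\<^bsub>T,H\<^esub> c) x) h) =
     sw (\<lambda>x c. ?F (sw (\<lambda>a b. (a \<otimes>\<^bsub>H,H\<^esub> b) \<otimes>\<^bsub>T,H\<^esub> c) x)) h"
    by (rule sw_linear[OF _ U _ l]) (use h in auto)
  also have "\<dots> = sw (\<lambda>x c. sw (\<lambda>a b. F a b c) x) h"
  proof (intro sw_cong refl)
    fix x c assume xc: "x \<in> carrier H" "c \<in> carrier H"
    have "?F (sw (\<lambda>a b. (a \<otimes>\<^bsub>H,H\<^esub> b) \<otimes>\<^bsub>T,H\<^esub> c) x) = sw (\<lambda>a b. ?F ((a \<otimes>\<^bsub>H,H\<^esub> b) \<otimes>\<^bsub>T,H\<^esub> c)) x"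
      by (rule sw_linear[OF _ U _ l]) (use xc in auto)
    also have "\<dots> = sw (\<lambda>a b. F a b c) x" by (intro sw_cong refl ev xc)
    finally show "?F (sw (\<lambda>a b. (a \<otimes>\<^bsub>H,H\<^esub> b) \<otimes>\<^bsub>T,H\<^esub> c) x) = sw (\<lambda>a b. F a b c) x" .
  qed
  also have "?F (sw (\<lambda>a y. sw (\<lambda>b c. (a \<otimes>\<^bsub>H,H\<^esub> b) \<otimes>\<^bsub>T,H\<^esub> c) y) h) =
     sw (\<lambda>a y. ?F (sw (\<lambda>b c. (a \<otimes>\<^bsub>H,H\<^esub> b) \<otimes>\<^bsub>T,H\<^esub> c) y)) h"
    by (rule sw_linear[OF _ U _ l]) (use h in auto)
  also have "\<dots> = sw (\<lambda>a y. sw (\<lambda>b c. F a b c) y) h"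
  proof (intro sw_cong refl)
    fix a y assume xc: "a \<in> carrier H" "y \<in> carrier H"
    have "?F (sw (\<lambda>b c. (a \<otimes>\<^bsub>H,H\<^esub> b) \<otimes>\<^bsub>T,H\<^esub> c) y) = sw (\<lambda>b c. ?F ((a \<otimes>\<^bsub>H,H\<^esub> b) \<otimes>\<^bsub>T,H\<^esub> c)) y"
      by (rule sw_linear[OF _ U _ l]) (use xc in auto)
    also have "\<dots> = sw (\<lambda>b c. F a b c) y" by (intro sw_cong refl ev xc)
    finally show "?F (sw (\<lambda>b c. (a \<otimes>\<^bsub>H,H\<^esub> b) \<otimes>\<^bsub>T,H\<^esub> c) y) = sw (\<lambda>b c. F a b c) y" .
  qed
  finally show ?thesis .
qed

text \<open>As a rewrite rule this pushes iterated coproducts into the right leg, a normal form in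
  which Sweedler expressions can be compared.\<close>

lemmas coassoc [simp] = coassoc_in[OF vspace_fspace]

lemma sw_counit_in:
  assumes U: "vspace U" and f: "lin H U f" and h: "h \<in> carrier H"
  shows "sw (\<lambda>a b. smul U (counit H a) (f b)) h = f h" "sw (\<lambda>a b. smul U (counit H b) (f a)) h = f h"
proof -
  have e: "sw (\<lambda>a b. smul H (counit H a) b) h = h" "sw (\<lambda>a b. smul H (counit H b) a) h = h"
    using hopf h by (simp_all add: hopf_algebra_def)
  have "f (sw (\<lambda>a b. smul H (counit H a) b) h) = sw (\<lambda>a b. f (smul H (counit H a) b)) h"
    by (rule sw_linear[OF _ U _ f]) (use h in auto)
  then show "sw (\<lambda>a b. smul U (counit H a) (f b)) h = f h"
    unfolding e by (simp add: linD(3)[OF f])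
  have "f (sw (\<lambda>a b. smul H (counit H b) a) h) = sw (\<lambda>a b. f (smul H (counit H b) a)) h"
    by (rule sw_linear[OF _ U _ f]) (use h in auto)
  then show "sw (\<lambda>a b. smul U (counit H b) (f a)) h = f h"
    unfolding e by (simp add: linD(3)[OF f])
qed

lemmas sw_counit [simp] = sw_counit_in[where U = fspace, OF vspace_fspace, simplified]
lemmas sw_counit_H [simp] = sw_counit_in[where U = H, OF vspace_alg]
lemmas sw_counit_scalars [simp] = sw_counit_in[where U = scalars, OF vspace_scalars, simplified]

lemma sw_antip_in:
  assumes U: "vspace U" and f: "lin H U f" and h: "h \<in> carrier H"
  shows "sw (\<lambda>a b. f (antip H a \<cdot>\<^bsub>H\<^esub> b)) h = smul U (counit H h) (f \<one>\<^bsub>H\<^esub>)"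
    "sw (\<lambda>a b. f (a \<cdot>\<^bsub>H\<^esub> antip H b)) h = smul U (counit H h) (f \<one>\<^bsub>H\<^esub>)"
proof -
  have e: "sw (\<lambda>a b. antip H a \<cdot>\<^bsub>H\<^esub> b) h = smul H (counit H h) \<one>\<^bsub>H\<^esub>"
    "sw (\<lambda>a b. a \<cdot>\<^bsub>H\<^esub> antip H b) h = smul H (counit H h) \<one>\<^bsub>H\<^esub>"
    using hopf h by (simp_all add: hopf_algebra_def)
  have "f (sw (\<lambda>a b. antip H a \<cdot>\<^bsub>H\<^esub> b) h) = sw (\<lambda>a b. f (antip H a \<cdot>\<^bsub>H\<^esub> b)) h"
    by (rule sw_linear[OF _ U _ f]) (use h in auto)
  then show "sw (\<lambda>a b. f (antip H a \<cdot>\<^bsub>H\<^esub> b)) h = smul U (counit H h) (f \<one>\<^bsub>H\<^esub>)"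
    unfolding e by (simp add: linD(3)[OF f])
  have "f (sw (\<lambda>a b. a \<cdot>\<^bsub>H\<^esub> antip H b) h) = sw (\<lambda>a b. f (a \<cdot>\<^bsub>H\<^esub> antip H b)) h"
    by (rule sw_linear[OF _ U _ f]) (use h in auto)
  then show "sw (\<lambda>a b. f (a \<cdot>\<^bsub>H\<^esub> antip H b)) h = smul U (counit H h) (f \<one>\<^bsub>H\<^esub>)"
    unfolding e by (simp add: linD(3)[OF f])
qed

context
  fixes U :: "('k, 'c::ab_group_add, 'z) vs_scheme" and G :: "'a \<Rightarrow> 'a \<Rightarrow> 'c" and h :: 'a
  assumes U: "vspace U" and G: "bilin H H U G" and h: "h \<in> carrier H"
begin

private lemma G1: "lin X H f \<Longrightarrow> c \<in> carrier H \<Longrightarrow> lin X U (\<lambda>x. G (f x) c)"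
  by (rule lin_bilin1[OF G]) simp_all

private lemma G2: "lin X H f \<Longrightarrow> c \<in> carrier H \<Longrightarrow> lin X U (\<lambda>x. G c (f x))"
  by (rule lin_bilin2[OF G]) simp_all

text \<open>The antipode axiom on two neighbouring legs of a double coproduct leaves a counit, which
  removes the third leg. In the first two equations the legs to be cancelled have to be brought
  together by coassociativity; in the last two they already form one coproduct.\<close>

lemma cancel_antip_in:
  shows "sw (\<lambda>a y. sw (\<lambda>b c. G (antip H a \<cdot>\<^bsub>H\<^esub> b) c) y) h = G \<one>\<^bsub>H\<^esub> h"
    and "sw (\<lambda>a y. sw (\<lambda>b c. G (a \<cdot>\<^bsub>H\<^esub> antip H b) c) y) h = G \<one>\<^bsub>H\<^esub> h"
    and "sw (\<lambda>a y. sw (\<lambda>b c. G a (antip H b \<cdot>\<^bsub>H\<^esub> c)) y) h = G h \<one>\<^bsub>H\<^esub>"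
    and "sw (\<lambda>a y. sw (\<lambda>b c. G a (b \<cdot>\<^bsub>H\<^esub> antip H c)) y) h = G h \<one>\<^bsub>H\<^esub>"
proof -
  have "sw (\<lambda>a y. sw (\<lambda>b c. G (antip H a \<cdot>\<^bsub>H\<^esub> b) c) y) h = sw (\<lambda>x c. sw (\<lambda>a b. G (antip H a \<cdot>\<^bsub>H\<^esub> b) c) x) h"
    by (rule coassoc_in[OF U, symmetric]) (simp_all add: h G1 G2)
  also have "\<dots> = sw (\<lambda>x c. smul U (counit H x) (G \<one>\<^bsub>H\<^esub> c)) h"
    by (intro sw_cong refl sw_antip_in(1)[OF U, where f = "\<lambda>u. G u _"]) (simp_all add: G1)
  also have "\<dots> = G \<one>\<^bsub>H\<^esub> h" by (rule sw_counit_in(1)[OF U _ h]) (simp add: G2)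
  finally show "sw (\<lambda>a y. sw (\<lambda>b c. G (antip H a \<cdot>\<^bsub>H\<^esub> b) c) y) h = G \<one>\<^bsub>H\<^esub> h" .
  have "sw (\<lambda>a y. sw (\<lambda>b c. G (a \<cdot>\<^bsub>H\<^esub> antip H b) c) y) h = sw (\<lambda>x c. sw (\<lambda>a b. G (a \<cdot>\<^bsub>H\<^esub> antip H b) c) x) h"
    by (rule coassoc_in[OF U, symmetric]) (simp_all add: h G1 G2)
  also have "\<dots> = sw (\<lambda>x c. smul U (counit H x) (G \<one>\<^bsub>H\<^esub> c)) h"
    by (intro sw_cong refl sw_antip_in(2)[OF U, where f = "\<lambda>u. G u _"]) (simp_all add: G1)
  also have "\<dots> = G \<one>\<^bsub>H\<^esub> h" by (rule sw_counit_in(1)[OF U _ h]) (simp add: G2)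
  finally show "sw (\<lambda>a y. sw (\<lambda>b c. G (a \<cdot>\<^bsub>H\<^esub> antip H b) c) y) h = G \<one>\<^bsub>H\<^esub> h" .
  have "sw (\<lambda>a y. sw (\<lambda>b c. G a (antip H b \<cdot>\<^bsub>H\<^esub> c)) y) h = sw (\<lambda>a x. smul U (counit H x) (G a \<one>\<^bsub>H\<^esub>)) h"
    by (intro sw_cong refl sw_antip_in(1)[OF U, where f = "\<lambda>u. G _ u"]) (simp_all add: G2)
  also have "\<dots> = G h \<one>\<^bsub>H\<^esub>" by (rule sw_counit_in(2)[OF U _ h]) (simp add: G1)
  finally show "sw (\<lambda>a y. sw (\<lambda>b c. G a (antip H b \<cdot>\<^bsub>H\<^esub> c)) y) h = G h \<one>\<^bsub>H\<^esub>" .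
  have "sw (\<lambda>a y. sw (\<lambda>b c. G a (b \<cdot>\<^bsub>H\<^esub> antip H c)) y) h = sw (\<lambda>a x. smul U (counit H x) (G a \<one>\<^bsub>H\<^esub>)) h"
    by (intro sw_cong refl sw_antip_in(2)[OF U, where f = "\<lambda>u. G _ u"]) (simp_all add: G2)
  also have "\<dots> = G h \<one>\<^bsub>H\<^esub>" by (rule sw_counit_in(2)[OF U _ h]) (simp add: G1)
  finally show "sw (\<lambda>a y. sw (\<lambda>b c. G a (b \<cdot>\<^bsub>H\<^esub> antip H c)) y) h = G h \<one>\<^bsub>H\<^esub>" .
qed

lemma sw_unit_in: "sw G \<one>\<^bsub>H\<^esub> = G \<one>\<^bsub>H\<^esub> \<one>\<^bsub>H\<^esub>"
proof -
  have "comul H \<one>\<^bsub>H\<^esub> = (\<one>\<^bsub>H\<^esub> \<otimes>\<^bsub>H,H\<^esub> \<one>\<^bsub>H\<^esub>)" using hopf by (simp add: hopf_algebra_def)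
  then show ?thesis unfolding sw2_def by (simp add: lift_tens_in[OF _ _ U G])
qed

lemma sw_mult_in:
  assumes g: "g \<in> carrier H"
  shows "sw G (g \<cdot>\<^bsub>H\<^esub> h) = sw (\<lambda>g1 g2. sw (\<lambda>h1 h2. G (g1 \<cdot>\<^bsub>H\<^esub> h1) (g2 \<cdot>\<^bsub>H\<^esub> h2)) h) g"
proof -
  have "comul H (g \<cdot>\<^bsub>H\<^esub> h) = tens_mul H H (comul H g) (comul H h)"
    using hopf g h by (simp add: hopf_algebra_def)
  also have "\<dots> = sw (\<lambda>g1 g2. sw (\<lambda>h1 h2. (g1 \<cdot>\<^bsub>H\<^esub> h1) \<otimes>\<^bsub>H,H\<^esub> (g2 \<cdot>\<^bsub>H\<^esub> h2)) h) g"
    by (simp add: tens_mul_def sw2_def)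
  finally have "sw G (g \<cdot>\<^bsub>H\<^esub> h) = lift H H G (sw (\<lambda>g1 g2. sw (\<lambda>h1 h2. (g1 \<cdot>\<^bsub>H\<^esub> h1) \<otimes>\<^bsub>H,H\<^esub> (g2 \<cdot>\<^bsub>H\<^esub> h2)) h) g)"
    unfolding sw2_def[of H G] by simp
  also have "\<dots> = sw (\<lambda>g1 g2. lift H H G (sw (\<lambda>h1 h2. (g1 \<cdot>\<^bsub>H\<^esub> h1) \<otimes>\<^bsub>H,H\<^esub> (g2 \<cdot>\<^bsub>H\<^esub> h2)) h)) g"
    by (rule sw_linear[of T U, OF _ U _ lin_lift[OF _ _ U G]]) (use g h in auto)
  also have "\<dots> = sw (\<lambda>g1 g2. sw (\<lambda>h1 h2. lift H H G ((g1 \<cdot>\<^bsub>H\<^esub> h1) \<otimes>\<^bsub>H,H\<^esub> (g2 \<cdot>\<^bsub>H\<^esub> h2))) h) g"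
    by (intro sw_cong refl sw_linear[of T U, OF _ U _ lin_lift[OF _ _ U G]]) (use g h in auto)
  also have "\<dots> = sw (\<lambda>g1 g2. sw (\<lambda>h1 h2. G (g1 \<cdot>\<^bsub>H\<^esub> h1) (g2 \<cdot>\<^bsub>H\<^esub> h2)) h) g"
    by (intro sw_cong refl lift_tens_in[OF _ _ U G]) auto
  finally show ?thesis .
qed

end

lemmas cancel_antip = cancel_antip_in[OF vspace_fspace]
lemmas sw_unit [simp] = sw_unit_in[OF vspace_fspace _ unit_mem]
lemmas sw_mult [simp] = sw_mult_in[OF vspace_fspace]

lemma comul_sw: "h \<in> carrier H \<Longrightarrow> comul H h = sw (\<lambda>a b. a \<otimes>\<^bsub>H,H\<^esub> b) h"
  by (simp add: sw2_def)

section \<open>The antipode, the counit and the coproduct\<close>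

lemma antip_unit [simp]: "antip H \<one>\<^bsub>H\<^esub> = \<one>\<^bsub>H\<^esub>"
proof -
  have "sw (\<lambda>a b. antip H a \<cdot>\<^bsub>H\<^esub> b) \<one>\<^bsub>H\<^esub> = \<one>\<^bsub>H\<^esub>"
    using sw_antip_in(1)[of H "\<lambda>x. x" "\<one>\<^bsub>H\<^esub>"] by (simp add: vspace_smul)
  then show ?thesis using sw_unit_in[of H "\<lambda>a b. antip H a \<cdot>\<^bsub>H\<^esub> b" "\<one>\<^bsub>H\<^esub>"] by simp
qed

text \<open>Inserting \<open>\<epsilon>(h\<^sub>2)\<close> turns \<open>\<epsilon>(S h)\<close> into
  \<open>\<epsilon>((S h\<^sub>1) h\<^sub>2)\<close>, which the antipode axiom evaluates.\<close>

lemma counit_antip [simp]: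
  assumes "h \<in> carrier H" shows "counit H (antip H h) = counit H h"
proof -
  have "counit H (antip H h) = sw (\<lambda>a b. counit H b * counit H (antip H a)) h"
    using assms by simp
  also have "\<dots> = sw (\<lambda>a b. counit H (antip H a \<cdot>\<^bsub>H\<^esub> b)) h"
    using assms by (simp add: mult.commute)
  also have "\<dots> = counit H h"
    using sw_antip_in(1)[of scalars "counit H" h] counit_lin assms by simp
  finally show ?thesis .
qed

text \<open>The coproduct of \<open>Sh\<close> and the flipped \<open>S \<otimes> S\<close> of the coproduct of \<open>h\<close> are a left and a right
  convolution inverse of the coproduct.\<close>

lemma comul_antip:
  assumes h: "h \<in> carrier H"
  shows "comul H (antip H h) = sw (\<lambda>a b. antip H b \<otimes>\<^bsub>H,H\<^esub> antip H a) h"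
proof -
  let ?m = "tens_mul H H" and ?D = "\<lambda>x. comul H (antip H x)"
  define R where "R w = sw (\<lambda>d e. antip H e \<otimes>\<^bsub>H,H\<^esub> antip H d) w" for w
  have R: "lin X T (\<lambda>x. R (f x))" if "lin X H f" for X f using that by (simp add: R_def)
  have R': "R w \<in> carrier T" if "w \<in> carrier H" for w using that by (simp add: R_def)
  have comul_mul: "?m (comul H x) (comul H y) = comul H (x \<cdot>\<^bsub>H\<^esub> y)" if "x \<in> carrier H" "y \<in> carrier H" for x y
    using hopf that by (simp add: hopf_algebra_def)
  have comul_R: "sw (\<lambda>x w. ?m (comul H x) (R w)) y = fsmul (counit H y) (\<one>\<^bsub>H\<^esub> \<otimes>\<^bsub>H,H\<^esub> \<one>\<^bsub>H\<^esub>)" if y: "y \<in> carrier H" for y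
  proof -
    have "sw (\<lambda>x w. ?m (comul H x) (R w)) y =
      sw (\<lambda>b z. sw (\<lambda>c w. sw (\<lambda>d e. (b \<cdot>\<^bsub>H\<^esub> antip H e) \<otimes>\<^bsub>H,H\<^esub> (c \<cdot>\<^bsub>H\<^esub> antip H d)) w) z) y"
      using y by (simp add: comul_sw R_def tens_mul_def)
    also have "\<dots> = sw (\<lambda>b z. (b \<cdot>\<^bsub>H\<^esub> antip H z) \<otimes>\<^bsub>H,H\<^esub> \<one>\<^bsub>H\<^esub>) y"
      by (intro sw_cong refl cancel_antip(2)[where G = "\<lambda>u e. (_ \<cdot>\<^bsub>H\<^esub> antip H e) \<otimes>\<^bsub>H,H\<^esub> u"]) auto
    also have "\<dots> = fsmul (counit H y) (\<one>\<^bsub>H\<^esub> \<otimes>\<^bsub>H,H\<^esub> \<one>\<^bsub>H\<^esub>)"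
      using sw_antip_in(2)[of fspace "\<lambda>u. u \<otimes>\<^bsub>H,H\<^esub> \<one>\<^bsub>H\<^esub>" y] y by simp
    finally show ?thesis .
  qed
  have "?D h = sw (\<lambda>a y. fsmul (counit H y) (?D a)) h"
    by (rule sw_counit(2)[symmetric]) (use h in simp_all)
  also have "\<dots> = sw (\<lambda>a y. ?m (?D a) (sw (\<lambda>x w. ?m (comul H x) (R w)) y)) h"
    by (intro sw_cong refl) (simp add: comul_R linD(3)[OF bilinD(1)[OF TT.tens_mul_bilin], simplified])
  also have "\<dots> = sw (\<lambda>a y. sw (\<lambda>x w. ?m (?D a) (?m (comul H x) (R w))) y) h"
    by (intro sw_cong refl sw_linear[of T fspace, where g = "?m _"]) (simp_all add: R R')
  also have "\<dots> = sw (\<lambda>a y. sw (\<lambda>x w. ?m (comul H (antip H a \<cdot>\<^bsub>H\<^esub> x)) (R w)) y) h"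
    by (intro sw_cong refl) (simp add: TT.tens_mul_assoc[symmetric] comul_mul R')
  also have "\<dots> = ?m (comul H \<one>\<^bsub>H\<^esub>) (R h)"
    by (rule cancel_antip(1)) (use h in \<open>simp_all add: R R'\<close>)
  also have "\<dots> = R h"
    using hopf h R' by (simp add: hopf_algebra_def)
  finally show ?thesis by (simp add: R_def)
qed

lemma sw_antip [simp]:
  assumes "bilin H H fspace F" "h \<in> carrier H"
  shows "sw F (antip H h) = sw (\<lambda>a b. F (antip H b) (antip H a)) h"
  using assms by (simp add: sw2_def[of H F] comul_antip)

end

lemma hopf_algI: "hopf_algebra H \<Longrightarrow> hopf_alg H"
  by unfold_locales (simp_all add: hopf_algebra_def)

subsection \<open>Bicovariant calculi\<close>

lemma fsmul_mem [simp]: "vspace V \<Longrightarrow> smul V = fsmul \<Longrightarrow> x \<in> carrier V \<Longrightarrow> fsmul c x \<in> carrier V"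
  using vspace_closed(4)[of V x c] by simp

lemma lin_tspan_in:
  assumes "vspace V" "lin (tprod V W) U f" "subsp V A" "B \<subseteq> carrier W" "t \<in> tspan V W A B" "vspace U" "subsp U S"
    and "\<And>a b. a \<in> A \<Longrightarrow> b \<in> B \<Longrightarrow> f (a \<otimes>\<^bsub>V,W\<^esub> b) \<in> S"
  shows "f t \<in> S"
  using assms(1,3,5)
proof (induction rule: tspan_induct)
  case zero
  show ?case unfolding lin_0[OF assms(2) vspace_tprod] using assms(6,7) by (simp add: subsp_iff)
next
  case (add s t)
  have sub: "tspan V W A B \<subseteq> carrier (tprod V W)"
    using assms(3,4) by (intro tspan_subset) (auto simp: subsp_def)
  show ?case
    unfolding linD(2)[OF assms(2) subsetD[OF sub add(1)] subsetD[OF sub add(2)]]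
    using add(3,4) assms(6,7) by (simp add: subsp_iff)
qed (rule assms(8))

lemma tens_flip:
  assumes "vspace V" "vspace W"
  shows "lin (tprod V W) (tprod W V) (lift V W (\<lambda>v w. w \<otimes>\<^bsub>W,V\<^esub> v))"
    and "t \<in> carrier (tprod V W) \<Longrightarrow> lift W V (\<lambda>w v. v \<otimes>\<^bsub>V,W\<^esub> w) (lift V W (\<lambda>v w. w \<otimes>\<^bsub>W,V\<^esub> v) t) = t"
  using assms by (auto intro!: lin_lift)

text \<open>The mirror image of \<open>ker_functional_tens\<close>, obtained by conjugating with the
  flip of the two factors.\<close>

lemma ker_functional_tens':
  assumes V: "vspace V" and W: "vspace W" and \<phi>: "lin W scalars \<phi>" and u: "u \<in> carrier W" "\<phi> u = 1"
    and t: "t \<in> carrier (tprod V W)" and 0: "lift V W (\<lambda>v w. smul V (\<phi> w) v) t = 0"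
  shows "t \<in> tspan V W (carrier V) {w \<in> carrier W. \<phi> w = 0}"
proof -
  let ?f = "lift V W (\<lambda>v w. w \<otimes>\<^bsub>W,V\<^esub> v)"
  have b: "bilin W V V (\<lambda>w v. smul V (\<phi> w) v)" using assms by auto
  have b': "bilin V W V (\<lambda>v w. smul V (\<phi> w) v)" using assms by auto
  have "lift W V (\<lambda>w v. smul V (\<phi> w) v) (?f t) = lift V W (\<lambda>v w. smul V (\<phi> w) v) t"
  proof (rule tprod_eqI[where V = V and W = W, OF V _ _ _ t])
    show "lin (tprod V W) V (\<lambda>t. lift W V (\<lambda>w v. smul V (\<phi> w) v) (?f t))"
      by (rule lin_compose[OF lin_lift[OF W V V b] tens_flip(1)[OF V W]])
    show "lin (tprod V W) V (lift V W (\<lambda>v w. smul V (\<phi> w) v))" by (rule lin_lift[OF V W V b'])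
  qed (use V W in \<open>simp add: lift_tens_in[OF W V V b] lift_tens_in[OF V W V b']\<close>)
  then have "?f t \<in> tspan W V {w \<in> carrier W. \<phi> w = 0} (carrier V)"
    using ker_functional_tens[OF W V \<phi> u, of "?f t"] linD(1)[OF tens_flip(1)[OF V W] t] 0 by simp
  then have "lift W V (\<lambda>w v. v \<otimes>\<^bsub>V,W\<^esub> w) (?f t) \<in> tspan V W (carrier V) {w \<in> carrier W. \<phi> w = 0}"
    by (rule lift_in_subsp[where U = "tprod V W", OF W V _ _ _ order_refl, rotated 3])
      (use V W lin_0[OF \<phi> W] linD(2,3)[OF \<phi>] in \<open>auto simp: subsp_iff[OF W]\<close>)
  then show ?thesis using tens_flip(2)[OF V W t] by simp
qed

lemma smul_univ [simp]: "smul (univ A) = fsmul"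
  by (simp add: univ_def)

lemma carrier_univ: "carrier (univ A) = {t \<in> carrier (tprod A A). lift A A (mul A) t = 0}"
  by (simp add: univ_def)

lemma tens_univ [simp]: "(v \<otimes>\<^bsub>V,univ A\<^esub> w) = (v \<otimes>\<^bsub>V,tprod A A\<^esub> w)" "(w \<otimes>\<^bsub>univ A,V\<^esub> v) = (w \<otimes>\<^bsub>tprod A A,V\<^esub> v)"
  by (rule tens_cong; simp)+

lemma (in algebra_on) lift_mul_lin: "lin (tprod A A) A (lift A A (mul A))"
  by (rule lin_lift) simp_all

lemma (in algebra_on) vspace_univ [simp]: "vspace (univ A)"
  by (rule vspaceI)
    (simp_all add: carrier_univ vector_space_fsmul linD(2)[OF lift_mul_lin] linD(3)[OF lift_mul_lin, simplified] vspace_smul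
      lin_0[OF lift_mul_lin])

section \<open>The trivialisation of the tensor square and its inverse\<close>

context hopf_alg
begin

text \<open>The inverse of \<open>triv\<close>. For \<open>g\<close> with counit zero the class of
  \<open>trivi (h \<otimes> g)\<close> is \<open>h\<close> times the Maurer-Cartan form at
  \<open>g\<close>.\<close>

definition trivi :: "('k, 'a, 'a) ten \<Rightarrow> ('k, 'a, 'a) ten" where
  "trivi = lift H H (\<lambda>h g. sw (\<lambda>g1 g2. (h \<cdot>\<^bsub>H\<^esub> antip H g1) \<otimes>\<^bsub>H,H\<^esub> g2) g)"

lemma triv_lin: "lin T T (triv H)"
  unfolding triv_def by (rule lin_lift) simp_all

lemma lin_triv [simp]:
  "lin X T f \<Longrightarrow> smul U = fsmul \<Longrightarrow> carrier T \<subseteq> carrier U \<Longrightarrow> lin X U (\<lambda>x. triv H (f x))"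
  by (rule lin_compose_widen[OF triv_lin]) simp_all

lemma triv_mem [simp]: "t \<in> carrier T \<Longrightarrow> triv H t \<in> carrier T"
  by (rule linD(1)[OF triv_lin])

lemma trivi_lin: "lin T T trivi"
  unfolding trivi_def by (rule lin_lift) simp_all

lemma lin_trivi [simp]:
  "lin X T f \<Longrightarrow> smul U = fsmul \<Longrightarrow> carrier T \<subseteq> carrier U \<Longrightarrow> lin X U (\<lambda>x. trivi (f x))"
  by (rule lin_compose_widen[OF trivi_lin]) simp_all

lemma trivi_mem [simp]: "t \<in> carrier T \<Longrightarrow> trivi t \<in> carrier T"
  by (rule linD(1)[OF trivi_lin])

lemma triv_tens: "h \<in> carrier H \<Longrightarrow> g \<in> carrier H \<Longrightarrow>
  triv H (h \<otimes>\<^bsub>H,H\<^esub> g) = sw (\<lambda>a b. (h \<cdot>\<^bsub>H\<^esub> a) \<otimes>\<^bsub>H,H\<^esub> b) g"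
  by (simp add: triv_def)

lemma trivi_tens: "h \<in> carrier H \<Longrightarrow> g \<in> carrier H \<Longrightarrow>
  trivi (h \<otimes>\<^bsub>H,H\<^esub> g) = sw (\<lambda>a b. (h \<cdot>\<^bsub>H\<^esub> antip H a) \<otimes>\<^bsub>H,H\<^esub> b) g"
  by (simp add: trivi_def)

lemma triv_sw: "bilin H H T F \<Longrightarrow> h \<in> carrier H \<Longrightarrow> triv H (sw F h) = sw (\<lambda>a b. triv H (F a b)) h"
  by (rule sw_linear[OF _ _ _ triv_lin]) simp_all

lemma trivi_sw: "bilin H H T F \<Longrightarrow> h \<in> carrier H \<Longrightarrow> trivi (sw F h) = sw (\<lambda>a b. trivi (F a b)) h"
  by (rule sw_linear[OF _ _ _ trivi_lin]) simp_all

lemma triv_trivi [simp]: assumes "t \<in> carrier T" shows "triv H (trivi t) = t"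
proof (rule tprod_eqI[where f = "\<lambda>t. triv H (trivi t)" and g = "\<lambda>t. t" and U = fspace and U' = fspace, OF vspace_alg _ _ _ assms])
  fix h g assume hg: "h \<in> carrier H" "g \<in> carrier H"
  have "triv H (trivi (h \<otimes>\<^bsub>H,H\<^esub> g)) = sw (\<lambda>a y. sw (\<lambda>b c. (h \<cdot>\<^bsub>H\<^esub> (antip H a \<cdot>\<^bsub>H\<^esub> b)) \<otimes>\<^bsub>H,H\<^esub> c) y) g"
    using hg by (simp add: trivi_tens triv_sw triv_tens mul_assoc)
  also have "\<dots> = (h \<otimes>\<^bsub>H,H\<^esub> g)"
    using cancel_antip(1)[of "\<lambda>u c. (h \<cdot>\<^bsub>H\<^esub> u) \<otimes>\<^bsub>H,H\<^esub> c" g] hg by simp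
  finally show "triv H (trivi (h \<otimes>\<^bsub>H,H\<^esub> g)) = (h \<otimes>\<^bsub>H,H\<^esub> g)" .
qed simp_all

lemma trivi_triv [simp]: assumes "t \<in> carrier T" shows "trivi (triv H t) = t"
proof (rule tprod_eqI[where f = "\<lambda>t. trivi (triv H t)" and g = "\<lambda>t. t" and U = fspace and U' = fspace, OF vspace_alg _ _ _ assms])
  fix h g assume hg: "h \<in> carrier H" "g \<in> carrier H"
  have "trivi (triv H (h \<otimes>\<^bsub>H,H\<^esub> g)) = sw (\<lambda>a y. sw (\<lambda>b c. (h \<cdot>\<^bsub>H\<^esub> (a \<cdot>\<^bsub>H\<^esub> antip H b)) \<otimes>\<^bsub>H,H\<^esub> c) y) g"
    using hg by (simp add: trivi_tens trivi_sw triv_tens mul_assoc)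
  also have "\<dots> = (h \<otimes>\<^bsub>H,H\<^esub> g)"
    using cancel_antip(2)[of "\<lambda>u c. (h \<cdot>\<^bsub>H\<^esub> u) \<otimes>\<^bsub>H,H\<^esub> c" g] hg by simp
  finally show "trivi (triv H (h \<otimes>\<^bsub>H,H\<^esub> g)) = (h \<otimes>\<^bsub>H,H\<^esub> g)" .
qed simp_all

lemma subsp_aug [simp]: "subsp H (aug H)"
  using lin_0[OF counit_lin] by (auto simp: subsp_iff aug_def)

lemma aug_subset: "aug H \<subseteq> carrier H"
  by (auto simp: aug_def)

text \<open>Since \<open>h g\<^sub>1 \<epsilon>(g\<^sub>2) = h g\<close>, the trivialisation turns
  the product of \<open>H\<close> into \<open>id \<otimes> \<epsilon>\<close>. The kernel of the
  product thereby becomes accessible as the kernel of a functional on one factor.\<close>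

lemma counit_triv:
  assumes "t \<in> carrier T"
  shows "lift H H (\<lambda>h g. smul H (counit H g) h) (triv H t) = lift H H (mul H) t"
proof (rule tprod_eqI[where f = "\<lambda>t. lift H H (\<lambda>h g. smul H (counit H g) h) (triv H t)" and U = H and U' = H, OF vspace_alg _ _ _ assms])
  have b: "bilin H H H (\<lambda>h g. smul H (counit H g) h)" by simp
  show "lin T H (\<lambda>t. lift H H (\<lambda>h g. smul H (counit H g) h) (triv H t))" by simp
  show "lin T H (lift H H (mul H))" by (rule lift_mul_lin)
  fix h g assume hg: "h \<in> carrier H" "g \<in> carrier H"
  have "lift H H (\<lambda>h g. smul H (counit H g) h) (triv H (h \<otimes>\<^bsub>H,H\<^esub> g)) =
    sw (\<lambda>a b. lift H H (\<lambda>h g. smul H (counit H g) h) ((h \<cdot>\<^bsub>H\<^esub> a) \<otimes>\<^bsub>H,H\<^esub> b)) g"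
    unfolding triv_tens[OF hg] by (rule sw_linear[OF _ _ _ lin_lift[OF _ _ _ b]]) (use hg in simp_all)
  also have "\<dots> = sw (\<lambda>a b. smul H (counit H b) (h \<cdot>\<^bsub>H\<^esub> a)) g"
    by (intro sw_cong refl lift_tens_in[OF _ _ _ b]) (use hg in simp_all)
  also have "\<dots> = h \<cdot>\<^bsub>H\<^esub> g" using hg by simp
  also have "\<dots> = lift H H (mul H) (h \<otimes>\<^bsub>H,H\<^esub> g)"
    by (rule lift_tens_in[OF _ _ _ mul_bilin, symmetric]) (use hg in simp_all)
  finally show "lift H H (\<lambda>h g. smul H (counit H g) h) (triv H (h \<otimes>\<^bsub>H,H\<^esub> g)) = lift H H (mul H) (h \<otimes>\<^bsub>H,H\<^esub> g)" .
qed

lemma calc_iff: "t \<in> calc H Q \<longleftrightarrow> t \<in> carrier T \<and> triv H t \<in> tspan H H (carrier H) Q"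
  by (simp add: calc_def)

lemma trivi_in_calc:
  "Q \<subseteq> carrier H \<Longrightarrow> s \<in> tspan H H (carrier H) Q \<Longrightarrow> trivi s \<in> calc H Q"
  using tspan_subset[OF order_refl, of Q H H] by (auto simp: calc_iff)

lemma calc_mono: "Q \<subseteq> Q' \<Longrightarrow> calc H Q \<subseteq> calc H Q'"
  using tspan_mono[OF order_refl, of Q Q' H H "carrier H"] by (auto simp: calc_iff)

lemma calc_image:
  assumes "Q \<subseteq> carrier H" shows "calc H Q = trivi ` tspan H H (carrier H) Q"
  using trivi_in_calc[OF assms] by (auto simp: calc_iff image_iff) (metis trivi_triv)

text \<open>By \<open>counit_triv\<close> and the description of the kernel of
  \<open>id \<otimes> \<epsilon>\<close> as \<open>H \<otimes> ker \<epsilon>\<close>. Universal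
  forms are thus themselves of the shape \<open>calc H Q\<close>, so that facts about such subspaces
  apply to them as well.\<close>

lemma univ_eq_calc: "carrier (univ H) = calc H (aug H)"
proof -
  have "lift H H (mul H) t = 0 \<longleftrightarrow> triv H t \<in> tspan H H (carrier H) (aug H)" if t: "t \<in> carrier T" for t
  proof
    assume "lift H H (mul H) t = 0"
    then show "triv H t \<in> tspan H H (carrier H) (aug H)"
      unfolding aug_def counit_triv[OF t, symmetric]
      by (intro ker_functional_tens'[OF _ _ counit_lin unit_mem]) (use t in simp_all)
  next
    assume "triv H t \<in> tspan H H (carrier H) (aug H)"
    then show "lift H H (mul H) t = 0"
      unfolding counit_triv[OF t, symmetric]
      by (intro lift_eq_0[where U = H and V = H and W = H]) (auto simp: aug_def vspace_smul)
  qed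
  then show ?thesis by (auto simp: calc_iff carrier_univ)
qed

lemma univ_T: "t \<in> carrier (univ H) \<Longrightarrow> t \<in> carrier T"
  by (simp add: carrier_univ)

lemma subsp_calc:
  assumes "subsp H Q" shows "subsp T (calc H Q)"
proof -
  have "Q \<subseteq> carrier H" using assms by (simp add: subsp_def)
  then have "subsp T (tspan H H (carrier H) Q)" by simp
  then show ?thesis
    using linD(2)[OF triv_lin] linD(3)[OF triv_lin, simplified] lin_0[OF triv_lin] by (auto simp: subsp_iff calc_iff)
qed

lemma lact_univ_tens [simp]:
  "a \<in> carrier H \<Longrightarrow> x \<in> carrier H \<Longrightarrow> y \<in> carrier H \<Longrightarrow> lact (univ H) a (x \<otimes>\<^bsub>H,H\<^esub> y) = ((a \<cdot>\<^bsub>H\<^esub> x) \<otimes>\<^bsub>H,H\<^esub> y)"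
  by (simp add: univ_def)

lemma ract_univ_tens [simp]:
  "a \<in> carrier H \<Longrightarrow> x \<in> carrier H \<Longrightarrow> y \<in> carrier H \<Longrightarrow> ract (univ H) (x \<otimes>\<^bsub>H,H\<^esub> y) a = (x \<otimes>\<^bsub>H,H\<^esub> (y \<cdot>\<^bsub>H\<^esub> a))"
  by (simp add: univ_def)

lemma lact_T_bilin: "bilin H T T (lact (univ H))"
  by (simp add: univ_def)

lemma ract_T_bilin: "bilin T H T (ract (univ H))"
  by (simp add: univ_def)

lemma act_T_mem [simp]:
  "a \<in> carrier H \<Longrightarrow> t \<in> carrier T \<Longrightarrow> lact (univ H) a t \<in> carrier T"
  "a \<in> carrier H \<Longrightarrow> t \<in> carrier T \<Longrightarrow> ract (univ H) t a \<in> carrier T"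
  using bilin_mem[OF lact_T_bilin] bilin_mem[OF ract_T_bilin] by auto

lemma lin_lact_T [simp]:
  "lin X H f \<Longrightarrow> t \<in> carrier T \<Longrightarrow> smul U = fsmul \<Longrightarrow> carrier T \<subseteq> carrier U \<Longrightarrow> lin X U (\<lambda>x. lact (univ H) (f x) t)"
  by (rule lin_bilin1[OF lact_T_bilin]) simp_all

lemma lin_lact_T' [simp]:
  "lin X T f \<Longrightarrow> a \<in> carrier H \<Longrightarrow> smul U = fsmul \<Longrightarrow> carrier T \<subseteq> carrier U \<Longrightarrow> lin X U (\<lambda>x. lact (univ H) a (f x))"
  by (rule lin_bilin2[OF lact_T_bilin]) simp_all

lemma lin_ract_T [simp]:
  "lin X H f \<Longrightarrow> t \<in> carrier T \<Longrightarrow> smul U = fsmul \<Longrightarrow> carrier T \<subseteq> carrier U \<Longrightarrow> lin X U (\<lambda>x. ract (univ H) t (f x))"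
  by (rule lin_bilin2[OF ract_T_bilin]) simp_all

lemma lin_ract_T' [simp]:
  "lin X T f \<Longrightarrow> a \<in> carrier H \<Longrightarrow> smul U = fsmul \<Longrightarrow> carrier T \<subseteq> carrier U \<Longrightarrow> lin X U (\<lambda>x. ract (univ H) (f x) a)"
  by (rule lin_bilin1[OF ract_T_bilin]) simp_all

lemma lact_sw: "bilin H H T F \<Longrightarrow> h \<in> carrier H \<Longrightarrow> a \<in> carrier H \<Longrightarrow>
    lact (univ H) a (sw F h) = sw (\<lambda>x y. lact (univ H) a (F x y)) h"
  by (rule sw_linear[OF _ _ _ bilinD(1)[OF lact_T_bilin]]) simp_all

lemma triv_lact:
  assumes "a \<in> carrier H" "t \<in> carrier T"
  shows "triv H (lact (univ H) a t) = lact (univ H) a (triv H t)"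
  by (rule tprod_eqI[where f = "\<lambda>t. triv H (lact (univ H) a t)" and U = fspace and U' = fspace, OF vspace_alg _ _ _ assms(2)])
    (use assms in \<open>simp_all add: triv_tens lact_sw mul_assoc\<close>)

text \<open>The coproduct is multiplicative, so \<open>h (g a)\<^sub>1 \<otimes> (g a)\<^sub>2 = h
  g\<^sub>1 a\<^sub>1 \<otimes> g\<^sub>2 a\<^sub>2\<close>: in the trivialisation the right action
  is diagonal.\<close>

lemma triv_ract:
  assumes a: "a \<in> carrier H" and t: "t \<in> carrier T"
  shows "triv H (ract (univ H) t a) =
    lift H H (\<lambda>x y. sw (\<lambda>a1 a2. (x \<cdot>\<^bsub>H\<^esub> a1) \<otimes>\<^bsub>H,H\<^esub> (y \<cdot>\<^bsub>H\<^esub> a2)) a) (triv H t)"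
  by (rule tprod_eqI[where f = "\<lambda>t. triv H (ract (univ H) t a)" and U = fspace and U' = fspace, OF vspace_alg _ _ _ t])
    (use a in \<open>simp_all add: triv_tens mul_assoc\<close>)

lemma trivi_ract:
  assumes "a \<in> carrier H" "h \<in> carrier H" "g \<in> carrier H"
  shows "ract (univ H) (trivi (h \<otimes>\<^bsub>H,H\<^esub> g)) a = sw (\<lambda>a1 a2. trivi ((h \<cdot>\<^bsub>H\<^esub> a1) \<otimes>\<^bsub>H,H\<^esub> (g \<cdot>\<^bsub>H\<^esub> a2))) a"
proof -
  have "ract (univ H) (trivi (h \<otimes>\<^bsub>H,H\<^esub> g)) a = trivi (triv H (ract (univ H) (trivi (h \<otimes>\<^bsub>H,H\<^esub> g)) a))"
    using assms by simp
  also have "\<dots> = trivi (sw (\<lambda>a1 a2. (h \<cdot>\<^bsub>H\<^esub> a1) \<otimes>\<^bsub>H,H\<^esub> (g \<cdot>\<^bsub>H\<^esub> a2)) a)"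
    using assms by (subst triv_ract) simp_all
  also have "\<dots> = sw (\<lambda>a1 a2. trivi ((h \<cdot>\<^bsub>H\<^esub> a1) \<otimes>\<^bsub>H,H\<^esub> (g \<cdot>\<^bsub>H\<^esub> a2))) a"
    using assms by (intro trivi_sw) simp_all
  finally show ?thesis .
qed

lemma trivi_lact:
  assumes "a \<in> carrier H" "h \<in> carrier H" "g \<in> carrier H"
  shows "lact (univ H) a (trivi (h \<otimes>\<^bsub>H,H\<^esub> g)) = trivi ((a \<cdot>\<^bsub>H\<^esub> h) \<otimes>\<^bsub>H,H\<^esub> g)"
  using assms by (simp add: trivi_tens lact_sw mul_assoc)

section \<open>The adjoint coaction and the coactions on the tensor square\<close>

lemma Ad_lin: "lin H T (Ad H)"
  unfolding Ad_def sw3_def by simp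

lemma lin_Ad [simp]: "lin X H f \<Longrightarrow> smul U = fsmul \<Longrightarrow> carrier T \<subseteq> carrier U \<Longrightarrow> lin X U (\<lambda>x. Ad H (f x))"
  by (rule lin_compose_widen[OF Ad_lin]) simp_all

lemma Ad_mem [simp]: "h \<in> carrier H \<Longrightarrow> Ad H h \<in> carrier T"
  by (rule linD(1)[OF Ad_lin])

lemma Ad_sw: "h \<in> carrier H \<Longrightarrow> Ad H h = sw (\<lambda>a y. sw (\<lambda>b c. b \<otimes>\<^bsub>H,H\<^esub> (antip H a \<cdot>\<^bsub>H\<^esub> c)) y) h"
  by (simp add: Ad_def sw3_def)

lemma lcoact_lin: "lin T (tprod H T) (lcoact H)"
  unfolding lcoact_def tens_univ by (rule lin_lift) simp_all

lemma rcoact_lin: "lin T (tprod T H) (rcoact H)"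
  unfolding rcoact_def tens_univ by (rule lin_lift) simp_all

lemma coact_mem [simp]:
  "t \<in> carrier T \<Longrightarrow> lcoact H t \<in> carrier (tprod H T)" "t \<in> carrier T \<Longrightarrow> rcoact H t \<in> carrier (tprod T H)"
  using linD(1)[OF lcoact_lin] linD(1)[OF rcoact_lin] by auto

lemma lin_lcoact [simp]:
  "lin X T f \<Longrightarrow> smul U = fsmul \<Longrightarrow> carrier (tprod H T) \<subseteq> carrier U \<Longrightarrow> lin X U (\<lambda>x. lcoact H (f x))"
  by (rule lin_compose_widen[OF lcoact_lin]) simp_all

lemma lin_rcoact [simp]:
  "lin X T f \<Longrightarrow> smul U = fsmul \<Longrightarrow> carrier (tprod T H) \<subseteq> carrier U \<Longrightarrow> lin X U (\<lambda>x. rcoact H (f x))"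
  by (rule lin_compose_widen[OF rcoact_lin]) simp_all

lemma lcoact_tens: "h \<in> carrier H \<Longrightarrow> g \<in> carrier H \<Longrightarrow>
    lcoact H (h \<otimes>\<^bsub>H,H\<^esub> g) = sw (\<lambda>a1 a2. sw (\<lambda>b1 b2. (a1 \<cdot>\<^bsub>H\<^esub> b1) \<otimes>\<^bsub>H,T\<^esub> (a2 \<otimes>\<^bsub>H,H\<^esub> b2)) g) h"
  by (simp add: lcoact_def)

lemma rcoact_tens: "h \<in> carrier H \<Longrightarrow> g \<in> carrier H \<Longrightarrow>
    rcoact H (h \<otimes>\<^bsub>H,H\<^esub> g) = sw (\<lambda>a1 a2. sw (\<lambda>b1 b2. (a1 \<otimes>\<^bsub>H,H\<^esub> b1) \<otimes>\<^bsub>T,H\<^esub> (a2 \<cdot>\<^bsub>H\<^esub> b2)) g) h"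
  by (simp add: rcoact_def)

text \<open>In the trivialisation the left coaction is the coproduct of the first factor, and the
  second factor is invariant. The identity is proved for \<open>triv\<close>, which contains no
  antipode, and then inverted.\<close>

lemma lcoact_trivi:
  assumes hg: "h \<in> carrier H" "g \<in> carrier H"
  shows "lcoact H (trivi (h \<otimes>\<^bsub>H,H\<^esub> g)) = sw (\<lambda>h1 h2. h1 \<otimes>\<^bsub>H,T\<^esub> trivi (h2 \<otimes>\<^bsub>H,H\<^esub> g)) h"
proof -
  let ?tr = "lift H T (\<lambda>x s. x \<otimes>\<^bsub>H,T\<^esub> triv H s)" and ?tri = "lift H T (\<lambda>x s. x \<otimes>\<^bsub>H,T\<^esub> trivi s)"
    and ?R = "lift H H (\<lambda>u v. sw (\<lambda>u1 u2. u1 \<otimes>\<^bsub>H,T\<^esub> (u2 \<otimes>\<^bsub>H,H\<^esub> v)) u)"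
  have 1: "?tr (lcoact H t) = ?R (triv H t)" if t: "t \<in> carrier T" for t
  proof (rule tprod_eqI[where f = "\<lambda>t. ?tr (lcoact H t)" and U = fspace and U' = fspace, OF vspace_alg _ _ _ t])
    fix h g assume hg: "h \<in> carrier H" "g \<in> carrier H"
    have "?R (triv H (h \<otimes>\<^bsub>H,H\<^esub> g)) =
      sw (\<lambda>g1 g2. sw (\<lambda>h1 h2. sw (\<lambda>c d. (h1 \<cdot>\<^bsub>H\<^esub> c) \<otimes>\<^bsub>H,T\<^esub> ((h2 \<cdot>\<^bsub>H\<^esub> d) \<otimes>\<^bsub>H,H\<^esub> g2)) g1) h) g"
      using hg by (simp add: triv_tens)
    also have "\<dots> = sw (\<lambda>h1 h2. sw (\<lambda>g1 g2. sw (\<lambda>c d. (h1 \<cdot>\<^bsub>H\<^esub> c) \<otimes>\<^bsub>H,T\<^esub> ((h2 \<cdot>\<^bsub>H\<^esub> d) \<otimes>\<^bsub>H,H\<^esub> g2)) g1) g) h"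
      by (rule sw_swap[of fspace]) (use hg in simp_all)
    also have "\<dots> = ?tr (lcoact H (h \<otimes>\<^bsub>H,H\<^esub> g))"
      using hg by (simp add: triv_tens lcoact_tens)
    finally show "?tr (lcoact H (h \<otimes>\<^bsub>H,H\<^esub> g)) = ?R (triv H (h \<otimes>\<^bsub>H,H\<^esub> g))" ..
  qed simp_all
  have 2: "?tri (?tr s) = s" if s: "s \<in> carrier (tprod H T)" for s
    by (rule tprod_eqI[where f = "\<lambda>s. ?tri (?tr s)" and g = "\<lambda>s. s" and U = fspace and U' = fspace, OF vspace_alg _ _ _ s])
      simp_all
  have "lcoact H (trivi (h \<otimes>\<^bsub>H,H\<^esub> g)) = ?tri (?R (h \<otimes>\<^bsub>H,H\<^esub> g))"
    using 1[of "trivi (h \<otimes>\<^bsub>H,H\<^esub> g)"] 2[of "lcoact H (trivi (h \<otimes>\<^bsub>H,H\<^esub> g))"] hg by simp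
  also have "\<dots> = sw (\<lambda>h1 h2. h1 \<otimes>\<^bsub>H,T\<^esub> trivi (h2 \<otimes>\<^bsub>H,H\<^esub> g)) h"
    using hg by simp
  finally show ?thesis .
qed

text \<open>In the trivialisation the right coaction combines the coproduct on the first factor with
  \<open>Ad\<close> on the second. Again the identity is proved for \<open>triv\<close> and then
  inverted; the only antipode to be dealt with is then the one inside \<open>Ad\<close>.\<close>

lemma rcoact_trivi:
  assumes hg: "h \<in> carrier H" "g \<in> carrier H"
  shows "rcoact H (trivi (h \<otimes>\<^bsub>H,H\<^esub> g)) =
    sw (\<lambda>h1 h2. lift H H (\<lambda>b y. trivi (h1 \<otimes>\<^bsub>H,H\<^esub> b) \<otimes>\<^bsub>T,H\<^esub> (h2 \<cdot>\<^bsub>H\<^esub> y)) (Ad H g)) h"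
proof -
  let ?tr = "lift T H (\<lambda>s x. triv H s \<otimes>\<^bsub>T,H\<^esub> x)" and ?tri = "lift T H (\<lambda>s x. trivi s \<otimes>\<^bsub>T,H\<^esub> x)"
    and ?R = "lift H H (\<lambda>u v. sw (\<lambda>u1 u2. lift H H (\<lambda>b y. (u1 \<otimes>\<^bsub>H,H\<^esub> b) \<otimes>\<^bsub>T,H\<^esub> (u2 \<cdot>\<^bsub>H\<^esub> y)) (Ad H v)) u)"
  have 1: "?tr (rcoact H t) = ?R (triv H t)" if t: "t \<in> carrier T" for t
  proof (rule tprod_eqI[where f = "\<lambda>t. ?tr (rcoact H t)" and U = fspace and U' = fspace, OF vspace_alg _ _ _ t])
    fix h g assume hg: "h \<in> carrier H" "g \<in> carrier H"
    let ?G = "\<lambda>h1 h2 c1 u y. sw (\<lambda>b e. ((h1 \<cdot>\<^bsub>H\<^esub> c1) \<otimes>\<^bsub>H,H\<^esub> b) \<otimes>\<^bsub>T,H\<^esub> (h2 \<cdot>\<^bsub>H\<^esub> (u \<cdot>\<^bsub>H\<^esub> e))) y"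
    have "?R (triv H (h \<otimes>\<^bsub>H,H\<^esub> g)) =
      sw (\<lambda>c v. sw (\<lambda>h1 h2. sw (\<lambda>c1 c2. sw (\<lambda>a y. ?G h1 h2 c1 (c2 \<cdot>\<^bsub>H\<^esub> antip H a) y) v) c) h) g"
      using hg by (simp add: triv_tens Ad_sw mul_assoc)
    also have "\<dots> = sw (\<lambda>h1 h2. sw (\<lambda>c v. sw (\<lambda>c1 c2. sw (\<lambda>a y. ?G h1 h2 c1 (c2 \<cdot>\<^bsub>H\<^esub> antip H a) y) v) c) g) h"
      by (rule sw_swap[of fspace]) (use hg in simp_all)
    also have "\<dots> = sw (\<lambda>h1 h2. sw (\<lambda>c1 z. sw (\<lambda>c2 v. sw (\<lambda>a y. ?G h1 h2 c1 (c2 \<cdot>\<^bsub>H\<^esub> antip H a) y) v) z) g) h"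
      using hg by simp
    also have "\<dots> = sw (\<lambda>h1 h2. sw (\<lambda>c1 z. ?G h1 h2 c1 \<one>\<^bsub>H\<^esub> z) g) h"
      \<comment> \<open>The leg \<open>c2\<close> produced by \<open>triv\<close> meets the antipode
        of \<open>Ad\<close>; their cancellation leaves the right coaction of
        \<open>h \<otimes> g\<close>.\<close>
      by (intro sw_cong refl cancel_antip(2)[where G = "?G _ _ _"]) (use hg in simp_all)
    also have "\<dots> = ?tr (rcoact H (h \<otimes>\<^bsub>H,H\<^esub> g))"
      using hg by (simp add: triv_tens rcoact_tens)
    finally show "?tr (rcoact H (h \<otimes>\<^bsub>H,H\<^esub> g)) = ?R (triv H (h \<otimes>\<^bsub>H,H\<^esub> g))" ..
  qed simp_all
  have 2: "?tri (?tr s) = s" if s: "s \<in> carrier (tprod T H)" for s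
    by (rule tprod_eqI[where f = "\<lambda>s. ?tri (?tr s)" and g = "\<lambda>s. s" and U = fspace and U' = fspace, OF vspace_tprod _ _ _ s])
      simp_all
  have "rcoact H (trivi (h \<otimes>\<^bsub>H,H\<^esub> g)) = ?tri (?R (h \<otimes>\<^bsub>H,H\<^esub> g))"
    using 1[of "trivi (h \<otimes>\<^bsub>H,H\<^esub> g)"] 2[of "rcoact H (trivi (h \<otimes>\<^bsub>H,H\<^esub> g))"] hg by simp
  also have "\<dots> = sw (\<lambda>h1 h2. lift H H (\<lambda>b y. trivi (h1 \<otimes>\<^bsub>H,H\<^esub> b) \<otimes>\<^bsub>T,H\<^esub> (h2 \<cdot>\<^bsub>H\<^esub> y)) (Ad H g)) h"
    using hg by simp
  finally show ?thesis .
qed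

lemma sw_in_subsp:
  assumes "vspace U" "bilin H H U F" "h \<in> carrier H" "subsp U S"
    and "\<And>a b. a \<in> carrier H \<Longrightarrow> b \<in> carrier H \<Longrightarrow> F a b \<in> S"
  shows "sw F h \<in> S"
  unfolding sw2_def
  by (rule lift_in_subsp[where U = U and A = "carrier H" and B = "carrier H"]) (use assms in \<open>auto simp: tspan_carrier\<close>)

end

section \<open>The calculus of an Ad-stable right ideal\<close>

locale calculus = hopf_alg H for H :: "('k::field, 'a::ab_group_add) hopf" +
  fixes Q :: "'a set"
  assumes ad_ideal: "ad_ideal H Q"
begin

lemma subsp_Q [simp]: "subsp H Q"
  using ad_ideal by (simp add: ad_ideal_def)

lemma Q_aug: "q \<in> Q \<Longrightarrow> q \<in> aug H"
  using ad_ideal by (auto simp: ad_ideal_def)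

lemma Q_mem [simp]: "q \<in> Q \<Longrightarrow> q \<in> carrier H"
  using Q_aug aug_subset by auto

lemma Q_sub [simp]: "Q \<subseteq> carrier H"
  by auto

lemma Q_counit [simp]: "q \<in> Q \<Longrightarrow> counit H q = 0"
  using Q_aug by (auto simp: aug_def)

lemma Q_mult [simp]: "q \<in> Q \<Longrightarrow> h \<in> carrier H \<Longrightarrow> q \<cdot>\<^bsub>H\<^esub> h \<in> Q"
  using ad_ideal by (auto simp: ad_ideal_def)

lemma Q_Ad: "q \<in> Q \<Longrightarrow> Ad H q \<in> tspan H H Q (carrier H)"
  using ad_ideal by (auto simp: ad_ideal_def)

abbreviation N :: "('k, 'a, 'a) ten set" where
  "N \<equiv> calc H Q"

lemma N_univ: "N \<subseteq> carrier (univ H)"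
  unfolding univ_eq_calc by (rule calc_mono) (use Q_aug in auto)

lemma N_T: "t \<in> N \<Longrightarrow> t \<in> carrier T"
  by (simp add: calc_iff)

lemma subsp_N_T: "subsp T N"
  by (rule subsp_calc) simp

lemma subsp_N [simp]: "subsp (univ H) N"
  using N_univ subsp_N_T by (auto simp: subsp_def)

text \<open>On \<open>H \<otimes> Q\<close> the left action touches the first factor only. The right
  action is diagonal and preserves this subspace because \<open>Q\<close> is a right ideal.\<close>

lemma N_act [simp]:
  assumes "n \<in> N" "a \<in> carrier H"
  shows "lact (univ H) a n \<in> N" "ract (univ H) n a \<in> N"
proof -
  let ?S = "tspan H H (carrier H) Q"
  have S: "subsp T ?S" by (rule subsp_tspan) simp_all
  have n: "n \<in> carrier T" "triv H n \<in> ?S" using assms(1) by (auto simp: calc_iff)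
  have "lact (univ H) a (triv H n) \<in> ?S"
    by (rule lin_tspan_in[OF vspace_alg bilinD(1)[OF lact_T_bilin] _ _ n(2) _ S]) (use assms in auto)
  then show "lact (univ H) a n \<in> N" using n assms by (simp add: calc_iff triv_lact)
  have "lift H H (\<lambda>x y. sw (\<lambda>a1 a2. (x \<cdot>\<^bsub>H\<^esub> a1) \<otimes>\<^bsub>H,H\<^esub> (y \<cdot>\<^bsub>H\<^esub> a2)) a) (triv H n) \<in> ?S"
    by (rule lift_in_subsp[OF _ _ _ _ _ _ n(2) S]) (use assms in \<open>auto intro!: sw_in_subsp[OF _ _ _ S]\<close>)
  then show "ract (univ H) n a \<in> N" using n assms by (simp add: calc_iff triv_ract)
qed

lemma lcoact_N:
  assumes "n \<in> N" shows "lcoact H n \<in> tspan H T (carrier H) N"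
proof -
  let ?S = "tspan H T (carrier H) N"
  have S: "subsp (tprod H T) ?S" by (rule subsp_tspan) (auto simp: N_T)
  have n: "n \<in> carrier T" "triv H n \<in> tspan H H (carrier H) Q" using assms by (auto simp: calc_iff)
  have "lcoact H (trivi (triv H n)) \<in> ?S"
    by (rule lin_tspan_in[OF vspace_alg lin_compose[OF lcoact_lin trivi_lin] _ _ n(2) _ S])
      (auto simp: lcoact_trivi intro!: sw_in_subsp[OF _ _ _ S] tens_in_tspan trivi_in_calc)
  then show ?thesis using n by simp
qed

text \<open>By \<open>rcoact_trivi\<close> the coaction acts on the factor \<open>Q\<close> through
  \<open>Ad\<close>, so this is the Ad-stability of \<open>Q\<close>. For the left coaction any
  subspace \<open>Q\<close> would be carried along unchanged.\<close>

lemma rcoact_N: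
  assumes "n \<in> N" shows "rcoact H n \<in> tspan T H N (carrier H)"
proof -
  let ?S = "tspan T H N (carrier H)"
  have S: "subsp (tprod T H) ?S" by (rule subsp_tspan) (auto simp: N_T)
  have n: "n \<in> carrier T" "triv H n \<in> tspan H H (carrier H) Q" using assms by (auto simp: calc_iff)
  have *: "lift H H (\<lambda>b y. trivi (h1 \<otimes>\<^bsub>H,H\<^esub> b) \<otimes>\<^bsub>T,H\<^esub> (h2 \<cdot>\<^bsub>H\<^esub> y)) (Ad H q) \<in> ?S"
    if "h1 \<in> carrier H" "h2 \<in> carrier H" "q \<in> Q" for h1 h2 q
    by (rule lift_in_subsp[OF _ _ _ _ _ _ Q_Ad S])
      (use that in \<open>auto intro!: tens_in_tspan trivi_in_calc\<close>)
  have "rcoact H (trivi (triv H n)) \<in> ?S"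
    by (rule lin_tspan_in[OF vspace_alg lin_compose[OF rcoact_lin trivi_lin] _ _ n(2) _ S])
      (auto simp: rcoact_trivi intro!: sw_in_subsp[OF _ _ _ S] *)
  then show ?thesis using n by simp
qed

lemma bicovariant_calc: "bicovariant H N"
proof -
  have e: "tspan H (univ H) = tspan H T" "tspan (univ H) H = tspan T H"
    by (rule tspan_space_cong; simp)+
  show ?thesis
    unfolding bicovariant_def sub_bimodule_def e by (auto simp: lcoact_N rcoact_N)
qed

end

subsection \<open>Bimodules and balanced tensor products\<close>

declare plus_fun_apply [simp del] zero_fun_apply [simp del] minus_apply [simp del] uminus_apply [simp del]

definition bimodule :: "('k::field, 'a::ab_group_add, 'x) alg_scheme \<Rightarrow> ('k, 'a, 'v::ab_group_add, 'y) bimod_scheme \<Rightarrow> bool" where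
  "bimodule A B \<longleftrightarrow> vspace B \<and> bilin A B B (lact B) \<and> bilin B A B (ract B) \<and>
     (\<forall>a\<in>carrier A. \<forall>b\<in>carrier A. \<forall>v\<in>carrier B.
        lact B (a \<cdot>\<^bsub>A\<^esub> b) v = lact B a (lact B b v) \<and> ract B v (a \<cdot>\<^bsub>A\<^esub> b) = ract B (ract B v a) b \<and>
        ract B (lact B a v) b = lact B a (ract B v b)) \<and>
     (\<forall>v\<in>carrier B. lact B \<one>\<^bsub>A\<^esub> v = v \<and> ract B v \<one>\<^bsub>A\<^esub> = v)"

text \<open>The common shape of \<open>forms1\<close> and \<open>forms2\<close>: the quotient of a
  bimodule by a sub-bimodule. The bimodule axioms are proved once for it and used in both
  degrees.\<close>

definition quot_bimod :: "('k::field, 'a::ab_group_add, 'v::ab_group_add, 'y) bimod_scheme \<Rightarrow> 'v set \<Rightarrow>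
    ('k, 'a, ('k, 'v) quo) bimod" where
  "quot_bimod V N =
     \<lparr>carrier = carrier (quot V N), smul = fsmul,
      lact = (\<lambda>a. descend V N (\<lambda>t. proj V N (lact V a t))),
      ract = (\<lambda>x a. descend V N (\<lambda>t. proj V N (ract V t a)) x)\<rparr>"

lemma forms1_quot: "forms1 A N = quot_bimod (univ A) N"
  by (simp add: forms1_def quot_bimod_def)

lemma forms2_quot: "forms2 H N = quot_bimod (balprod H (forms1 H N)) (braid_ker H N)"
  by (simp add: forms2_def quot_bimod_def Let_def)

lemma quot_bimod_simps: "smul (quot_bimod V N) = fsmul" "carrier (quot_bimod V N) = proj V N ` carrier V"
  by (simp_all add: quot_bimod_def carrier_quot)

lemma vspace_quot_bimod:
  assumes "vspace V" shows "vspace (quot_bimod V N)"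
  using vspace_quot[OF assms, of N] by (simp add: vspace_def quot_bimod_def)

locale bimod = algebra_on A for A :: "('k::field, 'a::ab_group_add, 'z) alg_scheme" +
  fixes B :: "('k, 'a, 'v::ab_group_add, 'y) bimod_scheme"
  assumes bimodule: "bimodule A B"
begin

lemma vspace_B [simp]: "vspace B"
  using bimodule by (simp add: bimodule_def)

lemma lact_bilin: "bilin A B B (lact B)" and ract_bilin: "bilin B A B (ract B)"
  using bimodule by (simp_all add: bimodule_def)

lemma act_mem [simp]:
  "a \<in> carrier A \<Longrightarrow> v \<in> carrier B \<Longrightarrow> lact B a v \<in> carrier B"
  "a \<in> carrier A \<Longrightarrow> v \<in> carrier B \<Longrightarrow> ract B v a \<in> carrier B"
  using bilin_mem[OF lact_bilin] bilin_mem[OF ract_bilin] by auto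

lemma act_simps:
  "a \<in> carrier A \<Longrightarrow> b \<in> carrier A \<Longrightarrow> v \<in> carrier B \<Longrightarrow> lact B (a \<cdot>\<^bsub>A\<^esub> b) v = lact B a (lact B b v)"
  "a \<in> carrier A \<Longrightarrow> b \<in> carrier A \<Longrightarrow> v \<in> carrier B \<Longrightarrow> ract B v (a \<cdot>\<^bsub>A\<^esub> b) = ract B (ract B v a) b"
  "a \<in> carrier A \<Longrightarrow> b \<in> carrier A \<Longrightarrow> v \<in> carrier B \<Longrightarrow> ract B (lact B a v) b = lact B a (ract B v b)"
  using bimodule by (simp_all add: bimodule_def)

lemma act_unit [simp]: "v \<in> carrier B \<Longrightarrow> lact B \<one>\<^bsub>A\<^esub> v = v" "v \<in> carrier B \<Longrightarrow> ract B v \<one>\<^bsub>A\<^esub> = v"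
  using bimodule by (simp_all add: bimodule_def)

lemma lin_lact1 [simp]:
  "lin X A f \<Longrightarrow> v \<in> carrier B \<Longrightarrow> smul U = smul B \<Longrightarrow> carrier B \<subseteq> carrier U \<Longrightarrow> lin X U (\<lambda>x. lact B (f x) v)"
  by (rule lin_bilin1[OF lact_bilin]) simp_all

lemma lin_lact2 [simp]:
  "lin X B f \<Longrightarrow> a \<in> carrier A \<Longrightarrow> smul U = smul B \<Longrightarrow> carrier B \<subseteq> carrier U \<Longrightarrow> lin X U (\<lambda>x. lact B a (f x))"
  by (rule lin_bilin2[OF lact_bilin]) simp_all

lemma lin_ract1 [simp]:
  "lin X B f \<Longrightarrow> a \<in> carrier A \<Longrightarrow> smul U = smul B \<Longrightarrow> carrier B \<subseteq> carrier U \<Longrightarrow> lin X U (\<lambda>x. ract B (f x) a)"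
  by (rule lin_bilin1[OF ract_bilin]) simp_all

lemma lin_ract2 [simp]:
  "lin X A f \<Longrightarrow> v \<in> carrier B \<Longrightarrow> smul U = smul B \<Longrightarrow> carrier B \<subseteq> carrier U \<Longrightarrow> lin X U (\<lambda>x. ract B v (f x))"
  by (rule lin_bilin2[OF ract_bilin]) simp_all

context
  fixes N
  assumes N: "subsp B N"
    and closed: "\<And>a n. a \<in> carrier A \<Longrightarrow> n \<in> N \<Longrightarrow> lact B a n \<in> N" "\<And>a n. a \<in> carrier A \<Longrightarrow> n \<in> N \<Longrightarrow> ract B n a \<in> N"
begin

lemma quot_lact_lin:
  assumes a: "a \<in> carrier A"
  shows "v \<in> carrier B \<Longrightarrow> lact (quot_bimod B N) a (proj B N v) = proj B N (lact B a v)"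
    "lin (quot B N) (quot B N) (lact (quot_bimod B N) a)"
proof -
  note d = descend_lin[where V = B and U = "quot B N" and f = "\<lambda>t. proj B N (lact B a t)", OF vspace_B N]
  show "v \<in> carrier B \<Longrightarrow> lact (quot_bimod B N) a (proj B N v) = proj B N (lact B a v)"
    unfolding quot_bimod_def bimod.simps by (rule d(1)) (use a closed in \<open>simp_all add: proj_eq_0[OF vspace_B N]\<close>)
  show "lin (quot B N) (quot B N) (lact (quot_bimod B N) a)"
    unfolding quot_bimod_def bimod.simps by (rule d(2)) (use a closed in \<open>simp_all add: proj_eq_0[OF vspace_B N]\<close>)
qed

lemma quot_ract_lin:
  assumes a: "a \<in> carrier A"
  shows "v \<in> carrier B \<Longrightarrow> ract (quot_bimod B N) (proj B N v) a = proj B N (ract B v a)"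
    "lin (quot B N) (quot B N) (\<lambda>x. ract (quot_bimod B N) x a)"
proof -
  note d = descend_lin[where V = B and U = "quot B N" and f = "\<lambda>t. proj B N (ract B t a)", OF vspace_B N]
  show "v \<in> carrier B \<Longrightarrow> ract (quot_bimod B N) (proj B N v) a = proj B N (ract B v a)"
    unfolding quot_bimod_def bimod.simps by (rule d(1)) (use a closed in \<open>simp_all add: proj_eq_0[OF vspace_B N]\<close>)
  show "lin (quot B N) (quot B N) (\<lambda>x. ract (quot_bimod B N) x a)"
    unfolding quot_bimod_def bimod.simps by (rule d(2)) (use a closed in \<open>simp_all add: proj_eq_0[OF vspace_B N]\<close>)
qed

lemma quot_bimodule: "bimodule A (quot_bimod B N)"
proof -
  let ?q = "quot_bimod B N"
  have c: "carrier ?q = carrier (quot B N)" "smul ?q = smul (quot B N)" by (simp_all add: quot_bimod_def)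
  have "lin ?q ?q (lact ?q a)" "lin ?q ?q (\<lambda>x. ract ?q x a)" if "a \<in> carrier A" for a
    using quot_lact_lin(2)[OF that] quot_ract_lin(2)[OF that] by (simp_all add: lin_def c)
  moreover have "lin A ?q (\<lambda>a. lact ?q a x)" "lin A ?q (\<lambda>a. ract ?q x a)" if x: "x \<in> carrier ?q" for x
  proof -
    obtain v where v: "v \<in> carrier B" "x = proj B N v" using x unfolding quot_bimod_simps by blast
    have "lin A ?q (\<lambda>a. proj B N (lact B a v))" "lin A ?q (\<lambda>a. proj B N (ract B v a))"
      using v by (simp_all add: c quot_bimod_simps(1))
    then show "lin A ?q (\<lambda>a. lact ?q a x)" "lin A ?q (\<lambda>a. ract ?q x a)"
      using v by (simp_all add: lin_def quot_lact_lin quot_ract_lin)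
  qed
  ultimately show ?thesis
    unfolding bimodule_def
    by (auto simp: vspace_quot_bimod) (auto simp: quot_bimod_simps quot_lact_lin quot_ract_lin act_simps)
qed

end

section \<open>The tensor square over the algebra\<close>

definition bt :: "'v \<Rightarrow> 'v \<Rightarrow> ('k, ('k, 'v, 'v) ten) quo" where
  "bt = baltens A B"

abbreviation BB :: "('k, 'a, ('k, ('k, 'v, 'v) ten) quo) bimod" where
  "BB \<equiv> balprod A B"

abbreviation R :: "('k, 'v, 'v) ten set" where
  "R \<equiv> bal_rel A B"

lemma smul_BB [simp]: "smul BB = fsmul"
  by (simp add: balprod_def)

lemma carrier_BB: "carrier BB = carrier (quot (tprod B B) R)"
  by (simp add: balprod_def)

lemma vspace_BB [simp]: "vspace BB"
  using vspace_quot[OF vspace_tprod, of B B R] by (simp add: vspace_def carrier_BB)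

lemma subsp_R: "subsp (tprod B B) R"
proof -
  have "{(ract B v a \<otimes>\<^bsub>B,B\<^esub> w) - (v \<otimes>\<^bsub>B,B\<^esub> lact B a w) | v a w. v \<in> carrier B \<and> a \<in> carrier A \<and> w \<in> carrier B}
    \<subseteq> carrier (tprod B B)" by auto
  then have "R \<subseteq> carrier (tprod B B)"
    unfolding bal_rel_def by (rule fs.span_minimal) (use vspace_tprod[of B B] in \<open>simp add: vspace_def\<close>)
  then show ?thesis by (simp add: subsp_def bal_rel_def)
qed

lemma bt_bilin: "bilin B B BB bt"
  by (simp add: bt_def baltens_def carrier_BB)

lemma bt_mem [simp]: "v \<in> carrier B \<Longrightarrow> w \<in> carrier B \<Longrightarrow> bt v w \<in> carrier BB"
  using bilin_mem[OF bt_bilin] by simp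

lemma lin_bt1 [simp]:
  "lin X B f \<Longrightarrow> w \<in> carrier B \<Longrightarrow> smul U = fsmul \<Longrightarrow> carrier BB \<subseteq> carrier U \<Longrightarrow> lin X U (\<lambda>x. bt (f x) w)"
  by (rule lin_bilin1[OF bt_bilin]) simp_all

lemma lin_bt2 [simp]:
  "lin X B f \<Longrightarrow> v \<in> carrier B \<Longrightarrow> smul U = fsmul \<Longrightarrow> carrier BB \<subseteq> carrier U \<Longrightarrow> lin X U (\<lambda>x. bt v (f x))"
  by (rule lin_bilin2[OF bt_bilin]) simp_all

lemma bt_balanced:
  "v \<in> carrier B \<Longrightarrow> a \<in> carrier A \<Longrightarrow> w \<in> carrier B \<Longrightarrow> bt (ract B v a) w = bt v (lact B a w)"
proof -
  assume "v \<in> carrier B" "a \<in> carrier A" "w \<in> carrier B"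
  then have "(ract B v a \<otimes>\<^bsub>B,B\<^esub> w) - (v \<otimes>\<^bsub>B,B\<^esub> lact B a w) \<in> R"
    unfolding bal_rel_def by (intro fs.span_base) blast
  then show ?thesis
    unfolding bt_def baltens_def by (simp add: proj_eq[OF vspace_tprod subsp_R])
qed

text \<open>The zeros of \<open>lift B B F\<close> form a subspace, and balancedness says that it
  contains the generators of \<open>R\<close>. This is the well-definedness half of the universal
  property stated in \<open>bal_lift\<close>.\<close>

lemma bal_lift_vanish:
  assumes U: "vspace U" and F: "bilin B B U F"
    and bal: "\<And>v a w. v \<in> carrier B \<Longrightarrow> a \<in> carrier A \<Longrightarrow> w \<in> carrier B \<Longrightarrow> F (ract B v a) w = F v (lact B a w)"
    and n: "n \<in> R"
  shows "lift B B F n = 0"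
proof -
  note l = lin_lift[OF vspace_B vspace_B U F]
  let ?K = "{n \<in> carrier (tprod B B). lift B B F n = 0}"
  have "R \<subseteq> ?K"
    unfolding bal_rel_def
  proof (rule fs.span_minimal)
    show "{(ract B v a \<otimes>\<^bsub>B,B\<^esub> w) - (v \<otimes>\<^bsub>B,B\<^esub> lact B a w) | v a w. v \<in> carrier B \<and> a \<in> carrier A \<and> w \<in> carrier B} \<subseteq> ?K"
      using lift_tens_in[OF vspace_B vspace_B U F] by (auto simp: lin_diff[OF l] bal)
    show "fs.subspace ?K"
      using lin_0[OF l] linD(2,3)[OF l] U by (auto simp: fs.subspace_def vspace_smul)
  qed
  then show ?thesis using n by blast
qed

lemma bal_lift:
  assumes U: "vspace U" and F: "bilin B B U F"
    and bal: "\<And>v a w. v \<in> carrier B \<Longrightarrow> a \<in> carrier A \<Longrightarrow> w \<in> carrier B \<Longrightarrow> F (ract B v a) w = F v (lact B a w)"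
  defines "f \<equiv> descend (tprod B B) R (lift B B F)"
  shows "lin BB U f" "v \<in> carrier B \<Longrightarrow> w \<in> carrier B \<Longrightarrow> f (bt v w) = F v w"
proof -
  note l = lin_lift[OF vspace_B vspace_B U F]
  note d = descend_lin[OF vspace_tprod subsp_R l bal_lift_vanish[OF U F bal], folded f_def]
  show "lin BB U f" using d(2) by (simp add: lin_def carrier_BB)
  show "f (bt v w) = F v w" if "v \<in> carrier B" "w \<in> carrier B"
    unfolding bt_def baltens_def using d(1)[of "v \<otimes>\<^bsub>B,B\<^esub> w"] that
    by (simp add: lift_tens_in[OF vspace_B vspace_B U F])
qed

lemma bal_ext:
  assumes "lin BB U f" "lin BB U' g"
    and "\<And>v w. v \<in> carrier B \<Longrightarrow> w \<in> carrier B \<Longrightarrow> f (bt v w) = g (bt v w)"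
    and "x \<in> carrier BB"
  shows "f x = g x"
proof -
  obtain t where t: "t \<in> carrier (tprod B B)" "x = proj (tprod B B) R t"
    using assms(4) by (auto simp: carrier_BB carrier_quot)
  have "f (proj (tprod B B) R t) = g (proj (tprod B B) R t)"
  proof (rule tprod_eqI[where f = "\<lambda>t. f (proj (tprod B B) R t)" and U = U and U' = U', OF vspace_B _ _ _ t(1)])
    show "lin (tprod B B) U (\<lambda>t. f (proj (tprod B B) R t))" "lin (tprod B B) U' (\<lambda>t. g (proj (tprod B B) R t))"
      by (rule lin_compose[OF assms(1)] lin_compose[OF assms(2)]; simp add: carrier_BB)+
  qed (use assms(3) in \<open>simp add: bt_def baltens_def\<close>)
  then show ?thesis using t by simp
qed

lemma BB_lact:
  assumes "a \<in> carrier A"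
  shows "lin BB BB (lact BB a)" "v \<in> carrier B \<Longrightarrow> w \<in> carrier B \<Longrightarrow> lact BB a (bt v w) = bt (lact B a v) w"
proof -
  have e: "lact BB a = descend (tprod B B) R (lift B B (\<lambda>v w. bt (lact B a v) w))"
    by (simp add: balprod_def bt_def)
  note l = bal_lift[where U = BB and F = "\<lambda>v w. bt (lact B a v) w", folded e]
  show "lin BB BB (lact BB a)" by (rule l(1)) (use assms in \<open>simp_all add: act_simps(3)[symmetric] bt_balanced\<close>)
  show "lact BB a (bt v w) = bt (lact B a v) w" if "v \<in> carrier B" "w \<in> carrier B"
    by (rule l(2)) (use assms that in \<open>simp_all add: act_simps(3)[symmetric] bt_balanced\<close>)
qed

lemma BB_ract:
  assumes "a \<in> carrier A"
  shows "lin BB BB (\<lambda>x. ract BB x a)" "v \<in> carrier B \<Longrightarrow> w \<in> carrier B \<Longrightarrow> ract BB (bt v w) a = bt v (ract B w a)"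
proof -
  have e: "(\<lambda>x. ract BB x a) = descend (tprod B B) R (lift B B (\<lambda>v w. bt v (ract B w a)))"
    by (simp add: balprod_def bt_def)
  note l = bal_lift[where U = BB and F = "\<lambda>v w. bt v (ract B w a)", folded e]
  show "lin BB BB (\<lambda>x. ract BB x a)" by (rule l(1)) (use assms in \<open>simp_all add: act_simps bt_balanced\<close>)
  show "ract BB (bt v w) a = bt v (ract B w a)" if "v \<in> carrier B" "w \<in> carrier B"
    by (rule l(2)) (use assms that in \<open>simp_all add: act_simps bt_balanced\<close>)
qed

lemma BB_mem [simp]:
  "a \<in> carrier A \<Longrightarrow> x \<in> carrier BB \<Longrightarrow> lact BB a x \<in> carrier BB"
  "a \<in> carrier A \<Longrightarrow> x \<in> carrier BB \<Longrightarrow> ract BB x a \<in> carrier BB"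
  using linD(1)[OF BB_lact(1)] linD(1)[OF BB_ract(1)] by auto

lemma bimodule_BB: "bimodule A BB"
proof -
  have 1: "lin A BB (\<lambda>a. lact BB a x)" if x: "x \<in> carrier BB" for x
  proof (rule linI)
    fix a b c assume ab: "a \<in> carrier A"
    have l: "lin A BB (\<lambda>a. bt (lact B a v) w)" if "v \<in> carrier B" "w \<in> carrier B" for v w using that by simp
    show "lact BB a x \<in> carrier BB" using ab x by simp
    show "lact BB (smul A c a) x = smul BB c (lact BB a x)"
      by (rule bal_ext[where U = BB and U' = BB, OF _ _ _ x])
        (use ab in \<open>simp_all add: BB_lact linD(3)[OF l, simplified]\<close>)
    assume b: "b \<in> carrier A"
    show "lact BB (a + b) x = lact BB a x + lact BB b x"
      by (rule bal_ext[where U = BB and U' = BB and g = "\<lambda>x. lact BB a x + lact BB b x", OF _ _ _ x])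
        (use ab b in \<open>simp_all add: BB_lact linD(2)[OF l]\<close>)
  qed
  have 2: "lin A BB (\<lambda>a. ract BB x a)" if x: "x \<in> carrier BB" for x
  proof (rule linI)
    fix a b c assume ab: "a \<in> carrier A"
    have l: "lin A BB (\<lambda>a. bt v (ract B w a))" if "v \<in> carrier B" "w \<in> carrier B" for v w using that by simp
    show "ract BB x a \<in> carrier BB" using ab x by simp
    show "ract BB x (smul A c a) = smul BB c (ract BB x a)"
      by (rule bal_ext[where U = BB and U' = BB, OF _ _ _ x])
        (use ab in \<open>simp_all add: BB_ract linD(3)[OF l, simplified]\<close>)
    assume b: "b \<in> carrier A"
    show "ract BB x (a + b) = ract BB x a + ract BB x b"
      by (rule bal_ext[where U = BB and U' = BB and g = "\<lambda>x. ract BB x a + ract BB x b", OF _ _ _ x])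
        (use ab b in \<open>simp_all add: BB_ract linD(2)[OF l]\<close>)
  qed
  have c: "lin BB BB (\<lambda>x. lact BB a (lact BB b x))" "lin BB BB (\<lambda>x. ract BB (ract BB x a) b)"
    "lin BB BB (\<lambda>x. ract BB (lact BB a x) b)" "lin BB BB (\<lambda>x. lact BB a (ract BB x b))"
    if "a \<in> carrier A" "b \<in> carrier A" for a b
    using that by (auto intro: lin_compose[OF BB_lact(1)] lin_compose[OF BB_ract(1)] BB_lact(1) BB_ract(1))
  have 3: "lact BB (a \<cdot>\<^bsub>A\<^esub> b) x = lact BB a (lact BB b x)" "ract BB x (a \<cdot>\<^bsub>A\<^esub> b) = ract BB (ract BB x a) b"
    "ract BB (lact BB a x) b = lact BB a (ract BB x b)" if "a \<in> carrier A" "b \<in> carrier A" "x \<in> carrier BB" for a b x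
    by (rule bal_ext[where U = BB and U' = BB, OF _ _ _ that(3)],
      use that in \<open>simp_all add: BB_lact BB_ract c act_simps\<close>)+
  have 4: "lact BB \<one>\<^bsub>A\<^esub> x = x" "ract BB x \<one>\<^bsub>A\<^esub> = x" if "x \<in> carrier BB" for x
    by (rule bal_ext[where U = BB and U' = BB and g = "\<lambda>x. x", OF _ _ _ that],
      use that in \<open>simp_all add: BB_lact BB_ract\<close>)+
  show ?thesis
    unfolding bimodule_def using 1 2 3 4 BB_lact(1) BB_ract(1) by (simp)
qed

end

subsection \<open>One-forms\<close>

lemma bimod_intro: "algebra_on A \<Longrightarrow> bimodule A B \<Longrightarrow> bimod A B"
  by (simp add: bimod_def bimod_axioms_def)

lemma tspan_eqI:
  assumes "vspace V" "lin (tprod V W) U f" "lin (tprod V W) U' g" "subsp V A" "B \<subseteq> carrier W"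
    "t \<in> tspan V W A B"
    and "\<And>a b. a \<in> A \<Longrightarrow> b \<in> B \<Longrightarrow> f (a \<otimes>\<^bsub>V,W\<^esub> b) = g (a \<otimes>\<^bsub>V,W\<^esub> b)"
  shows "f t = g t"
  using assms(1,4,6)
proof (induction rule: tspan_induct)
  case zero
  show ?case unfolding lin_0[OF assms(2) vspace_tprod] lin_0[OF assms(3) vspace_tprod] ..
next
  case (add s t)
  have sub: "tspan V W A B \<subseteq> carrier (tprod V W)"
    using assms(4,5) by (intro tspan_subset) (auto simp: subsp_def)
  show ?case
    unfolding linD(2)[OF assms(2) subsetD[OF sub add(1)] subsetD[OF sub add(2)]]
      linD(2)[OF assms(3) subsetD[OF sub add(1)] subsetD[OF sub add(2)]] add(3,4) ..
qed (rule assms(7))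

context hopf_alg
begin

lemma sw_add:
  assumes "bilin H H fspace F" "bilin H H fspace G" "h \<in> carrier H"
  shows "sw (\<lambda>a b. F a b + G a b) h = sw F h + sw G h"
  unfolding sw2_def by (rule lift_add_fun[OF _ _ vspace_fspace assms(1,2)]) (use assms(3) in simp_all)

lemma sw_diff:
  assumes "bilin H H fspace F" "bilin H H fspace G" "h \<in> carrier H"
  shows "sw (\<lambda>a b. F a b - G a b) h = sw F h - sw G h"
  using sw_add[of "\<lambda>a b. F a b - G a b" G h] assms by simp

lemma Ad_lift:
  assumes U: "vspace U" and F: "bilin H H U F" and h: "h \<in> carrier H"
  shows "lift H H F (Ad H h) = sw (\<lambda>a y. sw (\<lambda>b c. F b (antip H a \<cdot>\<^bsub>H\<^esub> c)) y) h"
proof -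
  note l = lin_lift[OF vspace_alg vspace_alg U F]
  have "lift H H F (Ad H h) = sw (\<lambda>a y. lift H H F (sw (\<lambda>b c. b \<otimes>\<^bsub>H,H\<^esub> (antip H a \<cdot>\<^bsub>H\<^esub> c)) y)) h"
    unfolding Ad_sw[OF h] by (rule sw_linear[OF _ U _ l]) (use h in simp_all)
  also have "\<dots> = sw (\<lambda>a y. sw (\<lambda>b c. lift H H F (b \<otimes>\<^bsub>H,H\<^esub> (antip H a \<cdot>\<^bsub>H\<^esub> c))) y) h"
    by (intro sw_cong refl sw_linear[OF _ U _ l]) simp_all
  also have "\<dots> = sw (\<lambda>a y. sw (\<lambda>b c. F b (antip H a \<cdot>\<^bsub>H\<^esub> c)) y) h"
    by (intro sw_cong refl lift_tens_in[OF _ _ U F]) simp_all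
  finally show ?thesis .
qed

text \<open>The counit on the first leg of \<open>Ad h\<close> leaves
  \<open>(S h\<^sub>1) h\<^sub>2 = \<epsilon>(h) 1\<close>, which is zero on
  \<open>aug H\<close>.\<close>

lemma Ad_aug: assumes "h \<in> aug H" shows "Ad H h \<in> tspan H H (aug H) (carrier H)"
proof -
  have h: "h \<in> carrier H" "counit H h = 0" using assms by (auto simp: aug_def)
  have "lift H H (\<lambda>v w. smul H (counit H v) w) (Ad H h) =
    sw (\<lambda>a y. sw (\<lambda>b c. smul H (counit H b) (antip H a \<cdot>\<^bsub>H\<^esub> c)) y) h"
    by (rule Ad_lift[where U = H]) (use h in simp_all)
  also have "\<dots> = sw (\<lambda>a y. antip H a \<cdot>\<^bsub>H\<^esub> y) h"
    by (intro sw_cong refl sw_counit_H(1)) simp_all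
  also have "\<dots> = 0" using sw_antip_in(1)[of H "\<lambda>x. x" h] h by (simp add: vspace_smul)
  finally show ?thesis
    unfolding aug_def by (intro ker_functional_tens[OF _ _ counit_lin unit_mem]) (use h in simp_all)
qed

lemma ad_ideal_aug: "ad_ideal H (aug H)"
proof -
  have "q \<cdot>\<^bsub>H\<^esub> h \<in> aug H" if "q \<in> aug H" "h \<in> carrier H" for q h
    using that by (simp add: aug_def)
  then show ?thesis unfolding ad_ideal_def using Ad_aug by auto
qed

text \<open>The ideal \<open>ker \<epsilon>\<close> itself fits the locale. Everything shown for
  \<open>N\<close> then also holds for the universal forms, by \<open>univ_eq_calc\<close>.\<close>

lemma calculus_aug: "calculus H (aug H)"
  by unfold_locales (rule ad_ideal_aug)

lemma bimodule_univ: "bimodule H (univ H)"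
proof -
  interpret U: calculus H "aug H" by (rule calculus_aug)
  \<comment> \<open>Stability of the universal forms under both actions is stability of
    \<open>N\<close> for the ideal \<open>aug H\<close>.\<close>
  note m = U.N_act[folded univ_eq_calc]
  have 1: "bilin H (univ H) (univ H) (lact (univ H))" "bilin (univ H) H (univ H) (ract (univ H))"
  proof -
    have sub: "carrier (univ H) \<subseteq> carrier T" by (auto simp: univ_T)
    show "bilin H (univ H) (univ H) (lact (univ H))"
    proof (rule bilinI)
      show "lin (univ H) (univ H) (lact (univ H) a)" if "a \<in> carrier H" for a
        by (rule lin_restrict[OF lin_narrow[OF bilinD(1)[OF lact_T_bilin that] _ sub]]) (use m that in simp_all)
      show "lin H (univ H) (\<lambda>a. lact (univ H) a t)" if "t \<in> carrier (univ H)" for t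
        by (rule lin_restrict[OF bilinD(2)[OF lact_T_bilin univ_T[OF that]]]) (use m that in simp_all)
    qed
    show "bilin (univ H) H (univ H) (ract (univ H))"
    proof (rule bilinI)
      show "lin (univ H) (univ H) (\<lambda>t. ract (univ H) t a)" if "a \<in> carrier H" for a
        by (rule lin_restrict[OF lin_narrow[OF bilinD(2)[OF ract_T_bilin that] _ sub]]) (use m that in simp_all)
      show "lin H (univ H) (\<lambda>a. ract (univ H) t a)" if "t \<in> carrier (univ H)" for t
        by (rule lin_restrict[OF bilinD(1)[OF ract_T_bilin univ_T[OF that]]]) (use m that in simp_all)
    qed
  qed
  have l: "lact (univ H) (a \<cdot>\<^bsub>H\<^esub> b) t = lact (univ H) a (lact (univ H) b t)"
    "ract (univ H) t (a \<cdot>\<^bsub>H\<^esub> b) = ract (univ H) (ract (univ H) t a) b"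
    "ract (univ H) (lact (univ H) a t) b = lact (univ H) a (ract (univ H) t b)"
    "lact (univ H) \<one>\<^bsub>H\<^esub> t = t" "ract (univ H) t \<one>\<^bsub>H\<^esub> = t"
    if "a \<in> carrier H" "b \<in> carrier H" "t \<in> carrier T" for a b t
  proof -
    show "lact (univ H) (a \<cdot>\<^bsub>H\<^esub> b) t = lact (univ H) a (lact (univ H) b t)"
      by (rule tprod_eqI[where V = H and W = H and U = fspace and U' = fspace and f = "lact (univ H) (a \<cdot>\<^bsub>H\<^esub> b)"])
        (use that in \<open>simp_all add: mul_assoc\<close>)
    show "ract (univ H) t (a \<cdot>\<^bsub>H\<^esub> b) = ract (univ H) (ract (univ H) t a) b"
      by (rule tprod_eqI[where V = H and W = H and U = fspace and U' = fspace and f = "\<lambda>t. ract (univ H) t (a \<cdot>\<^bsub>H\<^esub> b)"])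
        (use that in \<open>simp_all add: mul_assoc\<close>)
    show "ract (univ H) (lact (univ H) a t) b = lact (univ H) a (ract (univ H) t b)"
      by (rule tprod_eqI[where V = H and W = H and U = fspace and U' = fspace and f = "\<lambda>t. ract (univ H) (lact (univ H) a t) b"])
        (use that in \<open>simp_all add: mul_assoc\<close>)
    show "lact (univ H) \<one>\<^bsub>H\<^esub> t = t"
      by (rule tprod_eqI[where V = H and W = H and U = fspace and U' = fspace and f = "lact (univ H) \<one>\<^bsub>H\<^esub>" and g = "\<lambda>t. t"])
        (use that in simp_all)
    show "ract (univ H) t \<one>\<^bsub>H\<^esub> = t"
      by (rule tprod_eqI[where V = H and W = H and U = fspace and U' = fspace and f = "\<lambda>t. ract (univ H) t \<one>\<^bsub>H\<^esub>" and g = "\<lambda>t. t"])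
        (use that in simp_all)
  qed
  show ?thesis
    unfolding bimodule_def using 1 l(4,5)[OF unit_mem unit_mem] by (simp add: l(1-3) univ_T del: bilin_iff)
qed

definition pr :: "'a \<Rightarrow> 'a" where
  "pr h = h - smul H (counit H h) \<one>\<^bsub>H\<^esub>"

lemma lin_pr [simp]: "lin X H f \<Longrightarrow> smul U = smul H \<Longrightarrow> carrier H \<subseteq> carrier U \<Longrightarrow> lin X U (\<lambda>x. pr (f x))"
  by (rule lin_compose_widen[where g = pr and V = H and W = H]) (simp_all add: pr_def[abs_def])

lemma pr_aug [simp]: "h \<in> carrier H \<Longrightarrow> pr h \<in> aug H"
  by (simp add: aug_def pr_def)

lemma pr_mem [simp]: "h \<in> carrier H \<Longrightarrow> pr h \<in> carrier H"
  by (simp add: pr_def)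

lemma counit_pr [simp]: "h \<in> carrier H \<Longrightarrow> counit H (pr h) = 0"
  by (simp add: pr_def)

lemma pr_id: "h \<in> carrier H \<Longrightarrow> counit H h = 0 \<Longrightarrow> pr h = h"
  by (simp add: pr_def vspace_smul)

lemma pr_unit [simp]: "pr \<one>\<^bsub>H\<^esub> = 0"
  by (simp add: pr_def vspace_smul)

lemma counit_0 [simp]: "counit H 0 = 0"
  using lin_0[OF counit_lin] by simp

end

section \<open>Generators of the one-forms\<close>

context calculus
begin

abbreviation B1 :: "('k, 'a, ('k, 'a) form1) bimod" where
  "B1 \<equiv> forms1 H N"

definition cl :: "('k, 'a, 'a) ten \<Rightarrow> ('k, 'a) form1" where
  "cl = proj T N"

lemma proj_univ: "proj (univ H) N = cl"
  unfolding cl_def by (rule proj_space_cong) simp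

lemma bimod_univ: "bimod H (univ H)"
  by (rule bimod_intro[OF algebra_on_axioms bimodule_univ])

lemma bimodule_B1: "bimodule H B1"
  unfolding forms1_quot by (rule bimod.quot_bimodule[OF bimod_univ]) simp_all

sublocale B: bimod H B1
  by (rule bimod_intro[OF algebra_on_axioms bimodule_B1])

lemma smul_B1 [simp]: "smul B1 = fsmul"
  by (simp add: forms1_def)

lemma carrier_B1: "carrier B1 = cl ` carrier (univ H)"
  by (simp only: forms1_quot quot_bimod_simps proj_univ)

lemma carrier_B1_quot: "carrier B1 = carrier (quot (univ H) N)"
  by (simp add: forms1_def)

lemma cl_mem [simp]: "t \<in> carrier (univ H) \<Longrightarrow> cl t \<in> carrier B1"
  unfolding carrier_B1 by blast

lemma cl_lin: "lin (univ H) B1 cl"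
  using lin_proj[OF vspace_univ, of N] unfolding proj_univ by (simp add: lin_def carrier_B1_quot)

lemma cl_lin_T: "lin T (quot T N) cl"
  unfolding cl_def by (rule lin_proj) simp

lemma lin_cl_T [simp]: "lin X T f \<Longrightarrow> smul U = fsmul \<Longrightarrow> carrier (quot T N) \<subseteq> carrier U \<Longrightarrow> lin X U (\<lambda>x. cl (f x))"
  by (rule lin_compose_widen[OF cl_lin_T]) simp_all

lemma cl_N [simp]: "n \<in> N \<Longrightarrow> cl n = 0"
  unfolding cl_def by (simp add: proj_eq_0[OF vspace_tprod subsp_N_T])

lemma lact_cl: "a \<in> carrier H \<Longrightarrow> t \<in> carrier (univ H) \<Longrightarrow> lact B1 a (cl t) = cl (lact (univ H) a t)"
  using bimod.quot_lact_lin(1)[OF bimod_univ subsp_N N_act, of a t] unfolding forms1_quot proj_univ by simp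

lemma ract_cl: "a \<in> carrier H \<Longrightarrow> t \<in> carrier (univ H) \<Longrightarrow> ract B1 (cl t) a = cl (ract (univ H) t a)"
  using bimod.quot_ract_lin(1)[OF bimod_univ subsp_N N_act, of a t] unfolding forms1_quot proj_univ by simp

lemma trivi_univ [simp]:
  assumes "h \<in> carrier H" "g \<in> aug H" shows "trivi (h \<otimes>\<^bsub>H,H\<^esub> g) \<in> carrier (univ H)"
  unfolding univ_eq_calc by (rule trivi_in_calc[OF aug_subset]) (use assms in simp)

text \<open>\<open>E h g\<close> is \<open>h e(g)\<close> for the Maurer--Cartan form \<open>e\<close>, extended to all \<open>g\<close> by \<open>e(1) = 0\<close>.\<close>

definition E :: "'a \<Rightarrow> 'a \<Rightarrow> ('k, 'a) form1" where
  "E h g = cl (trivi (h \<otimes>\<^bsub>H,H\<^esub> pr g))"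

lemma E_bilin: "bilin H H B1 E"
proof (rule bilinI)
  show "lin H B1 (E h)" if "h \<in> carrier H" for h
    by (rule lin_restrict[where W = fspace])
      (use that in \<open>auto simp: E_def[abs_def]\<close>)
  show "lin H B1 (\<lambda>h. E h g)" if "g \<in> carrier H" for g
    by (rule lin_restrict[where W = fspace])
      (use that in \<open>auto simp: E_def[abs_def]\<close>)
qed

lemma E_mem [simp]: "h \<in> carrier H \<Longrightarrow> g \<in> carrier H \<Longrightarrow> E h g \<in> carrier B1"
  using bilin_mem[OF E_bilin] .

lemma lin_E1 [simp]:
  "lin X H f \<Longrightarrow> g \<in> carrier H \<Longrightarrow> smul U = fsmul \<Longrightarrow> carrier B1 \<subseteq> carrier U \<Longrightarrow> lin X U (\<lambda>x. E (f x) g)"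
  by (rule lin_bilin1[OF E_bilin]) simp_all

lemma lin_E2 [simp]:
  "lin X H f \<Longrightarrow> h \<in> carrier H \<Longrightarrow> smul U = fsmul \<Longrightarrow> carrier B1 \<subseteq> carrier U \<Longrightarrow> lin X U (\<lambda>x. E h (f x))"
  by (rule lin_bilin2[OF E_bilin]) simp_all

lemma E_unit [simp]: "h \<in> carrier H \<Longrightarrow> E h \<one>\<^bsub>H\<^esub> = 0"
  using lin_0[OF trivi_lin] by (simp add: E_def tens_linear lin_0[OF cl_lin_T])

lemma E_Q [simp]: "h \<in> carrier H \<Longrightarrow> q \<in> Q \<Longrightarrow> E h q = 0"
  by (simp add: E_def pr_id trivi_in_calc)

lemma E_pr [simp]: "g \<in> carrier H \<Longrightarrow> E h (pr g) = E h g"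
  by (simp add: E_def pr_id)

lemma lact_E [simp]:
  "a \<in> carrier H \<Longrightarrow> h \<in> carrier H \<Longrightarrow> g \<in> carrier H \<Longrightarrow> lact B1 a (E h g) = E (a \<cdot>\<^bsub>H\<^esub> h) g"
  by (simp add: E_def lact_cl trivi_lact)

text \<open>The commutation rule \<open>e(g) a = a\<^sub>1 e(g a\<^sub>2)\<close>, valid for
  \<open>g\<close> in \<open>ker \<epsilon>\<close>. The projection \<open>pr\<close> is essential:
  for \<open>g = 1\<close> the left side is zero by the convention \<open>e(1) = 0\<close>, whereas
  \<open>e(a\<^sub>2)\<close> need not vanish.\<close>

lemma ract_E:
  assumes "a \<in> carrier H" "h \<in> carrier H" "g \<in> carrier H"
  shows "ract B1 (E h g) a = sw (\<lambda>a1 a2. E (h \<cdot>\<^bsub>H\<^esub> a1) (pr g \<cdot>\<^bsub>H\<^esub> a2)) a"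
proof -
  have "ract B1 (E h g) a = cl (sw (\<lambda>a1 a2. trivi ((h \<cdot>\<^bsub>H\<^esub> a1) \<otimes>\<^bsub>H,H\<^esub> (pr g \<cdot>\<^bsub>H\<^esub> a2))) a)"
    using assms by (simp add: E_def ract_cl trivi_ract)
  also have "\<dots> = sw (\<lambda>a1 a2. cl (trivi ((h \<cdot>\<^bsub>H\<^esub> a1) \<otimes>\<^bsub>H,H\<^esub> (pr g \<cdot>\<^bsub>H\<^esub> a2)))) a"
    by (rule sw_linear[OF _ _ _ cl_lin_T]) (use assms in simp_all)
  also have "\<dots> = sw (\<lambda>a1 a2. E (h \<cdot>\<^bsub>H\<^esub> a1) (pr g \<cdot>\<^bsub>H\<^esub> a2)) a"
    using assms by (simp add: E_def pr_id)
  finally show ?thesis .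
qed

lemma triv_univ: "t \<in> carrier (univ H) \<Longrightarrow> triv H t \<in> tspan H H (carrier H) (aug H)"
  unfolding univ_eq_calc by (simp add: calc_iff)

text \<open>The \<open>E h g\<close> with \<open>g\<close> in \<open>ker \<epsilon>\<close> span the
  one-forms, because a universal form is \<open>trivi\<close> of an element of
  \<open>H \<otimes> ker \<epsilon>\<close>. A linear \<open>f\<close> and a subspace
  \<open>S\<close> are kept general so that the lemma serves both for identities, with
  \<open>S\<close> zero, and for statements about ranges.\<close>

lemma B1_in_subsp:
  assumes f: "lin B1 U f" "vspace U" "subsp U S" and "\<And>h g. h \<in> carrier H \<Longrightarrow> g \<in> aug H \<Longrightarrow> f (E h g) \<in> S" and x: "x \<in> carrier B1"
  shows "f x \<in> S"
proof -
  obtain t where t: "t \<in> carrier (univ H)" "x = cl t" using x by (auto simp: carrier_B1)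
  have "f (cl (trivi s)) \<in> S" if "s \<in> tspan H H (carrier H) (aug H)" for s
    using vspace_alg subsp_carrier[OF vspace_alg] that
  proof (induction rule: tspan_induct)
    case zero
    show ?case unfolding lin_0[OF trivi_lin vspace_tprod] lin_0[OF cl_lin_T vspace_tprod] lin_0[OF f(1) B.vspace_B]
      using assms(2,3) by (simp add: subsp_iff)
  next
    case (tens h g)
    then show ?case using assms(4)[of h g] aug_subset by (auto simp: E_def pr_id aug_def)
  next
    case (add s t)
    have st: "s \<in> carrier T" "t \<in> carrier T" "trivi s \<in> carrier (univ H)" "trivi t \<in> carrier (univ H)"
      using add(1,2) tspan_subset[OF order_refl aug_subset] trivi_in_calc[OF aug_subset] unfolding univ_eq_calc by auto
    have "f (cl (trivi (s + t))) = f (cl (trivi s)) + f (cl (trivi t))"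
      using st by (simp add: linD(2)[OF trivi_lin] linD(2)[OF cl_lin_T] linD(2)[OF f(1)])
    then show ?case using add(3,4) assms(2,3) by (simp add: subsp_iff)
  qed
  from this[OF triv_univ[OF t(1)]] show ?thesis using t univ_T by simp
qed

lemma B1_ext:
  assumes f: "lin B1 U f" and g: "lin B1 U g" and U: "vspace U"
    and eq: "\<And>h g'. h \<in> carrier H \<Longrightarrow> g' \<in> carrier H \<Longrightarrow> f (E h g') = g (E h g')" and x: "x \<in> carrier B1"
  shows "f x = g x"
proof -
  have "f x - g x \<in> {0}"
    by (rule B1_in_subsp[OF lin_minus[OF U f g] U subsp_0[OF U] _ x]) (use eq aug_subset in auto)
  then show ?thesis by simp
qed

text \<open>The linear map on one-forms with \<open>E h g \<mapsto> F h g\<close>. It is meaningful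
  if \<open>F\<close> vanishes when its second argument is the unit or lies in \<open>Q\<close>,
  which are the relations among the \<open>E h g\<close>.\<close>

definition Elift :: "('a \<Rightarrow> 'a \<Rightarrow> 'c::ab_group_add) \<Rightarrow> ('k, 'a) form1 \<Rightarrow> 'c" where
  "Elift F = descend (univ H) N (\<lambda>t. lift H H F (triv H t))"

context
  fixes U :: "('k, 'c::ab_group_add, 'z) vs_scheme" and F :: "'a \<Rightarrow> 'a \<Rightarrow> 'c"
  assumes U: "vspace U" and F: "bilin H H U F"
    and F1: "\<And>h. h \<in> carrier H \<Longrightarrow> F h \<one>\<^bsub>H\<^esub> = 0" and FQ: "\<And>h q. h \<in> carrier H \<Longrightarrow> q \<in> Q \<Longrightarrow> F h q = 0"
begin

private lemma d: "v \<in> carrier (univ H) \<Longrightarrow> Elift F (cl v) = lift H H F (triv H v)"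
    "lin (quot (univ H) N) U (Elift F)"
proof -
  have l: "lin (univ H) U (\<lambda>t. lift H H F (triv H t))"
    by (rule lin_narrow[where V = T]) (use U F in \<open>auto intro!: lin_lift1 simp: univ_T\<close>)
  have 0: "lift H H F (triv H n) = 0" if "n \<in> N" for n
    by (rule lift_eq_0[OF _ _ U F, where A = "carrier H" and B = Q]) (use that FQ in \<open>auto simp: calc_iff\<close>)
  note d = descend_lin[OF vspace_univ subsp_N l 0, folded Elift_def]
  show "v \<in> carrier (univ H) \<Longrightarrow> Elift F (cl v) = lift H H F (triv H v)" "lin (quot (univ H) N) U (Elift F)"
    using d unfolding proj_univ by auto
qed

lemma Elift_lin: "lin B1 U (Elift F)"
  using d(2) by (simp add: lin_def carrier_B1_quot)

lemma Elift_cl: "t \<in> carrier (univ H) \<Longrightarrow> Elift F (cl t) = lift H H F (triv H t)"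
  by (rule d(1))

lemma Elift_E: "h \<in> carrier H \<Longrightarrow> g \<in> carrier H \<Longrightarrow> Elift F (E h g) = F h g"
proof -
  assume hg: "h \<in> carrier H" "g \<in> carrier H"
  have "Elift F (E h g) = F h (pr g)"
    using hg by (simp add: E_def Elift_cl lift_tens_in[OF _ _ U F])
  also have "\<dots> = F h g"
    using hg lin_diff[OF bilinD(1)[OF F]] linD(3)[OF bilinD(1)[OF F]] by (simp add: pr_def F1 vspace_smul[OF U])
  finally show ?thesis .
qed

end

section \<open>The differential of a function\<close>

lemma duniv_univ [simp]: "g \<in> carrier H \<Longrightarrow> duniv H g \<in> carrier (univ H)"
  using lin_diff[OF lift_mul_lin] lift_tens_in[OF _ _ _ mul_bilin] by (simp add: duniv_def carrier_univ)

definition df :: "'a \<Rightarrow> ('k, 'a) form1" where "df = d0 H N"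

lemma df_cl: "df g = cl (duniv H g)"
  by (simp add: df_def d0_def proj_univ)

lemma df_mem [simp]: "g \<in> carrier H \<Longrightarrow> df g \<in> carrier B1"
  by (simp add: df_cl)

lemma lin_df [simp]: "lin X H f \<Longrightarrow> smul U = fsmul \<Longrightarrow> carrier B1 \<subseteq> carrier U \<Longrightarrow> lin X U (\<lambda>x. df (f x))"
proof (rule lin_compose_widen[where V = H and W = B1])
  show "lin H B1 df"
  proof (rule lin_restrict[where W = fspace])
    show "lin H fspace df" by (simp add: df_cl[abs_def] duniv_def)
  qed simp_all
qed simp_all

text \<open>The trivialisation of \<open>1 \<otimes> g - g \<otimes> 1\<close> is
  \<open>g\<^sub>1 \<otimes> g\<^sub>2 - g \<otimes> 1\<close>, and the second term is the counit
  part of the first. Thus \<open>dg = g\<^sub>1 e(g\<^sub>2)\<close>.\<close>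

lemma df_E: assumes "g \<in> carrier H" shows "df g = sw E g"
proof -
  have "triv H (duniv H g) = sw (\<lambda>a b. a \<otimes>\<^bsub>H,H\<^esub> pr b) g"
  proof -
    have "sw (\<lambda>a b. a \<otimes>\<^bsub>H,H\<^esub> pr b) g = sw (\<lambda>a b. (a \<otimes>\<^bsub>H,H\<^esub> b) - fsmul (counit H b) (a \<otimes>\<^bsub>H,H\<^esub> \<one>\<^bsub>H\<^esub>)) g"
      by (intro sw_cong refl) (simp add: pr_def tens_linear)
    also have "\<dots> = sw (\<lambda>a b. a \<otimes>\<^bsub>H,H\<^esub> b) g - (g \<otimes>\<^bsub>H,H\<^esub> \<one>\<^bsub>H\<^esub>)"
      using assms by (subst sw_diff) simp_all
    also have "\<dots> = triv H (duniv H g)"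
      using assms by (simp add: duniv_def lin_diff[OF triv_lin] triv_tens)
    finally show ?thesis ..
  qed
  then have "duniv H g = sw (\<lambda>a b. trivi (a \<otimes>\<^bsub>H,H\<^esub> pr b)) g"
    using trivi_triv[OF univ_T[OF duniv_univ[OF assms]]] assms by (simp add: trivi_sw)
  then have "df g = cl (sw (\<lambda>a b. trivi (a \<otimes>\<^bsub>H,H\<^esub> pr b)) g)" by (simp add: df_cl)
  also have "\<dots> = sw (\<lambda>a b. cl (trivi (a \<otimes>\<^bsub>H,H\<^esub> pr b))) g"
    by (rule sw_linear[OF _ _ _ cl_lin_T]) (use assms in simp_all)
  finally show ?thesis by (simp add: E_def)
qed

lemma df_unit [simp]: "df \<one>\<^bsub>H\<^esub> = 0"
  by (simp add: df_cl duniv_def lin_0[OF cl_lin_T])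

lemma df_mult:
  assumes "a \<in> carrier H" "b \<in> carrier H"
  shows "df (a \<cdot>\<^bsub>H\<^esub> b) = ract B1 (df a) b + lact B1 a (df b)"
proof -
  have "duniv H (a \<cdot>\<^bsub>H\<^esub> b) = ract (univ H) (duniv H a) b + lact (univ H) a (duniv H b)"
    using assms lin_diff[OF bilinD(2)[OF ract_T_bilin]] lin_diff[OF bilinD(1)[OF lact_T_bilin]] by (simp add: duniv_def)
  then show ?thesis
    using assms by (simp add: df_cl lact_cl ract_cl linD(2)[OF cl_lin_T] univ_T)
qed

end

text \<open>The coactions are defined on all of \<open>H \<otimes> H\<close>, whereas forms come
  from the subspace \<open>univ H\<close>. The lemma lets a lift be read on the large or on the
  small space.\<close>

lemma lift_restrict:
  assumes V: "vspace V" "vspace V'" "carrier V' \<subseteq> carrier V" "smul V' = smul V"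
    and W: "vspace W" "vspace W'" "carrier W' \<subseteq> carrier W" "smul W' = smul W"
    and U: "vspace U" and f: "bilin V W U f" and t: "t \<in> carrier (tprod V' W')"
  shows "lift V W f t = lift V' W' f t" "t \<in> carrier (tprod V W)"
proof -
  have c: "carrier (tprod V' W') = tspan V W (carrier V') (carrier W')"
    using tspan_space_cong[OF V(4) W(4)] by (simp add: tprod_def)
  have sub: "carrier (tprod V' W') \<subseteq> carrier (tprod V W)"
    unfolding c by (rule tspan_subset[OF V(3) W(3)])
  then show "t \<in> carrier (tprod V W)" using t by blast
  have f': "bilin V' W' U f"
    using f V(3,4) W(3,4) by (auto intro: lin_narrow)
  show "lift V W f t = lift V' W' f t"
  proof (rule tprod_eqI[OF V(2) _ _ _ t])
    show "lin (tprod V' W') U (lift V W f)"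
      by (rule lin_narrow[OF lin_lift[OF V(1) W(1) U f] _ sub]) simp
    show "lin (tprod V' W') U (lift V' W' f)" by (rule lin_lift[OF V(2) W(2) U f'])
    fix v w assume vw: "v \<in> carrier V'" "w \<in> carrier W'"
    then have "lift V W f (v \<otimes>\<^bsub>V,W\<^esub> w) = f v w"
      using V(3) W(3) by (intro lift_tens_in[OF V(1) W(1) U f]) auto
    then show "lift V W f (v \<otimes>\<^bsub>V',W'\<^esub> w) = lift V' W' f (v \<otimes>\<^bsub>V',W'\<^esub> w)"
      using lift_tens_in[OF V(2) W(2) U f' vw] tens_cong[OF V(4) W(4)] by metis
  qed
qed

lemma lift_zero [simp]:
  fixes V :: "('k::field, 'a::ab_group_add, 'y) vs_scheme" and W :: "('k, 'b::ab_group_add, 'z) vs_scheme"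
  assumes "vspace V" "vspace W" "t \<in> carrier (tprod V W)"
  shows "lift V W (\<lambda>v w. 0 :: 'x \<Rightarrow> 'k) t = 0"
  by (rule lift_eq_0[where U = fspace and A = "carrier V" and B = "carrier W"])
    (use assms in \<open>simp_all add: tspan_carrier\<close>)

context algebra_on
begin

lemma mul_0 [simp]: "a \<in> carrier A \<Longrightarrow> 0 \<cdot>\<^bsub>A\<^esub> a = 0" "a \<in> carrier A \<Longrightarrow> a \<cdot>\<^bsub>A\<^esub> 0 = 0"
  using lin_0[OF bilinD(2)[OF mul_bilin]] lin_0[OF bilinD(1)[OF mul_bilin]] by auto

end

context bimod
begin

lemma bt_0 [simp]: "v \<in> carrier B \<Longrightarrow> bt v 0 = 0" "v \<in> carrier B \<Longrightarrow> bt 0 v = 0"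
  using lin_0[OF bilinD(2)[OF bt_bilin]] lin_0[OF bilinD(1)[OF bt_bilin]] by auto

lemma act_0 [simp]: "a \<in> carrier A \<Longrightarrow> lact B a 0 = 0" "a \<in> carrier A \<Longrightarrow> ract B 0 a = 0"
  using lin_0[OF bilinD(1)[OF lact_bilin]] lin_0[OF bilinD(2)[OF ract_bilin]] by auto

end

context hopf_alg
begin

lemma rcoact_lact:
  assumes a: "a \<in> carrier H" and t: "t \<in> carrier T"
  shows "rcoact H (lact (univ H) a t) =
    sw (\<lambda>a1 a2. lift T H (\<lambda>s y. lact (univ H) a1 s \<otimes>\<^bsub>T,H\<^esub> (a2 \<cdot>\<^bsub>H\<^esub> y)) (rcoact H t)) a"
proof (rule tprod_eqI[where f = "\<lambda>t. rcoact H (lact (univ H) a t)" and U = fspace and U' = fspace, OF vspace_alg _ _ _ t])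
  fix h g assume "h \<in> carrier H" "g \<in> carrier H"
  then show "rcoact H (lact (univ H) a (h \<otimes>\<^bsub>H,H\<^esub> g)) =
    sw (\<lambda>a1 a2. lift T H (\<lambda>s y. lact (univ H) a1 s \<otimes>\<^bsub>T,H\<^esub> (a2 \<cdot>\<^bsub>H\<^esub> y)) (rcoact H (h \<otimes>\<^bsub>H,H\<^esub> g))) a"
    using a by (simp add: rcoact_tens mul_assoc)
qed (use a in simp_all)

lemma rcoact_ract:
  assumes a: "a \<in> carrier H" and t: "t \<in> carrier T"
  shows "rcoact H (ract (univ H) t a) =
    sw (\<lambda>a1 a2. lift T H (\<lambda>s y. ract (univ H) s a1 \<otimes>\<^bsub>T,H\<^esub> (y \<cdot>\<^bsub>H\<^esub> a2)) (rcoact H t)) a"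
proof (rule tprod_eqI[where f = "\<lambda>t. rcoact H (ract (univ H) t a)" and U = fspace and U' = fspace, OF vspace_alg _ _ _ t])
  fix h g assume hg: "h \<in> carrier H" "g \<in> carrier H"
  let ?F = "\<lambda>h1 h2 g1 g2 a1 a2. (h1 \<otimes>\<^bsub>H,H\<^esub> (g1 \<cdot>\<^bsub>H\<^esub> a1)) \<otimes>\<^bsub>T,H\<^esub> (h2 \<cdot>\<^bsub>H\<^esub> (g2 \<cdot>\<^bsub>H\<^esub> a2))"
  have "sw (\<lambda>a1 a2. lift T H (\<lambda>s y. ract (univ H) s a1 \<otimes>\<^bsub>T,H\<^esub> (y \<cdot>\<^bsub>H\<^esub> a2)) (rcoact H (h \<otimes>\<^bsub>H,H\<^esub> g))) a =
    sw (\<lambda>a1 a2. sw (\<lambda>h1 h2. sw (\<lambda>g1 g2. ?F h1 h2 g1 g2 a1 a2) g) h) a"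
    using a hg by (simp add: rcoact_tens mul_assoc)
  also have "\<dots> = sw (\<lambda>h1 h2. sw (\<lambda>a1 a2. sw (\<lambda>g1 g2. ?F h1 h2 g1 g2 a1 a2) g) a) h"
    by (rule sw_swap[of fspace]) (use hg a in simp_all)
  also have "\<dots> = sw (\<lambda>h1 h2. sw (\<lambda>g1 g2. sw (\<lambda>a1 a2. ?F h1 h2 g1 g2 a1 a2) a) g) h"
    by (intro sw_cong refl sw_swap[of fspace]) (use hg a in simp_all)
  also have "\<dots> = rcoact H (ract (univ H) (h \<otimes>\<^bsub>H,H\<^esub> g) a)"
    using a hg by (simp add: rcoact_tens)
  finally show "rcoact H (ract (univ H) (h \<otimes>\<^bsub>H,H\<^esub> g) a) =
    sw (\<lambda>a1 a2. lift T H (\<lambda>s y. ract (univ H) s a1 \<otimes>\<^bsub>T,H\<^esub> (y \<cdot>\<^bsub>H\<^esub> a2)) (rcoact H (h \<otimes>\<^bsub>H,H\<^esub> g))) a" ..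
qed (use a in simp_all)

text \<open>The case \<open>Q = aug H\<close> of \<open>rcoact_N\<close>. The right coaction stays
  inside \<open>\<Omega>\<^sup>1H \<otimes> H\<close>, where \<open>cl\<close> takes values in the
  carrier of \<open>B1\<close>.\<close>

lemma rcoact_univ: "t \<in> carrier (univ H) \<Longrightarrow> rcoact H t \<in> carrier (tprod (univ H) H)"
  using calculus.rcoact_N[OF calculus_aug, of t]
  unfolding univ_eq_calc[symmetric] tprod_def[of "univ H"] by (simp add: tspan_space_cong[of "univ H" T H H])

end

section \<open>Coactions on one-forms and invariant forms\<close>

context calculus
begin

lemma lin_cl [simp]: "lin X (univ H) f \<Longrightarrow> smul U = fsmul \<Longrightarrow> carrier B1 \<subseteq> carrier U \<Longrightarrow> lin X U (\<lambda>x. cl (f x))"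
  by (rule lin_compose_widen[OF cl_lin]) simp_all

text \<open>The left coaction induced on \<open>\<Omega>\<^sup>1(H)\<close>, in the form in which it
  occurs in \<open>left_invariant\<close>; \<open>dR\<close> is its counterpart for
  \<open>right_invariant\<close>.\<close>

definition dL :: "('k, 'a) form1 \<Rightarrow> ('k, 'a, ('k, 'a) form1) ten" where
  "dL = descend (univ H) N (\<lambda>t. lift H T (\<lambda>a s. a \<otimes>\<^bsub>H,B1\<^esub> proj (univ H) N s) (lcoact H t))"

definition dR :: "('k, 'a) form1 \<Rightarrow> ('k, ('k, 'a) form1, 'a) ten" where
  "dR = descend (univ H) N (\<lambda>t. lift T H (\<lambda>s a. proj (univ H) N s \<otimes>\<^bsub>B1,H\<^esub> a) (rcoact H t))"

lemma left_invariant_iff: "v \<in> left_invariant H N \<longleftrightarrow> v \<in> carrier B1 \<and> dL v = (\<one>\<^bsub>H\<^esub> \<otimes>\<^bsub>H,B1\<^esub> v)"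
  by (simp add: left_invariant_def dL_def)

lemma right_invariant_iff: "v \<in> right_invariant H N \<longleftrightarrow> v \<in> carrier B1 \<and> dR v = (v \<otimes>\<^bsub>B1,H\<^esub> \<one>\<^bsub>H\<^esub>)"
  by (simp add: right_invariant_def dR_def)

lemma tens_B1: "(a \<otimes>\<^bsub>H,B1\<^esub> v) = (a \<otimes>\<^bsub>H,quot T N\<^esub> v)" "(v \<otimes>\<^bsub>B1,H\<^esub> a) = (v \<otimes>\<^bsub>quot T N,H\<^esub> a)"
  by (rule tens_cong; simp)+

lemma cl_tens_bilin: "bilin H T fspace (\<lambda>a s. a \<otimes>\<^bsub>H,B1\<^esub> cl s)" "bilin T H fspace (\<lambda>s a. cl s \<otimes>\<^bsub>B1,H\<^esub> a)"
  by (simp_all add: tens_B1 cl_def)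

text \<open>The coaction descends because it maps \<open>N\<close> into
  \<open>H \<otimes> N\<close>, where \<open>cl\<close> kills the second factor.\<close>

lemma dL_cl: "t \<in> carrier (univ H) \<Longrightarrow> dL (cl t) = lift H T (\<lambda>a s. a \<otimes>\<^bsub>H,B1\<^esub> cl s) (lcoact H t)"
  and dL_lin_fspace: "lin B1 fspace dL"
proof -
  have l: "lin (univ H) fspace (\<lambda>t. lift H T (\<lambda>a s. a \<otimes>\<^bsub>H,B1\<^esub> cl s) (lcoact H t))"
    by (rule lin_narrow[where V = T]) (use cl_tens_bilin(1) in \<open>simp_all add: subset_iff univ_T del: bilin_iff\<close>)
  have 0: "lift H T (\<lambda>a s. a \<otimes>\<^bsub>H,B1\<^esub> cl s) (lcoact H n) = 0" if "n \<in> N" for n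
    by (rule lift_eq_0[OF _ _ _ cl_tens_bilin(1) _ _ lcoact_N[OF that]]) (auto simp: N_T tens_linear)
  note d = descend_lin[OF vspace_univ subsp_N l 0, folded dL_def[unfolded proj_univ]]
  show "t \<in> carrier (univ H) \<Longrightarrow> dL (cl t) = lift H T (\<lambda>a s. a \<otimes>\<^bsub>H,B1\<^esub> cl s) (lcoact H t)"
    "lin B1 fspace dL"
    using d unfolding proj_univ by (auto simp: lin_def carrier_B1_quot)
qed

lemma dR_cl: "t \<in> carrier (univ H) \<Longrightarrow> dR (cl t) = lift T H (\<lambda>s a. cl s \<otimes>\<^bsub>B1,H\<^esub> a) (rcoact H t)"
  and dR_lin_fspace: "lin B1 fspace dR"
proof -
  have l: "lin (univ H) fspace (\<lambda>t. lift T H (\<lambda>s a. cl s \<otimes>\<^bsub>B1,H\<^esub> a) (rcoact H t))"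
    by (rule lin_narrow[where V = T]) (use cl_tens_bilin(2) in \<open>simp_all add: subset_iff univ_T del: bilin_iff\<close>)
  have 0: "lift T H (\<lambda>s a. cl s \<otimes>\<^bsub>B1,H\<^esub> a) (rcoact H n) = 0" if "n \<in> N" for n
    by (rule lift_eq_0[OF _ _ _ cl_tens_bilin(2) subsp_N_T _ rcoact_N[OF that]]) (auto simp: tens_linear)
  note d = descend_lin[OF vspace_univ subsp_N l 0, folded dR_def[unfolded proj_univ]]
  show "t \<in> carrier (univ H) \<Longrightarrow> dR (cl t) = lift T H (\<lambda>s a. cl s \<otimes>\<^bsub>B1,H\<^esub> a) (rcoact H t)"
    "lin B1 fspace dR"
    using d unfolding proj_univ by (auto simp: lin_def carrier_B1_quot)
qed

lemma dL_E:
  assumes "h \<in> carrier H" "g \<in> carrier H"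
  shows "dL (E h g) = sw (\<lambda>h1 h2. h1 \<otimes>\<^bsub>H,B1\<^esub> E h2 g) h"
proof -
  have "dL (E h g) = lift H T (\<lambda>a s. a \<otimes>\<^bsub>H,B1\<^esub> cl s) (sw (\<lambda>h1 h2. h1 \<otimes>\<^bsub>H,T\<^esub> trivi (h2 \<otimes>\<^bsub>H,H\<^esub> pr g)) h)"
    using assms unfolding E_def by (subst dL_cl) (simp_all add: lcoact_trivi)
  also have "\<dots> = sw (\<lambda>h1 h2. lift H T (\<lambda>a s. a \<otimes>\<^bsub>H,B1\<^esub> cl s) (h1 \<otimes>\<^bsub>H,T\<^esub> trivi (h2 \<otimes>\<^bsub>H,H\<^esub> pr g))) h"
    by (rule lift_sw) (use assms cl_tens_bilin in simp_all)
  also have "\<dots> = sw (\<lambda>h1 h2. h1 \<otimes>\<^bsub>H,B1\<^esub> E h2 g) h"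
    unfolding E_def by (intro sw_cong refl lift_tens cl_tens_bilin) (use assms in simp_all)
  finally show ?thesis .
qed

text \<open>\<open>rcoact_trivi\<close> pushed to classes. What remains is to pass from the classes
  of \<open>trivi (h \<otimes> b)\<close> to \<open>E h b\<close>, and from \<open>pr g\<close> to
  \<open>g\<close>.\<close>

lemma dR_E:
  assumes hg: "h \<in> carrier H" "g \<in> carrier H"
  shows "dR (E h g) = sw (\<lambda>h1 h2. lift H H (\<lambda>b y. E h1 b \<otimes>\<^bsub>B1,H\<^esub> (h2 \<cdot>\<^bsub>H\<^esub> y)) (Ad H g)) h"
proof -
  let ?c = "\<lambda>s a. cl s \<otimes>\<^bsub>B1,H\<^esub> a"
  have "dR (E h g) = lift T H ?c
      (sw (\<lambda>h1 h2. lift H H (\<lambda>b y. trivi (h1 \<otimes>\<^bsub>H,H\<^esub> b) \<otimes>\<^bsub>T,H\<^esub> (h2 \<cdot>\<^bsub>H\<^esub> y)) (Ad H (pr g))) h)"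
    using assms unfolding E_def by (subst dR_cl) (simp_all add: rcoact_trivi)
  also have "\<dots> = sw (\<lambda>h1 h2. lift T H ?c
      (lift H H (\<lambda>b y. trivi (h1 \<otimes>\<^bsub>H,H\<^esub> b) \<otimes>\<^bsub>T,H\<^esub> (h2 \<cdot>\<^bsub>H\<^esub> y)) (Ad H (pr g)))) h"
    by (rule lift_sw) (use assms cl_tens_bilin in simp_all)
  also have "\<dots> = sw (\<lambda>h1 h2. lift H H (\<lambda>b y. cl (trivi (h1 \<otimes>\<^bsub>H,H\<^esub> b)) \<otimes>\<^bsub>B1,H\<^esub> (h2 \<cdot>\<^bsub>H\<^esub> y)) (Ad H (pr g))) h"
  proof (intro sw_cong refl)
    fix h1 h2 assume h: "h1 \<in> carrier H" "h2 \<in> carrier H"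
    have "lift T H ?c (lift H H (\<lambda>b y. trivi (h1 \<otimes>\<^bsub>H,H\<^esub> b) \<otimes>\<^bsub>T,H\<^esub> (h2 \<cdot>\<^bsub>H\<^esub> y)) (Ad H (pr g))) =
      lift H H (\<lambda>b y. lift T H ?c (trivi (h1 \<otimes>\<^bsub>H,H\<^esub> b) \<otimes>\<^bsub>T,H\<^esub> (h2 \<cdot>\<^bsub>H\<^esub> y))) (Ad H (pr g))"
      by (rule lift_lift) (use h assms cl_tens_bilin in simp_all)
    also have "\<dots> = lift H H (\<lambda>b y. cl (trivi (h1 \<otimes>\<^bsub>H,H\<^esub> b)) \<otimes>\<^bsub>B1,H\<^esub> (h2 \<cdot>\<^bsub>H\<^esub> y)) (Ad H (pr g))"
      by (intro lift_cong lift_tens cl_tens_bilin) (use h in simp_all)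
    finally show "lift T H ?c (lift H H (\<lambda>b y. trivi (h1 \<otimes>\<^bsub>H,H\<^esub> b) \<otimes>\<^bsub>T,H\<^esub> (h2 \<cdot>\<^bsub>H\<^esub> y)) (Ad H (pr g))) = \<dots>" .
  qed
  also have "\<dots> = sw (\<lambda>h1 h2. lift H H (\<lambda>b y. E h1 b \<otimes>\<^bsub>B1,H\<^esub> (h2 \<cdot>\<^bsub>H\<^esub> y)) (Ad H (pr g))) h"
  proof (intro sw_cong refl)
    fix h1 h2 assume h: "h1 \<in> carrier H" "h2 \<in> carrier H"
    show "lift H H (\<lambda>b y. cl (trivi (h1 \<otimes>\<^bsub>H,H\<^esub> b)) \<otimes>\<^bsub>B1,H\<^esub> (h2 \<cdot>\<^bsub>H\<^esub> y)) (Ad H (pr g)) =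
      lift H H (\<lambda>b y. E h1 b \<otimes>\<^bsub>B1,H\<^esub> (h2 \<cdot>\<^bsub>H\<^esub> y)) (Ad H (pr g))"
    \<comment> \<open>\<open>E h1 b\<close> is the class of \<open>trivi (h1 \<otimes> b)\<close>
      only for \<open>b\<close> in \<open>ker \<epsilon>\<close>. By \<open>Ad_aug\<close> the first
      leg of \<open>Ad (pr g)\<close> stays there.\<close>
    proof (rule tspan_eqI[OF vspace_alg _ _ subsp_aug order_refl Ad_aug])
      have 1: "bilin H H fspace (\<lambda>b y. cl (trivi (h1 \<otimes>\<^bsub>H,H\<^esub> b)) \<otimes>\<^bsub>B1,H\<^esub> (h2 \<cdot>\<^bsub>H\<^esub> y))"
        using h by (simp add: tens_B1 cl_def)
      have 2: "bilin H H fspace (\<lambda>b y. E h1 b \<otimes>\<^bsub>B1,H\<^esub> (h2 \<cdot>\<^bsub>H\<^esub> y))"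
        using h by simp
      show "lin T fspace (lift H H (\<lambda>b y. cl (trivi (h1 \<otimes>\<^bsub>H,H\<^esub> b)) \<otimes>\<^bsub>B1,H\<^esub> (h2 \<cdot>\<^bsub>H\<^esub> y)))"
        "lin T fspace (lift H H (\<lambda>b y. E h1 b \<otimes>\<^bsub>B1,H\<^esub> (h2 \<cdot>\<^bsub>H\<^esub> y)))"
        by (rule lin_lift[OF vspace_alg vspace_alg vspace_fspace 1] lin_lift[OF vspace_alg vspace_alg vspace_fspace 2])+
      show "pr g \<in> aug H" using hg by simp
      fix b y assume b: "b \<in> aug H" "y \<in> carrier H"
      then have b': "b \<in> carrier H" "pr b = b" by (auto simp: aug_def pr_id)
      show "lift H H (\<lambda>b y. cl (trivi (h1 \<otimes>\<^bsub>H,H\<^esub> b)) \<otimes>\<^bsub>B1,H\<^esub> (h2 \<cdot>\<^bsub>H\<^esub> y)) (b \<otimes>\<^bsub>H,H\<^esub> y) =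
        lift H H (\<lambda>b y. E h1 b \<otimes>\<^bsub>B1,H\<^esub> (h2 \<cdot>\<^bsub>H\<^esub> y)) (b \<otimes>\<^bsub>H,H\<^esub> y)"
        unfolding lift_tens[OF vspace_alg vspace_alg 1 b'(1) b(2)] lift_tens[OF vspace_alg vspace_alg 2 b'(1) b(2)]
        by (simp add: E_def b'(2))
    qed
  qed
  also have "\<dots> = sw (\<lambda>h1 h2. lift H H (\<lambda>b y. E h1 b \<otimes>\<^bsub>B1,H\<^esub> (h2 \<cdot>\<^bsub>H\<^esub> y)) (Ad H g)) h"
  proof (intro sw_cong refl)
    fix h1 h2 assume h: "h1 \<in> carrier H" "h2 \<in> carrier H"
    let ?f = "\<lambda>g. lift H H (\<lambda>b y. E h1 b \<otimes>\<^bsub>B1,H\<^esub> (h2 \<cdot>\<^bsub>H\<^esub> y)) (Ad H g)"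
    have l: "lin H fspace ?f" using h by simp
    have "?f \<one>\<^bsub>H\<^esub> = 0" using h by (simp add: Ad_sw tens_linear)
    then show "?f (pr g) = ?f g"
      using hg lin_diff[OF l, of g "smul H (counit H g) \<one>\<^bsub>H\<^esub>"] linD(3)[OF l, of "\<one>\<^bsub>H\<^esub>" "counit H g"] by (simp add: pr_def)
  qed
  finally show ?thesis .
qed

lemma subsp_fspace_carrier: "smul V = fsmul \<Longrightarrow> vspace V \<Longrightarrow> subsp fspace (carrier V)"
  by (simp add: vspace_def subsp_def)

lemma dL_lin: "lin B1 (tprod H B1) dL"
proof (rule lin_restrict[OF dL_lin_fspace])
  show "dL x \<in> carrier (tprod H B1)" if "x \<in> carrier B1" for x
    by (rule B1_in_subsp[OF dL_lin_fspace _ subsp_fspace_carrier _ that]) (use aug_subset in \<open>auto simp: dL_E subset_iff\<close>)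
qed simp

lemma dR_lin: "lin B1 (tprod B1 H) dR"
proof (rule lin_restrict[OF dR_lin_fspace])
  show "dR x \<in> carrier (tprod B1 H)" if "x \<in> carrier B1" for x
    by (rule B1_in_subsp[OF dR_lin_fspace _ subsp_fspace_carrier _ that]) (use aug_subset in \<open>auto simp: dR_E subset_iff\<close>)
qed simp

lemma dR_mem [simp]: "v \<in> carrier B1 \<Longrightarrow> dR v \<in> carrier (tprod B1 H)"
  by (rule linD(1)[OF dR_lin])

lemma lin_dR [simp]:
  "lin X B1 f \<Longrightarrow> smul U = fsmul \<Longrightarrow> carrier (tprod B1 H) \<subseteq> carrier U \<Longrightarrow> lin X U (\<lambda>x. dR (f x))"
  by (rule lin_compose_widen[OF dR_lin]) simp_all

lemma univ_sub_T: "carrier (univ H) \<subseteq> carrier T"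
  by (auto simp: univ_T)

lemma dR_univ:
  assumes "t \<in> carrier (univ H)"
  shows "dR (cl t) = lift (univ H) H (\<lambda>s a. cl s \<otimes>\<^bsub>B1,H\<^esub> a) (rcoact H t)"
  unfolding dR_cl[OF assms]
  by (rule lift_restrict(1)[OF _ _ univ_sub_T _ _ _ _ _ _ cl_tens_bilin(2) rcoact_univ[OF assms]]) simp_all

lemma dR_act:
  assumes a: "a \<in> carrier H" and v: "v \<in> carrier B1"
  shows "dR (lact B1 a v) = sw (\<lambda>a1 a2. lift B1 H (\<lambda>w y. lact B1 a1 w \<otimes>\<^bsub>B1,H\<^esub> (a2 \<cdot>\<^bsub>H\<^esub> y)) (dR v)) a"
    and "dR (ract B1 v a) = sw (\<lambda>a1 a2. lift B1 H (\<lambda>w y. ract B1 w a1 \<otimes>\<^bsub>B1,H\<^esub> (y \<cdot>\<^bsub>H\<^esub> a2)) (dR v)) a"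
proof -
  interpret Un: bimod H "univ H" by (rule bimod_univ)
  obtain t where t: "t \<in> carrier (univ H)" "v = cl t" using v by (auto simp: carrier_B1)
  note r = rcoact_univ[OF t(1)]
  have 1: "rcoact H (lact (univ H) a t) =
    sw (\<lambda>a1 a2. lift (univ H) H (\<lambda>s y. lact (univ H) a1 s \<otimes>\<^bsub>univ H,H\<^esub> (a2 \<cdot>\<^bsub>H\<^esub> y)) (rcoact H t)) a"
    unfolding rcoact_lact[OF a univ_T[OF t(1)]] tens_univ
    by (intro sw_cong refl lift_restrict(1)[where U = fspace, OF _ _ univ_sub_T _ _ _ _ _ _ _ r]) simp_all
  have 2: "rcoact H (ract (univ H) t a) =
    sw (\<lambda>a1 a2. lift (univ H) H (\<lambda>s y. ract (univ H) s a1 \<otimes>\<^bsub>univ H,H\<^esub> (y \<cdot>\<^bsub>H\<^esub> a2)) (rcoact H t)) a"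
    unfolding rcoact_ract[OF a univ_T[OF t(1)]] tens_univ
    by (intro sw_cong refl lift_restrict(1)[where U = fspace, OF _ _ univ_sub_T _ _ _ _ _ _ _ r]) simp_all
  show "dR (lact B1 a v) = sw (\<lambda>a1 a2. lift B1 H (\<lambda>w y. lact B1 a1 w \<otimes>\<^bsub>B1,H\<^esub> (a2 \<cdot>\<^bsub>H\<^esub> y)) (dR v)) a"
    using a t r by (simp add: lact_cl dR_univ 1 del: tens_univ)
  show "dR (ract B1 v a) = sw (\<lambda>a1 a2. lift B1 H (\<lambda>w y. ract B1 w a1 \<otimes>\<^bsub>B1,H\<^esub> (y \<cdot>\<^bsub>H\<^esub> a2)) (dR v)) a"
    using a t r by (simp add: ract_cl dR_univ 2 del: tens_univ)
qed

lemma E_left_invariant: "g \<in> carrier H \<Longrightarrow> E \<one>\<^bsub>H\<^esub> g \<in> left_invariant H N"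
  by (simp add: left_invariant_iff dL_E)

text \<open>The map \<open>?f\<close>, which multiplies a form by the antipode of its coaction,
  fixes every left-invariant form. On \<open>h e(g)\<close> it gives
  \<open>(S h\<^sub>1) h\<^sub>2 e(g) = \<epsilon>(h) e(g)\<close>, so its image consists of forms
  \<open>e(g)\<close>.\<close>

lemma left_invariant_E:
  assumes "v \<in> left_invariant H N"
  shows "\<exists>g\<in>carrier H. v = E \<one>\<^bsub>H\<^esub> g"
proof -
  have v: "v \<in> carrier B1" "dL v = (\<one>\<^bsub>H\<^esub> \<otimes>\<^bsub>H,B1\<^esub> v)" using assms by (auto simp: left_invariant_iff)
  let ?S = "E \<one>\<^bsub>H\<^esub> ` carrier H" and ?f = "\<lambda>x. lift H B1 (\<lambda>a w. lact B1 (antip H a) w) (dL x)"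
  note l = bilinD(1)[OF E_bilin unit_mem]
  have S: "subsp B1 ?S"
    unfolding subsp_iff[OF B.vspace_B] using linD(2,3)[OF l, symmetric] lin_0[OF l]
    by (auto simp: image_iff)
  have f: "lin B1 B1 ?f"
    by (rule lin_lift1[OF _ _ _ _ dL_lin]) simp_all
  have "?f v \<in> ?S"
  proof (rule B1_in_subsp[OF f B.vspace_B S _ v(1)])
    fix h g assume h: "h \<in> carrier H" and "g \<in> aug H"
    then have g: "g \<in> carrier H" using aug_subset by auto
    have "?f (E h g) = sw (\<lambda>h1 h2. E (antip H h1 \<cdot>\<^bsub>H\<^esub> h2) g) h"
      using h g by (simp add: dL_E)
    also have "\<dots> = fsmul (counit H h) (E \<one>\<^bsub>H\<^esub> g)"
      using sw_antip_in(1)[of B1 "\<lambda>u. E u g" h] h g by simp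
    also have "\<dots> \<in> ?S" using S g by (auto simp: subsp_iff)
    finally show "?f (E h g) \<in> ?S" .
  qed
  also have "?f v = v" using v by simp
  finally show ?thesis by blast
qed

text \<open>In both terms of \<open>1 \<otimes> g - g \<otimes> 1\<close> the unit coacts trivially,
  so the leg in \<open>H\<close> is \<open>g\<^sub>2\<close> each time: the differential commutes
  with the right coaction.\<close>

lemma dR_df:
  assumes g: "g \<in> carrier H" shows "dR (df g) = sw (\<lambda>a b. df a \<otimes>\<^bsub>B1,H\<^esub> b) g"
proof -
  let ?L = "lift T H (\<lambda>s a. cl s \<otimes>\<^bsub>quot T N,H\<^esub> a)"
  have "dR (df g) = ?L (sw (\<lambda>a b. (\<one>\<^bsub>H\<^esub> \<otimes>\<^bsub>H,H\<^esub> a) \<otimes>\<^bsub>T,H\<^esub> b) g - sw (\<lambda>a b. (a \<otimes>\<^bsub>H,H\<^esub> \<one>\<^bsub>H\<^esub>) \<otimes>\<^bsub>T,H\<^esub> b) g)"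
    unfolding df_cl dR_cl[OF duniv_univ[OF g]] using g
    by (simp add: duniv_def lin_diff[OF rcoact_lin] rcoact_tens tens_B1)
  also have "\<dots> = sw (\<lambda>a b. cl (\<one>\<^bsub>H\<^esub> \<otimes>\<^bsub>H,H\<^esub> a) \<otimes>\<^bsub>quot T N,H\<^esub> b) g - sw (\<lambda>a b. cl (a \<otimes>\<^bsub>H,H\<^esub> \<one>\<^bsub>H\<^esub>) \<otimes>\<^bsub>quot T N,H\<^esub> b) g"
    using g by (simp add: cl_def)
  also have "\<dots> = sw (\<lambda>a b. (cl (\<one>\<^bsub>H\<^esub> \<otimes>\<^bsub>H,H\<^esub> a) \<otimes>\<^bsub>quot T N,H\<^esub> b) - (cl (a \<otimes>\<^bsub>H,H\<^esub> \<one>\<^bsub>H\<^esub>) \<otimes>\<^bsub>quot T N,H\<^esub> b)) g"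
    using g by (intro sw_diff[symmetric]) (simp_all add: cl_def)
  also have "\<dots> = sw (\<lambda>a b. df a \<otimes>\<^bsub>B1,H\<^esub> b) g"
    by (intro sw_cong refl) (simp add: df_cl duniv_def lin_diff[OF cl_lin_T] tens_linear tens_B1)
  finally show ?thesis .
qed

text \<open>The right-handed counterpart \<open>(dx\<^sub>1) (S x\<^sub>2)\<close> of the
  Maurer-Cartan form \<open>(S x\<^sub>1) dx\<^sub>2\<close>.\<close>

definition rinv :: "'a \<Rightarrow> ('k, 'a) form1" where
  "rinv x = sw (\<lambda>a b. ract B1 (df a) (antip H b)) x"

lemma rinv_mem [simp]: "x \<in> carrier H \<Longrightarrow> rinv x \<in> carrier B1"
  by (simp add: rinv_def)

lemma lin_rinv [simp]: "lin X H f \<Longrightarrow> smul U = fsmul \<Longrightarrow> carrier B1 \<subseteq> carrier U \<Longrightarrow> lin X U (\<lambda>x. rinv (f x))"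
  by (rule lin_compose_widen[where g = rinv and V = H and W = B1]) (simp_all add: rinv_def[abs_def])

text \<open>The antipode reverses the coproduct, so the coaction of
  \<open>(dx\<^sub>1) (S x\<^sub>2)\<close> is
  \<open>(dx\<^sub>1) (S x\<^sub>4) \<otimes> x\<^sub>2 (S x\<^sub>3)\<close>, and the factor in
  \<open>H\<close> cancels to the unit.\<close>

lemma rinv_right_invariant:
  assumes x: "x \<in> carrier H" shows "rinv x \<in> right_invariant H N"
proof -
  let ?F = "\<lambda>a1 u c2. ract B1 (df a1) (antip H c2) \<otimes>\<^bsub>B1,H\<^esub> u"
  have "dR (rinv x) = sw (\<lambda>a b. dR (ract B1 (df a) (antip H b))) x"
    unfolding rinv_def by (rule sw_linear[OF _ _ _ dR_lin]) (use x in simp_all)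
  also have "\<dots> = sw (\<lambda>a b. sw (\<lambda>c1 c2. sw (\<lambda>a1 a2. ?F a1 (a2 \<cdot>\<^bsub>H\<^esub> antip H c1) c2) a) b) x"
    using x by (simp add: dR_act(2) dR_df)
  also have "\<dots> = sw (\<lambda>a b. sw (\<lambda>a1 a2. sw (\<lambda>c1 c2. ?F a1 (a2 \<cdot>\<^bsub>H\<^esub> antip H c1) c2) b) a) x"
    by (intro sw_cong refl sw_swap[of fspace]) (use x in simp_all)
  also have "\<dots> = sw (\<lambda>a1 y. sw (\<lambda>a2 b. sw (\<lambda>c1 c2. ?F a1 (a2 \<cdot>\<^bsub>H\<^esub> antip H c1) c2) b) y) x"
    using x by simp
  also have "\<dots> = sw (\<lambda>a1 y. ?F a1 \<one>\<^bsub>H\<^esub> y) x"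
    by (intro sw_cong refl cancel_antip(2)[where G = "?F _"]) (use x in simp_all)
  also have "\<dots> = (rinv x \<otimes>\<^bsub>B1,H\<^esub> \<one>\<^bsub>H\<^esub>)" using x by (simp add: rinv_def)
  finally show ?thesis using x by (simp add: right_invariant_iff)
qed

text \<open>The antipode in \<open>rinv\<close> cancels against the next leg. Differentials are
  therefore sums of right multiples of right-invariant forms.\<close>

lemma df_rinv:
  assumes g: "g \<in> carrier H" shows "df g = sw (\<lambda>a b. ract B1 (rinv a) b) g"
proof -
  have "sw (\<lambda>a b. ract B1 (rinv a) b) g = sw (\<lambda>x c. sw (\<lambda>a b. ract B1 (df a) (antip H b \<cdot>\<^bsub>H\<^esub> c)) x) g"
  proof (intro sw_cong refl)
    fix x c assume xc: "x \<in> carrier H" "c \<in> carrier H"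
    have "ract B1 (rinv x) c = sw (\<lambda>a b. ract B1 (ract B1 (df a) (antip H b)) c) x"
      unfolding rinv_def by (rule sw_linear[OF _ _ _ bilinD(2)[OF B.ract_bilin]]) (use xc in simp_all)
    also have "\<dots> = sw (\<lambda>a b. ract B1 (df a) (antip H b \<cdot>\<^bsub>H\<^esub> c)) x"
      using xc by (simp add: B.act_simps)
    finally show "ract B1 (rinv x) c = sw (\<lambda>a b. ract B1 (df a) (antip H b \<cdot>\<^bsub>H\<^esub> c)) x" .
  qed
  also have "\<dots> = sw (\<lambda>a y. sw (\<lambda>b c. ract B1 (df a) (antip H b \<cdot>\<^bsub>H\<^esub> c)) y) g"
    using g by simp
  also have "\<dots> = ract B1 (df g) \<one>\<^bsub>H\<^esub>"
    by (rule cancel_antip(3)) (use g in simp_all)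
  finally show ?thesis using g by simp
qed

text \<open>The inversion of \<open>dg = g\<^sub>1 e(g\<^sub>2)\<close> by the antipode.\<close>

lemma E_df:
  assumes g: "g \<in> carrier H" shows "E \<one>\<^bsub>H\<^esub> g = sw (\<lambda>a b. lact B1 (antip H a) (df b)) g"
proof -
  have "sw (\<lambda>a b. lact B1 (antip H a) (df b)) g = sw (\<lambda>a y. sw (\<lambda>b c. E (antip H a \<cdot>\<^bsub>H\<^esub> b) c) y) g"
  proof (intro sw_cong refl)
    fix a b assume ab: "a \<in> carrier H" "b \<in> carrier H"
    have "lact B1 (antip H a) (sw E b) = sw (\<lambda>x y. lact B1 (antip H a) (E x y)) b"
      by (rule sw_linear[OF _ _ _ bilinD(1)[OF B.lact_bilin]]) (use ab in simp_all)
    then show "lact B1 (antip H a) (df b) = sw (\<lambda>x y. E (antip H a \<cdot>\<^bsub>H\<^esub> x) y) b"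
      using ab by (simp add: df_E)
  qed
  also have "\<dots> = E \<one>\<^bsub>H\<^esub> g" by (rule cancel_antip(1)) (use g in simp_all)
  finally show ?thesis ..
qed

end

subsection \<open>The braiding\<close>

context calculus
begin

sublocale BB: bimod H B.BB
  by (rule bimod_intro[OF algebra_on_axioms B.bimodule_BB])

text \<open>With \<open>w\<^sub>0 \<otimes> w\<^sub>1\<close> the right coaction on \<open>w\<close>, the braiding is
  \<open>h e(g) \<otimes> w \<mapsto> h w\<^sub>0 \<otimes> e(g w\<^sub>1)\<close>.  In this form that it is balanced, is a bimodule map and flips
  invariant forms does not involve the antipode.\<close>

definition flip_E :: "('k, 'a) form1 \<Rightarrow> 'a \<Rightarrow> 'a \<Rightarrow> ('k, ('k, ('k, 'a) form1, ('k, 'a) form1) ten) quo" where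
  "flip_E w h g = lift B1 H (\<lambda>v y. B.bt (lact B1 h v) (E \<one>\<^bsub>H\<^esub> (pr g \<cdot>\<^bsub>H\<^esub> y))) (dR w)"

definition flip :: "('k, 'a) form1 \<Rightarrow> ('k, 'a) form1 \<Rightarrow> ('k, ('k, ('k, 'a) form1, ('k, 'a) form1) ten) quo" where
  "flip v w = Elift (flip_E w) v"

lemma E_0 [simp]: "h \<in> carrier H \<Longrightarrow> E h 0 = 0"
  using lin_0[OF bilinD(1)[OF E_bilin]] by simp

lemma flip_E_bilin: "w \<in> carrier B1 \<Longrightarrow> bilin H H B.BB (flip_E w)"
  by (simp add: flip_E_def[abs_def])

lemma flip_E_lin: "h \<in> carrier H \<Longrightarrow> g \<in> carrier H \<Longrightarrow> lin B1 B.BB (\<lambda>w. flip_E w h g)"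
  by (simp add: flip_E_def)

text \<open>\<open>pr\<close> kills the unit, and for \<open>q\<close> in \<open>Q\<close> the
  product \<open>q w\<^sub>1\<close> stays in the right ideal \<open>Q\<close>, where
  \<open>e\<close> vanishes. These are the two conditions for extending \<open>flip_E\<close> to all
  one-forms by \<open>Elift\<close>.\<close>

lemma flip_E_vanish:
  assumes "w \<in> carrier B1" "h \<in> carrier H"
  shows "flip_E w h \<one>\<^bsub>H\<^esub> = 0" "q \<in> Q \<Longrightarrow> flip_E w h q = 0"
  using assms by (simp_all add: flip_E_def pr_id)

lemmas flip_Elift = Elift_lin[OF B.vspace_BB flip_E_bilin flip_E_vanish] Elift_E[OF B.vspace_BB flip_E_bilin flip_E_vanish]
  Elift_cl[OF B.vspace_BB flip_E_bilin flip_E_vanish]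

lemma flip_EE: "w \<in> carrier B1 \<Longrightarrow> h \<in> carrier H \<Longrightarrow> g \<in> carrier H \<Longrightarrow> flip (E h g) w = flip_E w h g"
  unfolding flip_def by (rule flip_Elift(2))

lemma flip_bilin: "bilin B1 B1 B.BB flip"
proof (rule bilinI)
  show "lin B1 B.BB (\<lambda>v. flip v w)" if "w \<in> carrier B1" for w
    unfolding flip_def by (rule flip_Elift(1)) (use that in simp_all)
  show "lin B1 B.BB (flip v)" if v: "v \<in> carrier B1" for v
  proof -
    \<comment> \<open>For a fixed representative \<open>t\<close> of \<open>v\<close> the flip
      becomes a lift of \<open>flip_E w\<close> over one and the same tensor, which makes its
      linearity in \<open>w\<close> visible.\<close>
    obtain t where t: "t \<in> carrier (univ H)" "v = cl t" using v by (auto simp: carrier_B1)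
    have "lin B1 B.BB (\<lambda>w. lift H H (flip_E w) (triv H t))"
      by (rule lin_lift2) (use t flip_E_bilin in \<open>simp_all add: flip_E_lin univ_T\<close>)
    moreover have "flip v w = lift H H (flip_E w) (triv H t)" if "w \<in> carrier B1" for w
      unfolding flip_def t(2) by (rule flip_Elift(3)) (use that t in simp_all)
    ultimately show ?thesis
      using iffD2[OF lin_cong[OF _ B.vspace_B, of "flip v" "\<lambda>w. lift H H (flip_E w) (triv H t)" B.BB]] by blast
  qed
qed

text \<open>With \<open>g\<close> in \<open>ker \<epsilon>\<close>, both sides are
  \<open>h a\<^sub>1 w\<^sub>0 \<otimes> e(g a\<^sub>2 w\<^sub>1)\<close>: on the left by
  \<open>e(g) a = a\<^sub>1 e(g a\<^sub>2)\<close>, on the right because the coaction of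
  \<open>a w\<close> is \<open>a\<^sub>1 w\<^sub>0 \<otimes> a\<^sub>2 w\<^sub>1\<close>.\<close>

lemma flip_balanced:
  assumes v: "v \<in> carrier B1" and a: "a \<in> carrier H" and w: "w \<in> carrier B1"
  shows "flip (ract B1 v a) w = flip v (lact B1 a w)"
proof (rule B1_ext[where U = B.BB and f = "\<lambda>v. flip (ract B1 v a) w" and g = "\<lambda>v. flip v (lact B1 a w)", OF _ _ _ _ v])
  show "lin B1 B.BB (\<lambda>v. flip (ract B1 v a) w)"
    by (rule lin_compose[OF bilinD(2)[OF flip_bilin w] bilinD(2)[OF B.ract_bilin a]])
  show "lin B1 B.BB (\<lambda>v. flip v (lact B1 a w))"
    by (rule bilinD(2)[OF flip_bilin]) (use a w in simp)
  fix h g assume hg: "h \<in> carrier H" "g \<in> carrier H"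
  have "flip (ract B1 (E h g) a) w = sw (\<lambda>a1 a2. flip (E (h \<cdot>\<^bsub>H\<^esub> a1) (pr g \<cdot>\<^bsub>H\<^esub> a2)) w) a"
    unfolding ract_E[OF a hg] by (rule sw_linear[OF _ _ _ bilinD(2)[OF flip_bilin w]]) (use a hg in simp_all)
  also have "\<dots> = sw (\<lambda>a1 a2. flip_E w (h \<cdot>\<^bsub>H\<^esub> a1) (pr g \<cdot>\<^bsub>H\<^esub> a2)) a"
    using hg w a by (simp add: flip_EE)
  also have "\<dots> = flip_E (lact B1 a w) h g"
    using a w hg by (simp add: flip_E_def dR_act(1) pr_id B.act_simps mul_assoc)
  also have "\<dots> = flip (E h g) (lact B1 a w)" using a w hg by (simp add: flip_EE)
  finally show "flip (ract B1 (E h g) a) w = flip (E h g) (lact B1 a w)" .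
qed simp

lemma flip_lact:
  assumes v: "v \<in> carrier B1" and a: "a \<in> carrier H" and w: "w \<in> carrier B1"
  shows "flip (lact B1 a v) w = lact B.BB a (flip v w)"
proof (rule B1_ext[where U = B.BB and f = "\<lambda>v. flip (lact B1 a v) w" and g = "\<lambda>v. lact B.BB a (flip v w)", OF _ _ _ _ v])
  show "lin B1 B.BB (\<lambda>v. flip (lact B1 a v) w)"
    by (rule lin_compose[OF bilinD(2)[OF flip_bilin w] bilinD(1)[OF B.lact_bilin a]])
  show "lin B1 B.BB (\<lambda>v. lact B.BB a (flip v w))"
    by (rule lin_compose[OF B.BB_lact(1)[OF a] bilinD(2)[OF flip_bilin w]])
  fix h g assume hg: "h \<in> carrier H" "g \<in> carrier H"
  have "lact B.BB a (flip_E w h g) = lift B1 H (\<lambda>v y. lact B.BB a (B.bt (lact B1 h v) (E \<one>\<^bsub>H\<^esub> (pr g \<cdot>\<^bsub>H\<^esub> y)))) (dR w)"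
    unfolding flip_E_def by (rule lift_lin[OF _ _ _ _ _ B.BB_lact(1)[OF a]]) (use hg w in simp_all)
  then show "flip (lact B1 a (E h g)) w = lact B.BB a (flip (E h g) w)"
    using hg a w by (simp add: flip_EE B.BB_lact(2) B.act_simps) (simp add: flip_E_def B.act_simps)
qed simp

text \<open>The coaction of \<open>w a\<close> is
  \<open>w\<^sub>0 a\<^sub>1 \<otimes> w\<^sub>1 a\<^sub>2\<close>. Moving \<open>a\<^sub>1\<close>
  across the balanced tensor product leaves \<open>a\<^sub>1 e(g w\<^sub>1 a\<^sub>2)\<close> in the
  second factor, which is \<open>e(g w\<^sub>1) a\<close>.\<close>

lemma flip_ract:
  assumes v: "v \<in> carrier B1" and a: "a \<in> carrier H" and w: "w \<in> carrier B1"
  shows "flip v (ract B1 w a) = ract B.BB (flip v w) a"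
proof (rule B1_ext[where U = B.BB and f = "\<lambda>v. flip v (ract B1 w a)" and g = "\<lambda>v. ract B.BB (flip v w) a", OF _ _ _ _ v])
  show "lin B1 B.BB (\<lambda>v. flip v (ract B1 w a))"
    by (rule bilinD(2)[OF flip_bilin]) (use a w in simp)
  show "lin B1 B.BB (\<lambda>v. ract B.BB (flip v w) a)"
    by (rule lin_compose[OF B.BB_ract(1)[OF a] bilinD(2)[OF flip_bilin w]])
  fix h g assume hg: "h \<in> carrier H" "g \<in> carrier H"
  have e: "ract B1 (E \<one>\<^bsub>H\<^esub> (pr g \<cdot>\<^bsub>H\<^esub> y)) a = sw (\<lambda>a1 a2. lact B1 a1 (E \<one>\<^bsub>H\<^esub> (pr g \<cdot>\<^bsub>H\<^esub> (y \<cdot>\<^bsub>H\<^esub> a2)))) a"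
    if "y \<in> carrier H" for y using that a hg by (simp add: ract_E pr_id mul_assoc)
  have "flip_E (ract B1 w a) h g = sw (\<lambda>a1 a2. lift B1 H (\<lambda>v y. B.bt (lact B1 h (ract B1 v a1)) (E \<one>\<^bsub>H\<^esub> (pr g \<cdot>\<^bsub>H\<^esub> (y \<cdot>\<^bsub>H\<^esub> a2)))) (dR w)) a"
    using hg w a by (simp add: flip_E_def dR_act(2))
  also have "\<dots> = sw (\<lambda>a1 a2. lift B1 H (\<lambda>v y. B.bt (lact B1 h v) (lact B1 a1 (E \<one>\<^bsub>H\<^esub> (pr g \<cdot>\<^bsub>H\<^esub> (y \<cdot>\<^bsub>H\<^esub> a2))))) (dR w)) a"
    using hg by (intro sw_cong lift_cong refl) (simp add: B.bt_balanced B.act_simps(3)[symmetric])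
  also have "\<dots> = lift B1 H (\<lambda>v y. sw (\<lambda>a1 a2. B.bt (lact B1 h v) (lact B1 a1 (E \<one>\<^bsub>H\<^esub> (pr g \<cdot>\<^bsub>H\<^esub> (y \<cdot>\<^bsub>H\<^esub> a2))))) a) (dR w)"
    by (rule sw_lift_swap[of fspace]) (use hg w a in simp_all)
  also have "\<dots> = lift B1 H (\<lambda>v y. ract B.BB (B.bt (lact B1 h v) (E \<one>\<^bsub>H\<^esub> (pr g \<cdot>\<^bsub>H\<^esub> y))) a) (dR w)"
  proof (intro lift_cong)
    fix v y assume vy: "v \<in> carrier B1" "y \<in> carrier H"
    have "sw (\<lambda>a1 a2. B.bt (lact B1 h v) (lact B1 a1 (E \<one>\<^bsub>H\<^esub> (pr g \<cdot>\<^bsub>H\<^esub> (y \<cdot>\<^bsub>H\<^esub> a2))))) a =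
      B.bt (lact B1 h v) (sw (\<lambda>a1 a2. lact B1 a1 (E \<one>\<^bsub>H\<^esub> (pr g \<cdot>\<^bsub>H\<^esub> (y \<cdot>\<^bsub>H\<^esub> a2)))) a)"
      by (rule sw_linear[OF _ _ _ bilinD(1)[OF B.bt_bilin], symmetric]) (use vy hg a in simp_all)
    then show "sw (\<lambda>a1 a2. B.bt (lact B1 h v) (lact B1 a1 (E \<one>\<^bsub>H\<^esub> (pr g \<cdot>\<^bsub>H\<^esub> (y \<cdot>\<^bsub>H\<^esub> a2))))) a =
      ract B.BB (B.bt (lact B1 h v) (E \<one>\<^bsub>H\<^esub> (pr g \<cdot>\<^bsub>H\<^esub> y))) a"
      using vy hg a by (simp only: e[OF vy(2), symmetric]) (simp add: B.BB_ract(2))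
  qed
  also have "\<dots> = ract B.BB (flip_E w h g) a"
    unfolding flip_E_def by (rule lift_lin[OF _ _ _ _ _ B.BB_ract(1)[OF a], symmetric]) (use hg w in simp_all)
  finally show "flip (E h g) (ract B1 w a) = ract B.BB (flip (E h g) w) a" using a w hg by (simp add: flip_EE)
qed simp

text \<open>The map induced by \<open>flip\<close>. For left-invariant \<open>v = e(g)\<close> and
  right-invariant \<open>w\<close> the coaction of \<open>w\<close> is \<open>w \<otimes> 1\<close>,
  and the formula collapses to \<open>w \<otimes> v\<close>. The explicit formula is kept in the
  statement so that uniqueness can later attach it to \<open>braiding\<close>.\<close>

lemma braiding_exists:
  "\<exists>\<Psi>. bimodule_map H B.BB B.BB \<Psi> \<and> (\<forall>v\<in>carrier B1. \<forall>w\<in>carrier B1. \<Psi> (B.bt v w) = flip v w) \<and>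
     (\<forall>v\<in>left_invariant H N. \<forall>w\<in>right_invariant H N. \<Psi> (B.bt v w) = B.bt w v)"
proof -
  obtain \<Psi> where \<Psi>: "lin B.BB B.BB \<Psi>" "\<And>v w. v \<in> carrier B1 \<Longrightarrow> w \<in> carrier B1 \<Longrightarrow> \<Psi> (B.bt v w) = flip v w"
    using B.bal_lift[OF B.vspace_BB flip_bilin flip_balanced] by metis
  have "\<Psi> (lact B.BB a x) = lact B.BB a (\<Psi> x)" if a: "a \<in> carrier H" and x: "x \<in> carrier B.BB" for a x
    by (rule B.bal_ext[where U = B.BB and U' = B.BB and f = "\<lambda>x. \<Psi> (lact B.BB a x)" and g = "\<lambda>x. lact B.BB a (\<Psi> x)", OF _ _ _ x])
      (use a in \<open>simp_all add: lin_compose[OF \<Psi>(1) B.BB_lact(1)] lin_compose[OF B.BB_lact(1) \<Psi>(1)] \<Psi>(2) B.BB_lact(2) flip_lact\<close>)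
  moreover have "\<Psi> (ract B.BB x a) = ract B.BB (\<Psi> x) a" if a: "a \<in> carrier H" and x: "x \<in> carrier B.BB" for a x
    by (rule B.bal_ext[where U = B.BB and U' = B.BB and f = "\<lambda>x. \<Psi> (ract B.BB x a)" and g = "\<lambda>x. ract B.BB (\<Psi> x) a", OF _ _ _ x])
      (use a in \<open>simp_all add: lin_compose[OF \<Psi>(1) B.BB_ract(1)] lin_compose[OF B.BB_ract(1) \<Psi>(1)] \<Psi>(2) B.BB_ract(2) flip_ract\<close>)
  moreover have "\<Psi> (B.bt v w) = B.bt w v" if v: "v \<in> left_invariant H N" and w: "w \<in> right_invariant H N" for v w
  proof -
    obtain g where g: "g \<in> carrier H" "v = E \<one>\<^bsub>H\<^esub> g" using left_invariant_E[OF v] by blast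
    have w': "w \<in> carrier B1" "dR w = (w \<otimes>\<^bsub>B1,H\<^esub> \<one>\<^bsub>H\<^esub>)" using w by (auto simp: right_invariant_iff)
    show ?thesis using g w' by (simp add: \<Psi>(2) flip_EE flip_E_def)
  qed
  ultimately show ?thesis using \<Psi> by (auto simp: bimodule_map_def)
qed

section \<open>Uniqueness of the braiding\<close>

abbreviation \<Psi> where "\<Psi> \<equiv> braiding H N"

lemma braiding_spec:
  "bimodule_map H B.BB B.BB \<Psi>"
  "v \<in> left_invariant H N \<Longrightarrow> w \<in> right_invariant H N \<Longrightarrow> \<Psi> (B.bt v w) = B.bt w v"
proof -
  have "\<exists>\<Psi>. bimodule_map H B.BB B.BB \<Psi> \<and>
     (\<forall>v\<in>left_invariant H N. \<forall>w\<in>right_invariant H N. \<Psi> (baltens H B1 v w) = baltens H B1 w v)"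
    using braiding_exists unfolding B.bt_def by blast
  from someI_ex[OF this] show "bimodule_map H B.BB B.BB \<Psi>"
    "v \<in> left_invariant H N \<Longrightarrow> w \<in> right_invariant H N \<Longrightarrow> \<Psi> (B.bt v w) = B.bt w v"
    unfolding braiding_def B.bt_def by blast+
qed

text \<open>The elements \<open>h (e(g) \<otimes> rinv x) c\<close> span the balanced tensor square.
  In a second factor \<open>k e(g)\<close> the coefficient \<open>k\<close> passes to the first
  factor; writing \<open>e(g) = (S g\<^sub>1) dg\<^sub>2\<close>, so does
  \<open>S g\<^sub>1\<close>; and \<open>dg\<^sub>2\<close> is a sum of right multiples of
  \<open>rinv\<close>. The first factor, whatever it has become, is a sum of terms
  \<open>h e(g)\<close>.\<close>

lemma BB_ext_invariant:
  assumes f: "lin B.BB U f" and f': "lin B.BB U f'" and U: "vspace U"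
    and eq: "\<And>h g x c. h \<in> carrier H \<Longrightarrow> g \<in> carrier H \<Longrightarrow> x \<in> carrier H \<Longrightarrow> c \<in> carrier H \<Longrightarrow>
      f (lact B.BB h (ract B.BB (B.bt (E \<one>\<^bsub>H\<^esub> g) (rinv x)) c)) = f' (lact B.BB h (ract B.BB (B.bt (E \<one>\<^bsub>H\<^esub> g) (rinv x)) c))"
    and t: "t \<in> carrier B.BB"
  shows "f t = f' t"
proof (rule B.bal_ext[OF f f' _ t])
  have l: "lin B1 U (\<lambda>w. f (B.bt v w))" "lin B1 U (\<lambda>w. f' (B.bt v w))" if "v \<in> carrier B1" for v
    using lin_compose[OF f bilinD(1)[OF B.bt_bilin that]] lin_compose[OF f' bilinD(1)[OF B.bt_bilin that]] by auto
  have l': "lin B1 U (\<lambda>v. f (B.bt v w))" "lin B1 U (\<lambda>v. f' (B.bt v w))" if "w \<in> carrier B1" for w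
    using lin_compose[OF f bilinD(2)[OF B.bt_bilin that]] lin_compose[OF f' bilinD(2)[OF B.bt_bilin that]] by auto
  have 1: "f (B.bt v (ract B1 (rinv x) c)) = f' (B.bt v (ract B1 (rinv x) c))"
    if v: "v \<in> carrier B1" and xc: "x \<in> carrier H" "c \<in> carrier H" for v x c
    by (rule B1_ext[OF l' U _ v]) (use xc eq in \<open>simp_all add: B.BB_lact(2) B.BB_ract(2)\<close>)
  have 2: "f (B.bt v (df b)) = f' (B.bt v (df b))" if v: "v \<in> carrier B1" and b: "b \<in> carrier H" for v b
  proof -
    have "f (B.bt v (df b)) = sw (\<lambda>a c. f (B.bt v (ract B1 (rinv a) c))) b"
      unfolding df_rinv[OF b] by (rule sw_linear[OF _ U _ l(1)[OF v]]) (use b in simp_all)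
    also have "\<dots> = sw (\<lambda>a c. f' (B.bt v (ract B1 (rinv a) c))) b"
      by (intro sw_cong refl 1 v)
    also have "\<dots> = f' (B.bt v (df b))"
      unfolding df_rinv[OF b] by (rule sw_linear[OF _ U _ l(2)[OF v], symmetric]) (use b in simp_all)
    finally show ?thesis .
  qed
  fix v w assume v: "v \<in> carrier B1" and w: "w \<in> carrier B1"
  show "f (B.bt v w) = f' (B.bt v w)"
  proof (rule B1_ext[OF l(1)[OF v] l(2)[OF v] U _ w])
    fix h g assume hg: "h \<in> carrier H" "g \<in> carrier H"
    \<comment> \<open>The coefficient \<open>h\<close> of the second factor is absorbed into the
      first.\<close>
    have e: "B.bt v (E h g) = B.bt (ract B1 v h) (E \<one>\<^bsub>H\<^esub> g)" using hg v by (simp add: B.bt_balanced)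
    have v': "ract B1 v h \<in> carrier B1" using v hg by simp
    have "f (B.bt (ract B1 v h) (E \<one>\<^bsub>H\<^esub> g)) = sw (\<lambda>a b. f (B.bt (ract B1 v h) (lact B1 (antip H a) (df b)))) g"
      unfolding E_df[OF hg(2)] by (rule sw_linear[OF _ U _ l(1)[OF v']]) (use hg in simp_all)
    also have "\<dots> = sw (\<lambda>a b. f' (B.bt (ract B1 v h) (lact B1 (antip H a) (df b)))) g"
      by (intro sw_cong refl) (use v' in \<open>simp add: B.bt_balanced[symmetric] 2\<close>)
    also have "\<dots> = f' (B.bt (ract B1 v h) (E \<one>\<^bsub>H\<^esub> g))"
      unfolding E_df[OF hg(2)] by (rule sw_linear[OF _ U _ l(2)[OF v'], symmetric]) (use hg in simp_all)
    finally show "f (B.bt v (E h g)) = f' (B.bt v (E h g))" unfolding e .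
  qed
qed

lemma bimodule_map_invariant:
  assumes "bimodule_map H B.BB B.BB f"
    and "\<And>v w. v \<in> left_invariant H N \<Longrightarrow> w \<in> right_invariant H N \<Longrightarrow> f (B.bt v w) = B.bt w v"
    and "h \<in> carrier H" "g \<in> carrier H" "x \<in> carrier H" "c \<in> carrier H"
  shows "f (lact B.BB h (ract B.BB (B.bt (E \<one>\<^bsub>H\<^esub> g) (rinv x)) c)) = lact B.BB h (ract B.BB (B.bt (rinv x) (E \<one>\<^bsub>H\<^esub> g)) c)"
  using assms(1,3-) assms(2)[OF E_left_invariant rinv_right_invariant] by (simp add: bimodule_map_def)

lemma braiding_invariant:
  assumes "h \<in> carrier H" "g \<in> carrier H" "x \<in> carrier H" "c \<in> carrier H"
  shows "\<Psi> (lact B.BB h (ract B.BB (B.bt (E \<one>\<^bsub>H\<^esub> g) (rinv x)) c)) = lact B.BB h (ract B.BB (B.bt (rinv x) (E \<one>\<^bsub>H\<^esub> g)) c)"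
  using bimodule_map_invariant[of \<Psi>] braiding_spec assms by blast

lemma \<Psi>_lin: "lin B.BB B.BB \<Psi>"
  using braiding_spec(1) by (simp add: bimodule_map_def)

text \<open>Both \<open>\<Psi>\<close> and the map induced by \<open>flip\<close> are bimodule maps
  that flip invariant forms, so they agree on the spanning set of
  \<open>BB_ext_invariant\<close>.\<close>

lemma braiding_bt:
  assumes "v \<in> carrier B1" "w \<in> carrier B1"
  shows "\<Psi> (B.bt v w) = flip v w"
proof -
  obtain \<Phi> where \<Phi>: "bimodule_map H B.BB B.BB \<Phi>" "\<And>v w. v \<in> carrier B1 \<Longrightarrow> w \<in> carrier B1 \<Longrightarrow> \<Phi> (B.bt v w) = flip v w"
    "\<And>v w. v \<in> left_invariant H N \<Longrightarrow> w \<in> right_invariant H N \<Longrightarrow> \<Phi> (B.bt v w) = B.bt w v"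
    using braiding_exists by blast
  have "\<Psi> (B.bt v w) = \<Phi> (B.bt v w)"
  proof (rule BB_ext_invariant[OF \<Psi>_lin _ B.vspace_BB])
    show "lin B.BB B.BB \<Phi>" using \<Phi>(1) by (simp add: bimodule_map_def)
  qed (use assms in \<open>simp_all only: bimodule_map_invariant[OF \<Phi>(1,3)] braiding_invariant B.bt_mem\<close>)
  then show ?thesis using \<Phi>(2) assms by simp
qed

section \<open>Two-forms and the exterior derivative\<close>

abbreviation K where "K \<equiv> braid_ker H N"

lemma K_iff: "t \<in> K \<longleftrightarrow> t \<in> carrier B.BB \<and> \<Psi> t = t"
  by (auto simp: braid_ker_def)

lemma subsp_K [simp]: "subsp B.BB K"
  unfolding subsp_iff[OF B.vspace_BB] using linD(2,3)[OF \<Psi>_lin] lin_0[OF \<Psi>_lin] by (auto simp: K_iff)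

lemma K_act [simp]: "a \<in> carrier H \<Longrightarrow> n \<in> K \<Longrightarrow> lact B.BB a n \<in> K" "a \<in> carrier H \<Longrightarrow> n \<in> K \<Longrightarrow> ract B.BB n a \<in> K"
  using braiding_spec(1) by (auto simp: K_iff bimodule_map_def)

abbreviation B2 :: "('k, 'a, ('k, 'a) form2) bimod" where
  "B2 \<equiv> forms2 H N"

sublocale B2: bimod H B2
  unfolding forms2_quot by (rule bimod_intro[OF algebra_on_axioms BB.quot_bimodule]) simp_all

lemma carrier_B2: "carrier B2 = proj B.BB K ` carrier B.BB"
  by (simp only: forms2_quot quot_bimod_simps)

lemma smul_B2 [simp]: "smul B2 = fsmul"
  by (simp add: forms2_quot quot_bimod_simps)

lemma ract_B2: "a \<in> carrier H \<Longrightarrow> t \<in> carrier B.BB \<Longrightarrow> ract B2 (proj B.BB K t) a = proj B.BB K (ract B.BB t a)"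
  using BB.quot_ract_lin(1)[OF subsp_K K_act] by (simp add: forms2_quot)

lemma wedge_bt: "wedge H N v w = proj B.BB K (B.bt v w)"
  by (simp add: wedge_def B.bt_def)

text \<open>The sum \<open>e(g\<^sub>1) \<otimes> e(g\<^sub>2)\<close> before the braided quotient.
  For \<open>g\<close> in \<open>ker \<epsilon>\<close> its class is the exterior derivative of
  \<open>e(g)\<close> up to sign.\<close>

definition ee :: "'a \<Rightarrow> ('k, ('k, ('k, 'a) form1, ('k, 'a) form1) ten) quo" where
  "ee g = sw (\<lambda>a b. B.bt (E \<one>\<^bsub>H\<^esub> a) (E \<one>\<^bsub>H\<^esub> b)) g"

lemma ee_mem [simp]: "g \<in> carrier H \<Longrightarrow> ee g \<in> carrier B.BB"
  by (simp add: ee_def)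

text \<open>Apply \<open>d\<close> to \<open>(S g\<^sub>1) g\<^sub>2 = \<epsilon>(g) 1\<close>. The
  right side gives zero, and the Leibniz rule turns the left side into the wanted sum plus
  \<open>(S g\<^sub>1) dg\<^sub>2 = e(g)\<close>.\<close>

lemma df_antip:
  assumes g: "g \<in> carrier H" shows "sw (\<lambda>a b. ract B1 (df (antip H a)) b) g = - E \<one>\<^bsub>H\<^esub> g"
proof -
  have "sw (\<lambda>a b. ract B1 (df (antip H a)) b) g = sw (\<lambda>a b. df (antip H a \<cdot>\<^bsub>H\<^esub> b) - lact B1 (antip H a) (df b)) g"
    by (intro sw_cong refl) (simp add: df_mult)
  also have "\<dots> = sw (\<lambda>a b. df (antip H a \<cdot>\<^bsub>H\<^esub> b)) g - sw (\<lambda>a b. lact B1 (antip H a) (df b)) g"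
    by (rule sw_diff) (use g in simp_all)
  finally show ?thesis
    unfolding E_df[OF g, symmetric] using sw_antip_in(1)[of fspace df g] g by simp
qed

text \<open>Expand the second factor by \<open>dg = g\<^sub>1 e(g\<^sub>2)\<close>, move its
  coefficient across the balanced tensor product, and apply \<open>df_antip\<close> to the first
  factor.\<close>

lemma df_antip_df:
  assumes g: "g \<in> carrier H" shows "sw (\<lambda>a b. B.bt (df (antip H a)) (df b)) g = - ee g"
proof -
  have "sw (\<lambda>a b. B.bt (df (antip H a)) (df b)) g = sw (\<lambda>a y. sw (\<lambda>b c. B.bt (ract B1 (df (antip H a)) b) (E \<one>\<^bsub>H\<^esub> c)) y) g"
  proof (intro sw_cong refl)
    fix a y assume ay: "a \<in> carrier H" "y \<in> carrier H"
    have "B.bt (df (antip H a)) (df y) = sw (\<lambda>b c. B.bt (df (antip H a)) (E b c)) y"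
      unfolding df_E[OF ay(2)] by (rule sw_linear[OF _ _ _ bilinD(1)[OF B.bt_bilin]]) (use ay in simp_all)
    also have "\<dots> = sw (\<lambda>b c. B.bt (ract B1 (df (antip H a)) b) (E \<one>\<^bsub>H\<^esub> c)) y"
      by (intro sw_cong refl) (use ay in \<open>simp add: B.bt_balanced\<close>)
    finally show "B.bt (df (antip H a)) (df y) = sw (\<lambda>b c. B.bt (ract B1 (df (antip H a)) b) (E \<one>\<^bsub>H\<^esub> c)) y" .
  qed
  also have "\<dots> = sw (\<lambda>x c. sw (\<lambda>a b. B.bt (ract B1 (df (antip H a)) b) (E \<one>\<^bsub>H\<^esub> c)) x) g"
    by (rule coassoc_in[OF vspace_fspace, symmetric]) (use g in simp_all)
  also have "\<dots> = sw (\<lambda>x c. - B.bt (E \<one>\<^bsub>H\<^esub> x) (E \<one>\<^bsub>H\<^esub> c)) g"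
  proof (intro sw_cong refl)
    fix x c assume xc: "x \<in> carrier H" "c \<in> carrier H"
    have l: "lin B1 B.BB (\<lambda>v. B.bt v (E \<one>\<^bsub>H\<^esub> c))" using xc by simp
    have "sw (\<lambda>a b. B.bt (ract B1 (df (antip H a)) b) (E \<one>\<^bsub>H\<^esub> c)) x = B.bt (- E \<one>\<^bsub>H\<^esub> x) (E \<one>\<^bsub>H\<^esub> c)"
      unfolding df_antip[OF xc(1), symmetric] by (rule sw_linear[OF _ _ _ l, symmetric]) (use xc in simp_all)
    then show "sw (\<lambda>a b. B.bt (ract B1 (df (antip H a)) b) (E \<one>\<^bsub>H\<^esub> c)) x = - B.bt (E \<one>\<^bsub>H\<^esub> x) (E \<one>\<^bsub>H\<^esub> c)"
      using lin_neg[OF l] xc by simp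
  qed
  also have "\<dots> = - ee g"
    unfolding ee_def using sw_diff[of "\<lambda>a b. 0" "\<lambda>a b. B.bt (E \<one>\<^bsub>H\<^esub> a) (E \<one>\<^bsub>H\<^esub> b)" g] g by (simp add: sw2_def)
  finally show ?thesis .
qed

text \<open>The exterior derivative of a universal form, with values in the balanced tensor square.
  That it maps \<open>N\<close> into \<open>K\<close>, as \<open>d1\<close> requires, is the lemma
  \<open>dd_N\<close>.\<close>

definition dd :: "('k, 'a, 'a) ten \<Rightarrow> ('k, ('k, ('k, 'a) form1, ('k, 'a) form1) ten) quo" where
  "dd = lift H H (\<lambda>a b. B.bt (df a) (df b))"

lemma dd_lin: "lin T B.BB dd"
  unfolding dd_def by (rule lin_lift) simp_all

text \<open>The Leibniz rule for \<open>d (h (S g\<^sub>1))\<close> splits the sum in two: the term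
  with \<open>dh\<close> collects \<open>(S g\<^sub>1) dg\<^sub>2 = e(g)\<close> in the second
  factor, and the other is \<open>h\<close> times the sum of \<open>df_antip_df\<close>.\<close>

lemma dd_trivi:
  assumes hg: "h \<in> carrier H" "g \<in> carrier H"
  shows "dd (trivi (h \<otimes>\<^bsub>H,H\<^esub> g)) = B.bt (df h) (E \<one>\<^bsub>H\<^esub> g) - lact B.BB h (ee g)"
proof -
  have "dd (trivi (h \<otimes>\<^bsub>H,H\<^esub> g)) = sw (\<lambda>a b. B.bt (df (h \<cdot>\<^bsub>H\<^esub> antip H a)) (df b)) g"
    using hg by (simp add: trivi_tens dd_def)
  also have "\<dots> = sw (\<lambda>a b. B.bt (df h) (lact B1 (antip H a) (df b)) + lact B.BB h (B.bt (df (antip H a)) (df b))) g"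
  proof (intro sw_cong refl)
    fix a b assume ab: "a \<in> carrier H" "b \<in> carrier H"
    have l: "lin B1 B.BB (\<lambda>v. B.bt v (df b))" using ab by simp
    show "B.bt (df (h \<cdot>\<^bsub>H\<^esub> antip H a)) (df b) = B.bt (df h) (lact B1 (antip H a) (df b)) + lact B.BB h (B.bt (df (antip H a)) (df b))"
      using ab hg by (simp add: df_mult linD(2)[OF l] B.bt_balanced B.BB_lact(2))
  qed
  also have "\<dots> = sw (\<lambda>a b. B.bt (df h) (lact B1 (antip H a) (df b))) g + sw (\<lambda>a b. lact B.BB h (B.bt (df (antip H a)) (df b))) g"
    by (rule sw_add) (use hg in simp_all)
  finally have 1: "dd (trivi (h \<otimes>\<^bsub>H,H\<^esub> g)) = \<dots>" .
  have 2: "sw (\<lambda>a b. B.bt (df h) (lact B1 (antip H a) (df b))) g = B.bt (df h) (E \<one>\<^bsub>H\<^esub> g)"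
    unfolding E_df[OF hg(2)] by (rule sw_linear[OF _ _ _ bilinD(1)[OF B.bt_bilin], symmetric]) (use hg in simp_all)
  have 3: "sw (\<lambda>a b. lact B.BB h (B.bt (df (antip H a)) (df b))) g = lact B.BB h (- ee g)"
    unfolding df_antip_df[OF hg(2), symmetric] by (rule sw_linear[OF _ _ _ B.BB_lact(1), symmetric]) (use hg in simp_all)
  show ?thesis unfolding 1 2 3 using lin_neg[OF B.BB_lact(1)[OF hg(1)]] hg by simp
qed

text \<open>Braiding \<open>e(q\<^sub>1) \<otimes> e(q\<^sub>2)\<close> gives a sum of terms
  \<open>e(b) \<otimes> e(pr(q\<^sub>1) y)\<close> with \<open>b \<otimes> y\<close> the adjoint
  coaction of \<open>q\<^sub>2\<close>. The part of \<open>pr(q\<^sub>1)\<close> without counit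
  returns the original element, since \<open>q\<^sub>1\<close> cancels the antipode in
  \<open>Ad\<close>; the counit part vanishes because \<open>Ad q\<close> lies in
  \<open>Q \<otimes> H\<close>.\<close>

lemma ee_Q:
  assumes q: "q \<in> Q" shows "ee q \<in> K"
proof -
  have q': "q \<in> carrier H" using q by simp
  let ?L = "\<lambda>z. lift H H (\<lambda>b y. B.bt (E \<one>\<^bsub>H\<^esub> b) (E \<one>\<^bsub>H\<^esub> (z \<cdot>\<^bsub>H\<^esub> y)))"
  have "\<Psi> (ee q) = sw (\<lambda>x z. flip (E \<one>\<^bsub>H\<^esub> x) (E \<one>\<^bsub>H\<^esub> z)) q"
    unfolding ee_def using q' by (subst sw_linear[OF _ _ _ \<Psi>_lin]) (simp_all add: braiding_bt)
  also have "\<dots> = sw (\<lambda>x z. ?L (pr x) (Ad H z)) q"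
    by (intro sw_cong refl) (simp add: flip_EE flip_E_def dR_E)
  \<comment> \<open>Split \<open>pr x\<close> into \<open>x\<close> and its counit multiple of the
    unit.\<close>
  also have "\<dots> = sw (\<lambda>x z. ?L x (Ad H z) - fsmul (counit H x) (?L \<one>\<^bsub>H\<^esub> (Ad H z))) q"
  proof (intro sw_cong refl)
    fix x z assume xz: "x \<in> carrier H" "z \<in> carrier H"
    have l: "lin H fspace (\<lambda>x. ?L x (Ad H z))" using xz by simp
    show "?L (pr x) (Ad H z) = ?L x (Ad H z) - fsmul (counit H x) (?L \<one>\<^bsub>H\<^esub> (Ad H z))"
      using lin_diff[OF l, of x "smul H (counit H x) \<one>\<^bsub>H\<^esub>"] linD(3)[OF l, of "\<one>\<^bsub>H\<^esub>" "counit H x"] xz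
      by (simp add: pr_def)
  qed
  also have "\<dots> = sw (\<lambda>x z. ?L x (Ad H z)) q - ?L \<one>\<^bsub>H\<^esub> (Ad H q)"
    using q' by (subst sw_diff) simp_all
  finally have 1: "\<Psi> (ee q) = \<dots>" .
  \<comment> \<open>The Ad-stability of \<open>Q\<close> enters here: the first leg of
    \<open>Ad q\<close> is in \<open>Q\<close>, where \<open>e\<close> is zero.\<close>
  have 2: "?L \<one>\<^bsub>H\<^esub> (Ad H q) = 0"
    by (rule lift_eq_0[OF _ _ _ _ _ _ Q_Ad[OF q], where U = fspace]) simp_all
  have "sw (\<lambda>x z. ?L x (Ad H z)) q = sw (\<lambda>x z. sw (\<lambda>a y. sw (\<lambda>b c. B.bt (E \<one>\<^bsub>H\<^esub> b) (E \<one>\<^bsub>H\<^esub> (x \<cdot>\<^bsub>H\<^esub> antip H a \<cdot>\<^bsub>H\<^esub> c))) y) z) q"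
    by (intro sw_cong refl, subst Ad_lift[where U = fspace]) (simp_all add: mul_assoc)
  also have "\<dots> = sw (\<lambda>b c. B.bt (E \<one>\<^bsub>H\<^esub> b) (E \<one>\<^bsub>H\<^esub> (\<one>\<^bsub>H\<^esub> \<cdot>\<^bsub>H\<^esub> c))) q"
    by (rule cancel_antip(2)[where G = "\<lambda>u y. sw (\<lambda>b c. B.bt (E \<one>\<^bsub>H\<^esub> b) (E \<one>\<^bsub>H\<^esub> (u \<cdot>\<^bsub>H\<^esub> c))) y"]) (use q' in simp_all)
  also have "\<dots> = ee q" unfolding ee_def using q' by simp
  finally have 3: "sw (\<lambda>x z. ?L x (Ad H z)) q = ee q" .
  show ?thesis using 1[unfolded 2 3] q' by (simp add: K_iff)
qed

lemma dd_N: assumes "n \<in> N" shows "dd n \<in> K"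
proof -
  have n: "n \<in> carrier T" "triv H n \<in> tspan H H (carrier H) Q" using assms by (auto simp: calc_iff)
  have "dd (trivi (triv H n)) \<in> K"
  proof (rule lin_tspan_in[OF vspace_alg lin_compose[OF dd_lin trivi_lin] _ _ n(2) B.vspace_BB subsp_K])
    fix h q assume hq: "h \<in> carrier H" "q \<in> Q"
    \<comment> \<open>The term with \<open>dh\<close> in \<open>dd_trivi\<close> disappears because
      \<open>e(q) = 0\<close>.\<close>
    then have "dd (trivi (h \<otimes>\<^bsub>H,H\<^esub> q)) = - lact B.BB h (ee q)" by (simp add: dd_trivi)
    moreover have "- x \<in> K" if "x \<in> K" for x
      using that lin_neg[OF \<Psi>_lin] by (simp add: K_iff)
    ultimately show "dd (trivi (h \<otimes>\<^bsub>H,H\<^esub> q)) \<in> K" using hq ee_Q by simp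
  qed simp_all
  then show ?thesis using n by simp
qed

lemma d1_cl:
  assumes t: "t \<in> carrier (univ H)" shows "d1 H N (cl t) = proj B.BB K (dd t)"
proof -
  let ?W = "lift H H (\<lambda>a b. wedge H N (d0 H N a) (d0 H N b))"
  have e: "?W t = proj B.BB K (dd t)" if "t \<in> carrier T" for t
    unfolding dd_def wedge_bt df_def[symmetric]
    by (rule lift_lin[symmetric, where U = B.BB and U' = fspace]) (use that in simp_all)
  have l: "lin T (quot B.BB K) (\<lambda>t. proj B.BB K (dd t))"
    using dd_lin by simp
  have "lin (univ H) (quot B.BB K) ?W"
    by (rule iffD2[OF lin_cong[OF e[OF univ_T] vspace_univ]]) (simp_all add: lin_narrow[OF l _ univ_sub_T])
  from descend_lin(1)[OF vspace_univ subsp_N this] show ?thesis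
    using t e dd_N N_T univ_T by (simp add: d1_def proj_univ proj_eq_0[OF B.vspace_BB subsp_K])
qed

text \<open>For \<open>h = 1\<close> the term \<open>dh \<otimes> e(g)\<close> of
  \<open>dd_trivi\<close> vanishes. What is left is the Maurer-Cartan equation.\<close>

lemma d1_E: assumes "g \<in> aug H" shows "d1 H N (E \<one>\<^bsub>H\<^esub> g) = - proj B.BB K (ee g)"
proof -
  have g: "g \<in> carrier H" "pr g = g" using assms by (auto simp: aug_def pr_id)
  have "d1 H N (E \<one>\<^bsub>H\<^esub> g) = proj B.BB K (- ee g)"
    using g assms by (simp add: E_def d1_cl dd_trivi)
  then show ?thesis using proj_linear(2)[OF B.vspace_BB, of K 0 "ee g"] by (simp add: proj_linear)
qed

subsection \<open>The Maurer--Cartan form\<close>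

abbreviation A0 :: "('k, 'a) vs" where
  "A0 \<equiv> \<lparr>carrier = aug H, smul = smul H\<rparr>"

abbreviation Om :: "('k, ('k, 'a) quo) vs" where
  "Om \<equiv> Omega0 H Q"

lemma vspace_A0 [simp]: "vspace A0"
  by (rule vspace_sub) simp_all

lemma subsp_A0 [simp]: "subsp A0 Q"
  using subsp_Q Q_aug by (auto simp: subsp_def)

lemma vspace_Om [simp]: "vspace Om"
  by (simp add: Omega0_def)

lemma smul_Om [simp]: "smul Om = fsmul"
  by (simp add: Omega0_def)

lemma pi0_A0: "pi0 H Q g = proj A0 Q (pr g)"
  unfolding pi0_def pr_def by (rule fun_cong[OF proj_space_cong]) simp

lemma carrier_Om_aug: "carrier Om = pi0 H Q ` aug H"
proof -
  have "carrier Om = proj A0 Q ` aug H" by (simp add: Omega0_def carrier_quot)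
  also have "\<dots> = pi0 H Q ` aug H" by (rule image_cong) (auto simp: pi0_A0 aug_def pr_id)
  finally show ?thesis .
qed

lemma carrier_Om: "carrier Om = pi0 H Q ` carrier H"
proof -
  have "pi0 H Q g \<in> pi0 H Q ` aug H" if "g \<in> carrier H" for g
    using that by (intro image_eqI[where x = "pr g"]) (simp_all add: pi0_A0 pr_id)
  then show ?thesis unfolding carrier_Om_aug using aug_subset by auto
qed

lemma pi0_lin: "lin H Om (pi0 H Q)"
proof -
  have "lin H A0 pr" by (rule lin_restrict[where W = H]) (use lin_pr[of H "\<lambda>x. x" H] in simp_all)
  then show ?thesis unfolding pi0_A0[abs_def] Omega0_def by (rule lin_compose[OF lin_proj[OF vspace_A0]])
qed

lemma lin_pi0 [simp]: "lin X H f \<Longrightarrow> smul U = fsmul \<Longrightarrow> carrier Om \<subseteq> carrier U \<Longrightarrow> lin X U (\<lambda>x. pi0 H Q (f x))"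
  by (rule lin_compose_widen[OF pi0_lin]) simp_all

lemma pi0_mem [simp]: "g \<in> carrier H \<Longrightarrow> pi0 H Q g \<in> carrier Om"
  by (rule linD(1)[OF pi0_lin])

lemma pi0_eq_0: "g \<in> carrier H \<Longrightarrow> pi0 H Q g = 0 \<longleftrightarrow> pr g \<in> Q"
  by (simp add: pi0_A0 proj_eq_0[OF vspace_A0 subsp_A0])

lemma pi0_unit [simp]: "pi0 H Q \<one>\<^bsub>H\<^esub> = 0"
  using subsp_Q by (simp add: pi0_eq_0 subsp_iff[OF vspace_alg])

lemma pi0_Q [simp]: "q \<in> Q \<Longrightarrow> pi0 H Q q = 0"
  by (simp add: pi0_eq_0 pr_id)

lemma maurer_cartan_eq: "maurer_cartan H Q = descend A0 Q (E \<one>\<^bsub>H\<^esub>)"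
proof -
  have "proj (univ H) N (sw (\<lambda>a b. antip H a \<otimes>\<^bsub>H,H\<^esub> b) h) = E \<one>\<^bsub>H\<^esub> h" if "h \<in> carrier A0" for h
    using that by (simp add: aug_def proj_univ E_def trivi_tens pr_id)
  then show ?thesis
    unfolding maurer_cartan_def by (rule ext[OF descend_cong])
qed

lemma E_lin_A0: "lin A0 B1 (E \<one>\<^bsub>H\<^esub>)"
  by (rule lin_narrow[OF bilinD(1)[OF E_bilin unit_mem]]) (simp_all add: aug_subset)

lemma maurer_cartan_lin: "lin Om B1 (maurer_cartan H Q)"
  unfolding maurer_cartan_eq Omega0_def by (rule descend_lin(2)[OF vspace_A0 subsp_A0 E_lin_A0]) simp

text \<open>Valid for every \<open>g\<close> and not only in \<open>ker \<epsilon>\<close>, since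
  both sides vanish at the unit. The curvature needs this form, because the legs of a coproduct need
  not lie in \<open>ker \<epsilon>\<close>.\<close>

lemma maurer_cartan_pi0: "g \<in> carrier H \<Longrightarrow> maurer_cartan H Q (pi0 H Q g) = E \<one>\<^bsub>H\<^esub> g"
  unfolding maurer_cartan_eq pi0_A0 by (subst descend_lin(1)[OF vspace_A0 subsp_A0 E_lin_A0]) simp_all

lemma maurer_cartan_mem [simp]: "v \<in> carrier Om \<Longrightarrow> maurer_cartan H Q v \<in> carrier B1"
  by (rule linD(1)[OF maurer_cartan_lin])

lemma maurer_cartan_aug:
  "v \<in> aug H \<Longrightarrow> maurer_cartan H Q (pi0 H Q v) = proj (univ H) N (sw (\<lambda>a b. antip H a \<otimes>\<^bsub>H,H\<^esub> b) v)"
  by (simp add: aug_def maurer_cartan_pi0 proj_univ E_def trivi_tens pr_id)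

lemma curvature_maurer_cartan:
  assumes "h \<in> aug H" shows "curvature H Q (maurer_cartan H Q) h = 0"
proof -
  have h: "h \<in> carrier H" using assms aug_subset by auto
  have "sw (\<lambda>a b. wedge H N (maurer_cartan H Q (pi0 H Q a)) (maurer_cartan H Q (pi0 H Q b))) h =
    sw (\<lambda>a b. proj B.BB K (B.bt (E \<one>\<^bsub>H\<^esub> a) (E \<one>\<^bsub>H\<^esub> b))) h"
    by (intro sw_cong refl) (simp add: maurer_cartan_pi0 wedge_bt)
  also have "\<dots> = proj B.BB K (ee h)"
    unfolding ee_def by (rule sw_linear[OF _ _ _ lin_proj[OF B.vspace_BB], symmetric]) (use h in simp_all)
  finally show ?thesis
    using assms h by (simp add: curvature_def maurer_cartan_pi0 d1_E)
qed

section \<open>The adjoint coaction on \<open>\<Omega>\<^sub>0\<close> and the bein property\<close>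

definition Adpi :: "('k, 'a) quo \<Rightarrow> ('k, ('k, 'a) quo, 'a) ten" where
  "Adpi = descend A0 Q (\<lambda>h. lift H H (\<lambda>g a. pi0 H Q g \<otimes>\<^bsub>Om,H\<^esub> a) (Ad H h))"

lemma Adpi_lin: "lin Om (tprod Om H) Adpi"
  and Adpi_aug: "h \<in> aug H \<Longrightarrow> Adpi (pi0 H Q h) = lift H H (\<lambda>g a. pi0 H Q g \<otimes>\<^bsub>Om,H\<^esub> a) (Ad H h)"
proof -
  have l: "lin A0 (tprod Om H) (\<lambda>h. lift H H (\<lambda>g a. pi0 H Q g \<otimes>\<^bsub>Om,H\<^esub> a) (Ad H h))"
    by (rule lin_narrow[where V = H]) (simp_all add: aug_subset)
  have 0: "lift H H (\<lambda>g a. pi0 H Q g \<otimes>\<^bsub>Om,H\<^esub> a) (Ad H q) = 0" if "q \<in> Q" for q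
    by (rule lift_eq_0[OF _ _ _ _ _ _ Q_Ad[OF that], where U = fspace]) (simp_all add: tens_linear)
  note d = descend_lin[OF vspace_A0 subsp_A0 l 0, folded Adpi_def]
  show "lin Om (tprod Om H) Adpi" using d(2) by (simp add: Omega0_def)
  show "Adpi (pi0 H Q h) = lift H H (\<lambda>g a. pi0 H Q g \<otimes>\<^bsub>Om,H\<^esub> a) (Ad H h)" if "h \<in> aug H"
    using d(1)[of h] that by (simp add: pi0_A0[of h] aug_def pr_id)
qed

lemma Adpi_pi0:
  assumes g: "g \<in> carrier H"
  shows "Adpi (pi0 H Q g) = sw (\<lambda>a y. sw (\<lambda>b c. pi0 H Q b \<otimes>\<^bsub>Om,H\<^esub> (antip H a \<cdot>\<^bsub>H\<^esub> c)) y) g"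
proof -
  let ?f = "\<lambda>g. lift H H (\<lambda>g a. pi0 H Q g \<otimes>\<^bsub>Om,H\<^esub> a) (Ad H g)"
  have l: "lin H fspace ?f" by simp
  have "pi0 H Q g = pi0 H Q (pr g)" using g by (simp add: pi0_A0 pr_id)
  then have "Adpi (pi0 H Q g) = ?f (pr g)" using Adpi_aug g by simp
  also have "\<dots> = ?f g"
  proof -
    have "?f \<one>\<^bsub>H\<^esub> = 0" by (simp add: Ad_sw tens_linear)
    then show ?thesis
      using g lin_diff[OF l, of g "smul H (counit H g) \<one>\<^bsub>H\<^esub>"] linD(3)[OF l, of "\<one>\<^bsub>H\<^esub>" "counit H g"] by (simp add: pr_def)
  qed
  also have "\<dots> = sw (\<lambda>a y. sw (\<lambda>b c. pi0 H Q b \<otimes>\<^bsub>Om,H\<^esub> (antip H a \<cdot>\<^bsub>H\<^esub> c)) y) g"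
    by (rule Ad_lift[OF vspace_fspace]) (use g in simp_all)
  finally show ?thesis .
qed

lemma Adpi_mem [simp]: "v \<in> carrier Om \<Longrightarrow> Adpi v \<in> carrier (tprod Om H)"
  by (rule linD(1)[OF Adpi_lin])

lemma lin_Adpi [simp]:
  "lin X Om f \<Longrightarrow> smul U = fsmul \<Longrightarrow> carrier (tprod Om H) \<subseteq> carrier U \<Longrightarrow> lin X U (\<lambda>x. Adpi (f x))"
  by (rule lin_compose_widen[OF Adpi_lin]) simp_all

text \<open>The adjoint coaction is
  \<open>g \<mapsto> g\<^sub>2 \<otimes> (S g\<^sub>1) g\<^sub>3\<close>. Both sides of
  coassociativity become \<open>g\<^sub>3 \<otimes> (S g\<^sub>2) g\<^sub>4 \<otimes> (S g\<^sub>1)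
  g\<^sub>5\<close>, the right one because the antipode reverses the coproduct; only the order of
  summation has to be adjusted.\<close>

lemma right_comodule_Om: "right_comodule H Om Adpi"
  unfolding right_comodule_def
proof (intro conjI ballI Adpi_lin)
  fix v assume v: "v \<in> carrier Om"
  then obtain g where g: "g \<in> carrier H" "v = pi0 H Q g" unfolding carrier_Om by blast
  let ?t = "\<lambda>r x y. (pi0 H Q r \<otimes>\<^bsub>Om,H\<^esub> x) \<otimes>\<^bsub>tprod Om H,H\<^esub> y"
  have "lift Om H (\<lambda>w h. Adpi w \<otimes>\<^bsub>tprod Om H,H\<^esub> h) (Adpi v) =
    sw (\<lambda>a y. sw (\<lambda>b c. sw (\<lambda>p q. sw (\<lambda>r s. ?t r (antip H p \<cdot>\<^bsub>H\<^esub> s) (antip H a \<cdot>\<^bsub>H\<^esub> c)) q) b) y) g"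
    using g by (simp add: Adpi_pi0)
  also have "\<dots> = sw (\<lambda>a y. sw (\<lambda>p z. sw (\<lambda>r w. sw (\<lambda>s c. ?t r (antip H p \<cdot>\<^bsub>H\<^esub> s) (antip H a \<cdot>\<^bsub>H\<^esub> c)) w) z) y) g"
    using g by simp
  also have "\<dots> = sw (\<lambda>x y. sw (\<lambda>a p. sw (\<lambda>r w. sw (\<lambda>s c. ?t r (antip H p \<cdot>\<^bsub>H\<^esub> s) (antip H a \<cdot>\<^bsub>H\<^esub> c)) w) y) x) g"
    using g by simp
  also have "\<dots> = sw (\<lambda>x y. sw (\<lambda>r w. sw (\<lambda>a p. sw (\<lambda>s c. ?t r (antip H p \<cdot>\<^bsub>H\<^esub> s) (antip H a \<cdot>\<^bsub>H\<^esub> c)) w) x) y) g"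
    by (intro sw_cong refl sw_swap[of fspace]) simp_all
  also have "\<dots> = lift Om H (\<lambda>w h. sw (\<lambda>a b. (w \<otimes>\<^bsub>Om,H\<^esub> a) \<otimes>\<^bsub>tprod Om H,H\<^esub> b) h) (Adpi v)"
    using g by (simp add: Adpi_pi0)
  finally show "lift Om H (\<lambda>w h. Adpi w \<otimes>\<^bsub>tprod Om H,H\<^esub> h) (Adpi v) =
    lift Om H (\<lambda>w h. sw (\<lambda>a b. (w \<otimes>\<^bsub>Om,H\<^esub> a) \<otimes>\<^bsub>tprod Om H,H\<^esub> b) h) (Adpi v)" .
  have "lift Om H (\<lambda>w h. smul Om (counit H h) w) (Adpi v) =
    sw (\<lambda>a y. sw (\<lambda>b c. fsmul (counit H c) (fsmul (counit H a) (pi0 H Q b))) y) g"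
    using g by (simp add: Adpi_pi0 mult.commute)
  also have "\<dots> = sw (\<lambda>a y. fsmul (counit H a) (pi0 H Q y)) g"
    by (intro sw_cong refl sw_counit(2)) simp_all
  also have "\<dots> = v" using g by simp
  finally show "lift Om H (\<lambda>w h. smul Om (counit H h) w) (Adpi v) = v" .
qed

text \<open>The inverse is induced by \<open>E h g \<mapsto> h \<otimes> pi0 g\<close>. It is
  admissible for \<open>Elift\<close> because \<open>pi0\<close> vanishes at the unit and on
  \<open>Q\<close>, and the two composites are the identity on generators.\<close>

lemma bein_maurer_cartan: "bein H Q (maurer_cartan H Q)"
proof -
  let ?f = "lift H Om (\<lambda>h v. lact B1 h (maurer_cartan H Q v))"
  let ?F = "\<lambda>h g. h \<otimes>\<^bsub>H,Om\<^esub> pi0 H Q g"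
  have F: "bilin H H (tprod H Om) ?F" "\<And>h. h \<in> carrier H \<Longrightarrow> ?F h \<one>\<^bsub>H\<^esub> = 0"
    "\<And>h q. h \<in> carrier H \<Longrightarrow> q \<in> Q \<Longrightarrow> ?F h q = 0"
    by (simp_all add: tens_linear)
  note i = Elift_lin[OF vspace_tprod F] Elift_E[OF vspace_tprod F]
  have b: "bilin H Om B1 (\<lambda>h v. lact B1 h (maurer_cartan H Q v))"
    by (auto intro!: B.lin_lact2 maurer_cartan_lin)
  have l: "lin (tprod H Om) B1 ?f" by (rule lin_lift[OF _ _ _ b]) simp_all
  have ev: "?f (h \<otimes>\<^bsub>H,Om\<^esub> pi0 H Q g) = E h g" if "h \<in> carrier H" "g \<in> carrier H" for h g
    using that by (subst lift_tens_in[OF _ _ _ b]) (simp_all add: maurer_cartan_pi0)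
  have 1: "Elift ?F (?f t) = t" if t: "t \<in> carrier (tprod H Om)" for t
  proof (rule tprod_eqI[where f = "\<lambda>t. Elift ?F (?f t)" and g = "\<lambda>t. t", OF vspace_alg _ _ _ t])
    show "lin (tprod H Om) (tprod H Om) (\<lambda>t. Elift ?F (?f t))" by (rule lin_compose[OF i(1) l])
    show "lin (tprod H Om) fspace (\<lambda>t. t)" by simp
    fix h v assume h: "h \<in> carrier H" and "v \<in> carrier Om"
    then obtain g where "g \<in> carrier H" "v = pi0 H Q g" unfolding carrier_Om by blast
    then show "Elift ?F (?f (h \<otimes>\<^bsub>H,Om\<^esub> v)) = (h \<otimes>\<^bsub>H,Om\<^esub> v)" using h by (simp only: ev i(2))
  qed
  have 2: "?f (Elift ?F x) = x" if x: "x \<in> carrier B1" for x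
  proof (rule B1_ext[where f = "\<lambda>x. ?f (Elift ?F x)" and g = "\<lambda>x. x" and U = B1, OF _ _ _ _ x])
    show "lin B1 B1 (\<lambda>x. ?f (Elift ?F x))" by (rule lin_compose[OF l i(1)])
    show "?f (Elift ?F (E h g)) = E h g" if "h \<in> carrier H" "g \<in> carrier H" for h g
      using that by (simp only: ev i(2))
  qed simp_all
  have "bij_betw ?f (carrier (tprod H Om)) (carrier B1)"
    by (rule bij_betw_byWitness[where f' = "Elift ?F"]) (use 1 2 linD(1)[OF l] linD(1)[OF i(1)] in auto)
  then show ?thesis
    unfolding bein_def using right_comodule_Om maurer_cartan_lin by (simp add: Adpi_def)
qed

end

subsection \<open>The tensor product Hopf algebra\<close>

locale hopf_pair = M: hopf_alg M + H: hopf_alg H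
  for M :: "('k::field, 'm::ab_group_add) hopf" and H :: "('k, 'h::ab_group_add) hopf"
begin

sublocale MH: algebra_pair M H ..

abbreviation P :: "('k, ('k, 'm, 'h) ten) hopf" where
  "P \<equiv> tens_hopf M H"

text \<open>The underlying vector space of \<open>P\<close>. The structure maps are studied on it
  until \<open>P\<close> is known to be a Hopf algebra and the Hopf locale can be
  instantiated.\<close>

abbreviation PP :: "('k, ('k, 'm, 'h) ten) vs" where
  "PP \<equiv> tprod M H"

lemma smul_P [simp]: "smul P = fsmul"
  by (simp add: tens_hopf_def)

lemma carrier_P: "carrier P = carrier PP"
  by (simp add: tens_hopf_def)

lemma vspace_P [simp]: "vspace P"
  using vspace_tprod[of M H] by (simp add: vspace_def carrier_P)

lemma lin_P: "lin P U f \<longleftrightarrow> lin PP U f" "lin X P g \<longleftrightarrow> lin X PP g"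
  by (simp_all add: lin_def carrier_P)

lemma P_space: "tprod P P = tprod PP PP" "lift P P = lift PP PP" "(x \<otimes>\<^bsub>P,P\<^esub> y) = (x \<otimes>\<^bsub>PP,PP\<^esub> y)"
  by (rule tprod_space_cong lift_space_cong tens_cong; simp add: carrier_P)+

lemma swap:
  assumes "vspace U" "\<And>a b. a \<in> carrier M \<Longrightarrow> b \<in> carrier M \<Longrightarrow> bilin H H U (F a b)"
    "\<And>c d. c \<in> carrier H \<Longrightarrow> d \<in> carrier H \<Longrightarrow> bilin M M U (\<lambda>a b. F a b c d)" "m \<in> carrier M" "h \<in> carrier H"
  shows "H.sw (\<lambda>c d. M.sw (\<lambda>a b. F a b c d) m) h = M.sw (\<lambda>a b. H.sw (\<lambda>c d. F a b c d) h) m"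
  unfolding sw2_def by (rule lift_swap[symmetric]) (use assms in auto)

definition cop :: "('k, 'm, 'h) ten \<Rightarrow> ('k, ('k, 'm, 'h) ten, ('k, 'm, 'h) ten) ten" where
  "cop = lift M H (\<lambda>m h. M.sw (\<lambda>m1 m2. H.sw (\<lambda>h1 h2. (m1 \<otimes>\<^bsub>M,H\<^esub> h1) \<otimes>\<^bsub>PP,PP\<^esub> (m2 \<otimes>\<^bsub>M,H\<^esub> h2)) h) m)"

lemma comul_P: "comul P = cop"
  by (simp add: tens_hopf_def cop_def)

lemma cop_lin: "lin PP (tprod PP PP) cop"
  unfolding cop_def by (rule lin_lift) simp_all

lemma cop_mem [simp]: "x \<in> carrier PP \<Longrightarrow> cop x \<in> carrier (tprod PP PP)"
  by (rule linD(1)[OF cop_lin])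

lemma lin_cop [simp]:
  "lin X PP f \<Longrightarrow> smul U = fsmul \<Longrightarrow> carrier (tprod PP PP) \<subseteq> carrier U \<Longrightarrow> lin X U (\<lambda>x. cop (f x))"
  by (rule lin_compose_widen[OF cop_lin]) simp_all

lemma cop_tens: "m \<in> carrier M \<Longrightarrow> h \<in> carrier H \<Longrightarrow> cop (m \<otimes>\<^bsub>M,H\<^esub> h) =
    M.sw (\<lambda>m1 m2. H.sw (\<lambda>h1 h2. (m1 \<otimes>\<^bsub>M,H\<^esub> h1) \<otimes>\<^bsub>PP,PP\<^esub> (m2 \<otimes>\<^bsub>M,H\<^esub> h2)) h) m"
  by (simp add: cop_def)

lemma P_sw: "sw2 P F x = lift PP PP F (cop x)"
  by (simp add: sw2_def comul_P P_space)

lemma cop_sw: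
  assumes "bilin PP PP fspace F" "m \<in> carrier M" "h \<in> carrier H"
  shows "lift PP PP F (cop (m \<otimes>\<^bsub>M,H\<^esub> h)) = M.sw (\<lambda>m1 m2. H.sw (\<lambda>h1 h2. F (m1 \<otimes>\<^bsub>M,H\<^esub> h1) (m2 \<otimes>\<^bsub>M,H\<^esub> h2)) h) m"
proof -
  note L = lin_lift[OF vspace_tprod vspace_tprod vspace_fspace assms(1)]
  have "lift PP PP F (cop (m \<otimes>\<^bsub>M,H\<^esub> h)) =
    M.sw (\<lambda>m1 m2. lift PP PP F (H.sw (\<lambda>h1 h2. (m1 \<otimes>\<^bsub>M,H\<^esub> h1) \<otimes>\<^bsub>PP,PP\<^esub> (m2 \<otimes>\<^bsub>M,H\<^esub> h2)) h)) m"
    unfolding cop_tens[OF assms(2,3)] by (rule M.sw_linear[OF _ _ _ L]) (use assms(2,3) in simp_all)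
  also have "\<dots> = M.sw (\<lambda>m1 m2. H.sw (\<lambda>h1 h2. lift PP PP F ((m1 \<otimes>\<^bsub>M,H\<^esub> h1) \<otimes>\<^bsub>PP,PP\<^esub> (m2 \<otimes>\<^bsub>M,H\<^esub> h2))) h) m"
    by (intro M.sw_cong refl H.sw_linear[OF _ _ _ L]) (use assms(2,3) in simp_all)
  also have "\<dots> = M.sw (\<lambda>m1 m2. H.sw (\<lambda>h1 h2. F (m1 \<otimes>\<^bsub>M,H\<^esub> h1) (m2 \<otimes>\<^bsub>M,H\<^esub> h2)) h) m"
    by (intro M.sw_cong H.sw_cong refl lift_tens[OF _ _ assms(1)]) (use assms(2,3) in simp_all)
  finally show ?thesis .
qed

lemma counit_P: "counit P = lift M H (\<lambda>m h. counit M m * counit H h)"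
  and antip_P: "antip P = lift M H (\<lambda>m h. antip M m \<otimes>\<^bsub>M,H\<^esub> antip H h)"
  by (simp_all add: tens_hopf_def)

lemma counit_P_tens: "m \<in> carrier M \<Longrightarrow> h \<in> carrier H \<Longrightarrow> counit P (m \<otimes>\<^bsub>M,H\<^esub> h) = counit M m * counit H h"
  unfolding counit_P by (rule lift_tens_in[OF _ _ vspace_scalars]) simp_all

lemma counit_P_lin: "lin PP scalars (counit P)"
  unfolding counit_P by (rule lin_lift) simp_all

lemma lin_counit_P [simp]: "lin X PP f \<Longrightarrow> lin X scalars (\<lambda>x. counit P (f x))"
  by (rule lin_compose[OF counit_P_lin])

lemma antip_P_tens: "m \<in> carrier M \<Longrightarrow> h \<in> carrier H \<Longrightarrow> antip P (m \<otimes>\<^bsub>M,H\<^esub> h) = (antip M m \<otimes>\<^bsub>M,H\<^esub> antip H h)"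
  unfolding antip_P by simp

lemma antip_P_lin: "lin PP PP (antip P)"
  unfolding antip_P by (rule lin_lift) simp_all

lemma lin_antip_P [simp]:
  "lin X PP f \<Longrightarrow> smul U = fsmul \<Longrightarrow> carrier PP \<subseteq> carrier U \<Longrightarrow> lin X U (\<lambda>x. antip P (f x))"
  by (rule lin_compose_widen[OF antip_P_lin]) simp_all

lemma antip_P_mem [simp]: "x \<in> carrier PP \<Longrightarrow> antip P x \<in> carrier PP"
  by (rule linD(1)[OF antip_P_lin])

lemma PP_eqI:
  assumes "lin PP U f" "lin PP U' g" "x \<in> carrier PP"
    and "\<And>m h. m \<in> carrier M \<Longrightarrow> h \<in> carrier H \<Longrightarrow> f (m \<otimes>\<^bsub>M,H\<^esub> h) = g (m \<otimes>\<^bsub>M,H\<^esub> h)"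
  shows "f x = g x"
  by (rule tprod_eqI[OF M.vspace_alg assms(1,2,4,3)])

text \<open>Apart from bijectivity of the antipode, the axioms about elements are linear in each of
  them, so pure tensors suffice. There they split into the axioms for \<open>M\<close> and for
  \<open>H\<close>, once Sweedler sums over the two factors have been exchanged.\<close>

lemma hopf_P: "hopf_algebra P"
proof -
  have mul: "mul P = tens_mul M H" "\<one>\<^bsub>P\<^esub> = (\<one>\<^bsub>M\<^esub> \<otimes>\<^bsub>M,H\<^esub> \<one>\<^bsub>H\<^esub>)" by (simp_all add: tens_hopf_def)
  have "algebra P"
    unfolding algebra_def using MH.tens_mul_bilin MH.tens_mul_assoc
    by (simp add: mul lin_P carrier_P)
  moreover have "lin P (tprod P P) (comul P)" using cop_lin by (simp add: comul_P lin_P P_space)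
  moreover have "sw2 P (\<lambda>x c. sw2 P (\<lambda>a b. (a \<otimes>\<^bsub>P,P\<^esub> b) \<otimes>\<^bsub>tprod P P,P\<^esub> c) x) x =
        sw2 P (\<lambda>a y. sw2 P (\<lambda>b c. (a \<otimes>\<^bsub>P,P\<^esub> b) \<otimes>\<^bsub>tprod P P,P\<^esub> c) y) x" if "x \<in> carrier P" for x
  proof -
    have x: "x \<in> carrier PP" using that by (simp add: carrier_P)
    let ?t = "\<lambda>a b c. (a \<otimes>\<^bsub>PP,PP\<^esub> b) \<otimes>\<^bsub>tprod PP PP,PP\<^esub> c"
    let ?l = "\<lambda>x. lift PP PP (\<lambda>y c. lift PP PP (\<lambda>a b. ?t a b c) (cop y)) (cop x)"
    let ?r = "\<lambda>x. lift PP PP (\<lambda>a y. lift PP PP (\<lambda>b c. ?t a b c) (cop y)) (cop x)"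
    have e: "((a \<otimes>\<^bsub>P,P\<^esub> b) \<otimes>\<^bsub>tprod P P,P\<^esub> c) = ?t a b c" for a b c
      unfolding P_space by (rule tens_cong) simp_all
    have "?l x = ?r x"
    proof (rule PP_eqI[where f = ?l and g = ?r, OF _ _ x])
      show "lin PP fspace ?l" "lin PP fspace ?r" by simp_all
      fix m h assume mh: "m \<in> carrier M" "h \<in> carrier H"
      let ?T = "\<lambda>a b m2 c d h2. ?t (a \<otimes>\<^bsub>M,H\<^esub> c) (b \<otimes>\<^bsub>M,H\<^esub> d) (m2 \<otimes>\<^bsub>M,H\<^esub> h2)"
      have "?l (m \<otimes>\<^bsub>M,H\<^esub> h) =
        M.sw (\<lambda>m1 m2. H.sw (\<lambda>h1 h2. M.sw (\<lambda>a b. H.sw (\<lambda>c d. ?T a b m2 c d h2) h1) m1) h) m"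
        using mh by (simp add: cop_sw)
      \<comment> \<open>With the sums over \<open>M\<close> outside those over \<open>H\<close>,
        coassociativity of each factor can be applied separately.\<close>
      also have "\<dots> = M.sw (\<lambda>m1 m2. M.sw (\<lambda>a b. H.sw (\<lambda>h1 h2. H.sw (\<lambda>c d. ?T a b m2 c d h2) h1) h) m1) m"
        by (intro M.sw_cong refl swap[of fspace]) (use mh in simp_all)
      also have "\<dots> = M.sw (\<lambda>a y. M.sw (\<lambda>b m2. H.sw (\<lambda>c z. H.sw (\<lambda>d h2. ?T a b m2 c d h2) z) h) y) m"
        using mh by simp
      also have "\<dots> = M.sw (\<lambda>a y. H.sw (\<lambda>c z. M.sw (\<lambda>b m2. H.sw (\<lambda>d h2. ?T a b m2 c d h2) z) y) h) m"
        by (intro M.sw_cong refl swap[of fspace, symmetric]) (use mh in simp_all)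
      also have "\<dots> = ?r (m \<otimes>\<^bsub>M,H\<^esub> h)"
        using mh by (simp add: cop_sw)
      finally show "?l (m \<otimes>\<^bsub>M,H\<^esub> h) = ?r (m \<otimes>\<^bsub>M,H\<^esub> h)" .
    qed
    then show ?thesis unfolding e by (simp only: P_sw)
  qed
  moreover have "comul P (x \<cdot>\<^bsub>P\<^esub> y) = tens_mul P P (comul P x) (comul P y)" if "x \<in> carrier P" "y \<in> carrier P" for x y
  proof -
    have x: "x \<in> carrier PP" and y: "y \<in> carrier PP" using that by (simp_all add: carrier_P)
    let ?m = "tens_mul M H"
    let ?r = "\<lambda>x y. lift PP PP (\<lambda>a b. lift PP PP (\<lambda>a' b'. ?m a a' \<otimes>\<^bsub>PP,PP\<^esub> ?m b b') (cop y)) (cop x)"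
    have e: "tens_mul P P (comul P x) (comul P y) = ?r x y"
      by (simp add: tens_mul_def[of P P] P_space comul_P mul)
    have 1: "cop (?m (m \<otimes>\<^bsub>M,H\<^esub> h) (m' \<otimes>\<^bsub>M,H\<^esub> h')) = ?r (m \<otimes>\<^bsub>M,H\<^esub> h) (m' \<otimes>\<^bsub>M,H\<^esub> h')"
      if mh: "m \<in> carrier M" "h \<in> carrier H" "m' \<in> carrier M" "h' \<in> carrier H" for m h m' h'
    proof -
      let ?T = "\<lambda>a b c d a' b' c' d'. ((a \<cdot>\<^bsub>M\<^esub> a') \<otimes>\<^bsub>M,H\<^esub> (c \<cdot>\<^bsub>H\<^esub> c')) \<otimes>\<^bsub>PP,PP\<^esub> ((b \<cdot>\<^bsub>M\<^esub> b') \<otimes>\<^bsub>M,H\<^esub> (d \<cdot>\<^bsub>H\<^esub> d'))"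
      have "?r (m \<otimes>\<^bsub>M,H\<^esub> h) (m' \<otimes>\<^bsub>M,H\<^esub> h') =
        M.sw (\<lambda>a b. H.sw (\<lambda>c d. M.sw (\<lambda>a' b'. H.sw (\<lambda>c' d'. ?T a b c d a' b' c' d') h') m') h) m"
        using mh by (simp add: cop_sw)
      also have "\<dots> = M.sw (\<lambda>a b. M.sw (\<lambda>a' b'. H.sw (\<lambda>c d. H.sw (\<lambda>c' d'. ?T a b c d a' b' c' d') h') h) m') m"
        by (intro M.sw_cong refl swap[of fspace]) (use mh in simp_all)
      also have "\<dots> = cop (?m (m \<otimes>\<^bsub>M,H\<^esub> h) (m' \<otimes>\<^bsub>M,H\<^esub> h'))"
        using mh by (simp add: cop_tens)
      finally show ?thesis ..
    qed
    have 2: "cop (?m (m \<otimes>\<^bsub>M,H\<^esub> h) y) = ?r (m \<otimes>\<^bsub>M,H\<^esub> h) y" if mh: "m \<in> carrier M" "h \<in> carrier H" for m h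
      by (rule PP_eqI[where f = "\<lambda>y. cop (?m (m \<otimes>\<^bsub>M,H\<^esub> h) y)" and g = "?r (m \<otimes>\<^bsub>M,H\<^esub> h)" and U = fspace and U' = fspace, OF _ _ y])
        (use mh 1 in simp_all)
    have "cop (?m x y) = ?r x y"
      by (rule PP_eqI[where f = "\<lambda>x. cop (?m x y)" and g = "\<lambda>x. ?r x y" and U = fspace and U' = fspace, OF _ _ x])
        (use 2 y in simp_all)
    then show ?thesis unfolding e by (simp add: comul_P mul)
  qed
  moreover have "comul P \<one>\<^bsub>P\<^esub> = (\<one>\<^bsub>P\<^esub> \<otimes>\<^bsub>P,P\<^esub> \<one>\<^bsub>P\<^esub>)"
    by (simp add: mul comul_P cop_tens P_space)
  moreover have "lin P scalars (counit P)" using counit_P_lin by (simp add: lin_P)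
  moreover have "sw2 P (\<lambda>a b. smul P (counit P a) b) x = x \<and> sw2 P (\<lambda>a b. smul P (counit P b) a) x = x"
    if "x \<in> carrier P" for x
  proof -
    have x: "x \<in> carrier PP" using that by (simp add: carrier_P)
    have f: "fsmul (c * d) v = fsmul d (fsmul c v)" for c d and v :: "('k, 'm, 'h) ten"
      by (simp add: mult.commute)
    have "lift PP PP (\<lambda>a b. fsmul (counit P a) b) (cop x) = x"
    proof (rule PP_eqI[where f = "\<lambda>x. lift PP PP (\<lambda>a b. fsmul (counit P a) b) (cop x)" and g = "\<lambda>x. x" and U = fspace and U' = fspace, OF _ _ x])
      fix m h assume mh: "m \<in> carrier M" "h \<in> carrier H"
      have "lift PP PP (\<lambda>a b. fsmul (counit P a) b) (cop (m \<otimes>\<^bsub>M,H\<^esub> h)) =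
        M.sw (\<lambda>m1 m2. H.sw (\<lambda>h1 h2. fsmul (counit H h1) (fsmul (counit M m1) (m2 \<otimes>\<^bsub>M,H\<^esub> h2))) h) m"
        using mh by (simp add: cop_sw counit_P_tens f del: fs.scale_scale)
      also have "\<dots> = M.sw (\<lambda>m1 m2. fsmul (counit M m1) (m2 \<otimes>\<^bsub>M,H\<^esub> h)) m"
        by (intro M.sw_cong refl H.sw_counit(1)) (use mh in simp_all)
      also have "\<dots> = (m \<otimes>\<^bsub>M,H\<^esub> h)" using mh by simp
      finally show "lift PP PP (\<lambda>a b. fsmul (counit P a) b) (cop (m \<otimes>\<^bsub>M,H\<^esub> h)) = (m \<otimes>\<^bsub>M,H\<^esub> h)" .
    qed simp_all
    moreover have "lift PP PP (\<lambda>a b. fsmul (counit P b) a) (cop x) = x"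
    proof (rule PP_eqI[where f = "\<lambda>x. lift PP PP (\<lambda>a b. fsmul (counit P b) a) (cop x)" and g = "\<lambda>x. x" and U = fspace and U' = fspace, OF _ _ x])
      fix m h assume mh: "m \<in> carrier M" "h \<in> carrier H"
      have "lift PP PP (\<lambda>a b. fsmul (counit P b) a) (cop (m \<otimes>\<^bsub>M,H\<^esub> h)) =
        M.sw (\<lambda>m1 m2. H.sw (\<lambda>h1 h2. fsmul (counit H h2) (fsmul (counit M m2) (m1 \<otimes>\<^bsub>M,H\<^esub> h1))) h) m"
        using mh by (simp add: cop_sw counit_P_tens f del: fs.scale_scale)
      also have "\<dots> = M.sw (\<lambda>m1 m2. fsmul (counit M m2) (m1 \<otimes>\<^bsub>M,H\<^esub> h)) m"
        by (intro M.sw_cong refl H.sw_counit(2)) (use mh in simp_all)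
      also have "\<dots> = (m \<otimes>\<^bsub>M,H\<^esub> h)" using mh by simp
      finally show "lift PP PP (\<lambda>a b. fsmul (counit P b) a) (cop (m \<otimes>\<^bsub>M,H\<^esub> h)) = (m \<otimes>\<^bsub>M,H\<^esub> h)" .
    qed simp_all
    ultimately show ?thesis by (simp add: P_sw)
  qed
  moreover have "counit P (x \<cdot>\<^bsub>P\<^esub> y) = counit P x * counit P y" if "x \<in> carrier P" "y \<in> carrier P" for x y
  proof -
    have x: "x \<in> carrier PP" and y: "y \<in> carrier PP" using that by (simp_all add: carrier_P)
    have 2: "counit P (tens_mul M H (m \<otimes>\<^bsub>M,H\<^esub> h) y) = counit P (m \<otimes>\<^bsub>M,H\<^esub> h) * counit P y" if mh: "m \<in> carrier M" "h \<in> carrier H" for m h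
      by (rule PP_eqI[where f = "\<lambda>y. counit P (tens_mul M H (m \<otimes>\<^bsub>M,H\<^esub> h) y)" and U = scalars and U' = scalars, OF _ _ y])
        (use mh in \<open>simp_all add: counit_P_tens\<close>)
    have "counit P (tens_mul M H x y) = counit P x * counit P y"
      by (rule PP_eqI[where f = "\<lambda>x. counit P (tens_mul M H x y)" and U = scalars and U' = scalars, OF _ _ x])
        (use 2 y in simp_all)
    then show ?thesis by (simp add: mul)
  qed
  moreover have "counit P \<one>\<^bsub>P\<^esub> = 1" by (simp add: mul counit_P_tens)
  moreover have "lin P P (antip P)" using antip_P_lin by (simp add: lin_P)
  moreover have "sw2 P (\<lambda>a b. antip P a \<cdot>\<^bsub>P\<^esub> b) x = smul P (counit P x) \<one>\<^bsub>P\<^esub> \<and>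
      sw2 P (\<lambda>a b. a \<cdot>\<^bsub>P\<^esub> antip P b) x = smul P (counit P x) \<one>\<^bsub>P\<^esub>" if "x \<in> carrier P" for x
  proof -
    have x: "x \<in> carrier PP" using that by (simp add: carrier_P)
    let ?m = "tens_mul M H"
    have "lift PP PP (\<lambda>a b. ?m (antip P a) b) (cop x) = fsmul (counit P x) (\<one>\<^bsub>M\<^esub> \<otimes>\<^bsub>M,H\<^esub> \<one>\<^bsub>H\<^esub>)"
    proof (rule PP_eqI[where f = "\<lambda>x. lift PP PP (\<lambda>a b. ?m (antip P a) b) (cop x)" and U = fspace and U' = fspace, OF _ _ x])
      fix m h assume mh: "m \<in> carrier M" "h \<in> carrier H"
      have "lift PP PP (\<lambda>a b. ?m (antip P a) b) (cop (m \<otimes>\<^bsub>M,H\<^esub> h)) =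
        M.sw (\<lambda>m1 m2. H.sw (\<lambda>h1 h2. (antip M m1 \<cdot>\<^bsub>M\<^esub> m2) \<otimes>\<^bsub>M,H\<^esub> (antip H h1 \<cdot>\<^bsub>H\<^esub> h2)) h) m"
        using mh by (simp add: cop_sw antip_P_tens)
      also have "\<dots> = M.sw (\<lambda>m1 m2. smul fspace (counit H h) ((antip M m1 \<cdot>\<^bsub>M\<^esub> m2) \<otimes>\<^bsub>M,H\<^esub> \<one>\<^bsub>H\<^esub>)) m"
        by (intro M.sw_cong refl H.sw_antip_in(1)[where f = "\<lambda>u. _ \<otimes>\<^bsub>M,H\<^esub> u"]) (use mh in simp_all)
      also have "\<dots> = fsmul (counit M m) (fsmul (counit H h) (\<one>\<^bsub>M\<^esub> \<otimes>\<^bsub>M,H\<^esub> \<one>\<^bsub>H\<^esub>))"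
        using M.sw_antip_in(1)[of fspace "\<lambda>u. fsmul (counit H h) (u \<otimes>\<^bsub>M,H\<^esub> \<one>\<^bsub>H\<^esub>)" m] mh by simp
      finally show "lift PP PP (\<lambda>a b. ?m (antip P a) b) (cop (m \<otimes>\<^bsub>M,H\<^esub> h)) = fsmul (counit P (m \<otimes>\<^bsub>M,H\<^esub> h)) (\<one>\<^bsub>M\<^esub> \<otimes>\<^bsub>M,H\<^esub> \<one>\<^bsub>H\<^esub>)"
        using mh by (simp add: counit_P_tens)
    qed simp_all
    moreover have "lift PP PP (\<lambda>a b. ?m a (antip P b)) (cop x) = fsmul (counit P x) (\<one>\<^bsub>M\<^esub> \<otimes>\<^bsub>M,H\<^esub> \<one>\<^bsub>H\<^esub>)"
    proof (rule PP_eqI[where f = "\<lambda>x. lift PP PP (\<lambda>a b. ?m a (antip P b)) (cop x)" and U = fspace and U' = fspace, OF _ _ x])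
      fix m h assume mh: "m \<in> carrier M" "h \<in> carrier H"
      have "lift PP PP (\<lambda>a b. ?m a (antip P b)) (cop (m \<otimes>\<^bsub>M,H\<^esub> h)) =
        M.sw (\<lambda>m1 m2. H.sw (\<lambda>h1 h2. (m1 \<cdot>\<^bsub>M\<^esub> antip M m2) \<otimes>\<^bsub>M,H\<^esub> (h1 \<cdot>\<^bsub>H\<^esub> antip H h2)) h) m"
        using mh by (simp add: cop_sw antip_P_tens)
      also have "\<dots> = M.sw (\<lambda>m1 m2. smul fspace (counit H h) ((m1 \<cdot>\<^bsub>M\<^esub> antip M m2) \<otimes>\<^bsub>M,H\<^esub> \<one>\<^bsub>H\<^esub>)) m"
        by (intro M.sw_cong refl H.sw_antip_in(2)[where f = "\<lambda>u. _ \<otimes>\<^bsub>M,H\<^esub> u"]) (use mh in simp_all)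
      also have "\<dots> = fsmul (counit M m) (fsmul (counit H h) (\<one>\<^bsub>M\<^esub> \<otimes>\<^bsub>M,H\<^esub> \<one>\<^bsub>H\<^esub>))"
        using M.sw_antip_in(2)[of fspace "\<lambda>u. fsmul (counit H h) (u \<otimes>\<^bsub>M,H\<^esub> \<one>\<^bsub>H\<^esub>)" m] mh by simp
      finally show "lift PP PP (\<lambda>a b. ?m a (antip P b)) (cop (m \<otimes>\<^bsub>M,H\<^esub> h)) = fsmul (counit P (m \<otimes>\<^bsub>M,H\<^esub> h)) (\<one>\<^bsub>M\<^esub> \<otimes>\<^bsub>M,H\<^esub> \<one>\<^bsub>H\<^esub>)"
        using mh by (simp add: counit_P_tens)
    qed simp_all
    ultimately show ?thesis by (simp add: P_sw mul)
  qed
  moreover have "bij_betw (antip P) (carrier P) (carrier P)"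
  proof -
    \<comment> \<open>The set-theoretic inverse of a bijective linear map is linear. The inverses of
      the two antipodes can therefore be tensored, and the result inverts the antipode of
      \<open>P\<close>.\<close>
    have inv: "\<exists>g. lin V V g \<and> (\<forall>x\<in>carrier V. g (f x) = x \<and> f (g x) = x)"
      if f: "lin V V f" "bij_betw f (carrier V) (carrier V)" and V: "vspace V" for V :: "('k, 'v::ab_group_add, 'z) vs_scheme" and f
    proof -
      let ?g = "the_inv_into (carrier V) f"
      have i: "inj_on f (carrier V)" "f ` carrier V = carrier V" using f(2) by (auto simp: bij_betw_def)
      have g: "?g x \<in> carrier V" "f (?g x) = x" if "x \<in> carrier V" for x
        using that i the_inv_into_into[OF i(1), of x] f_the_inv_into_f[OF i(1), of x] by auto
      have g': "?g (f x) = x" if "x \<in> carrier V" for x using the_inv_into_f_f[OF i(1) that] .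
      have "lin V V ?g"
      proof (rule linI)
        fix x c assume x: "x \<in> carrier V"
        show "?g x \<in> carrier V" using g x by simp
        show "?g (smul V c x) = smul V c (?g x)"
          using g'[of "smul V c (?g x)"] g x V by (simp add: linD(3)[OF f(1)])
        fix y assume y: "y \<in> carrier V"
        show "?g (x + y) = ?g x + ?g y"
          using g'[of "?g x + ?g y"] g x y V by (simp add: linD(2)[OF f(1)])
      qed
      then show ?thesis using g g' by blast
    qed
    have "bij_betw (antip M) (carrier M) (carrier M)" "bij_betw (antip H) (carrier H) (carrier H)"
      using M.hopf H.hopf by (simp_all add: hopf_algebra_def)
    then obtain s t where s: "lin M M s" "\<forall>x\<in>carrier M. s (antip M x) = x \<and> antip M (s x) = x"
      and t: "lin H H t" "\<forall>x\<in>carrier H. t (antip H x) = x \<and> antip H (t x) = x"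
      using inv[OF M.antip_lin] inv[OF H.antip_lin] by auto
    note mem = linD(1)[OF s(1)] linD(1)[OF t(1)]
    let ?g = "lift M H (\<lambda>m h. s m \<otimes>\<^bsub>M,H\<^esub> t h)"
    have b: "bilin M H PP (\<lambda>m h. s m \<otimes>\<^bsub>M,H\<^esub> t h)" using s(1) t(1) mem by simp
    have g: "lin PP PP ?g" by (rule lin_lift[OF _ _ _ b]) simp_all
    have ge: "?g (m \<otimes>\<^bsub>M,H\<^esub> h) = (s m \<otimes>\<^bsub>M,H\<^esub> t h)" if "m \<in> carrier M" "h \<in> carrier H" for m h
      using that by (subst lift_tens_in[OF _ _ _ b]) simp_all
    have "?g (antip P x) = x" "antip P (?g x) = x" if x: "x \<in> carrier PP" for x
    proof -
      show "?g (antip P x) = x"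
        by (rule PP_eqI[where f = "\<lambda>x. ?g (antip P x)" and g = "\<lambda>x. x" and U' = PP, OF lin_compose[OF g antip_P_lin] lin_id x])
          (use s t in \<open>simp_all add: antip_P_tens ge\<close>)
      show "antip P (?g x) = x"
        by (rule PP_eqI[where f = "\<lambda>x. antip P (?g x)" and g = "\<lambda>x. x" and U' = PP, OF lin_compose[OF antip_P_lin g] lin_id x])
          (use s t mem in \<open>simp_all add: antip_P_tens ge\<close>)
    qed
    then show ?thesis
      unfolding carrier_P by (intro bij_betw_byWitness[where f' = ?g]) (use linD(1)[OF g] in auto)
  qed
  ultimately show ?thesis
    unfolding hopf_algebra_def by (simp only: simp_thms ball_simps) blast
qed

end

subsection \<open>The product calculus\<close>

lemma subsp_sum3:
  assumes V: "vspace V" and A: "subsp V A" and B: "subsp V B" and C: "subsp V C"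
  shows "subsp V (sum3 A B C)" "A \<subseteq> sum3 A B C" "B \<subseteq> sum3 A B C" "C \<subseteq> sum3 A B C"
proof -
  note s = A[unfolded subsp_iff[OF V]] B[unfolded subsp_iff[OF V]] C[unfolded subsp_iff[OF V]]
  show "subsp V (sum3 A B C)"
    unfolding subsp_iff[OF V]
  proof (intro conjI ballI allI subsetI)
    show "x \<in> carrier V" if "x \<in> sum3 A B C" for x
      using that s V by (auto simp: sum3_def intro!: vspace_closed)
    have "0 + 0 + 0 \<in> sum3 A B C" unfolding sum3_def using s by blast
    then show "0 \<in> sum3 A B C" by simp
    show "x + y \<in> sum3 A B C" if xy: "x \<in> sum3 A B C" "y \<in> sum3 A B C" for x y
    proof -
      obtain a b c a' b' c' where x: "x = a + b + c" "y = a' + b' + c'"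
        "a \<in> A" "b \<in> B" "c \<in> C" "a' \<in> A" "b' \<in> B" "c' \<in> C"
        using xy unfolding sum3_def by blast
      have "x + y = (a + a') + (b + b') + (c + c')" unfolding x by (simp add: algebra_simps)
      then show ?thesis unfolding sum3_def using x s by blast
    qed
    show "smul V r x \<in> sum3 A B C" if xx: "x \<in> sum3 A B C" for r x
    proof -
      obtain a b c where x: "x = a + b + c" "a \<in> A" "b \<in> B" "c \<in> C"
        using xx unfolding sum3_def by blast
      have "smul V r x = smul V r a + smul V r b + smul V r c" unfolding x by (simp add: vspace_smul[OF V])
      then show ?thesis unfolding sum3_def using x s by blast
    qed
  qed
  have 1: "x + 0 + 0 \<in> sum3 A B C" if "x \<in> A" for x unfolding sum3_def using s that by blast
  have 2: "0 + x + 0 \<in> sum3 A B C" if "x \<in> B" for x unfolding sum3_def using s that by blast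
  have 3: "0 + 0 + x \<in> sum3 A B C" if "x \<in> C" for x unfolding sum3_def using s that by blast
  show "A \<subseteq> sum3 A B C" "B \<subseteq> sum3 A B C" "C \<subseteq> sum3 A B C" using 1 2 3 by auto
qed

lemma sum3_subset:
  assumes V: "vspace V" and S: "subsp V S" and "A \<subseteq> S" "B \<subseteq> S" "C \<subseteq> S"
  shows "sum3 A B C \<subseteq> S"
  using assms(3-) S[unfolded subsp_iff[OF V]] unfolding sum3_def by blast

lemma lin_image_sum3:
  assumes f: "lin V W f" and V: "vspace V" and "A \<subseteq> carrier V" "B \<subseteq> carrier V" "C \<subseteq> carrier V"
  shows "f ` sum3 A B C = sum3 (f ` A) (f ` B) (f ` C)"
proof -
  have e: "f (a + b + c) = f a + f b + f c" if "a \<in> A" "b \<in> B" "c \<in> C" for a b c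
  proof -
    have "a \<in> carrier V" "b \<in> carrier V" "c \<in> carrier V" using that assms(3-) by auto
    then show ?thesis using V by (simp add: linD(2)[OF f])
  qed
  show ?thesis
    unfolding sum3_def by (force simp: e image_iff)
qed

lemma subsp_lin_image:
  assumes f: "lin V W f" and V: "vspace V" and W: "vspace W" and A: "subsp V A"
  shows "subsp W (f ` A)"
proof -
  note s = A[unfolded subsp_iff[OF V]]
  have "f x + f y \<in> f ` A" if "x \<in> A" "y \<in> A" for x y
    using that s linD(2)[OF f, of x y] by (intro image_eqI[where x = "x + y"]) (auto simp: subset_iff)
  moreover have "smul W c (f x) \<in> f ` A" if "x \<in> A" for x c
    using that s linD(3)[OF f, of x c] by (intro image_eqI[where x = "smul V c x"]) (auto simp: subset_iff)
  moreover have "0 \<in> f ` A" using s lin_0[OF f V] by (intro image_eqI[where x = 0]) auto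
  ultimately show ?thesis unfolding subsp_iff[OF W] using s linD(1)[OF f] by auto
qed

lemma tspan_sum3:
  assumes V: "vspace V" and W: "vspace W" and D: "subsp V D" and ABC: "subsp W A" "subsp W B" "subsp W C"
  shows "tspan V W D (sum3 A B C) = sum3 (tspan V W D A) (tspan V W D B) (tspan V W D C)"
proof
  have D': "D \<subseteq> carrier V" and W': "A \<subseteq> carrier W" "B \<subseteq> carrier W" "C \<subseteq> carrier W"
    using D ABC by (auto simp: subsp_def)
  note s = subsp_sum3[OF W ABC]
  note S = subsp_sum3[OF vspace_tprod subsp_tspan subsp_tspan subsp_tspan, OF D' W'(1) D' W'(2) D' W'(3)]
  show "tspan V W D (sum3 A B C) \<subseteq> sum3 (tspan V W D A) (tspan V W D B) (tspan V W D C)"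
  proof
    fix t assume t: "t \<in> tspan V W D (sum3 A B C)"
    show "t \<in> sum3 (tspan V W D A) (tspan V W D B) (tspan V W D C)"
    proof (rule lin_tspan_in[where f = "\<lambda>t. t" and U = "tprod V W", OF V _ D _ t vspace_tprod S(1)])
      show "sum3 A B C \<subseteq> carrier W" using s(1) by (simp add: subsp_def)
      fix a b assume a: "a \<in> D" and "b \<in> sum3 A B C"
      then obtain x y z where b: "b = x + y + z" "x \<in> A" "y \<in> B" "z \<in> C" unfolding sum3_def by blast
      have "(a \<otimes>\<^bsub>V,W\<^esub> b) = (a \<otimes>\<^bsub>V,W\<^esub> x) + (a \<otimes>\<^bsub>V,W\<^esub> y) + (a \<otimes>\<^bsub>V,W\<^esub> z)"
        unfolding b by (simp add: tens_linear V W)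
      moreover have "(a \<otimes>\<^bsub>V,W\<^esub> x) \<in> tspan V W D A" "(a \<otimes>\<^bsub>V,W\<^esub> y) \<in> tspan V W D B" "(a \<otimes>\<^bsub>V,W\<^esub> z) \<in> tspan V W D C"
        using a b by auto
      ultimately show "(a \<otimes>\<^bsub>V,W\<^esub> b) \<in> sum3 (tspan V W D A) (tspan V W D B) (tspan V W D C)"
        unfolding sum3_def by blast
    qed simp
  qed
  show "sum3 (tspan V W D A) (tspan V W D B) (tspan V W D C) \<subseteq> tspan V W D (sum3 A B C)"
    by (rule sum3_subset[OF vspace_tprod subsp_tspan[OF D']]) (use s tspan_mono[OF order_refl s(2), of V W D] tspan_mono[OF order_refl s(3), of V W D]
      tspan_mono[OF order_refl s(4), of V W D] in \<open>auto simp: subsp_def\<close>)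
qed

section \<open>Ad-stable subspaces\<close>

context hopf_alg
begin

text \<open>The conditions of \<open>ad_ideal\<close> other than containment in
  \<open>ker \<epsilon>\<close>. The summands of \<open>Q_prod\<close> have factors such as all of
  \<open>H\<close>, which satisfy these conditions without lying in
  \<open>ker \<epsilon>\<close>.\<close>

definition ad_stable :: "'a set \<Rightarrow> bool" where
  "ad_stable A \<longleftrightarrow> subsp H A \<and> (\<forall>a\<in>A. \<forall>h\<in>carrier H. a \<cdot>\<^bsub>H\<^esub> h \<in> A) \<and> Ad H ` A \<subseteq> tspan H H A (carrier H)"

lemma ad_ideal_iff: "ad_ideal H A \<longleftrightarrow> ad_stable A \<and> A \<subseteq> aug H"
  by (auto simp: ad_ideal_def ad_stable_def)

lemma ad_stable_carrier: "ad_stable (carrier H)"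
  by (auto simp: ad_stable_def tspan_carrier)

lemma ad_stable_aug: "ad_stable (aug H)"
  using ad_ideal_aug by (simp add: ad_ideal_iff)

lemma ad_stable_sum3:
  assumes "ad_stable A" "ad_stable B" "ad_stable C"
  shows "ad_stable (sum3 A B C)"
proof -
  have s: "subsp H A" "subsp H B" "subsp H C" using assms by (auto simp: ad_stable_def)
  note S = subsp_sum3[OF vspace_alg s]
  have sub: "A \<subseteq> carrier H" "B \<subseteq> carrier H" "C \<subseteq> carrier H" using s by (auto simp: subsp_def)
  have "x \<cdot>\<^bsub>H\<^esub> h \<in> sum3 A B C" if x: "x \<in> sum3 A B C" and h: "h \<in> carrier H" for x h
  proof -
    obtain a b c where x: "x = a + b + c" "a \<in> A" "b \<in> B" "c \<in> C" using x unfolding sum3_def by blast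
    have "a \<in> carrier H" "b \<in> carrier H" "c \<in> carrier H" using x sub by auto
    then have "x \<cdot>\<^bsub>H\<^esub> h = a \<cdot>\<^bsub>H\<^esub> h + b \<cdot>\<^bsub>H\<^esub> h + c \<cdot>\<^bsub>H\<^esub> h" using x(1) h by (simp add: mul_linear)
    moreover have "a \<cdot>\<^bsub>H\<^esub> h \<in> A" "b \<cdot>\<^bsub>H\<^esub> h \<in> B" "c \<cdot>\<^bsub>H\<^esub> h \<in> C" using x assms h by (auto simp: ad_stable_def)
    ultimately show ?thesis unfolding sum3_def by blast
  qed
  moreover have "Ad H ` sum3 A B C \<subseteq> tspan H H (sum3 A B C) (carrier H)"
    unfolding lin_image_sum3[OF Ad_lin vspace_alg sub]
  proof (rule sum3_subset[OF vspace_tprod])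
    show "subsp T (tspan H H (sum3 A B C) (carrier H))"
      by (rule subsp_tspan) (use S(1) in \<open>auto simp: subsp_def\<close>)
  qed (use assms tspan_mono[OF S(2) order_refl, of H H "carrier H"] tspan_mono[OF S(3) order_refl, of H H "carrier H"]
      tspan_mono[OF S(4) order_refl, of H H "carrier H"] in \<open>auto simp: ad_stable_def\<close>)
  ultimately show ?thesis using S(1) by (auto simp: ad_stable_def)
qed

lemma calc_carrier: "calc H (carrier H) = carrier T"
  by (auto simp: calc_iff tspan_carrier)

lemma calc_sum3:
  assumes "subsp H A" "subsp H B" "subsp H C"
  shows "calc H (sum3 A B C) = sum3 (calc H A) (calc H B) (calc H C)"
proof -
  have sub: "A \<subseteq> carrier H" "B \<subseteq> carrier H" "C \<subseteq> carrier H" "sum3 A B C \<subseteq> carrier H"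
    using assms subsp_sum3(1)[OF vspace_alg assms] by (auto simp: subsp_def)
  show ?thesis
    unfolding sub(1-3)[THEN calc_image] calc_image[OF sub(4)] tspan_sum3[OF vspace_alg vspace_alg subsp_carrier[OF vspace_alg] assms]
    by (rule lin_image_sum3[OF trivi_lin]) (use sub tspan_subset[OF order_refl, of _ H H] in auto)
qed

end

context hopf_pair
begin

sublocale P: hopf_alg P
  by (rule hopf_algI[OF hopf_P])

lemma PP_sub_P [simp]: "carrier PP \<subseteq> carrier P"
  by (simp add: carrier_P)

lemma P_tens_mem [simp]: "m \<in> carrier M \<Longrightarrow> h \<in> carrier H \<Longrightarrow> (m \<otimes>\<^bsub>M,H\<^esub> h) \<in> carrier P"
  by (simp add: carrier_P)

lemma P_mul [simp]:
  assumes "m \<in> carrier M" "h \<in> carrier H" "m' \<in> carrier M" "h' \<in> carrier H"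
  shows "(m \<otimes>\<^bsub>M,H\<^esub> h) \<cdot>\<^bsub>P\<^esub> (m' \<otimes>\<^bsub>M,H\<^esub> h') = ((m \<cdot>\<^bsub>M\<^esub> m') \<otimes>\<^bsub>M,H\<^esub> (h \<cdot>\<^bsub>H\<^esub> h'))"
proof -
  have "mul P = tens_mul M H" by (simp add: tens_hopf_def)
  then show ?thesis using assms by simp
qed

lemma P_unit: "\<one>\<^bsub>P\<^esub> = (\<one>\<^bsub>M\<^esub> \<otimes>\<^bsub>M,H\<^esub> \<one>\<^bsub>H\<^esub>)"
  by (simp add: tens_hopf_def)

lemma P_sw_tens [simp]:
  assumes "bilin P P fspace F" "m \<in> carrier M" "h \<in> carrier H"
  shows "sw2 P F (m \<otimes>\<^bsub>M,H\<^esub> h) = M.sw (\<lambda>m1 m2. H.sw (\<lambda>h1 h2. F (m1 \<otimes>\<^bsub>M,H\<^esub> h1) (m2 \<otimes>\<^bsub>M,H\<^esub> h2)) h) m"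
proof -
  have "bilin PP PP fspace F" using assms(1) by (simp add: carrier_P lin_P)
  then show ?thesis unfolding P_sw by (rule cop_sw) fact+
qed

declare counit_P_tens [simp] antip_P_tens [simp]

lemma P_eqI:
  assumes "lin P U f" "lin P U' g" "x \<in> carrier P"
    and "\<And>m h. m \<in> carrier M \<Longrightarrow> h \<in> carrier H \<Longrightarrow> f (m \<otimes>\<^bsub>M,H\<^esub> h) = g (m \<otimes>\<^bsub>M,H\<^esub> h)"
  shows "f x = g x"
  using assms PP_eqI[of U f U' g x] by (simp add: lin_P carrier_P)

text \<open>Coproduct, product and antipode of \<open>P\<close> act factorwise, so up to a
  permutation of legs its adjoint coaction is the tensor product of those of \<open>M\<close> and
  \<open>H\<close>. Only sums over \<open>M\<close> and over \<open>H\<close> have to be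
  exchanged.\<close>

lemma Ad_P:
  assumes mh: "m \<in> carrier M" "h \<in> carrier H"
  shows "Ad P (m \<otimes>\<^bsub>M,H\<^esub> h) =
    lift M M (\<lambda>m' m''. lift H H (\<lambda>h' h''. (m' \<otimes>\<^bsub>M,H\<^esub> h') \<otimes>\<^bsub>P,P\<^esub> (m'' \<otimes>\<^bsub>M,H\<^esub> h'')) (Ad H h)) (Ad M m)"
proof -
  let ?t = "\<lambda>m1 b c h1 d e. (b \<otimes>\<^bsub>M,H\<^esub> d) \<otimes>\<^bsub>P,P\<^esub> ((antip M m1 \<cdot>\<^bsub>M\<^esub> c) \<otimes>\<^bsub>M,H\<^esub> (antip H h1 \<cdot>\<^bsub>H\<^esub> e))"
  have "Ad P (m \<otimes>\<^bsub>M,H\<^esub> h) = M.sw (\<lambda>m1 m2. H.sw (\<lambda>h1 h2. M.sw (\<lambda>b c. H.sw (\<lambda>d e. ?t m1 b c h1 d e) h2) m2) h) m"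
    using mh by (simp add: P.Ad_sw)
  also have "\<dots> = M.sw (\<lambda>m1 m2. M.sw (\<lambda>b c. H.sw (\<lambda>h1 h2. H.sw (\<lambda>d e. ?t m1 b c h1 d e) h2) h) m2) m"
    by (intro M.sw_cong refl swap[of fspace]) (use mh in simp_all)
  also have "\<dots> = lift M M (\<lambda>m' m''. lift H H (\<lambda>h' h''. (m' \<otimes>\<^bsub>M,H\<^esub> h') \<otimes>\<^bsub>P,P\<^esub> (m'' \<otimes>\<^bsub>M,H\<^esub> h'')) (Ad H h)) (Ad M m)"
    using mh by (simp add: M.Ad_sw H.Ad_sw)
  finally show ?thesis .
qed

lemma subsp_tspan_P: "A \<subseteq> carrier M \<Longrightarrow> B \<subseteq> carrier H \<Longrightarrow> subsp P (tspan M H A B)"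
  using subsp_tspan[of A M B H] by (simp add: subsp_def carrier_P)

text \<open>By linearity it suffices to look at generators \<open>a \<otimes> b\<close>, on which
  both the right multiplication and \<open>Ad_P\<close> can be followed in each factor
  separately.\<close>

lemma ad_stable_tspan:
  assumes A: "M.ad_stable A" and B: "H.ad_stable B"
  shows "P.ad_stable (tspan M H A B)"
proof -
  let ?S = "tspan M H A B"
  have sA: "subsp M A" and sB: "subsp H B" using A B by (auto simp: M.ad_stable_def H.ad_stable_def)
  then have sub: "A \<subseteq> carrier M" "B \<subseteq> carrier H" by (auto simp: subsp_def)
  note S = subsp_tspan_P[OF sub]
  have "x \<cdot>\<^bsub>P\<^esub> y \<in> ?S" if x: "x \<in> ?S" and y: "y \<in> carrier P" for x y
  proof (rule lin_tspan_in[where f = "\<lambda>x. x \<cdot>\<^bsub>P\<^esub> y", OF M.vspace_alg _ sA sub(2) x vspace_P S])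
    show "lin PP P (\<lambda>x. x \<cdot>\<^bsub>P\<^esub> y)" unfolding lin_P(1)[symmetric] using y by simp
    fix a b assume ab: "a \<in> A" "b \<in> B"
    have y': "y \<in> tspan M H (carrier M) (carrier H)" using y by (simp add: tspan_carrier carrier_P)
    show "(a \<otimes>\<^bsub>M,H\<^esub> b) \<cdot>\<^bsub>P\<^esub> y \<in> ?S"
    proof (rule lin_tspan_in[where f = "\<lambda>y. (a \<otimes>\<^bsub>M,H\<^esub> b) \<cdot>\<^bsub>P\<^esub> y", OF M.vspace_alg _ subsp_carrier[OF M.vspace_alg] order_refl y' vspace_P S])
      show "lin PP P (\<lambda>y. (a \<otimes>\<^bsub>M,H\<^esub> b) \<cdot>\<^bsub>P\<^esub> y)" unfolding lin_P(1)[symmetric] using ab sub by (auto simp: subset_iff)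
      fix m h assume "m \<in> carrier M" "h \<in> carrier H"
      moreover have "a \<in> carrier M" "b \<in> carrier H" using ab sub by auto
      ultimately show "(a \<otimes>\<^bsub>M,H\<^esub> b) \<cdot>\<^bsub>P\<^esub> (m \<otimes>\<^bsub>M,H\<^esub> h) \<in> ?S"
        using A B ab by (auto simp: M.ad_stable_def H.ad_stable_def intro!: tens_in_tspan)
    qed
  qed
  moreover have "Ad P x \<in> tspan P P ?S (carrier P)" if x: "x \<in> ?S" for x
  proof (rule lin_tspan_in[where f = "Ad P", OF M.vspace_alg _ sA sub(2) x vspace_tprod])
    show "lin PP (tprod P P) (Ad P)" unfolding lin_P(1)[symmetric] by (rule P.Ad_lin)
    show S': "subsp (tprod P P) (tspan P P ?S (carrier P))" by (rule subsp_tspan) (use S in \<open>auto simp: subsp_def\<close>)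
    fix a b assume ab: "a \<in> A" "b \<in> B"
    have ab': "a \<in> carrier M" "b \<in> carrier H" using ab sub by auto
    have Ad: "Ad M a \<in> tspan M M A (carrier M)" "Ad H b \<in> tspan H H B (carrier H)"
      using A B ab by (auto simp: M.ad_stable_def H.ad_stable_def)
    show "Ad P (a \<otimes>\<^bsub>M,H\<^esub> b) \<in> tspan P P ?S (carrier P)"
      unfolding Ad_P[OF ab']
    proof (rule lift_in_subsp[OF _ _ vspace_tprod _ sA order_refl Ad(1) S'])
      fix m' m'' assume m: "m' \<in> A" "m'' \<in> carrier M"
      then have m': "m' \<in> carrier M" using sub by auto
      show "lift H H (\<lambda>h' h''. (m' \<otimes>\<^bsub>M,H\<^esub> h') \<otimes>\<^bsub>P,P\<^esub> (m'' \<otimes>\<^bsub>M,H\<^esub> h'')) (Ad H b) \<in> tspan P P ?S (carrier P)"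
        by (rule lift_in_subsp[OF _ _ vspace_tprod _ sB order_refl Ad(2) S']) (use m m' in \<open>simp_all\<close>)
    qed (use ab' in simp_all)
  qed
  ultimately show ?thesis using S by (auto simp: P.ad_stable_def)
qed

lemma shuffle_lin: "lin (tprod (tprod M M) (tprod H H)) (tprod P P) (shuffle M H)"
  unfolding shuffle_def P_space(3)[symmetric] by (rule lin_lift) simp_all

lemma shuffle_tens: "s \<in> carrier (tprod M M) \<Longrightarrow> t \<in> carrier (tprod H H) \<Longrightarrow>
  shuffle M H (s \<otimes>\<^bsub>tprod M M,tprod H H\<^esub> t) = lift M M (\<lambda>m m'. lift H H (\<lambda>h h'. (m \<otimes>\<^bsub>M,H\<^esub> h) \<otimes>\<^bsub>P,P\<^esub> (m' \<otimes>\<^bsub>M,H\<^esub> h')) t) s"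
  unfolding shuffle_def P_space(3)[symmetric] by (rule lift_tens) simp_all

lemma shuffle_trivi:
  assumes s: "s \<in> carrier (tprod M M)" and t: "t \<in> carrier (tprod H H)"
  shows "shuffle M H (M.trivi s \<otimes>\<^bsub>tprod M M,tprod H H\<^esub> H.trivi t) = P.trivi (shuffle M H (s \<otimes>\<^bsub>tprod M M,tprod H H\<^esub> t))"
proof -
  let ?V = "tprod M M" and ?W = "tprod H H"
  let ?l = "\<lambda>s t. shuffle M H (M.trivi s \<otimes>\<^bsub>?V,?W\<^esub> H.trivi t)" and ?r = "\<lambda>s t. P.trivi (shuffle M H (s \<otimes>\<^bsub>?V,?W\<^esub> t))"
  have 1: "lin ?V (tprod P P) (\<lambda>s. ?l s t)" "lin ?V (tprod P P) (\<lambda>s. ?r s t)" if "t \<in> carrier ?W" for t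
    using that by (auto intro!: lin_compose[OF shuffle_lin] lin_compose[OF P.trivi_lin])
  have 2: "lin ?W (tprod P P) (?l s)" "lin ?W (tprod P P) (?r s)" if "s \<in> carrier ?V" for s
    using that by (auto intro!: lin_compose[OF shuffle_lin] lin_compose[OF P.trivi_lin])
  have 3: "?l (m \<otimes>\<^bsub>M,M\<^esub> a) (h \<otimes>\<^bsub>H,H\<^esub> b) = ?r (m \<otimes>\<^bsub>M,M\<^esub> a) (h \<otimes>\<^bsub>H,H\<^esub> b)"
    if "m \<in> carrier M" "a \<in> carrier M" "h \<in> carrier H" "b \<in> carrier H" for m a h b
  proof -
    have e: "?l (m \<otimes>\<^bsub>M,M\<^esub> a) (h \<otimes>\<^bsub>H,H\<^esub> b) = lift M M (\<lambda>m m'. lift H H (\<lambda>h h'.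
        (m \<otimes>\<^bsub>M,H\<^esub> h) \<otimes>\<^bsub>P,P\<^esub> (m' \<otimes>\<^bsub>M,H\<^esub> h')) (H.trivi (h \<otimes>\<^bsub>H,H\<^esub> b))) (M.trivi (m \<otimes>\<^bsub>M,M\<^esub> a))"
      by (rule shuffle_tens) (use that in simp_all)
    show ?thesis unfolding e using that by (simp add: shuffle_tens M.trivi_tens H.trivi_tens P.trivi_tens)
  qed
  have 4: "?l (m \<otimes>\<^bsub>M,M\<^esub> a) t = ?r (m \<otimes>\<^bsub>M,M\<^esub> a) t" if "m \<in> carrier M" "a \<in> carrier M" for m a
    by (rule tprod_eqI[OF H.vspace_alg 2(1) 2(2) _ t]) (use 3 that in simp_all)
  show ?thesis
    by (rule tprod_eqI[where f = "\<lambda>s. ?l s t" and g = "\<lambda>s. ?r s t", OF M.vspace_alg 1(1) 1(2) _ s]) (use 4 t in simp_all)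
qed

text \<open>Both sides are spanned by the elements that \<open>shuffle_trivi\<close> identifies. The
  lemma is stated for arbitrary subspaces \<open>A\<close> and \<open>B\<close> so that each of the
  three summands of \<open>N_prod\<close> is an instance of it.\<close>

lemma shuffle_calc:
  assumes A: "subsp M A" and B: "subsp H B"
  shows "shuffle M H ` tspan (tprod M M) (tprod H H) (calc M A) (calc H B) = calc P (tspan M H A B)"
proof
  let ?V = "tprod M M" and ?W = "tprod H H"
  let ?I = "shuffle M H ` tspan ?V ?W (calc M A) (calc H B)"
  have sub: "A \<subseteq> carrier M" "B \<subseteq> carrier H" using A B by (auto simp: subsp_def)
  note S = subsp_tspan_P[OF sub]
  have SP: "tspan M H A B \<subseteq> carrier P" using S by (simp add: subsp_def)
  note cA = M.subsp_calc[OF A] and cB = H.subsp_calc[OF B]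
  have cA': "calc M A \<subseteq> carrier ?V" and cB': "calc H B \<subseteq> carrier ?W" using cA cB by (auto simp: subsp_def)
  show "?I \<subseteq> calc P (tspan M H A B)"
  proof
    fix z assume "z \<in> ?I"
    then obtain u where u: "u \<in> tspan ?V ?W (calc M A) (calc H B)" "z = shuffle M H u" by blast
    have "shuffle M H u \<in> calc P (tspan M H A B)"
    proof (rule lin_tspan_in[OF vspace_tprod shuffle_lin cA cB' u(1) vspace_tprod P.subsp_calc[OF S]])
      fix x y assume "x \<in> calc M A" "y \<in> calc H B"
      then obtain s t where st: "s \<in> tspan M M (carrier M) A" "x = M.trivi s" "t \<in> tspan H H (carrier H) B" "y = H.trivi t"
        unfolding M.calc_image[OF sub(1)] H.calc_image[OF sub(2)] by blast
      have st': "s \<in> carrier ?V" "t \<in> carrier ?W"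
        using st tspan_subset[OF order_refl sub(1), of M] tspan_subset[OF order_refl sub(2), of H] by auto
      let ?S = "tspan P P (carrier P) (tspan M H A B)"
      have S': "subsp (tprod P P) ?S" using SP by simp
      have "lift M M (\<lambda>m m'. lift H H (\<lambda>h h'. (m \<otimes>\<^bsub>M,H\<^esub> h) \<otimes>\<^bsub>P,P\<^esub> (m' \<otimes>\<^bsub>M,H\<^esub> h')) t) s \<in> ?S"
      proof (rule lift_in_subsp[OF _ _ vspace_tprod _ subsp_carrier[OF M.vspace_alg] sub(1) st(1) S'])
        fix m m' assume m: "m \<in> carrier M" "m' \<in> A"
        then have m': "m' \<in> carrier M" using sub by auto
        show "lift H H (\<lambda>h h'. (m \<otimes>\<^bsub>M,H\<^esub> h) \<otimes>\<^bsub>P,P\<^esub> (m' \<otimes>\<^bsub>M,H\<^esub> h')) t \<in> ?S"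
          by (rule lift_in_subsp[OF _ _ vspace_tprod _ subsp_carrier[OF H.vspace_alg] sub(2) st(3) S']) (use m m' in simp_all)
      qed (use st' in simp_all)
      then show "shuffle M H (x \<otimes>\<^bsub>?V,?W\<^esub> y) \<in> calc P (tspan M H A B)"
        unfolding st(2,4) shuffle_trivi[OF st'] shuffle_tens[OF st'] by (rule P.trivi_in_calc[OF SP])
    qed
    then show "z \<in> calc P (tspan M H A B)" using u by simp
  qed
  show "calc P (tspan M H A B) \<subseteq> ?I"
  proof
    fix z assume "z \<in> calc P (tspan M H A B)"
    then obtain u where u: "u \<in> tspan P P (carrier P) (tspan M H A B)" "z = P.trivi u" unfolding P.calc_image[OF SP] by blast
    have I: "subsp (tprod P P) ?I"
      by (rule subsp_lin_image[OF shuffle_lin]) (use cA' cB' in simp_all)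
    have "P.trivi u \<in> ?I"
    proof (rule lin_tspan_in[OF vspace_P P.trivi_lin subsp_carrier[OF vspace_P] SP u(1) vspace_tprod I])
      fix p y assume p: "p \<in> carrier P" and y: "y \<in> tspan M H A B"
      have p': "p \<in> tspan M H (carrier M) (carrier H)" using p by (simp add: tspan_carrier carrier_P)
      have y': "y \<in> carrier P" using y SP by auto
      show "P.trivi (p \<otimes>\<^bsub>P,P\<^esub> y) \<in> ?I"
      proof (rule lin_tspan_in[where f = "\<lambda>p. P.trivi (p \<otimes>\<^bsub>P,P\<^esub> y)", OF M.vspace_alg _ subsp_carrier[OF M.vspace_alg] order_refl p' vspace_tprod I])
        show "lin PP (tprod P P) (\<lambda>p. P.trivi (p \<otimes>\<^bsub>P,P\<^esub> y))"
          unfolding lin_P(1)[symmetric] using y' by simp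
        fix m h assume mh: "m \<in> carrier M" "h \<in> carrier H"
        show "P.trivi ((m \<otimes>\<^bsub>M,H\<^esub> h) \<otimes>\<^bsub>P,P\<^esub> y) \<in> ?I"
        proof (rule lin_tspan_in[where f = "\<lambda>y. P.trivi ((m \<otimes>\<^bsub>M,H\<^esub> h) \<otimes>\<^bsub>P,P\<^esub> y)", OF M.vspace_alg _ A sub(2) y vspace_tprod I])
          show "lin PP (tprod P P) (\<lambda>y. P.trivi ((m \<otimes>\<^bsub>M,H\<^esub> h) \<otimes>\<^bsub>P,P\<^esub> y))"
            unfolding lin_P(1)[symmetric] using mh by simp
          fix a b assume ab: "a \<in> A" "b \<in> B"
          then have ab': "a \<in> carrier M" "b \<in> carrier H" using sub by auto
          have "P.trivi ((m \<otimes>\<^bsub>M,H\<^esub> h) \<otimes>\<^bsub>P,P\<^esub> (a \<otimes>\<^bsub>M,H\<^esub> b)) =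
            shuffle M H (M.trivi (m \<otimes>\<^bsub>M,M\<^esub> a) \<otimes>\<^bsub>?V,?W\<^esub> H.trivi (h \<otimes>\<^bsub>H,H\<^esub> b))"
            using mh ab' by (subst shuffle_trivi) (simp_all add: shuffle_tens)
          moreover have "M.trivi (m \<otimes>\<^bsub>M,M\<^esub> a) \<in> calc M A" "H.trivi (h \<otimes>\<^bsub>H,H\<^esub> b) \<in> calc H B"
            using mh ab by (auto intro!: M.trivi_in_calc[OF sub(1)] H.trivi_in_calc[OF sub(2)] tens_in_tspan)
          ultimately show "P.trivi ((m \<otimes>\<^bsub>M,H\<^esub> h) \<otimes>\<^bsub>P,P\<^esub> (a \<otimes>\<^bsub>M,H\<^esub> b)) \<in> ?I" by auto
        qed
      qed
    qed
    then show "z \<in> ?I" using u by simp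
  qed
qed

end

lemma lin_inj_on:
  assumes f: "lin V W f" and V: "vspace V" and k: "\<And>x. x \<in> carrier V \<Longrightarrow> f x = 0 \<Longrightarrow> x = 0"
  shows "inj_on f (carrier V)"
proof (rule inj_onI)
  fix x y assume xy: "x \<in> carrier V" "y \<in> carrier V" "f x = f y"
  then have "f (x - y) = 0" using lin_diff[OF f V] by simp
  then show "x = y" using k[of "x - y"] xy V by simp
qed

text \<open>Over a field the image of \<open>f\<close> is a direct summand of \<open>W\<close>:
  project onto it, choose a preimage under \<open>f\<close>, and apply \<open>k\<close>.\<close>

lemma lin_factor:
  assumes f: "lin V W f" and k: "lin V U k" and V: "vspace V" and W: "vspace W"
    and ker: "\<And>v. v \<in> carrier V \<Longrightarrow> f v = 0 \<Longrightarrow> k v = 0"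
  shows "\<exists>g. lin W U g \<and> (\<forall>v\<in>carrier V. g (f v) = k v)"
proof -
  have I: "subsp W (f ` carrier V)" by (rule subsp_lin_image[OF f V W]) (use V in simp)
  obtain p where p: "Vector_Spaces.linear (smul W) (smul W) p" "range p \<subseteq> f ` carrier V" "\<forall>n\<in>f ` carrier V. p n = n"
    using subspace_projection[OF vspace_vector_space[OF W], of "f ` carrier V"] I by (auto simp: subsp_def)
  define s where "s w = (SOME v. v \<in> carrier V \<and> f v = p w)" for w
  have s: "s w \<in> carrier V \<and> f (s w) = p w" for w
  proof -
    have "p w \<in> f ` carrier V" using p(2) by blast
    then have "\<exists>v. v \<in> carrier V \<and> f v = p w" by (elim imageE) auto
    then show ?thesis unfolding s_def by (rule someI_ex)
  qed
  \<comment> \<open>The choice of a preimage need not be linear, but two preimages differ by an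
    element of the kernel of \<open>f\<close>, which \<open>k\<close> kills. Hence the composite is
    linear.\<close>
  have eq: "k v = k v'" if "v \<in> carrier V" "v' \<in> carrier V" "f v = f v'" for v v'
    using ker[of "v - v'"] that V lin_diff[OF f V] lin_diff[OF k V] by simp
  have pl: "p (x + y) = p x + p y" "p (smul W c x) = smul W c (p x)" for x y c
    using p(1) by (auto simp: Vector_Spaces.linear_iff)
  have "lin W U (\<lambda>w. k (s w))"
  proof (rule linI)
    fix x c
    show "k (s x) \<in> carrier U" using s linD(1)[OF k] by blast
    have "k (s (smul W c x)) = k (smul V c (s x))"
      by (rule eq) (use s V in \<open>simp_all add: linD(3)[OF f] pl\<close>)
    then show "k (s (smul W c x)) = smul U c (k (s x))" using s linD(3)[OF k] by simp
    fix y
    have "k (s (x + y)) = k (s x + s y)"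
      by (rule eq) (use s V in \<open>simp_all add: linD(2)[OF f] pl\<close>)
    then show "k (s (x + y)) = k (s x) + k (s y)" using s linD(2)[OF k] by simp
  qed
  moreover have "k (s (f v)) = k v" if "v \<in> carrier V" for v
    by (rule eq) (use that s p(3) in auto)
  ultimately show ?thesis by blast
qed

section \<open>The ideal and the calculus of the product\<close>

locale calculus_pair = M: calculus M Q\<^sub>M + H: calculus H Q\<^sub>H
  for M :: "('k::field, 'm::ab_group_add) hopf" and Q\<^sub>M
    and H :: "('k, 'h::ab_group_add) hopf" and Q\<^sub>H
begin

sublocale hopf_pair M H ..

abbreviation QP :: "('k, 'm, 'h) ten set" where
  "QP \<equiv> Q_prod M H Q\<^sub>M Q\<^sub>H"

lemma ad_stable_QP: "P.ad_stable QP"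
proof -
  have "M.ad_stable Q\<^sub>M" "H.ad_stable Q\<^sub>H" using M.ad_ideal H.ad_ideal by (simp_all add: M.ad_ideal_iff H.ad_ideal_iff)
  then show ?thesis
    unfolding Q_prod_def
    by (intro P.ad_stable_sum3 ad_stable_tspan M.ad_stable_carrier H.ad_stable_carrier M.ad_stable_aug H.ad_stable_aug)
qed

lemma subsp_parts: "subsp P (tspan M H Q\<^sub>M (carrier H))" "subsp P (tspan M H (carrier M) Q\<^sub>H)" "subsp P (tspan M H (aug M) (aug H))"
  by (rule subsp_tspan_P; use M.aug_subset H.aug_subset in simp)+

lemma QP_lin_in:
  assumes f: "lin P U f" and U: "vspace U" and S: "subsp U S" and y: "y \<in> QP"
    and 1: "\<And>q h. q \<in> Q\<^sub>M \<Longrightarrow> h \<in> carrier H \<Longrightarrow> f (q \<otimes>\<^bsub>M,H\<^esub> h) \<in> S"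
    and 2: "\<And>m q. m \<in> carrier M \<Longrightarrow> q \<in> Q\<^sub>H \<Longrightarrow> f (m \<otimes>\<^bsub>M,H\<^esub> q) \<in> S"
    and 3: "\<And>a b. a \<in> aug M \<Longrightarrow> b \<in> aug H \<Longrightarrow> f (a \<otimes>\<^bsub>M,H\<^esub> b) \<in> S"
  shows "f y \<in> S"
proof -
  obtain a b c where y: "y = a + b + c" "a \<in> tspan M H Q\<^sub>M (carrier H)" "b \<in> tspan M H (carrier M) Q\<^sub>H" "c \<in> tspan M H (aug M) (aug H)"
    using y unfolding Q_prod_def sum3_def by blast
  have f': "lin PP U f" using f by (simp add: lin_P)
  have "f a \<in> S" by (rule lin_tspan_in[OF M.vspace_alg f' _ _ y(2) U S]) (use 1 in simp_all)
  moreover have "f b \<in> S" by (rule lin_tspan_in[OF M.vspace_alg f' _ _ y(3) U S]) (use 2 in simp_all)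
  moreover have "f c \<in> S" by (rule lin_tspan_in[OF M.vspace_alg f' _ _ y(4) U S]) (use 3 H.aug_subset in simp_all)
  moreover have "f y = f a + f b + f c"
  proof -
    have "a \<in> carrier P" "b \<in> carrier P" "c \<in> carrier P" using y subsp_parts by (auto simp: subsp_def)
    then show ?thesis unfolding y(1) by (simp add: linD(2)[OF f])
  qed
  ultimately show ?thesis using S by (simp add: subsp_iff[OF U])
qed

lemma ad_ideal_QP: "ad_ideal P QP"
proof -
  have "q \<in> aug P" if "q \<in> QP" for q
    by (rule QP_lin_in[where f = "\<lambda>x. x", OF _ vspace_P P.subsp_aug that]) (auto simp: aug_def)
  then show ?thesis using ad_stable_QP by (auto simp: P.ad_ideal_iff)
qed

sublocale P: calculus P QP
  by unfold_locales (rule ad_ideal_QP)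

lemma QP_tens: "q \<in> Q\<^sub>M \<Longrightarrow> h \<in> carrier H \<Longrightarrow> (q \<otimes>\<^bsub>M,H\<^esub> h) \<in> QP" "m \<in> carrier M \<Longrightarrow> q' \<in> Q\<^sub>H \<Longrightarrow> (m \<otimes>\<^bsub>M,H\<^esub> q') \<in> QP"
  using subsp_sum3(2,3)[OF vspace_P subsp_parts] unfolding Q_prod_def by (blast intro: tens_in_tspan)+

text \<open>All of \<open>M \<otimes> M\<close> is \<open>calc\<close> of \<open>carrier M\<close>
  and the universal forms are \<open>calc\<close> of \<open>aug M\<close>, and likewise for
  \<open>H\<close>. The three summands are therefore instances of \<open>shuffle_calc\<close>, for
  the pairs \<open>Q\<^sub>M\<close> with \<open>carrier H\<close>, \<open>carrier M\<close> with
  \<open>Q\<^sub>H\<close>, and \<open>aug M\<close> with \<open>aug H\<close>.\<close>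

lemma N_prod_eq: "N_prod M H M.N H.N = calc P QP"
proof -
  have s: "subsp M Q\<^sub>M" "subsp M (carrier M)" "subsp M (aug M)" "subsp H Q\<^sub>H" "subsp H (carrier H)" "subsp H (aug H)" by simp_all
  have c: "calc M A \<subseteq> carrier (tprod M M)" for A by (auto simp: M.calc_iff)
  have c': "calc H A \<subseteq> carrier (tprod H H)" for A by (auto simp: H.calc_iff)
  show ?thesis
    unfolding N_prod_def Q_prod_def M.calc_carrier[symmetric] H.calc_carrier[symmetric] M.univ_eq_calc H.univ_eq_calc
      P.calc_sum3[OF subsp_parts] shuffle_calc[OF s(1,5), symmetric] shuffle_calc[OF s(2,4), symmetric] shuffle_calc[OF s(3,6), symmetric]
    by (rule lin_image_sum3[OF shuffle_lin]) (use tspan_subset[OF c c'] in simp_all)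
qed

section \<open>Splitting of \<open>\<Omega>\<^sub>0\<close> of the product\<close>

definition eM :: "('k, 'm, 'h) ten \<Rightarrow> 'm" where "eM = lift M H (\<lambda>m h. smul M (counit H h) m)"
definition eH :: "('k, 'm, 'h) ten \<Rightarrow> 'h" where "eH = lift M H (\<lambda>m h. smul H (counit M m) h)"

lemma e_lin: "lin P M eM" "lin P H eH"
  unfolding lin_P eM_def eH_def by (rule lin_lift; simp)+

lemma e_tens: "m \<in> carrier M \<Longrightarrow> h \<in> carrier H \<Longrightarrow> eM (m \<otimes>\<^bsub>M,H\<^esub> h) = smul M (counit H h) m"
    "m \<in> carrier M \<Longrightarrow> h \<in> carrier H \<Longrightarrow> eH (m \<otimes>\<^bsub>M,H\<^esub> h) = smul H (counit M m) h"
  unfolding eM_def eH_def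
  by (rule lift_tens_in[where U = M] lift_tens_in[where U = H]; simp)+

text \<open>The maps \<open>id \<otimes> \<epsilon>\<close> and
  \<open>\<epsilon> \<otimes> id\<close> carry one summand of \<open>QP\<close> into the
  corresponding ideal; on the generators of the other two the factor that is evaluated has counit
  zero. They serve to detect when a class coming from \<open>M\<close> or \<open>H\<close> vanishes
  in \<open>P\<close>.\<close>

lemma e_QP: assumes "y \<in> QP" shows "eM y \<in> Q\<^sub>M" "eH y \<in> Q\<^sub>H"
proof -
  note sM = M.subsp_Q[unfolded subsp_iff[OF M.vspace_alg]] and sH = H.subsp_Q[unfolded subsp_iff[OF H.vspace_alg]]
  show "eM y \<in> Q\<^sub>M"
    by (rule QP_lin_in[OF e_lin(1) _ M.subsp_Q assms]) (use sM in \<open>auto simp: e_tens aug_def vspace_smul\<close>)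
  show "eH y \<in> Q\<^sub>H"
    by (rule QP_lin_in[OF e_lin(2) _ H.subsp_Q assms]) (use sH in \<open>auto simp: e_tens aug_def vspace_smul\<close>)
qed

lemma Omega0_decomposition:
  "\<exists>i\<^sub>M i\<^sub>H.
     lin (Omega0 M Q\<^sub>M) (Omega0 P QP) i\<^sub>M \<and>
     (\<forall>m\<in>aug M. i\<^sub>M (pi0 M Q\<^sub>M m) = pi0 P QP (m \<otimes>\<^bsub>M,H\<^esub> \<one>\<^bsub>H\<^esub>)) \<and>
     inj_on i\<^sub>M (carrier (Omega0 M Q\<^sub>M)) \<and>
     lin (Omega0 H Q\<^sub>H) (Omega0 P QP) i\<^sub>H \<and>
     (\<forall>h\<in>aug H. i\<^sub>H (pi0 H Q\<^sub>H h) = pi0 P QP (\<one>\<^bsub>M\<^esub> \<otimes>\<^bsub>M,H\<^esub> h)) \<and>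
     inj_on i\<^sub>H (carrier (Omega0 H Q\<^sub>H)) \<and>
     carrier (Omega0 P QP) =
       {v + w | v w. v \<in> i\<^sub>M ` carrier (Omega0 M Q\<^sub>M) \<and> w \<in> i\<^sub>H ` carrier (Omega0 H Q\<^sub>H)} \<and>
     i\<^sub>M ` carrier (Omega0 M Q\<^sub>M) \<inter> i\<^sub>H ` carrier (Omega0 H Q\<^sub>H) = {0}"
proof -
  let ?fM = "\<lambda>m. pi0 P QP (m \<otimes>\<^bsub>M,H\<^esub> \<one>\<^bsub>H\<^esub>)" and ?fH = "\<lambda>h. pi0 P QP (\<one>\<^bsub>M\<^esub> \<otimes>\<^bsub>M,H\<^esub> h)"
  have l: "lin M P.Om ?fM" "lin H P.Om ?fH" by simp_all
  have lM: "lin M.A0 P.Om ?fM" by (rule lin_narrow[OF l(1)]) (simp_all add: M.aug_subset)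
  have lH: "lin H.A0 P.Om ?fH" by (rule lin_narrow[OF l(2)]) (simp_all add: H.aug_subset)
  define iM where "iM = descend M.A0 Q\<^sub>M ?fM"
  define iH where "iH = descend H.A0 Q\<^sub>H ?fH"
  have zM: "?fM q = 0" if "q \<in> Q\<^sub>M" for q using that by (simp add: QP_tens)
  have zH: "?fH q = 0" if "q \<in> Q\<^sub>H" for q using that by (simp add: QP_tens)
  note dM = descend_lin[OF M.vspace_A0 M.subsp_A0 lM zM, folded iM_def]
  note dH = descend_lin[OF H.vspace_A0 H.subsp_A0 lH zH, folded iH_def]
  have iM: "iM (pi0 M Q\<^sub>M m) = ?fM m" if "m \<in> aug M" for m
    using that dM(1)[of m] by (simp add: M.pi0_A0[of m] aug_def M.pr_id)
  have iH: "iH (pi0 H Q\<^sub>H h) = ?fH h" if "h \<in> aug H" for h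
    using that dH(1)[of h] by (simp add: H.pi0_A0[of h] aug_def H.pr_id)
  have LM: "lin M.Om P.Om iM" using dM(2) by (simp add: Omega0_def)
  have LH: "lin H.Om P.Om iH" using dH(2) by (simp add: Omega0_def)
  have carr: "m \<in> carrier M \<and> counit M m = 0" if "m \<in> aug M" for m using that by (simp add: aug_def)
  have carr': "h \<in> carrier H \<and> counit H h = 0" if "h \<in> aug H" for h using that by (simp add: aug_def)
  have injM: "inj_on iM (carrier M.Om)"
  proof (rule lin_inj_on[OF LM M.vspace_Om])
    fix x assume "x \<in> carrier M.Om" and 0: "iM x = 0"
    then obtain m where m: "m \<in> aug M" "x = pi0 M Q\<^sub>M m" unfolding M.carrier_Om_aug by blast
    then have "(m \<otimes>\<^bsub>M,H\<^esub> \<one>\<^bsub>H\<^esub>) \<in> QP" using 0 carr[OF m(1)] by (simp add: iM P.pi0_eq_0 P.pr_id)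
    from e_QP(1)[OF this] show "x = 0" using m carr[OF m(1)] by (simp add: e_tens vspace_smul)
  qed
  have injH: "inj_on iH (carrier H.Om)"
  proof (rule lin_inj_on[OF LH H.vspace_Om])
    fix x assume "x \<in> carrier H.Om" and 0: "iH x = 0"
    then obtain h where h: "h \<in> aug H" "x = pi0 H Q\<^sub>H h" unfolding H.carrier_Om_aug by blast
    then have "(\<one>\<^bsub>M\<^esub> \<otimes>\<^bsub>M,H\<^esub> h) \<in> QP" using 0 carr'[OF h(1)] by (simp add: iH P.pi0_eq_0 P.pr_id)
    from e_QP(2)[OF this] show "x = 0" using h carr'[OF h(1)] by (simp add: e_tens vspace_smul)
  qed
  have imM: "iM ` carrier M.Om = ?fM ` aug M" unfolding M.carrier_Om_aug image_image by (rule image_cong) (simp_all add: iM)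
  have imH: "iH ` carrier H.Om = ?fH ` aug H" unfolding H.carrier_Om_aug image_image by (rule image_cong) (simp_all add: iH)
  have sum: "carrier P.Om = {v + w | v w. v \<in> ?fM ` aug M \<and> w \<in> ?fH ` aug H}"
  proof
    show "{v + w | v w. v \<in> ?fM ` aug M \<and> w \<in> ?fH ` aug H} \<subseteq> carrier P.Om"
      using carr carr' by (auto intro!: vspace_closed)
    show "carrier P.Om \<subseteq> {v + w | v w. v \<in> ?fM ` aug M \<and> w \<in> ?fH ` aug H}"
    proof
      fix x assume "x \<in> carrier P.Om"
      then obtain p where p: "p \<in> carrier P" "x = pi0 P QP p" unfolding P.carrier_Om by blast
      \<comment> \<open>Modulo \<open>QP\<close> and constants, \<open>p\<close> is
        \<open>eM p \<otimes> 1 + 1 \<otimes> eH p\<close>.\<close>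
      let ?g = "\<lambda>p. ?fM (M.pr (eM p)) + ?fH (H.pr (eH p))"
      have "pi0 P QP p = ?g p"
      proof (rule P_eqI[where f = "pi0 P QP" and g = ?g and U = fspace and U' = fspace, OF _ _ p(1)])
        show "lin P fspace (pi0 P QP)" by simp
        show "lin P fspace ?g"
          by (rule lin_add) (use lin_compose[OF l(1) M.lin_pr[OF e_lin(1)]] lin_compose[OF l(2) H.lin_pr[OF e_lin(2)]] in
              \<open>auto intro: lin_widen\<close>)
        fix m h assume mh: "m \<in> carrier M" "h \<in> carrier H"
        have "((M.pr m) \<otimes>\<^bsub>M,H\<^esub> (H.pr h)) \<in> QP"
          using subsp_sum3(4)[OF vspace_P subsp_parts] mh unfolding Q_prod_def by (auto intro!: tens_in_tspan)
        then have "pi0 P QP ((M.pr m) \<otimes>\<^bsub>M,H\<^esub> (H.pr h)) = 0" by simp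
        \<comment> \<open>Writing \<open>m\<close> as \<open>pr m\<close> plus a multiple of the
          unit, and \<open>h\<close> likewise, gives four terms. The first lies in the summand of
          \<open>QP\<close> spanned by \<open>aug M\<close> and \<open>aug H\<close>, and the last
          is a constant.\<close>
        moreover have "(m \<otimes>\<^bsub>M,H\<^esub> h) = ((M.pr m) \<otimes>\<^bsub>M,H\<^esub> (H.pr h)) + fsmul (counit H h) (M.pr m \<otimes>\<^bsub>M,H\<^esub> \<one>\<^bsub>H\<^esub>)
           + fsmul (counit M m) (\<one>\<^bsub>M\<^esub> \<otimes>\<^bsub>M,H\<^esub> H.pr h) + fsmul (counit M m * counit H h) \<one>\<^bsub>P\<^esub>"
          by (simp add: M.pr_def H.pr_def tens_linear P_unit fs.scale_right_diff_distrib mult.commute)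
        moreover have "pi0 P QP (((M.pr m) \<otimes>\<^bsub>M,H\<^esub> (H.pr h)) + fsmul (counit H h) (M.pr m \<otimes>\<^bsub>M,H\<^esub> \<one>\<^bsub>H\<^esub>)
           + fsmul (counit M m) (\<one>\<^bsub>M\<^esub> \<otimes>\<^bsub>M,H\<^esub> H.pr h) + fsmul (counit M m * counit H h) \<one>\<^bsub>P\<^esub>) =
           pi0 P QP ((M.pr m) \<otimes>\<^bsub>M,H\<^esub> (H.pr h)) + fsmul (counit H h) (?fM (M.pr m)) + fsmul (counit M m) (?fH (H.pr h))"
          using mh linD(3)[OF P.pi0_lin, simplified] by (simp add: linD(2)[OF P.pi0_lin])
        ultimately have e: "pi0 P QP (m \<otimes>\<^bsub>M,H\<^esub> h) = fsmul (counit H h) (?fM (M.pr m)) + fsmul (counit M m) (?fH (H.pr h))" by simp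
        have "M.pr (eM (m \<otimes>\<^bsub>M,H\<^esub> h)) = smul M (counit H h) (M.pr m)" "H.pr (eH (m \<otimes>\<^bsub>M,H\<^esub> h)) = smul H (counit M m) (H.pr h)"
          using mh by (simp_all add: e_tens M.pr_def H.pr_def vspace_smul)
        then show "pi0 P QP (m \<otimes>\<^bsub>M,H\<^esub> h) = ?g (m \<otimes>\<^bsub>M,H\<^esub> h)"
          unfolding e using mh linD(3)[OF l(1)] linD(3)[OF l(2)] by simp
      qed
      moreover have "M.pr (eM p) \<in> aug M" "H.pr (eH p) \<in> aug H" using linD(1)[OF e_lin(1)] linD(1)[OF e_lin(2)] p by auto
      ultimately show "x \<in> {v + w | v w. v \<in> ?fM ` aug M \<and> w \<in> ?fH ` aug H}" using p(2) by blast
    qed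
  qed
  have "v = 0" if v: "v \<in> ?fM ` aug M" "v \<in> ?fH ` aug H" for v
  proof -
    obtain m h where mh: "m \<in> aug M" "v = ?fM m" "h \<in> aug H" "v = ?fH h" using v by blast
    note c = carr[OF mh(1)] carr'[OF mh(3)]
    have "pi0 P QP ((m \<otimes>\<^bsub>M,H\<^esub> \<one>\<^bsub>H\<^esub>) - (\<one>\<^bsub>M\<^esub> \<otimes>\<^bsub>M,H\<^esub> h)) = 0"
      using mh c by (simp add: lin_diff[OF P.pi0_lin])
    then have "(m \<otimes>\<^bsub>M,H\<^esub> \<one>\<^bsub>H\<^esub>) - (\<one>\<^bsub>M\<^esub> \<otimes>\<^bsub>M,H\<^esub> h) \<in> QP" using c by (simp add: P.pi0_eq_0 P.pr_id)
    \<comment> \<open>\<open>eM\<close> sends \<open>m \<otimes> 1 - 1 \<otimes> h\<close> to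
      \<open>m - \<epsilon>(h) 1\<close>, which is \<open>m\<close>.\<close>
    from e_QP(1)[OF this] have "m \<in> Q\<^sub>M" using c by (simp add: lin_diff[OF e_lin(1)] e_tens vspace_smul)
    then show ?thesis using mh zM by simp
  qed
  moreover have "0 \<in> ?fM ` aug M"
    using lin_0[OF l(1)] by (intro image_eqI[where x = 0]) (simp_all add: aug_def)
  moreover have "0 \<in> ?fH ` aug H"
    using lin_0[OF l(2)] by (intro image_eqI[where x = 0]) (simp_all add: aug_def)
  ultimately have int: "?fM ` aug M \<inter> ?fH ` aug H = {0}" by blast
  show ?thesis
    by (intro exI[of _ iM] exI[of _ iH] conjI ballI LM LH injM injH iM iH)
      (simp_all only: imM imH sum int)
qed

end

subsection \<open>Two-forms on the product\<close>

context calculus_pair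
begin

section \<open>The inclusion of \<open>M\<close> into the product\<close>

definition emb :: "'m \<Rightarrow> ('k, 'm, 'h) ten" where
  "emb m = (m \<otimes>\<^bsub>M,H\<^esub> \<one>\<^bsub>H\<^esub>)"

lemma emb_mem [simp]: "m \<in> carrier M \<Longrightarrow> emb m \<in> carrier P"
  by (simp add: emb_def)

lemma lin_emb [simp]: "lin X M f \<Longrightarrow> smul U = fsmul \<Longrightarrow> carrier P \<subseteq> carrier U \<Longrightarrow> lin X U (\<lambda>x. emb (f x))"
  unfolding emb_def by (rule lin_tens1) (simp_all add: carrier_P)

lemma emb_mul: "m \<in> carrier M \<Longrightarrow> m' \<in> carrier M \<Longrightarrow> emb (m \<cdot>\<^bsub>M\<^esub> m') = emb m \<cdot>\<^bsub>P\<^esub> emb m'"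
  by (simp add: emb_def)

lemma emb_unit: "emb \<one>\<^bsub>M\<^esub> = \<one>\<^bsub>P\<^esub>"
  by (simp add: emb_def P_unit)

lemma emb_antip: "m \<in> carrier M \<Longrightarrow> antip P (emb m) = emb (antip M m)"
  by (simp add: emb_def)

lemma emb_pr: "m \<in> carrier M \<Longrightarrow> P.pr (emb m) = emb (M.pr m)"
  by (simp add: emb_def P.pr_def M.pr_def P_unit tens_linear)

lemma emb_sw: "bilin P P fspace F \<Longrightarrow> m \<in> carrier M \<Longrightarrow> sw2 P F (emb m) = M.sw (\<lambda>a b. F (emb a) (emb b)) m"
proof -
  assume F: "bilin P P fspace F" and m: "m \<in> carrier M"
  have l: "lin X fspace (\<lambda>x. F (f x) c)" "lin X fspace (\<lambda>x. F c (f x))" if "lin X P f" "c \<in> carrier P" for X :: "('k, 'h) hopf" and f c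
    using lin_bilin1[OF F that, of fspace] lin_bilin2[OF F that, of fspace] by simp_all
  have "sw2 P F (emb m) = M.sw (\<lambda>m1 m2. H.sw (\<lambda>h1 h2. F (m1 \<otimes>\<^bsub>M,H\<^esub> h1) (m2 \<otimes>\<^bsub>M,H\<^esub> h2)) \<one>\<^bsub>H\<^esub>) m"
    unfolding emb_def by (rule P_sw_tens[OF F m]) simp
  also have "\<dots> = M.sw (\<lambda>a b. F (emb a) (emb b)) m"
    unfolding emb_def by (intro M.sw_cong refl H.sw_unit) (simp_all add: l)
  finally show ?thesis .
qed

definition emb2 :: "('k, 'm, 'm) ten \<Rightarrow> ('k, ('k, 'm, 'h) ten, ('k, 'm, 'h) ten) ten" where
  "emb2 = lift M M (\<lambda>m m'. emb m \<otimes>\<^bsub>P,P\<^esub> emb m')"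

lemma emb2_lin: "lin (tprod M M) (tprod P P) emb2"
  unfolding emb2_def by (rule lin_lift) simp_all

lemma emb2_mem [simp]: "t \<in> carrier (tprod M M) \<Longrightarrow> emb2 t \<in> carrier (tprod P P)"
  by (rule linD(1)[OF emb2_lin])

lemma lin_emb2 [simp]: "lin X (tprod M M) f \<Longrightarrow> smul U = fsmul \<Longrightarrow> carrier (tprod P P) \<subseteq> carrier U \<Longrightarrow> lin X U (\<lambda>x. emb2 (f x))"
  by (rule lin_compose_widen[OF emb2_lin]) simp_all

lemma emb2_tens [simp]: "m \<in> carrier M \<Longrightarrow> m' \<in> carrier M \<Longrightarrow> emb2 (m \<otimes>\<^bsub>M,M\<^esub> m') = (emb m \<otimes>\<^bsub>P,P\<^esub> emb m')"
  by (simp add: emb2_def)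

lemma emb2_sw: "bilin M M (tprod M M) F \<Longrightarrow> m \<in> carrier M \<Longrightarrow> emb2 (M.sw F m) = M.sw (\<lambda>a b. emb2 (F a b)) m"
  by (rule M.sw_linear[OF _ _ _ emb2_lin]) simp_all

lemma emb2_eqI:
  assumes "lin (tprod M M) fspace f" "lin (tprod M M) fspace g" "t \<in> carrier (tprod M M)"
    "\<And>a b. a \<in> carrier M \<Longrightarrow> b \<in> carrier M \<Longrightarrow> f (a \<otimes>\<^bsub>M,M\<^esub> b) = g (a \<otimes>\<^bsub>M,M\<^esub> b)"
  shows "f t = g t"
  by (rule tprod_eqI[OF M.vspace_alg assms(1,2,4,3)])

text \<open>\<open>triv\<close> is built from product and coproduct alone, and \<open>emb\<close>
  respects both.\<close>

lemma triv_emb2: "t \<in> carrier (tprod M M) \<Longrightarrow> triv P (emb2 t) = emb2 (triv M t)"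
  by (rule emb2_eqI[where f = "\<lambda>t. triv P (emb2 t)"])
    (simp_all add: P.triv_tens M.triv_tens emb2_sw emb_sw emb_mul)

lemma trivi_emb2:
  assumes "t \<in> carrier (tprod M M)" shows "P.trivi (emb2 t) = emb2 (M.trivi t)"
  using triv_emb2[of "M.trivi t"] P.trivi_triv[of "emb2 (M.trivi t)"] assms by simp

lemma emb2_act:
  assumes "m \<in> carrier M" "t \<in> carrier (tprod M M)"
  shows "emb2 (lact (univ M) m t) = lact (univ P) (emb m) (emb2 t)"
    "emb2 (ract (univ M) t m) = ract (univ P) (emb2 t) (emb m)"
proof -
  show "emb2 (lact (univ M) m t) = lact (univ P) (emb m) (emb2 t)"
    by (rule emb2_eqI[where f = "\<lambda>t. emb2 (lact (univ M) m t)", OF _ _ assms(2)]) (use assms(1) in \<open>simp_all add: emb_mul\<close>)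
  show "emb2 (ract (univ M) t m) = ract (univ P) (emb2 t) (emb m)"
    by (rule emb2_eqI[where f = "\<lambda>t. emb2 (ract (univ M) t m)", OF _ _ assms(2)]) (use assms(1) in \<open>simp_all add: emb_mul\<close>)
qed

text \<open>As \<open>emb2\<close> commutes with \<open>triv\<close>, it maps
  \<open>M \<otimes> A\<close> in the trivialisation into \<open>P \<otimes> A'\<close>. For the
  kernels of the counits this restricts \<open>emb2\<close> to universal forms; for
  \<open>Q\<^sub>M\<close> and \<open>QP\<close> it makes \<open>emb2\<close> descend to
  \<open>\<Omega>\<^sup>1(M)\<close>.\<close>

lemma emb2_calc:
  assumes A: "subsp M A" and A': "subsp P A'" and e: "\<And>a. a \<in> A \<Longrightarrow> emb a \<in> A'" and t: "t \<in> calc M A"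
  shows "emb2 t \<in> calc P A'"
proof -
  have t': "t \<in> carrier (tprod M M)" "triv M t \<in> tspan M M (carrier M) A" using t by (auto simp: M.calc_iff)
  have "emb2 (triv M t) \<in> tspan P P (carrier P) A'"
  proof (rule lin_tspan_in[OF M.vspace_alg emb2_lin _ _ t'(2)])
    show "subsp (tprod P P) (tspan P P (carrier P) A')" by (rule subsp_tspan) (use A' in \<open>auto simp: subsp_def\<close>)
    show "emb2 (m \<otimes>\<^bsub>M,M\<^esub> a) \<in> tspan P P (carrier P) A'" if "m \<in> carrier M" "a \<in> A" for m a
      using that A e by (auto simp: subsp_def intro!: tens_in_tspan)
  qed (use A in \<open>simp_all add: subsp_def M.vspace_alg[unfolded vspace_def]\<close>)
  then show ?thesis using t' by (simp add: P.calc_iff triv_emb2)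
qed

lemma emb2_univ [simp]: "t \<in> carrier (univ M) \<Longrightarrow> emb2 t \<in> carrier (univ P)"
  unfolding M.univ_eq_calc P.univ_eq_calc
  by (rule emb2_calc[OF M.subsp_aug P.subsp_aug]) (auto simp: aug_def emb_def)

lemma emb2_N: "t \<in> M.N \<Longrightarrow> emb2 t \<in> P.N"
  by (rule emb2_calc[OF M.subsp_Q P.subsp_Q]) (auto simp: emb_def QP_tens)

definition j1 :: "('k, 'm) form1 \<Rightarrow> ('k, ('k, 'm, 'h) ten) form1" where
  "j1 = descend (univ M) M.N (\<lambda>t. P.cl (emb2 t))"

lemma j1_cl: "t \<in> carrier (univ M) \<Longrightarrow> j1 (M.cl t) = P.cl (emb2 t)"
  and j1_lin: "lin M.B1 P.B1 j1"
proof -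
  have "lin (univ M) P.B1 (\<lambda>t. P.cl (emb2 t))"
    by (rule lin_compose[OF P.cl_lin], rule lin_restrict[OF lin_narrow[OF emb2_lin _ M.univ_sub_T]]) simp_all
  note d = descend_lin[OF M.vspace_univ M.subsp_N this, folded j1_def]
  show "j1 (M.cl t) = P.cl (emb2 t)" if "t \<in> carrier (univ M)"
    using d(1)[of t] that emb2_N by (simp add: M.proj_univ)
  show "lin M.B1 P.B1 j1" using d(2) emb2_N by (simp add: lin_def M.carrier_B1_quot)
qed

lemma j1_mem [simp]: "v \<in> carrier M.B1 \<Longrightarrow> j1 v \<in> carrier P.B1"
  by (rule linD(1)[OF j1_lin])

lemma lin_j1 [simp]: "lin X M.B1 f \<Longrightarrow> smul U = fsmul \<Longrightarrow> carrier P.B1 \<subseteq> carrier U \<Longrightarrow> lin X U (\<lambda>x. j1 (f x))"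
  by (rule lin_compose_widen[OF j1_lin]) simp_all

lemma j1_E:
  assumes "m \<in> carrier M" "m' \<in> carrier M"
  shows "j1 (M.E m m') = P.E (emb m) (emb m')"
  using assms by (simp add: M.E_def P.E_def j1_cl emb_pr trivi_emb2[symmetric])

lemma j1_act:
  assumes m: "m \<in> carrier M" and v: "v \<in> carrier M.B1"
  shows "j1 (lact M.B1 m v) = lact P.B1 (emb m) (j1 v)" "j1 (ract M.B1 v m) = ract P.B1 (j1 v) (emb m)"
proof -
  interpret UM: bimod M "univ M" by (rule M.bimod_univ)
  obtain t where t: "t \<in> carrier (univ M)" "v = M.cl t" using v by (auto simp: M.carrier_B1)
  show "j1 (lact M.B1 m v) = lact P.B1 (emb m) (j1 v)" "j1 (ract M.B1 v m) = ract P.B1 (j1 v) (emb m)"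
    using t m by (simp_all add: M.lact_cl M.ract_cl P.lact_cl P.ract_cl j1_cl emb2_act M.univ_T)
qed

lemma j1_df: "m \<in> carrier M \<Longrightarrow> j1 (M.df m) = P.df (emb m)"
proof -
  assume m: "m \<in> carrier M"
  have "emb2 (duniv M m) = duniv P (emb m)"
    using m lin_diff[OF emb2_lin] by (simp add: duniv_def emb_unit)
  then show ?thesis using m by (simp add: M.df_cl P.df_cl j1_cl)
qed

text \<open>The differential, the right action, the coproduct and the antipode are all respected by
  the inclusion. Together with \<open>j1_E\<close> this matches the generators on which both
  braidings are known.\<close>

lemma j1_rinv: "m \<in> carrier M \<Longrightarrow> j1 (M.rinv m) = P.rinv (emb m)"
proof -
  assume m: "m \<in> carrier M"
  have "j1 (M.rinv m) = M.sw (\<lambda>a b. j1 (ract M.B1 (M.df a) (antip M b))) m"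
    unfolding M.rinv_def by (rule M.sw_linear[OF _ _ _ j1_lin]) (use m in simp_all)
  also have "\<dots> = M.sw (\<lambda>a b. ract P.B1 (P.df (emb a)) (antip P (emb b))) m"
    by (intro M.sw_cong refl) (simp add: j1_act j1_df emb_antip)
  also have "\<dots> = P.rinv (emb m)" unfolding P.rinv_def using m by (simp add: emb_sw)
  finally show ?thesis .
qed

section \<open>The inclusion on tensor squares and two-forms\<close>

definition J2 :: "('k, ('k, ('k, 'm) form1, ('k, 'm) form1) ten) quo \<Rightarrow>
    ('k, ('k, ('k, ('k, 'm, 'h) ten) form1, ('k, ('k, 'm, 'h) ten) form1) ten) quo" where
  "J2 = descend (tprod M.B1 M.B1) M.B.R (lift M.B1 M.B1 (\<lambda>v w. P.B.bt (j1 v) (j1 w)))"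

lemma J2_lin: "lin M.B.BB P.B.BB J2"
  and J2_bt: "v \<in> carrier M.B1 \<Longrightarrow> w \<in> carrier M.B1 \<Longrightarrow> J2 (M.B.bt v w) = P.B.bt (j1 v) (j1 w)"
proof -
  have 1: "bilin M.B1 M.B1 P.B.BB (\<lambda>v w. P.B.bt (j1 v) (j1 w))" by simp
  note l = M.B.bal_lift[OF P.B.vspace_BB 1, folded J2_def]
  show "lin M.B.BB P.B.BB J2" by (rule l(1)) (simp add: j1_act P.B.bt_balanced)
  show "J2 (M.B.bt v w) = P.B.bt (j1 v) (j1 w)" if "v \<in> carrier M.B1" "w \<in> carrier M.B1"
    by (rule l(2)) (use that in \<open>simp_all add: j1_act P.B.bt_balanced\<close>)
qed

lemma J2_mem [simp]: "t \<in> carrier M.B.BB \<Longrightarrow> J2 t \<in> carrier P.B.BB"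
  by (rule linD(1)[OF J2_lin])

lemma lin_J2 [simp]: "lin X M.B.BB f \<Longrightarrow> smul U = fsmul \<Longrightarrow> carrier P.B.BB \<subseteq> carrier U \<Longrightarrow> lin X U (\<lambda>x. J2 (f x))"
  by (rule lin_compose_widen[OF J2_lin]) simp_all

lemma J2_act:
  assumes m: "m \<in> carrier M" and t: "t \<in> carrier M.B.BB"
  shows "J2 (lact M.B.BB m t) = lact P.B.BB (emb m) (J2 t)" "J2 (ract M.B.BB t m) = ract P.B.BB (J2 t) (emb m)"
proof -
  show "J2 (lact M.B.BB m t) = lact P.B.BB (emb m) (J2 t)"
    by (rule M.B.bal_ext[where f = "\<lambda>t. J2 (lact M.B.BB m t)" and g = "\<lambda>t. lact P.B.BB (emb m) (J2 t)" and U = P.B.BB and U' = P.B.BB, OF _ _ _ t])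
      (use m in \<open>simp_all add: lin_compose[OF J2_lin M.B.BB_lact(1)] lin_compose[OF P.B.BB_lact(1) J2_lin] J2_bt M.B.BB_lact(2) P.B.BB_lact(2) j1_act\<close>)
  show "J2 (ract M.B.BB t m) = ract P.B.BB (J2 t) (emb m)"
    by (rule M.B.bal_ext[where f = "\<lambda>t. J2 (ract M.B.BB t m)" and g = "\<lambda>t. ract P.B.BB (J2 t) (emb m)" and U = P.B.BB and U' = P.B.BB, OF _ _ _ t])
      (use m in \<open>simp_all add: lin_compose[OF J2_lin M.B.BB_ract(1)] lin_compose[OF P.B.BB_ract(1) J2_lin] J2_bt M.B.BB_ract(2) P.B.BB_ract(2) j1_act\<close>)
qed

text \<open>On the spanning elements \<open>h (e(g) \<otimes> rinv x) c\<close> the braiding of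
  \<open>M\<close> is the flip, and \<open>J2\<close> sends them to elements of the same kind over
  \<open>P\<close>, where the braiding is again the flip.\<close>

lemma J2_braiding:
  assumes t: "t \<in> carrier M.B.BB" shows "J2 (M.\<Psi> t) = P.\<Psi> (J2 t)"
proof (rule M.BB_ext_invariant[where U = P.B.BB and f = "\<lambda>t. J2 (M.\<Psi> t)" and f' = "\<lambda>t. P.\<Psi> (J2 t)", OF _ _ _ _ t])
  show "lin M.B.BB P.B.BB (\<lambda>t. J2 (M.\<Psi> t))" "lin M.B.BB P.B.BB (\<lambda>t. P.\<Psi> (J2 t))"
    by (rule lin_compose[OF J2_lin M.\<Psi>_lin] lin_compose[OF P.\<Psi>_lin J2_lin])+
  fix h g x c assume a: "h \<in> carrier M" "g \<in> carrier M" "x \<in> carrier M" "c \<in> carrier M"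
  have "J2 (M.\<Psi> (lact M.B.BB h (ract M.B.BB (M.B.bt (M.E \<one>\<^bsub>M\<^esub> g) (M.rinv x)) c))) =
    lact P.B.BB (emb h) (ract P.B.BB (P.B.bt (P.rinv (emb x)) (P.E \<one>\<^bsub>P\<^esub> (emb g))) (emb c))"
    using a by (simp add: M.braiding_invariant J2_act J2_bt j1_E j1_rinv emb_unit)
  also have "\<dots> = P.\<Psi> (lact P.B.BB (emb h) (ract P.B.BB (P.B.bt (P.E \<one>\<^bsub>P\<^esub> (emb g)) (P.rinv (emb x))) (emb c)))"
    using a by (simp add: P.braiding_invariant)
  also have "\<dots> = P.\<Psi> (J2 (lact M.B.BB h (ract M.B.BB (M.B.bt (M.E \<one>\<^bsub>M\<^esub> g) (M.rinv x)) c)))"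
    using a by (simp add: J2_act J2_bt j1_E j1_rinv emb_unit)
  finally show "J2 (M.\<Psi> (lact M.B.BB h (ract M.B.BB (M.B.bt (M.E \<one>\<^bsub>M\<^esub> g) (M.rinv x)) c))) = \<dots>" .
qed simp

lemma J2_K: "t \<in> M.K \<Longrightarrow> J2 t \<in> P.K"
  using J2_braiding[of t] by (simp add: M.K_iff P.K_iff)

definition j2 :: "('k, 'm) form2 \<Rightarrow> ('k, ('k, 'm, 'h) ten) form2" where
  "j2 = descend M.B.BB M.K (\<lambda>t. proj P.B.BB P.K (J2 t))"

lemma j2_proj: "t \<in> carrier M.B.BB \<Longrightarrow> j2 (proj M.B.BB M.K t) = proj P.B.BB P.K (J2 t)"
  and j2_lin: "lin M.B2 P.B2 j2"
proof -
  have 1: "lin M.B.BB (quot P.B.BB P.K) (\<lambda>t. proj P.B.BB P.K (J2 t))" by simp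
  have 0: "proj P.B.BB P.K (J2 n) = 0" if "n \<in> M.K" for n
    using J2_K[OF that] by (simp add: proj_eq_0[OF P.B.vspace_BB P.subsp_K])
  note d = descend_lin[OF M.B.vspace_BB M.subsp_K 1 0, folded j2_def]
  show "j2 (proj M.B.BB M.K t) = proj P.B.BB P.K (J2 t)" if "t \<in> carrier M.B.BB" by (rule d(1)) (use that in simp_all)
  show "lin M.B2 P.B2 j2" using d(2) by (simp add: lin_def M.carrier_B2 P.carrier_B2 carrier_quot)
qed

lemma j2_wedge:
  "v \<in> carrier M.B1 \<Longrightarrow> w \<in> carrier M.B1 \<Longrightarrow> j2 (wedge M M.N v w) = wedge P P.N (j1 v) (j1 w)"
  by (simp add: M.wedge_bt P.wedge_bt j2_proj J2_bt)

text \<open>The retraction \<open>\<Omega>\<^sup>1(P) \<rightarrow> \<Omega>\<^sup>1(M) \<otimes> H\<close> that multiplies the two factors in \<open>H\<close>.\<close>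

definition rF :: "('k, 'm, 'h) ten \<Rightarrow> ('k, 'm, 'h) ten \<Rightarrow> ('k, ('k, 'm) form1, 'h) ten" where
  "rF x y = lift M H (\<lambda>m h. lift M H (\<lambda>m' h'. M.E m m' \<otimes>\<^bsub>M.B1,H\<^esub> smul H (counit H h') h) y) x"

lemma rF_bilin: "bilin P P (tprod M.B1 H) rF"
  unfolding rF_def[abs_def] bilin_def lin_P carrier_P by (simp add: H.counit_lin)

lemma rF_tens: "m \<in> carrier M \<Longrightarrow> h \<in> carrier H \<Longrightarrow> m' \<in> carrier M \<Longrightarrow> h' \<in> carrier H \<Longrightarrow>
    rF (m \<otimes>\<^bsub>M,H\<^esub> h) (m' \<otimes>\<^bsub>M,H\<^esub> h') = fsmul (counit H h') (M.E m m' \<otimes>\<^bsub>M.B1,H\<^esub> h)"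
  by (simp add: rF_def tens_linear)

lemma rF_lin:
  "lin X P f \<Longrightarrow> c \<in> carrier P \<Longrightarrow> smul U = fsmul \<Longrightarrow> carrier (tprod M.B1 H) \<subseteq> carrier U \<Longrightarrow> lin X U (\<lambda>x. rF (f x) c)"
  "lin X P f \<Longrightarrow> c \<in> carrier P \<Longrightarrow> smul U = fsmul \<Longrightarrow> carrier (tprod M.B1 H) \<subseteq> carrier U \<Longrightarrow> lin X U (\<lambda>x. rF c (f x))"
  using lin_bilin1[OF rF_bilin] lin_bilin2[OF rF_bilin] by (metis smul_tprod)+

text \<open>On the three summands of \<open>QP\<close>: \<open>e\<close> vanishes on
  \<open>Q\<^sub>M\<close>, while a second factor in \<open>Q\<^sub>H\<close> or
  \<open>aug H\<close> has counit zero. These are the conditions under which \<open>Elift\<close>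
  yields a map on \<open>\<Omega>\<^sup>1(P)\<close>.\<close>

lemma rF_vanish:
  assumes x: "x \<in> carrier P"
  shows "rF x \<one>\<^bsub>P\<^esub> = 0" "q \<in> QP \<Longrightarrow> rF x q = 0"
proof -
  show "rF x \<one>\<^bsub>P\<^esub> = 0"
    by (rule P_eqI[where f = "\<lambda>x. rF x \<one>\<^bsub>P\<^esub>" and g = "\<lambda>x. 0" and U = fspace and U' = fspace, OF _ _ x])
      (simp_all add: rF_lin P_unit rF_tens tens_linear)
  assume q: "q \<in> QP"
  have 1: "rF (m \<otimes>\<^bsub>M,H\<^esub> h) q = 0" if "m \<in> carrier M" "h \<in> carrier H" for m h
  proof -
    have l: "lin P fspace (rF (m \<otimes>\<^bsub>M,H\<^esub> h))" using rF_lin(2)[of P "\<lambda>x. x" _ fspace] that by simp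
    have "rF (m \<otimes>\<^bsub>M,H\<^esub> h) q \<in> {0}"
      by (rule QP_lin_in[OF l vspace_fspace subsp_0[OF vspace_fspace] q]) (use that in \<open>auto simp: rF_tens tens_linear aug_def\<close>)
    then show ?thesis by simp
  qed
  have "q \<in> carrier P" using q by simp
  then show "rF x q = 0"
    by (intro P_eqI[where f = "\<lambda>x. rF x q" and g = "\<lambda>x. 0" and U = fspace and U' = fspace, OF _ _ x])
      (simp_all add: rF_lin 1)
qed

definition ret :: "('k, ('k, 'm, 'h) ten) form1 \<Rightarrow> ('k, ('k, 'm) form1, 'h) ten" where
  "ret = P.Elift rF"

lemmas ret_lin = P.Elift_lin[OF vspace_tprod rF_bilin rF_vanish, folded ret_def]
lemmas ret_E = P.Elift_E[OF vspace_tprod rF_bilin rF_vanish, folded ret_def]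

lemma ret_mem [simp]: "v \<in> carrier P.B1 \<Longrightarrow> ret v \<in> carrier (tprod M.B1 H)"
  by (rule linD(1)[OF ret_lin])

lemma lin_ret [simp]: "lin X P.B1 f \<Longrightarrow> smul U = fsmul \<Longrightarrow> carrier (tprod M.B1 H) \<subseteq> carrier U \<Longrightarrow> lin X U (\<lambda>x. ret (f x))"
  by (rule lin_compose_widen[OF ret_lin]) simp_all

lemma P_B1_ext:
  assumes f: "lin P.B1 fspace f" and g: "lin P.B1 fspace g" and v: "v \<in> carrier P.B1"
    and eq: "\<And>m h m' h'. m \<in> carrier M \<Longrightarrow> h \<in> carrier H \<Longrightarrow> m' \<in> carrier M \<Longrightarrow> h' \<in> carrier H \<Longrightarrow>
      f (P.E (m \<otimes>\<^bsub>M,H\<^esub> h) (m' \<otimes>\<^bsub>M,H\<^esub> h')) = g (P.E (m \<otimes>\<^bsub>M,H\<^esub> h) (m' \<otimes>\<^bsub>M,H\<^esub> h'))"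
  shows "f v = g v"
proof (rule P.B1_ext[OF f g vspace_fspace _ v])
  fix x y assume x: "x \<in> carrier P" and y: "y \<in> carrier P"
  have 1: "f (P.E (m \<otimes>\<^bsub>M,H\<^esub> h) y) = g (P.E (m \<otimes>\<^bsub>M,H\<^esub> h) y)" if "m \<in> carrier M" "h \<in> carrier H" for m h
    by (rule P_eqI[where f = "\<lambda>y. f (P.E (m \<otimes>\<^bsub>M,H\<^esub> h) y)" and g = "\<lambda>y. g (P.E (m \<otimes>\<^bsub>M,H\<^esub> h) y)", OF lin_compose[OF f] lin_compose[OF g] y])
      (use that eq in simp_all)
  show "f (P.E x y) = g (P.E x y)"
    by (rule P_eqI[where f = "\<lambda>x. f (P.E x y)" and g = "\<lambda>x. g (P.E x y)", OF lin_compose[OF f] lin_compose[OF g] x])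
      (use y 1 in simp_all)
qed

text \<open>\<open>pr\<close> of \<open>P\<close> subtracts
  \<open>\<epsilon>(m) \<epsilon>(h) 1\<close>. Once the factor in \<open>H\<close> is replaced by
  its counit, what is left is \<open>\<epsilon>(h) pr m\<close>. The expression is the one that the
  right action on generators produces by \<open>ract_E\<close>.\<close>

lemma rF_pr:
  assumes "a \<in> carrier M" "b \<in> carrier H" "m \<in> carrier M" "h \<in> carrier H" "n \<in> carrier M" "k \<in> carrier H"
  shows "rF (a \<otimes>\<^bsub>M,H\<^esub> b) (P.pr (m \<otimes>\<^bsub>M,H\<^esub> h) \<cdot>\<^bsub>P\<^esub> (n \<otimes>\<^bsub>M,H\<^esub> k)) =
    fsmul (counit H k) (fsmul (counit H h) (M.E a (M.pr m \<cdot>\<^bsub>M\<^esub> n) \<otimes>\<^bsub>M.B1,H\<^esub> b))"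
proof -
  have l: "lin P fspace (rF (a \<otimes>\<^bsub>M,H\<^esub> b))" using rF_lin(2)[of P "\<lambda>x. x" _ fspace] assms by simp
  have lE: "lin M fspace (M.E a)" using M.lin_E2[of M "\<lambda>x. x" _ fspace] assms by simp
  have "P.pr (m \<otimes>\<^bsub>M,H\<^esub> h) \<cdot>\<^bsub>P\<^esub> (n \<otimes>\<^bsub>M,H\<^esub> k) =
    ((m \<cdot>\<^bsub>M\<^esub> n) \<otimes>\<^bsub>M,H\<^esub> (h \<cdot>\<^bsub>H\<^esub> k)) - fsmul (counit M m * counit H h) (n \<otimes>\<^bsub>M,H\<^esub> k)"
    using assms P.mul_linear(5)[of "\<one>\<^bsub>P\<^esub>" "\<one>\<^bsub>P\<^esub>" "n \<otimes>\<^bsub>M,H\<^esub> k"] by (simp add: P.pr_def P.mul_linear)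
  then have "rF (a \<otimes>\<^bsub>M,H\<^esub> b) (P.pr (m \<otimes>\<^bsub>M,H\<^esub> h) \<cdot>\<^bsub>P\<^esub> (n \<otimes>\<^bsub>M,H\<^esub> k)) =
    fsmul (counit H h * counit H k) (M.E a (m \<cdot>\<^bsub>M\<^esub> n) \<otimes>\<^bsub>M.B1,H\<^esub> b) - fsmul (counit M m * counit H h) (fsmul (counit H k) (M.E a n \<otimes>\<^bsub>M.B1,H\<^esub> b))"
    using assms linD(3)[OF l, simplified] by (simp add: lin_diff[OF l] rF_tens)
  moreover have "M.E a (M.pr m \<cdot>\<^bsub>M\<^esub> n) = M.E a (m \<cdot>\<^bsub>M\<^esub> n) - fsmul (counit M m) (M.E a n)"
    using assms linD(3)[OF lE] by (simp add: M.pr_def M.mul_linear lin_diff[OF lE])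
  moreover have "((x - fsmul c y) \<otimes>\<^bsub>M.B1,H\<^esub> b) = (x \<otimes>\<^bsub>M.B1,H\<^esub> b) - fsmul c (y \<otimes>\<^bsub>M.B1,H\<^esub> b)" for x y c
    using tens_linear(2,3)[OF M.B.vspace_B H.vspace_alg] by simp
  ultimately show ?thesis by (simp add: fs.scale_right_diff_distrib mult_ac)
qed

text \<open>On \<open>\<Omega>\<^sup>1(M) \<otimes> H\<close> the algebra \<open>P\<close> acts
  through \<open>M\<close> on the forms and through multiplication on \<open>H\<close>, and
  \<open>ret\<close> respects this action. With \<open>ret_ract\<close> it makes the product of two
  retracted forms balanced over \<open>P\<close>.\<close>

lemma ret_lact:
  assumes v: "v \<in> carrier P.B1" and p: "n \<in> carrier M" "k \<in> carrier H"
  shows "ret (lact P.B1 (n \<otimes>\<^bsub>M,H\<^esub> k) v) = lift M.B1 H (\<lambda>\<omega> h. lact M.B1 n \<omega> \<otimes>\<^bsub>M.B1,H\<^esub> (k \<cdot>\<^bsub>H\<^esub> h)) (ret v)"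
proof (rule P_B1_ext[where f = "\<lambda>v. ret (lact P.B1 (n \<otimes>\<^bsub>M,H\<^esub> k) v)", OF _ _ v])
  fix m h m' h' assume a: "m \<in> carrier M" "h \<in> carrier H" "m' \<in> carrier M" "h' \<in> carrier H"
  show "ret (lact P.B1 (n \<otimes>\<^bsub>M,H\<^esub> k) (P.E (m \<otimes>\<^bsub>M,H\<^esub> h) (m' \<otimes>\<^bsub>M,H\<^esub> h'))) =
    lift M.B1 H (\<lambda>\<omega> h. lact M.B1 n \<omega> \<otimes>\<^bsub>M.B1,H\<^esub> (k \<cdot>\<^bsub>H\<^esub> h)) (ret (P.E (m \<otimes>\<^bsub>M,H\<^esub> h) (m' \<otimes>\<^bsub>M,H\<^esub> h')))"
    using a p by (simp add: ret_E rF_tens)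
qed (use p in simp_all)

lemma ret_ract:
  assumes v: "v \<in> carrier P.B1" and p: "n \<in> carrier M" "k \<in> carrier H"
  shows "ret (ract P.B1 v (n \<otimes>\<^bsub>M,H\<^esub> k)) = lift M.B1 H (\<lambda>\<omega> h. ract M.B1 \<omega> n \<otimes>\<^bsub>M.B1,H\<^esub> (h \<cdot>\<^bsub>H\<^esub> k)) (ret v)"
proof (rule P_B1_ext[where f = "\<lambda>v. ret (ract P.B1 v (n \<otimes>\<^bsub>M,H\<^esub> k))", OF _ _ v])
  fix m h m' h' assume a: "m \<in> carrier M" "h \<in> carrier H" "m' \<in> carrier M" "h' \<in> carrier H"
  let ?x = "m \<otimes>\<^bsub>M,H\<^esub> h" and ?y = "m' \<otimes>\<^bsub>M,H\<^esub> h'"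
  have "ret (ract P.B1 (P.E ?x ?y) (n \<otimes>\<^bsub>M,H\<^esub> k)) =
    ret (M.sw (\<lambda>n1 n2. H.sw (\<lambda>k1 k2. P.E (?x \<cdot>\<^bsub>P\<^esub> (n1 \<otimes>\<^bsub>M,H\<^esub> k1)) (P.pr ?y \<cdot>\<^bsub>P\<^esub> (n2 \<otimes>\<^bsub>M,H\<^esub> k2))) k) n)"
    using a p by (simp add: P.ract_E del: P_mul)
  also have "\<dots> = M.sw (\<lambda>n1 n2. ret (H.sw (\<lambda>k1 k2. P.E (?x \<cdot>\<^bsub>P\<^esub> (n1 \<otimes>\<^bsub>M,H\<^esub> k1)) (P.pr ?y \<cdot>\<^bsub>P\<^esub> (n2 \<otimes>\<^bsub>M,H\<^esub> k2))) k)) n"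
    by (rule M.sw_linear[OF _ _ _ ret_lin]) (use a p in \<open>simp_all del: P_mul\<close>)
  also have "\<dots> = M.sw (\<lambda>n1 n2. H.sw (\<lambda>k1 k2. ret (P.E (?x \<cdot>\<^bsub>P\<^esub> (n1 \<otimes>\<^bsub>M,H\<^esub> k1)) (P.pr ?y \<cdot>\<^bsub>P\<^esub> (n2 \<otimes>\<^bsub>M,H\<^esub> k2)))) k) n"
    by (intro M.sw_cong refl H.sw_linear[OF _ _ _ ret_lin]) (use a p in \<open>simp_all del: P_mul\<close>)
  also have "\<dots> = M.sw (\<lambda>n1 n2. H.sw (\<lambda>k1 k2. fsmul (counit H k2) (fsmul (counit H h')
      (M.E (m \<cdot>\<^bsub>M\<^esub> n1) (M.pr m' \<cdot>\<^bsub>M\<^esub> n2) \<otimes>\<^bsub>M.B1,H\<^esub> (h \<cdot>\<^bsub>H\<^esub> k1)))) k) n"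
    using a p by (simp add: ret_E rF_pr del: fs.scale_scale)
  \<comment> \<open>The counit sits on the second leg of the coproduct of \<open>k\<close>, so the
    sum over \<open>H\<close> recombines to \<open>k\<close>.\<close>
  also have "\<dots> = M.sw (\<lambda>n1 n2. fsmul (counit H h')
      (M.E (m \<cdot>\<^bsub>M\<^esub> n1) (M.pr m' \<cdot>\<^bsub>M\<^esub> n2) \<otimes>\<^bsub>M.B1,H\<^esub> (h \<cdot>\<^bsub>H\<^esub> k))) n"
    by (intro M.sw_cong refl H.sw_counit(2)) (use a p in simp_all)
  also have "\<dots> = fsmul (counit H h') (ract M.B1 (M.E m m') n \<otimes>\<^bsub>M.B1,H\<^esub> (h \<cdot>\<^bsub>H\<^esub> k))"
    using a p M.sw_linear[of "tprod M.B1 H" "tprod M.B1 H" _ "fsmul (counit H h')", symmetric] by (simp add: M.ract_E)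
  also have "\<dots> = lift M.B1 H (\<lambda>\<omega> h. ract M.B1 \<omega> n \<otimes>\<^bsub>M.B1,H\<^esub> (h \<cdot>\<^bsub>H\<^esub> k)) (ret (P.E ?x ?y))"
    using a p by (simp add: ret_E rF_tens)
  finally show "ret (ract P.B1 (P.E ?x ?y) (n \<otimes>\<^bsub>M,H\<^esub> k)) = \<dots>" .
qed (use p in simp_all)

lemma ret_j1: "\<omega> \<in> carrier M.B1 \<Longrightarrow> ret (j1 \<omega>) = (\<omega> \<otimes>\<^bsub>M.B1,H\<^esub> \<one>\<^bsub>H\<^esub>)"
  by (rule M.B1_ext[where f = "\<lambda>\<omega>. ret (j1 \<omega>)" and U = fspace])
    (simp_all add: j1_E emb_def ret_E rF_tens)

section \<open>A left inverse on tensor squares\<close>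

definition rmul :: "('k, ('k, 'm) form1, 'h) ten \<Rightarrow> ('k, ('k, 'm) form1, 'h) ten \<Rightarrow>
    ('k, ('k, ('k, ('k, 'm) form1, ('k, 'm) form1) ten) quo, 'h) ten" where
  "rmul s t = lift M.B1 H (\<lambda>\<omega> h. lift M.B1 H (\<lambda>\<omega>' h'. M.B.bt \<omega> \<omega>' \<otimes>\<^bsub>M.B.BB,H\<^esub> (h \<cdot>\<^bsub>H\<^esub> h')) t) s"

lemma rmul_bilin: "bilin (tprod M.B1 H) (tprod M.B1 H) (tprod M.B.BB H) rmul"
  by (simp add: rmul_def[abs_def])

text \<open>The factor \<open>n\<close> crosses between the forms because \<open>M.B.bt\<close> is
  balanced over \<open>M\<close>, and \<open>k\<close> crosses by associativity in
  \<open>H\<close>.\<close>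

lemma rmul_balanced:
  assumes n: "n \<in> carrier M" and k: "k \<in> carrier H" and s: "s \<in> carrier (tprod M.B1 H)" and t: "t \<in> carrier (tprod M.B1 H)"
  shows "rmul (lift M.B1 H (\<lambda>\<omega> h. ract M.B1 \<omega> n \<otimes>\<^bsub>M.B1,H\<^esub> (h \<cdot>\<^bsub>H\<^esub> k)) s) t =
    rmul s (lift M.B1 H (\<lambda>\<omega> h. lact M.B1 n \<omega> \<otimes>\<^bsub>M.B1,H\<^esub> (k \<cdot>\<^bsub>H\<^esub> h)) t)"
  using assms by (simp add: rmul_def M.B.bt_balanced H.mul_assoc)

lemma ret_balanced:
  assumes v: "v \<in> carrier P.B1" and p: "p \<in> carrier P" and w: "w \<in> carrier P.B1"
  shows "rmul (ret (ract P.B1 v p)) (ret w) = rmul (ret v) (ret (lact P.B1 p w))"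
proof (rule P_eqI[where f = "\<lambda>p. rmul (ret (ract P.B1 v p)) (ret w)" and g = "\<lambda>p. rmul (ret v) (ret (lact P.B1 p w))"
      and U = "tprod M.B.BB H" and U' = "tprod M.B.BB H", OF _ _ p])
  show "lin P (tprod M.B.BB H) (\<lambda>p. rmul (ret (ract P.B1 v p)) (ret w))"
    by (rule lin_bilin1[OF rmul_bilin]) (use v w in simp_all)
  show "lin P (tprod M.B.BB H) (\<lambda>p. rmul (ret v) (ret (lact P.B1 p w)))"
    by (rule lin_bilin2[OF rmul_bilin]) (use v w in simp_all)
  show "rmul (ret (ract P.B1 v (m \<otimes>\<^bsub>M,H\<^esub> h))) (ret w) = rmul (ret v) (ret (lact P.B1 (m \<otimes>\<^bsub>M,H\<^esub> h) w))"
    if "m \<in> carrier M" "h \<in> carrier H" for m h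
    using that v w by (simp add: ret_ract ret_lact rmul_balanced)
qed

definition GG :: "('k, ('k, ('k, ('k, 'm) form1, ('k, 'm) form1) ten) quo, 'h) ten \<Rightarrow>
    ('k, ('k, ('k, ('k, 'm, 'h) ten) form1, ('k, ('k, 'm, 'h) ten) form1) ten) quo" where
  "GG = lift M.B.BB H (\<lambda>t h. ract P.B.BB (J2 t) (\<one>\<^bsub>M\<^esub> \<otimes>\<^bsub>M,H\<^esub> h))"

lemma GG_bilin: "bilin M.B.BB H P.B.BB (\<lambda>t h. ract P.B.BB (J2 t) (\<one>\<^bsub>M\<^esub> \<otimes>\<^bsub>M,H\<^esub> h))"
  by simp

lemma GG_lin: "lin (tprod M.B.BB H) P.B.BB GG"
  unfolding GG_def by (rule lin_lift[OF _ _ _ GG_bilin]) simp_all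

lemma GG_tens: "t \<in> carrier M.B.BB \<Longrightarrow> h \<in> carrier H \<Longrightarrow> GG (t \<otimes>\<^bsub>M.B.BB,H\<^esub> h) = ract P.B.BB (J2 t) (\<one>\<^bsub>M\<^esub> \<otimes>\<^bsub>M,H\<^esub> h)"
  unfolding GG_def by (rule lift_tens_in[OF _ _ _ GG_bilin]) simp_all

lemma GG_retract: "\<exists>R. lin P.B.BB (tprod M.B.BB H) R \<and> (\<forall>\<tau>\<in>carrier (tprod M.B.BB H). R (GG \<tau>) = \<tau>)"
proof -
  have F: "bilin P.B1 P.B1 (tprod M.B.BB H) (\<lambda>v w. rmul (ret v) (ret w))"
    by (rule bilin_compose[OF rmul_bilin ret_lin ret_lin])
  obtain R where R: "lin P.B.BB (tprod M.B.BB H) R"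
    "\<And>v w. v \<in> carrier P.B1 \<Longrightarrow> w \<in> carrier P.B1 \<Longrightarrow> R (P.B.bt v w) = rmul (ret v) (ret w)"
  proof -
    note b = P.B.bal_lift[OF _ F, OF vspace_tprod ret_balanced]
    show thesis by (rule that, rule b(1); (assumption | rule b(2)); assumption)
  qed
  \<comment> \<open>\<open>ret\<close> sends \<open>j1 v\<close> to \<open>v \<otimes> 1\<close> and
    \<open>(j1 w) (1 \<otimes> h)\<close> to \<open>w \<otimes> h\<close>; their product under
    \<open>rmul\<close> is \<open>(v \<otimes> w) \<otimes> h\<close>.\<close>
  have 1: "R (GG (M.B.bt v w \<otimes>\<^bsub>M.B.BB,H\<^esub> h)) = (M.B.bt v w \<otimes>\<^bsub>M.B.BB,H\<^esub> h)"
    if "v \<in> carrier M.B1" "w \<in> carrier M.B1" "h \<in> carrier H" for v w h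
    using that by (simp add: GG_tens J2_bt P.B.BB_ract(2) R(2) ret_j1 ret_ract rmul_def)
  have l: "lin (tprod M.B.BB H) (tprod M.B.BB H) (\<lambda>\<tau>. R (GG \<tau>))" by (rule lin_compose[OF R(1) GG_lin])
  have 2: "R (GG (t \<otimes>\<^bsub>M.B.BB,H\<^esub> h)) = (t \<otimes>\<^bsub>M.B.BB,H\<^esub> h)" if t: "t \<in> carrier M.B.BB" and h: "h \<in> carrier H" for t h
    by (rule M.B.bal_ext[where f = "\<lambda>t. R (GG (t \<otimes>\<^bsub>M.B.BB,H\<^esub> h))" and g = "\<lambda>t. t \<otimes>\<^bsub>M.B.BB,H\<^esub> h" and U' = "tprod M.B.BB H", OF lin_compose[OF l] _ _ t])
      (use 1 h in simp_all)
  have "R (GG \<tau>) = \<tau>" if \<tau>: "\<tau> \<in> carrier (tprod M.B.BB H)" for \<tau>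
    by (rule tprod_eqI[where f = "\<lambda>\<tau>. R (GG \<tau>)" and g = "\<lambda>\<tau>. \<tau>" and U' = "tprod M.B.BB H", OF _ l _ _ \<tau>]) (simp_all add: 2)
  then show ?thesis using R(1) by blast
qed

text \<open>The braiding of \<open>P\<close> is a right module map, so the factor
  \<open>1 \<otimes> h\<close> can be pulled out; \<open>J2_braiding\<close> handles the
  rest.\<close>

lemma GG_braiding:
  assumes \<tau>: "\<tau> \<in> carrier (tprod M.B.BB H)"
  shows "P.\<Psi> (GG \<tau>) = GG (lift M.B.BB H (\<lambda>t h. M.\<Psi> t \<otimes>\<^bsub>M.B.BB,H\<^esub> h) \<tau>)"
proof -
  have M: "M.\<Psi> t \<in> carrier M.B.BB" if "t \<in> carrier M.B.BB" for t using linD(1)[OF M.\<Psi>_lin that] .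
  have b: "bilin M.B.BB H (tprod M.B.BB H) (\<lambda>t h. M.\<Psi> t \<otimes>\<^bsub>M.B.BB,H\<^esub> h)"
    using M by (simp add: lin_tens1[OF M.\<Psi>_lin])
  have l: "lin (tprod M.B.BB H) (tprod M.B.BB H) (lift M.B.BB H (\<lambda>t h. M.\<Psi> t \<otimes>\<^bsub>M.B.BB,H\<^esub> h))"
    by (rule lin_lift[OF _ _ _ b]) simp_all
  show ?thesis
  proof (rule tprod_eqI[where f = "\<lambda>\<tau>. P.\<Psi> (GG \<tau>)" and g = "\<lambda>\<tau>. GG (lift M.B.BB H (\<lambda>t h. M.\<Psi> t \<otimes>\<^bsub>M.B.BB,H\<^esub> h) \<tau>)",
        OF M.B.vspace_BB lin_compose[OF P.\<Psi>_lin GG_lin] lin_compose[OF GG_lin l] _ \<tau>])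
    fix t h assume t: "t \<in> carrier M.B.BB" and h: "h \<in> carrier H"
    have "P.\<Psi> (ract P.B.BB (J2 t) (\<one>\<^bsub>M\<^esub> \<otimes>\<^bsub>M,H\<^esub> h)) = ract P.B.BB (P.\<Psi> (J2 t)) (\<one>\<^bsub>M\<^esub> \<otimes>\<^bsub>M,H\<^esub> h)"
      using P.braiding_spec(1) t h by (simp add: bimodule_map_def)
    moreover have "lift M.B.BB H (\<lambda>t h. M.\<Psi> t \<otimes>\<^bsub>M.B.BB,H\<^esub> h) (t \<otimes>\<^bsub>M.B.BB,H\<^esub> h) = (M.\<Psi> t \<otimes>\<^bsub>M.B.BB,H\<^esub> h)"
      by (rule lift_tens_in[OF _ _ _ b]) (use t h in simp_all)
    ultimately show "P.\<Psi> (GG (t \<otimes>\<^bsub>M.B.BB,H\<^esub> h)) = GG (lift M.B.BB H (\<lambda>t h. M.\<Psi> t \<otimes>\<^bsub>M.B.BB,H\<^esub> h) (t \<otimes>\<^bsub>M.B.BB,H\<^esub> h))"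
      using t h M by (simp only: GG_tens J2_braiding)
  qed
qed

section \<open>Injectivity on two-forms\<close>

abbreviation mult2 :: "('k, ('k, 'm) form2, 'h) ten \<Rightarrow> ('k, ('k, 'm, 'h) ten) form2" where
  "mult2 \<equiv> lift M.B2 H (\<lambda>\<alpha> h. ract P.B2 (j2 \<alpha>) (\<one>\<^bsub>M\<^esub> \<otimes>\<^bsub>M,H\<^esub> h))"

lemma mult2_bilin: "bilin M.B2 H P.B2 (\<lambda>\<alpha> h. ract P.B2 (j2 \<alpha>) (\<one>\<^bsub>M\<^esub> \<otimes>\<^bsub>M,H\<^esub> h))"
  using j2_lin linD(1)[OF j2_lin] by (simp add: P.B2.lin_ract1)

lemma mult2_inj: "inj_on mult2 (carrier (tprod M.B2 H))"
proof (rule lin_inj_on)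
  show ml: "lin (tprod M.B2 H) P.B2 mult2" by (rule lin_lift[OF _ _ _ mult2_bilin]) simp_all
  let ?pM = "proj M.B.BB M.K" and ?pP = "proj P.B.BB P.K"
  let ?q = "lift M.B.BB H (\<lambda>t h. ?pM t \<otimes>\<^bsub>M.B2,H\<^esub> h)"
  have pM: "lin M.B.BB M.B2 ?pM"
    using lin_proj[OF M.B.vspace_BB, of M.K] by (simp add: lin_def M.carrier_B2 carrier_quot)
  have pM': "?pM t \<in> carrier M.B2" if "t \<in> carrier M.B.BB" for t by (rule linD(1)[OF pM that])
  have qb: "bilin M.B.BB H (tprod M.B2 H) (\<lambda>t h. ?pM t \<otimes>\<^bsub>M.B2,H\<^esub> h)"
    using pM' by (simp add: lin_tens1[OF pM])
  have ql: "lin (tprod M.B.BB H) (tprod M.B2 H) ?q" by (rule lin_lift[OF _ _ _ qb]) simp_all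
  have qt: "?q (t \<otimes>\<^bsub>M.B.BB,H\<^esub> h) = (?pM t \<otimes>\<^bsub>M.B2,H\<^esub> h)" if "t \<in> carrier M.B.BB" "h \<in> carrier H" for t h
    by (rule lift_tens_in[OF _ _ _ qb]) (use that in simp_all)
  \<comment> \<open>The square formed by \<open>mult2\<close>, \<open>GG\<close> and the two
    projections commutes, so that a relation between two-forms can be studied in the tensor
    squares.\<close>
  have mq: "mult2 (?q \<tau>) = ?pP (GG \<tau>)" if \<tau>: "\<tau> \<in> carrier (tprod M.B.BB H)" for \<tau>
  proof (rule tprod_eqI[where f = "\<lambda>\<tau>. mult2 (?q \<tau>)" and g = "\<lambda>\<tau>. ?pP (GG \<tau>)",
        OF M.B.vspace_BB lin_compose[OF ml ql] lin_compose[OF lin_proj[OF P.B.vspace_BB] GG_lin] _ \<tau>])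
    fix t h assume t: "t \<in> carrier M.B.BB" and h: "h \<in> carrier H"
    have "mult2 (?pM t \<otimes>\<^bsub>M.B2,H\<^esub> h) = ract P.B2 (j2 (?pM t)) (\<one>\<^bsub>M\<^esub> \<otimes>\<^bsub>M,H\<^esub> h)"
      by (rule lift_tens_in[OF _ _ _ mult2_bilin]) (use t h pM' in simp_all)
    then show "mult2 (?q (t \<otimes>\<^bsub>M.B.BB,H\<^esub> h)) = ?pP (GG (t \<otimes>\<^bsub>M.B.BB,H\<^esub> h))"
      using t h by (simp add: qt j2_proj P.ract_B2 GG_tens)
  qed
  fix x assume x: "x \<in> carrier (tprod M.B2 H)" and 0: "mult2 x = 0"
  \<comment> \<open>\<open>?q\<close> is onto: its image is a subspace that contains all pure
    tensors.\<close>
  have "x \<in> ?q ` carrier (tprod M.B.BB H)"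
  proof -
    have S: "subsp (tprod M.B2 H) (?q ` carrier (tprod M.B.BB H))" by (rule subsp_lin_image[OF ql]) simp_all
    show ?thesis
    proof (rule lin_tspan_in[where f = "\<lambda>x. x" and V = M.B2 and W = H and A = "carrier M.B2" and B = "carrier H", OF _ _ _ _ _ _ S])
      show "x \<in> tspan M.B2 H (carrier M.B2) (carrier H)" using x by (simp add: tspan_carrier)
      fix \<alpha> h assume \<alpha>: "\<alpha> \<in> carrier M.B2" and h: "h \<in> carrier H"
      then obtain t where "t \<in> carrier M.B.BB" "\<alpha> = ?pM t" by (auto simp: M.carrier_B2)
      then show "(\<alpha> \<otimes>\<^bsub>M.B2,H\<^esub> h) \<in> ?q ` carrier (tprod M.B.BB H)"
        using h qt by (intro image_eqI[where x = "t \<otimes>\<^bsub>M.B.BB,H\<^esub> h"]) simp_all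
    qed simp_all
  qed
  then obtain \<tau> where \<tau>: "\<tau> \<in> carrier (tprod M.B.BB H)" "x = ?q \<tau>" by blast
  let ?D = "\<lambda>t. t - M.\<Psi> t"
  have M: "M.\<Psi> t \<in> carrier M.B.BB" if "t \<in> carrier M.B.BB" for t using linD(1)[OF M.\<Psi>_lin that] .
  have D: "lin M.B.BB M.B.BB ?D" using M.\<Psi>_lin by simp
  \<comment> \<open>The kernel of \<open>?D\<close> is \<open>M.K\<close>, which the projection to
    \<open>\<Omega>\<^sup>2(M)\<close> kills. As \<open>g\<close> is linear on the whole tensor
    square, it can be tensored with the identity of \<open>H\<close>.\<close>
  obtain g where g: "lin M.B.BB M.B2 g" "\<forall>t\<in>carrier M.B.BB. g (?D t) = ?pM t"
    using lin_factor[OF D pM M.B.vspace_BB M.B.vspace_BB] by (auto simp: M.K_iff proj_eq_0[OF M.B.vspace_BB M.subsp_K])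
  obtain R where R: "\<forall>\<tau>\<in>carrier (tprod M.B.BB H). R (GG \<tau>) = \<tau>" using GG_retract by blast
  let ?Ps = "lift M.B.BB H (\<lambda>t h. M.\<Psi> t \<otimes>\<^bsub>M.B.BB,H\<^esub> h)"
  have Psb: "bilin M.B.BB H (tprod M.B.BB H) (\<lambda>t h. M.\<Psi> t \<otimes>\<^bsub>M.B.BB,H\<^esub> h)"
    using M by (simp add: lin_tens1[OF M.\<Psi>_lin])
  have Ps: "lin (tprod M.B.BB H) (tprod M.B.BB H) ?Ps" by (rule lin_lift[OF _ _ _ Psb]) simp_all
  \<comment> \<open>Vanishing in \<open>\<Omega>\<^sup>2(P)\<close> means that
    \<open>GG \<tau>\<close> is fixed by the braiding. As \<open>GG\<close> intertwines the
    braidings and has a left inverse, \<open>\<tau>\<close> itself is fixed by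
    \<open>?Ps\<close>.\<close>
  have "GG \<tau> \<in> P.K" using 0 mq[OF \<tau>(1)] \<tau> by (simp add: proj_eq_0[OF P.B.vspace_BB P.subsp_K])
  then have "GG (?Ps \<tau>) = GG \<tau>" using GG_braiding[OF \<tau>(1)] by (simp add: P.K_iff)
  then have inv: "?Ps \<tau> = \<tau>" using R \<tau>(1) linD(1)[OF Ps \<tau>(1)] by metis
  let ?g = "lift M.B.BB H (\<lambda>t h. g t \<otimes>\<^bsub>M.B2,H\<^esub> h)"
  have g': "g t \<in> carrier M.B2" if "t \<in> carrier M.B.BB" for t by (rule linD(1)[OF g(1) that])
  have gb: "bilin M.B.BB H (tprod M.B2 H) (\<lambda>t h. g t \<otimes>\<^bsub>M.B2,H\<^esub> h)"
    using g' by (simp add: lin_tens1[OF g(1)])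
  have gl: "lin (tprod M.B.BB H) (tprod M.B2 H) ?g" by (rule lin_lift[OF _ _ _ gb]) simp_all
  \<comment> \<open>This is the factorisation of the projection through \<open>?D\<close>, tensored
    with \<open>H\<close>. The argument of \<open>?g\<close> is zero by \<open>inv\<close>.\<close>
  have "?q \<tau> = ?g (\<tau> - ?Ps \<tau>)"
  proof (rule tprod_eqI[where f = ?q and g = "\<lambda>\<tau>. ?g (\<tau> - ?Ps \<tau>)", OF M.B.vspace_BB ql lin_compose[OF gl] _ \<tau>(1)])
    show "lin (tprod M.B.BB H) (tprod M.B.BB H) (\<lambda>\<tau>. \<tau> - ?Ps \<tau>)" by (rule lin_minus[OF vspace_tprod lin_id Ps]) simp_all
    fix t h assume t: "t \<in> carrier M.B.BB" and h: "h \<in> carrier H"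
    have "?Ps (t \<otimes>\<^bsub>M.B.BB,H\<^esub> h) = (M.\<Psi> t \<otimes>\<^bsub>M.B.BB,H\<^esub> h)"
      by (rule lift_tens_in[OF _ _ _ Psb]) (use t h in simp_all)
    then have "(t \<otimes>\<^bsub>M.B.BB,H\<^esub> h) - ?Ps (t \<otimes>\<^bsub>M.B.BB,H\<^esub> h) = (?D t \<otimes>\<^bsub>M.B.BB,H\<^esub> h)"
      by (simp add: tens_linear)
    moreover have "?g (?D t \<otimes>\<^bsub>M.B.BB,H\<^esub> h) = (g (?D t) \<otimes>\<^bsub>M.B2,H\<^esub> h)"
      by (rule lift_tens_in[OF _ _ _ gb]) (use t h M in simp_all)
    ultimately show "?q (t \<otimes>\<^bsub>M.B.BB,H\<^esub> h) = ?g ((t \<otimes>\<^bsub>M.B.BB,H\<^esub> h) - ?Ps (t \<otimes>\<^bsub>M.B.BB,H\<^esub> h))"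
      using t h g(2) by (simp only: qt)
  qed
  also have "\<dots> = 0" unfolding inv using lin_0[OF gl vspace_tprod] by simp
  finally show "x = 0" using \<tau>(2) by simp
qed simp

text \<open>The restriction of \<open>mult2\<close> to elements \<open>\<alpha> \<otimes> 1\<close>.
  The counit on the second factor recovers \<open>\<alpha>\<close> from
  \<open>\<alpha> \<otimes> 1\<close>.\<close>

lemma j2_inj: "inj_on j2 (carrier M.B2)"
proof (rule lin_inj_on[OF j2_lin M.B2.vspace_B])
  fix \<alpha> assume \<alpha>: "\<alpha> \<in> carrier M.B2" and 0: "j2 \<alpha> = 0"
  have "mult2 (\<alpha> \<otimes>\<^bsub>M.B2,H\<^esub> \<one>\<^bsub>H\<^esub>) = ract P.B2 (j2 \<alpha>) (\<one>\<^bsub>M\<^esub> \<otimes>\<^bsub>M,H\<^esub> \<one>\<^bsub>H\<^esub>)"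
    by (rule lift_tens_in[OF _ _ _ mult2_bilin]) (use \<alpha> in simp_all)
  also have "\<dots> = 0" using 0 P.B2.act_0(2)[of "\<one>\<^bsub>P\<^esub>"] by (simp add: P_unit)
  also have "0 = mult2 0" using lin_0[OF lin_lift[OF _ _ _ mult2_bilin]] by simp
  finally have "(\<alpha> \<otimes>\<^bsub>M.B2,H\<^esub> \<one>\<^bsub>H\<^esub>) = 0"
    using mult2_inj \<alpha> by (auto dest!: inj_onD)
  then have "lift M.B2 H (\<lambda>\<alpha> h. fsmul (counit H h) \<alpha>) (\<alpha> \<otimes>\<^bsub>M.B2,H\<^esub> \<one>\<^bsub>H\<^esub>) = lift M.B2 H (\<lambda>\<alpha> h. fsmul (counit H h) \<alpha>) 0"
    by simp
  then show "\<alpha> = 0" using \<alpha> H.counit_lin by simp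
qed

lemma emb2_eq: "emb2 = lift M M (\<lambda>m m'. (m \<otimes>\<^bsub>M,H\<^esub> \<one>\<^bsub>H\<^esub>) \<otimes>\<^bsub>P,P\<^esub> (m' \<otimes>\<^bsub>M,H\<^esub> \<one>\<^bsub>H\<^esub>))"
  by (simp add: emb2_def emb_def)

lemma Omega2_embedding:
  "\<exists>j\<^sub>1 j\<^sub>2.
     lin M.B1 P.B1 j\<^sub>1 \<and>
     (\<forall>t\<in>carrier (univ M). j\<^sub>1 (proj (univ M) M.N t) =
        proj (univ P) P.N
          (lift M M (\<lambda>m m'. (m \<otimes>\<^bsub>M,H\<^esub> \<one>\<^bsub>H\<^esub>) \<otimes>\<^bsub>P,P\<^esub> (m' \<otimes>\<^bsub>M,H\<^esub> \<one>\<^bsub>H\<^esub>)) t)) \<and>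
     lin M.B2 P.B2 j\<^sub>2 \<and>
     (\<forall>\<alpha>\<in>carrier M.B1. \<forall>\<beta>\<in>carrier M.B1. j\<^sub>2 (wedge M M.N \<alpha> \<beta>) = wedge P P.N (j\<^sub>1 \<alpha>) (j\<^sub>1 \<beta>)) \<and>
     inj_on j\<^sub>2 (carrier M.B2) \<and>
     inj_on (lift M.B2 H (\<lambda>\<alpha> h. ract P.B2 (j\<^sub>2 \<alpha>) (\<one>\<^bsub>M\<^esub> \<otimes>\<^bsub>M,H\<^esub> h))) (carrier (tprod M.B2 H))"
  using j1_lin j2_lin j2_inj mult2_inj
  by (intro exI[of _ j1] exI[of _ j2] conjI ballI) (simp_all only: M.proj_univ P.proj_univ j1_cl emb2_eq j2_wedge)

end

text \<open>The existentially quantified maps are determined on the carriers by the displayed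
  values, because the classes of \<open>aug\<close> exhaust \<open>\<Omega>\<^sub>0\<close>, those
  of \<open>univ\<close> exhaust the one-forms, and wedge products span the two-forms. Results
  proved for the calculus of \<open>Q\<^sub>P\<close> become results about \<open>N\<^sub>P\<close>
  by \<open>N_prod_eq\<close>.\<close>

theorem lemma4p1:
  fixes M :: "('k::field, 'm::ab_group_add) hopf"
    and H :: "('k, 'h::ab_group_add) hopf"
    and Q\<^sub>M :: "'m set" and Q\<^sub>H :: "'h set"
  assumes "hopf_algebra M" and "hopf_algebra H"
    and "ad_ideal M Q\<^sub>M" and "ad_ideal H Q\<^sub>H"
  shows
    "let P = tens_hopf M H;
         N\<^sub>M = calc M Q\<^sub>M;
         N\<^sub>H = calc H Q\<^sub>H;
         N\<^sub>P = N_prod M H N\<^sub>M N\<^sub>H;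
         Q\<^sub>P = Q_prod M H Q\<^sub>M Q\<^sub>H
     in hopf_algebra P \<and> bicovariant P N\<^sub>P \<and> ad_ideal P Q\<^sub>P \<and> N\<^sub>P = calc P Q\<^sub>P \<and>
       (\<exists>i\<^sub>M i\<^sub>H.
          lin (Omega0 M Q\<^sub>M) (Omega0 P Q\<^sub>P) i\<^sub>M \<and>
          (\<forall>m\<in>aug M. i\<^sub>M (pi0 M Q\<^sub>M m) = pi0 P Q\<^sub>P (m \<otimes>\<^bsub>M,H\<^esub> \<one>\<^bsub>H\<^esub>)) \<and>
          inj_on i\<^sub>M (carrier (Omega0 M Q\<^sub>M)) \<and>
          lin (Omega0 H Q\<^sub>H) (Omega0 P Q\<^sub>P) i\<^sub>H \<and>
          (\<forall>h\<in>aug H. i\<^sub>H (pi0 H Q\<^sub>H h) = pi0 P Q\<^sub>P (\<one>\<^bsub>M\<^esub> \<otimes>\<^bsub>M,H\<^esub> h)) \<and>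
          inj_on i\<^sub>H (carrier (Omega0 H Q\<^sub>H)) \<and>
          carrier (Omega0 P Q\<^sub>P) =
            {v + w | v w. v \<in> i\<^sub>M ` carrier (Omega0 M Q\<^sub>M) \<and> w \<in> i\<^sub>H ` carrier (Omega0 H Q\<^sub>H)} \<and>
          i\<^sub>M ` carrier (Omega0 M Q\<^sub>M) \<inter> i\<^sub>H ` carrier (Omega0 H Q\<^sub>H) = {0}) \<and>
       (\<exists>j\<^sub>1 j\<^sub>2.
          lin (forms1 M N\<^sub>M) (forms1 P N\<^sub>P) j\<^sub>1 \<and>
          (\<forall>t\<in>carrier (univ M). j\<^sub>1 (proj (univ M) N\<^sub>M t) =
             proj (univ P) N\<^sub>P
               (lift M M (\<lambda>m m'. (m \<otimes>\<^bsub>M,H\<^esub> \<one>\<^bsub>H\<^esub>) \<otimes>\<^bsub>P,P\<^esub> (m' \<otimes>\<^bsub>M,H\<^esub> \<one>\<^bsub>H\<^esub>)) t)) \<and>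
          lin (forms2 M N\<^sub>M) (forms2 P N\<^sub>P) j\<^sub>2 \<and>
          (\<forall>\<alpha>\<in>carrier (forms1 M N\<^sub>M). \<forall>\<beta>\<in>carrier (forms1 M N\<^sub>M).
             j\<^sub>2 (wedge M N\<^sub>M \<alpha> \<beta>) = wedge P N\<^sub>P (j\<^sub>1 \<alpha>) (j\<^sub>1 \<beta>)) \<and>
          inj_on j\<^sub>2 (carrier (forms2 M N\<^sub>M)) \<and>
          inj_on (lift (forms2 M N\<^sub>M) H
                   (\<lambda>\<alpha> h. ract (forms2 P N\<^sub>P) (j\<^sub>2 \<alpha>) (\<one>\<^bsub>M\<^esub> \<otimes>\<^bsub>M,H\<^esub> h)))
            (carrier (tprod (forms2 M N\<^sub>M) H))) \<and>
       (\<forall>v\<in>aug H. maurer_cartan H Q\<^sub>H (pi0 H Q\<^sub>H v) =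
          proj (univ H) N\<^sub>H (sw2 H (\<lambda>a b. antip H a \<otimes>\<^bsub>H,H\<^esub> b) v)) \<and>
       bein H Q\<^sub>H (maurer_cartan H Q\<^sub>H) \<and>
       gauge_field H Q\<^sub>H (maurer_cartan H Q\<^sub>H) \<and>
       (\<forall>h\<in>aug H. curvature H Q\<^sub>H (maurer_cartan H Q\<^sub>H) h = 0)"
  proof -
  interpret calculus_pair M Q\<^sub>M H Q\<^sub>H
    using assms by (intro calculus_pair.intro calculus.intro calculus_axioms.intro hopf_algI)
  show ?thesis
    unfolding Let_def N_prod_eq gauge_field_def
    using hopf_P P.bicovariant_calc ad_ideal_QP Omega0_decomposition Omega2_embedding
      H.maurer_cartan_aug H.bein_maurer_cartan H.maurer_cartan_lin H.curvature_maurer_cartan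
    by (intro conjI ballI refl)
qed

end
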